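(* There is an absolute constant $c_0$ such that the following holds for the specific policy $A_{\mathrm{NRM}}=\mathrm{J}\big(\mathrm{F}(\mathrm{H}(A_{\mathrm{pen}}))\big)$ constructed in the context. For every $\epsilon\in(0,1)$, $A_{\mathrm{NRM}}$ is an admissible policy for NRM with the following properties. (1) On any trajectory $S\in\mathcal{S}$ one can compute the decisions $A_{\mathrm{NRM}}(S_{[t]})$ for all $t=1,\ldots,T$ on-the-fly, in per-decision time $$\mathcal{C}\times\exp\Big(c_0\big(\tfrac{Lq}{\iota}\big)^3\big\lceil\log(\tfrac{m}{\epsilon})\big\rceil\,\epsilon^{-1}\min(\sqrt m,\epsilon^{-1})\Big),$$ such that $$\mathbb{E}\Big[\sum_{E\in\mathcal{E}}\mu(E)\sum_{r=1}^{q-1}Z^r(E)A^r_{\mathrm{NRM}}(E)\Big]\ge\mathrm{OPT}_{\mathrm{NRM}}-\epsilon T\quad\text{so long as }T\ge c_0\big(\tfrac{Lq}{\iota}\big)^3m\,\epsilon^{-2}.$$ (2) On any trajectory $S\in\mathcal{S}$ one can compute the decisions $A_{\mathrm{NRM}}(S_{[t]})$ for all $t=1,\ldots,T$ on-the-fly, in per-decision time $$\mathcal{C}\times\exp\Big(c_0\big(\tfrac{L\kappa}{\iota\nu}\big)^2\big\lceil\log(\tfrac q\epsilon)\big\rceil\,\epsilon^{-1}\Big),$$ such that $$\mathbb{E}\Big[\sum_{E\in\mathcal{E}}\mu(E)\sum_{r=1}^{q-1}Z^r(E)A^r_{\mathrm{NRM}}(E)\Big]\ge\mathrm{OPT}_{\mathrm{NRM}}-\epsilon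 T\quad\text{so long as }T\ge c_0\big(\tfrac{L\kappa}{\iota\nu}\big)^2\log(2m)\,\epsilon^{-2}.$$
   Context: **Model.** There are $T$ periods, $q\ge2$ options $0,\ldots,q-1$, and $m$ resources with known budgets $b_1,\ldots,b_m>0$. $(M_t)_{t=1}^T$ is a stochastic process in $\mathbb{R}^D$ with a general (possibly non-Markovian) law; $M_{[t]}=(M_1,\ldots,M_t)$; $\mathcal{S}^t$ is the support of $M_{[t]}$, $\mathcal{S}=\mathcal{S}^T$, $\mathcal{E}=\bigcup_{t=1}^T\mathcal{S}^t$ (assumed finite); $\mu(E)=\mathbb{P}(M_{[t]}=E)$ for $E\in\mathcal{S}^t$; $S_{[t]}$ is the length-$t$ prefix of $S$; $E'\subseteq E$ means $E'$ is a prefix of $E$. For $E\in\mathcal{S}^t$, $Z^r(E)$ is the reward and $a^r_i(E)$ the amount of resource $i$ consumed if option $r$ is chosen in period $t$ on history $E$; $Z^0(E)=a^0_i(E)=0$. Assumptions: $Z^r(E),a^r_i(E)\in[0,1]$; for each $r,E$ at most $L$ of $a^r_1(E),\ldots,a^r_m(E)$ are nonzero; each $a^r_i(E)$ is $0$ or at least $\iota$, with $\iota\in(0,1]$ fixed. **Problem and admissible policies.** NRM (network revenue management, with flexible products): maximize $\sum_{E\in\mathcal{E}}\mu(E)\sum_{r=1}^{q-1}Z^r(E)X^r(E)$ subject to $\sum_{t=1}^T\sum_{r=1}^{q-1}a^r_i(S_{[t]})X^r(S_{[t]})\le b_i$ for all $i$ and $S\in\mathcal{S}$; $X^r(E)\in\{0,1\}$,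 $\sum_{j=0}^{q-1}X^j(E)=1$ for all $r$ and $E\in\mathcal{E}$. Optimal value $\mathrm{OPT}_{\mathrm{NRM}}$. A (randomized) policy is a map $A:\mathcal{E}\times[0,1]\to\{0,1\}^q$ with output components summing to 1, the second argument being an independent uniform seed (suppressed; expectations are over all randomness used by the policy, including simulator outputs); $A^r(E)$ is component $r$. It is admissible if with probability 1 all resource constraints hold with $X=A$. **Computational model.** $\mu$ is not known and is accessed only through a simulator SIM: given $E\in\mathcal{E}$, at cost $\mathcal{C}\ge1$, SIM returns an independent draw of a complete trajectory from the conditional law given prefix $E$. Arithmetic operations take unit time, memory access is free, sampling $k$ indices without replacement from $\{1,\ldots,T\}$ takes $O(k)$ time, sampling a uniform, Bernoulli or Beta variable takes unit time, and for $E\subseteq S'$ the set $\bigcup_{i\in a^+(E)}\mathcal{T}_i(S')$ (defined below) can be extracted in unit time. On-the-fly means the decision at time $t$ is computed from the observed $S_{[t]}$; per-decision time is the total time for computation and simulation for one decision. An absolute constant does not depend on any problem parameter. **Notation.** $x^+=\max(0,x)$; $\nu=\min_ib_i/T$; $\kappa=\max_{E,i}|\{r:a^r_i(E)>0\}|$; $a^{r,+}(E)=\{i:a^r_i(E)>0\}$; $a^+(E)=\bigcup_{r=1}^{q-1}a^{r,+}(E)$; $\mathcal{T}_i(S)=\bigcup_{r=1}^{q-1}\{t:a^r_i(S_{[t]})>0\}$; $\mathcal{RT}_i(S)=\{(r,t):a^r_i(S_{[t]})>0\}$; $U_r=\max_{S,i}|\mathcal{RT}_i(S)|$ (the subscript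 is just notation); $W=\max_{S\in\mathcal{S},S'\subseteq S,r}\sum_{t=1}^T\sum_{l=1}^{q-1}|a^{l,+}(S_{[t]})\cap a^{r,+}(S')|$. $\mathcal{Q}^0$ is the set of $(X^r)_{0\le r\le q-1}$ with $X^r\in[0,1]$, $\sum_rX^r=1$; $\mathcal{Q}^1$ is the set of $(X^r_t)_{0\le r\le q-1,1\le t\le T}$ with $(X^r_t)_r\in\mathcal{Q}^0$ for all $t$; $\mathcal{Q}^2$ is the set of $(X^r(E))_{0\le r\le q-1,E\in\mathcal{E}}$ with $(X^r(E))_r\in\mathcal{Q}^0$ for all $E$. $V=\max_{S\in\mathcal{S},X\in\mathcal{Q}^1}|\{i:\sum_{t=1}^T\sum_{r=1}^{q-1}X^r_ta^r_i(S_{[t]})\ge\frac12b_i\}|$. $\Pi$ is Euclidean projection onto $\mathcal{Q}^0$; $\overline e^q=(1,0,\ldots,0)\in\mathbb{R}^q$. **The policy $A^{\theta}$ with accuracy $\delta$.** Let $\phi'_\theta(x)=\min(x^+/\theta,1)$. Given step size $\alpha$, momentum constants $\beta_k\ge0$, and positive integers $\eta_1,\eta_2\le T$ (the bound $T$ applying to $\eta_2$ only) and $K$: for each $k\ge0$ let $\mathcal{S}^{E,k}$ be a multiset of $\eta_1$ independent draws of SIM$(E)$ (independent across $E$) and $\aleph^k$ a uniformly random set of $\eta_2$ indices from $\{1,\ldots,T\}$ drawn without replacement (the same for all $E$), all independent across $k$. For $X\in\mathbb{R}^{q\times|\mathcal{E}|}$ let $\hat G^k(X)_E\in\mathbb{R}^q$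 have components, $l=0,\ldots,q-1$, $$\hat G^k(X)_{E,l}=Z^l(E)-2\iota^{-1}\sum_{i=1}^ma^l_i(E)\,\eta_1^{-1}\sum_{S'\in\mathcal{S}^{E,k}}\phi'_\theta\Big(\frac{T}{\eta_2}\sum_{t\in\aleph^k}\sum_{r=1}^{q-1}a^r_i(S'_{[t]})X^r(S'_{[t]})-b_i\Big).$$ A memoization table has $\Upsilon(E,-1)=\Upsilon(E,0)=\overline e^q$ for all $E$ and all other entries initially $\emptyset$; $\Upsilon^k$ denotes $\Upsilon(\cdot,k)$. The recursive routine $\mathrm{R}(E,k)$ does the following if $\Upsilon(E,k)=\emptyset$: it calls SIM$(E)$ $\eta_1$ times, storing the outputs as $\mathcal{S}^{E,k-1}$; calls $\mathrm{R}(E,k-1)$ if $\Upsilon(E,k-1)=\emptyset$; for each $S'\in\mathcal{S}^{E,k-1}$ and $t\in\aleph^{k-1}\cap\bigcup_{i\in a^+(E)}\mathcal{T}_i(S')$ calls $\mathrm{R}(S'_{[t]},k-1)$ if $\Upsilon(S'_{[t]},k-1)=\emptyset$; and sets $$\Upsilon(E,k)=\Pi\Big((1+\beta_{k-1})\Upsilon(E,k-1)-\beta_{k-1}\Upsilon(E,k-2)+\alpha\hat G^{k-1}\big((1+\beta_{k-1})\Upsilon^{k-1}-\beta_{k-1}\Upsilon^{k-2}\big)_E\Big).$$ At each time $t$ the policy calls $\mathrm{R}(S_{[t]},K)$ and returns $K^{-1}\sum_{j=1}^K\Upsilon(S_{[t]},j)$ in setting (i) below, or $\Upsilon(S_{[t]},K)$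 in settings (ii), (iii). With $\rho=\lceil(U_rLW)^{1/4}/\sqrt{\iota\theta}\rceil$ the settings are: (i) $\beta_k=0$ for all $k$, $\alpha=\frac{\iota^2\delta}{24L^2q}$, $K=\lceil\frac{288L^2q}{\delta^2\iota^2}\rceil$, $\eta_1,\eta_2$ the least integers with $\eta_1\ge\frac{2304L^2q}{\iota^2\delta^2}$, $\eta_2\ge\min(\frac{20736L^2T^2q}{\iota^2\theta^2\delta^2},T)$; (ii) $\beta_0=0$, $\beta_k=\frac{k-1}{k+2}$ for $k\ge1$, $\alpha=\frac14\rho^{-2}$, $K=14\rho\lceil\delta^{-1/2}\rceil$, $\eta_1,\eta_2$ the least integers with $\eta_1\ge\frac{142800L^2q}{\iota^2\delta^2}$, $\eta_2\ge\min(\frac{691200L^2T^2q}{\iota^2\theta^2\delta^2},T)$; (iii) as (ii) but with $\eta_2=T$. The setting used is the one with the smallest per-decision runtime bound. **The policy $A_{\mathrm{pen}}$** with accuracy $\epsilon'$ is $A^\theta$ with $\theta=\frac{\epsilon'T\iota}{4V}$ and accuracy $\delta=\frac{\epsilon'}{2}$; its outputs form an element of $\mathcal{Q}^2$. **Rounding and patching maps** (applied on-the-fly). For $X\in\mathcal{Q}^2$: - $\mathrm{H}(X)$: independently for each $E$, draw $\hat r(X,E)\in\{0,\ldots,q-1\}$ with $\mathbb{P}(\hat r(X,E)=l)=X^l(E)$, and set $\mathrm{H}(X)^r(E)=1$ if $r=\hat r(X,E)$, else $0$. - $\mathrm{F}(X)$ is defined by forward induction over $t$ and, within $t$, over $r=1,\ldots,q-1$: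 for $E\in\mathcal{S}^t$, $$\mathrm{F}(X)^r(E)=\min\Big(X^r(E),\min_{i\in a^{r,+}(E)}\frac{b_i-\sum_{u=1}^{t-1}\sum_{l=1}^{q-1}a^l_i(E_{[u]})\mathrm{F}(X)^l(E_{[u]})-\sum_{l=1}^{r-1}a^l_i(E)\mathrm{F}(X)^l(E)}{a^r_i(E)}\Big)$$ (empty sums are 0), with $\mathrm{F}(X)^r(E)=X^r(E)$ if $a^{r,+}(E)=\emptyset$; $\mathrm{F}(X)^0(E)=1-\sum_{r=1}^{q-1}\mathrm{F}(X)^r(E)$. - $\mathrm{J}(X)^r(E)=X^r(E)$ for all $r$ if $X^r(E)\in\{0,1\}$ for all $r$; otherwise $\mathrm{J}(X)^0(E)=1$ and $\mathrm{J}(X)^r(E)=0$ for $r\ne0$. **The policy $A_{\mathrm{NRM}}$** (for given $\epsilon$) is $\mathrm{J}\big(\mathrm{F}(\mathrm{H}(A_{\mathrm{pen}}))\big)$ with $A_{\mathrm{pen}}$ run with accuracy $\epsilon'=.45\,\epsilon$.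
   Formalization: In the time bound of (2), κ and ν are replaced by max(1,κ) and min(1,ν); θ uses max(1,V) and ρ is at least 1. If κ=0 or ν>2 then V=0, so θ is undefined; for V≥1 one has κ≥1, ν≤2, and 4c_0 gives the stated bound. *)

theory Defs
  imports "HOL-Probability.Probability" "HOL-Library.Landau_Symbols" "HOL-Library.Monad_Syntax"
begin

section \<open>Problem instances\<close>

text \<open>
  A point of \<open>\<real>\<^sup>D\<close> is a real list of length \<open>D\<close>, and a history \<open>M\<^sub>[\<^sub>t\<^sub>]\<close> is the list of the
  first \<open>t\<close> points.  Dimensions are values rather than types, so that a constant
  chosen before the instance cannot depend on them.
\<close>

type_synonym hist = "real list list"

record nrm_instance =
  dimension :: nat
  horizon :: nat
  num_choices :: nat
  num_resources :: nat
  budget :: "nat \<Rightarrow> real"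
  law :: "hist pmf"                                        \<comment> \<open>law of \<open>(M\<^sub>1, \<dots>, M\<^sub>T)\<close>\<close>
  reward :: "nat \<Rightarrow> hist \<Rightarrow> real"                          \<comment> \<open>\<open>Z\<^sup>r(E)\<close>\<close>
  consumption :: "nat \<Rightarrow> nat \<Rightarrow> hist \<Rightarrow> real"              \<comment> \<open>\<open>a\<^sup>r\<^sub>i(E)\<close>, arguments \<open>r i E\<close>\<close>
  sparsity :: nat                                          \<comment> \<open>\<open>L\<close>\<close>
  granularity :: real                                      \<comment> \<open>\<open>\<iota>\<close>\<close>
  sim_cost :: real

datatype setting = Setting_i | Setting_ii | Setting_iii

record params =
  step_size :: real
  momentum :: "nat \<Rightarrow> real"
  num_sims :: nat                                          \<comment> \<open>\<open>\<eta>\<^sub>1\<close>\<close>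
  num_indices :: nat                                       \<comment> \<open>\<open>\<eta>\<^sub>2\<close>\<close>
  rounds :: nat                                            \<comment> \<open>\<open>K\<close>\<close>
  averaged :: bool                                         \<comment> \<open>return the average of the iterates\<close>

section \<open>Probabilistic programs with a running-time account\<close>

text \<open>
  A program transforms a machine state at random.  The state holds the memory kept
  between decisions and the time used so far.  Reading and writing memory is
  free; every other primitive advances the clock.  Programs below are composed
  of these primitives only, with instance data read from memory.
\<close>

record machine =
  table :: "hist \<Rightarrow> nat \<Rightarrow> real list option"               \<comment> \<open>\<open>\<Upsilon>\<close>, \<open>None\<close> being an empty entry\<close>
  index_sets :: "nat \<Rightarrow> nat list"                          \<comment> \<open>\<open>\<aleph>\<^sup>k\<close>\<close>
  used :: "nat \<Rightarrow> real"                                    \<comment> \<open>amount of each resource committed by \<open>F\<close>\<close>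
  clock :: real

type_synonym 'a prog = "machine \<Rightarrow> ('a \<times> machine) pmf"

definition ret :: "'a \<Rightarrow> 'a prog" where
  "ret x = (\<lambda>s. return_pmf (x, s))"

definition bind_prog :: "'a prog \<Rightarrow> ('a \<Rightarrow> 'b prog) \<Rightarrow> 'b prog" where
  "bind_prog p f = (\<lambda>s. bind_pmf (p s) (\<lambda>(x, s'). f x s'))"

adhoc_overloading Monad_Syntax.bind \<rightleftharpoons> bind_prog

definition get :: "machine prog" where
  "get = (\<lambda>s. return_pmf (s, s))"

definition update :: "(machine \<Rightarrow> machine) \<Rightarrow> unit prog" where
  "update f = (\<lambda>s. return_pmf ((), f s))"

definition tick :: "real \<Rightarrow> unit prog" where
  "tick c = update (\<lambda>s. s\<lparr>clock := clock s + c\<rparr>)"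

definition timed_draw :: "real \<Rightarrow> 'a pmf \<Rightarrow> 'a prog" where
  "timed_draw c p = do { tick c; (\<lambda>s. map_pmf (\<lambda>x. (x, s)) p) }"

definition op1 :: "'a \<Rightarrow> 'a prog" where
  "op1 x = do { tick 1; ret x }"

abbreviation addM :: "real \<Rightarrow> real \<Rightarrow> real prog" where "addM x y \<equiv> op1 (x + y)"
abbreviation subM :: "real \<Rightarrow> real \<Rightarrow> real prog" where "subM x y \<equiv> op1 (x - y)"
abbreviation mulM :: "real \<Rightarrow> real \<Rightarrow> real prog" where "mulM x y \<equiv> op1 (x * y)"
abbreviation divM :: "real \<Rightarrow> real \<Rightarrow> real prog" where "divM x y \<equiv> op1 (x / y)"
abbreviation minM :: "real \<Rightarrow> real \<Rightarrow> real prog" where "minM x y \<equiv> op1 (min x y)"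
abbreviation maxM :: "real \<Rightarrow> real \<Rightarrow> real prog" where "maxM x y \<equiv> op1 (max x y)"
abbreviation leM :: "real \<Rightarrow> real \<Rightarrow> bool prog" where "leM x y \<equiv> op1 (x \<le> y)"
abbreviation eqM :: "real \<Rightarrow> real \<Rightarrow> bool prog" where "eqM x y \<equiv> op1 (x = y)"
abbreviation memberM :: "nat \<Rightarrow> nat set \<Rightarrow> bool prog" where "memberM t A \<equiv> op1 (t \<in> A)"

definition bernoulliM :: "real \<Rightarrow> bool prog" where
  "bernoulliM p = timed_draw 1 (bernoulli_pmf p)"

text \<open>Each pass through a loop costs one unit in addition to the cost of its body.\<close>

primrec mapM :: "('a \<Rightarrow> 'b prog) \<Rightarrow> 'a list \<Rightarrow> 'b list prog" where
  "mapM f [] = ret []"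
| "mapM f (x # xs) = do { tick 1; y \<leftarrow> f x; ys \<leftarrow> mapM f xs; ret (y # ys) }"

primrec foldM :: "('b \<Rightarrow> 'a \<Rightarrow> 'b prog) \<Rightarrow> 'b \<Rightarrow> 'a list \<Rightarrow> 'b prog" where
  "foldM f z [] = ret z"
| "foldM f z (x # xs) = do { tick 1; z' \<leftarrow> f z x; foldM f z' xs }"

primrec filterM :: "('a \<Rightarrow> bool prog) \<Rightarrow> 'a list \<Rightarrow> 'a list prog" where
  "filterM P [] = ret []"
| "filterM P (x # xs) =
     do { tick 1; c \<leftarrow> P x; ys \<leftarrow> filterM P xs; ret (if c then x # ys else ys) }"

definition sumM :: "('a \<Rightarrow> real prog) \<Rightarrow> 'a list \<Rightarrow> real prog" where
  "sumM f xs = foldM (\<lambda>s x. do { v \<leftarrow> f x; addM s v }) 0 xs"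

text \<open>
  Euclidean projection of \<open>y\<close> onto the probability simplex.  It is the vector with entries
  \<open>max (y\<^sub>l - \<tau>) 0\<close>, where \<open>\<tau>\<close> is the largest of the numbers
  \<open>(\<Sum>{y\<^sub>j. y\<^sub>j \<ge> y\<^sub>l} - 1) / card {j. y\<^sub>j \<ge> y\<^sub>l}\<close> over \<open>l\<close>.
\<close>

definition projM :: "real list \<Rightarrow> real list prog" where
  "projM ys = do {
     ts \<leftarrow> mapM (\<lambda>v. do {
            s \<leftarrow> sumM (\<lambda>w. do { c \<leftarrow> leM v w; ret (if c then w else 0) }) ys;
            n \<leftarrow> sumM (\<lambda>w. do { c \<leftarrow> leM v w; ret (if c then 1 else 0) }) ys;
            d \<leftarrow> subM s 1;
            divM d n }) ys;
     \<tau> \<leftarrow> foldM maxM (hd ts) (tl ts);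
     mapM (\<lambda>y. do { d \<leftarrow> subM y \<tau>; maxM d 0 }) ys }"

text \<open>
  Draws \<open>l\<close> with probability proportional to its weight by successive Bernoulli trials;
  \<open>rest\<close> is the total weight of the list.
\<close>

fun categoricalM :: "nat \<Rightarrow> real \<Rightarrow> real list \<Rightarrow> nat prog" where
  "categoricalM l rest [] = ret l"
| "categoricalM l rest [x] = ret l"
| "categoricalM l rest (x # y # xs) = do {
     p \<leftarrow> divM x rest;
     c \<leftarrow> bernoulliM p;
     if c then ret l
     else do { rest' \<leftarrow> subM rest x; categoricalM (Suc l) rest' (y # xs) } }"

text \<open>Runs the decision procedure on successive histories, recording each output with its time.\<close>

primrec timed_run :: "(hist \<Rightarrow> real list prog) \<Rightarrow> hist list \<Rightarrow> (real list \<times> real) list prog" where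
  "timed_run dec [] = ret []"
| "timed_run dec (E # Es) = do {
     s \<leftarrow> get;
     x \<leftarrow> dec E;
     s' \<leftarrow> get;
     rs \<leftarrow> timed_run dec Es;
     ret ((x, clock s' - clock s) # rs) }"

section \<open>The model\<close>

text \<open>
  \<open>samp_time k\<close> is the time for sampling \<open>k\<close> indices without replacement.  Resources are
  numbered \<open>1, \<dots>, m\<close>, periods \<open>1, \<dots>, T\<close> and options \<open>0, \<dots>, q - 1\<close>; \<open>take t S\<close> is \<open>S\<^sub>[\<^sub>t\<^sub>]\<close>.
\<close>

locale nrm =
  fixes samp_time :: "nat \<Rightarrow> real" and I :: nrm_instance
begin

abbreviation T :: nat where "T \<equiv> horizon I"
abbreviation q :: nat where "q \<equiv> num_choices I"
abbreviation m :: nat where "m \<equiv> num_resources I"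
abbreviation b :: "nat \<Rightarrow> real" where "b \<equiv> budget I"
abbreviation Z :: "nat \<Rightarrow> hist \<Rightarrow> real" where "Z \<equiv> reward I"
abbreviation a :: "nat \<Rightarrow> nat \<Rightarrow> hist \<Rightarrow> real" where "a \<equiv> consumption I"
abbreviation L :: nat where "L \<equiv> sparsity I"
abbreviation \<iota> :: real where "\<iota> \<equiv> granularity I"

definition trajectories :: "hist set" where
  "trajectories = set_pmf (law I)"

definition histories :: "hist set" where
  "histories = (\<Union>t\<in>{1..T}. set_pmf (map_pmf (take t) (law I)))"

definition \<mu> :: "hist \<Rightarrow> real" where
  "\<mu> E = pmf (map_pmf (take (length E)) (law I)) E"

definition well_formed :: bool where
  "well_formed \<longleftrightarrow>
     1 \<le> T \<and> 2 \<le> q \<and> 1 \<le> m \<and> 1 \<le> L \<and> 0 < \<iota> \<and> \<iota> \<le> 1 \<and> 1 \<le> sim_cost I \<and>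
     (\<forall>i\<in>{1..m}. 0 < b i) \<and>
     (\<forall>S\<in>trajectories. length S = T \<and> (\<forall>x\<in>set S. length x = dimension I)) \<and>
     finite histories \<and>
     (\<forall>E\<in>histories.
        Z 0 E = 0 \<and> (\<forall>i\<in>{1..m}. a 0 i E = 0) \<and>
        (\<forall>r<q. 0 \<le> Z r E \<and> Z r E \<le> 1 \<and>
           card {i\<in>{1..m}. a r i E \<noteq> 0} \<le> L \<and>
           (\<forall>i\<in>{1..m}. 0 \<le> a r i E \<and> a r i E \<le> 1 \<and> (a r i E = 0 \<or> \<iota> \<le> a r i E))))"

definition objective :: "(hist \<Rightarrow> nat \<Rightarrow> real) \<Rightarrow> real" where
  "objective X = (\<Sum>E\<in>histories. \<mu> E * (\<Sum>r=1..<q. Z r E * X E r))"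

definition selection :: "(hist \<Rightarrow> nat \<Rightarrow> real) \<Rightarrow> bool" where
  "selection X \<longleftrightarrow> (\<forall>E\<in>histories. (\<forall>r<q. X E r \<in> {0, 1}) \<and> (\<Sum>r<q. X E r) = 1)"

definition within_budgets :: "(hist \<Rightarrow> nat \<Rightarrow> real) \<Rightarrow> bool" where
  "within_budgets X \<longleftrightarrow>
     (\<forall>S\<in>trajectories. \<forall>i\<in>{1..m}.
        (\<Sum>t=1..T. \<Sum>r=1..<q. a r i (take t S) * X (take t S) r) \<le> b i)"

definition OPT :: real where
  "OPT = Sup {objective X | X. selection X \<and> within_budgets X}"

text \<open>A randomized policy is given by the joint law of its outputs on all histories.\<close>

definition admissible :: "(hist \<Rightarrow> nat \<Rightarrow> real) pmf \<Rightarrow> bool" where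
  "admissible P \<longleftrightarrow> (AE A in measure_pmf P. selection A \<and> within_budgets A)"

definition expected_reward :: "(hist \<Rightarrow> nat \<Rightarrow> real) pmf \<Rightarrow> real" where
  "expected_reward P = measure_pmf.expectation P objective"

definition \<nu> :: real where
  "\<nu> = Min (b ` {1..m}) / T"

definition \<kappa> :: nat where
  "\<kappa> = Max {card {r\<in>{..<q}. 0 < a r i E} | E i. E \<in> histories \<and> i \<in> {1..m}}"

text \<open>
  A time bound that decreases in \<open>\<nu>\<close> and vanishes in the exponent for \<open>\<kappa> = 0\<close> cannot hold for
  \<open>\<nu> \<rightarrow> \<infinity>\<close> or \<open>\<kappa> = 0\<close>, as every decision takes some time.  Time bounds are therefore stated with
  \<open>max 1 \<kappa>\<close> and \<open>min 1 \<nu>\<close>, which are \<open>\<kappa>\<close> and \<open>\<nu>\<close> unless no resource is ever consumed or every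
  budget exceeds \<open>T\<close> (and so never binds).
\<close>

definition aplus :: "nat \<Rightarrow> hist \<Rightarrow> nat set" where
  "aplus r E = {i\<in>{1..m}. 0 < a r i E}"

definition times :: "nat \<Rightarrow> hist \<Rightarrow> nat set" where
  "times i S = (\<Union>r\<in>{1..<q}. {t\<in>{1..T}. 0 < a r i (take t S)})"

definition option_times :: "nat \<Rightarrow> hist \<Rightarrow> (nat \<times> nat) set" where
  "option_times i S = {(r, t). r < q \<and> t \<in> {1..T} \<and> 0 < a r i (take t S)}"

definition U\<^sub>r :: nat where
  "U\<^sub>r = Max {card (option_times i S) | S i. S \<in> trajectories \<and> i \<in> {1..m}}"

definition W :: nat where
  "W = Max {\<Sum>t=1..T. \<Sum>l=1..<q. card (aplus l (take t S) \<inter> aplus r (take u S)) | S u r.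
              S \<in> trajectories \<and> u \<in> {1..T} \<and> r < q}"

definition Q0 :: "(nat \<Rightarrow> real) set" where
  "Q0 = {x. (\<forall>r<q. 0 \<le> x r \<and> x r \<le> 1) \<and> (\<Sum>r<q. x r) = 1 \<and> (\<forall>r\<ge>q. x r = 0)}"

definition Q1 :: "(nat \<Rightarrow> nat \<Rightarrow> real) set" where
  "Q1 = {X. \<forall>t\<in>{1..T}. X t \<in> Q0}"

definition V :: nat where
  "V = Max {card {i\<in>{1..m}. (\<Sum>t=1..T. \<Sum>r=1..<q. X t r * a r i (take t S)) \<ge> b i / 2} | S X.
              S \<in> trajectories \<and> X \<in> Q1}"

definition proj :: "(nat \<Rightarrow> real) \<Rightarrow> nat \<Rightarrow> real" where
  "proj y = arg_min (\<lambda>x. L2_set (\<lambda>r. x r - y r) {..<q}) (\<lambda>x. x \<in> Q0)"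

definition null_choice :: "nat \<Rightarrow> real" where
  "null_choice r = (if r = 0 then 1 else 0)"

definition SIM :: "hist \<Rightarrow> hist pmf" where
  "SIM E = cond_pmf (law I) {S. take (length E) S = E}"

section \<open>The policy \<open>A\<^sup>\<theta>\<close>\<close>

definition \<phi>' :: "real \<Rightarrow> real \<Rightarrow> real" where
  "\<phi>' \<theta> x = min (max 0 x / \<theta>) 1"

text \<open>\<open>sims (E, k)\<close> lists the simulated trajectories \<open>\<S>\<^sup>E\<^sup>,\<^sup>k\<close>, and \<open>al k\<close> is \<open>\<aleph>\<^sup>k\<close>.\<close>

definition gradient :: "real \<Rightarrow> params \<Rightarrow> (hist \<times> nat \<Rightarrow> hist list) \<Rightarrow> (nat \<Rightarrow> nat set) \<Rightarrow> nat
    \<Rightarrow> (hist \<Rightarrow> nat \<Rightarrow> real) \<Rightarrow> hist \<Rightarrow> nat \<Rightarrow> real" where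
  "gradient \<theta> p sims al k X E l =
     Z l E - 2 / \<iota> * (\<Sum>i=1..m. a l i E * (1 / num_sims p *
       (\<Sum>S'\<leftarrow>sims (E, k).
          \<phi>' \<theta> (T / num_indices p * (\<Sum>t\<in>al k. \<Sum>r=1..<q. a r i (take t S') * X (take t S') r)
                - b i))))"

text \<open>
  Since \<open>\<Upsilon>(E, -1) = \<Upsilon>(E, 0)\<close>, truncated subtraction in \<open>k - 1\<close> gives the right value at \<open>k = 0\<close>.
\<close>

fun iterate :: "real \<Rightarrow> params \<Rightarrow> (hist \<times> nat \<Rightarrow> hist list) \<Rightarrow> (nat \<Rightarrow> nat set) \<Rightarrow> nat
    \<Rightarrow> hist \<Rightarrow> nat \<Rightarrow> real" where
  "iterate \<theta> p sims al 0 E = null_choice"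
| "iterate \<theta> p sims al (Suc k) E =
     (let Y = (\<lambda>E' r. (1 + momentum p k) * iterate \<theta> p sims al k E' r
                      - momentum p k * iterate \<theta> p sims al (k - 1) E' r)
      in proj (\<lambda>l. Y E l + step_size p * gradient \<theta> p sims al k Y E l))"

definition policy_output :: "real \<Rightarrow> params \<Rightarrow> (hist \<times> nat \<Rightarrow> hist list) \<Rightarrow> (nat \<Rightarrow> nat set)
    \<Rightarrow> hist \<Rightarrow> nat \<Rightarrow> real" where
  "policy_output \<theta> p sims al E l =
     (if averaged p then 1 / rounds p * (\<Sum>j=1..rounds p. iterate \<theta> p sims al j E l)
      else iterate \<theta> p sims al (rounds p) E l)"

definition draws :: "params \<Rightarrow> ((hist \<times> nat \<Rightarrow> hist list) \<times> (nat \<Rightarrow> nat set)) pmf" where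
  "draws p = pair_pmf
     (Pi_pmf (histories \<times> {..<rounds p}) [] (\<lambda>(E, k). replicate_pmf (num_sims p) (SIM E)))
     (Pi_pmf {..<rounds p} {} (\<lambda>k. pmf_of_set {A. A \<subseteq> {1..T} \<and> card A = num_indices p}))"

definition A_params :: "real \<Rightarrow> params \<Rightarrow> (hist \<Rightarrow> nat \<Rightarrow> real) pmf" where
  "A_params \<theta> p = map_pmf (\<lambda>(sims, al). policy_output \<theta> p sims al) (draws p)"

text \<open>
  The paper's \<open>\<rho>\<close> is positive as soon as some option consumes some resource.  The lower
  bound \<open>1\<close> only matters when nothing is ever consumed, where \<open>\<rho>\<^sup>-\<^sup>2\<close> would be undefined.
\<close>

definition \<rho> :: "real \<Rightarrow> nat" where
  "\<rho> \<theta> = max 1 (nat \<lceil>root 4 (U\<^sub>r * L * W) / sqrt (\<iota> * \<theta>)\<rceil>)"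

definition params_i :: "real \<Rightarrow> real \<Rightarrow> params" where
  "params_i \<theta> \<delta> =
     \<lparr>step_size = \<iota>\<^sup>2 * \<delta> / (24 * L\<^sup>2 * q),
      momentum = (\<lambda>k. 0),
      num_sims = nat \<lceil>2304 * L\<^sup>2 * q / (\<iota>\<^sup>2 * \<delta>\<^sup>2)\<rceil>,
      num_indices = nat \<lceil>min (20736 * L\<^sup>2 * T\<^sup>2 * q / (\<iota>\<^sup>2 * \<theta>\<^sup>2 * \<delta>\<^sup>2)) T\<rceil>,
      rounds = nat \<lceil>288 * L\<^sup>2 * q / (\<delta>\<^sup>2 * \<iota>\<^sup>2)\<rceil>,
      averaged = True\<rparr>"

definition params_ii :: "real \<Rightarrow> real \<Rightarrow> params" where
  "params_ii \<theta> \<delta> =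
     \<lparr>step_size = 1 / 4 * (1 / (\<rho> \<theta>)\<^sup>2),
      momentum = (\<lambda>k. if k = 0 then 0 else (real k - 1) / (real k + 2)),
      num_sims = nat \<lceil>142800 * L\<^sup>2 * q / (\<iota>\<^sup>2 * \<delta>\<^sup>2)\<rceil>,
      num_indices = nat \<lceil>min (691200 * L\<^sup>2 * T\<^sup>2 * q / (\<iota>\<^sup>2 * \<theta>\<^sup>2 * \<delta>\<^sup>2)) T\<rceil>,
      rounds = 14 * \<rho> \<theta> * nat \<lceil>1 / sqrt \<delta>\<rceil>,
      averaged = False\<rparr>"

definition settings :: "real \<Rightarrow> real \<Rightarrow> setting \<Rightarrow> params" where
  "settings \<theta> \<delta> c = (case c of
       Setting_i \<Rightarrow> params_i \<theta> \<delta>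
     | Setting_ii \<Rightarrow> params_ii \<theta> \<delta>
     | Setting_iii \<Rightarrow> (params_ii \<theta> \<delta>)\<lparr>num_indices := T\<rparr>)"

section \<open>On-the-fly implementation of \<open>A\<^sup>\<theta>\<close>\<close>

definition null_list :: "real list" where
  "null_list = map null_choice [0..<q]"

definition initial :: machine where
  "initial = \<lparr>table = (\<lambda>E k. if k = 0 then Some null_list else None),
              index_sets = (\<lambda>k. []), used = (\<lambda>i. 0), clock = 0\<rparr>"

definition simM :: "hist \<Rightarrow> hist prog" where
  "simM E = timed_draw (sim_cost I) (SIM E)"

definition index_setM :: "nat \<Rightarrow> nat list prog" where
  "index_setM n = timed_draw (samp_time n)
     (map_pmf sorted_list_of_set (pmf_of_set {A. A \<subseteq> {1..T} \<and> card A = n}))"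

definition relevant_timesM :: "hist \<Rightarrow> hist \<Rightarrow> nat set prog" where
  "relevant_timesM E S' = op1 (\<Union>i\<in>(\<Union>r\<in>{1..<q}. aplus r E). times i S')"

definition emptyM :: "hist \<Rightarrow> nat \<Rightarrow> bool prog" where
  "emptyM E k = do { s \<leftarrow> get; op1 (table s E k = None) }"

definition entryM :: "hist \<Rightarrow> nat \<Rightarrow> real list prog" where
  "entryM E k = do { s \<leftarrow> get; ret (the (table s E k)) }"

definition storeM :: "hist \<Rightarrow> nat \<Rightarrow> real list \<Rightarrow> unit prog" where
  "storeM E k x = update (\<lambda>s. s\<lparr>table := (table s)(E := (table s E)(k := Some x))\<rparr>)"

definition extrapolateM :: "params \<Rightarrow> nat \<Rightarrow> hist \<Rightarrow> nat \<Rightarrow> real prog" where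
  "extrapolateM p k E r = do {
     x \<leftarrow> entryM E k;
     y \<leftarrow> entryM E (k - 1);
     c \<leftarrow> addM 1 (momentum p k);
     u \<leftarrow> mulM c (x ! r);
     v \<leftarrow> mulM (momentum p k) (y ! r);
     subM u v }"

definition \<phi>'M :: "real \<Rightarrow> real \<Rightarrow> real prog" where
  "\<phi>'M \<theta> x = do { y \<leftarrow> maxM 0 x; z \<leftarrow> divM y \<theta>; minM z 1 }"

text \<open>
  \<open>sts\<close> lists the simulated trajectories, each with the sampled times at which it can
  contribute to the sums over \<open>\<aleph>\<^sup>k\<close>.
\<close>

definition gradientM :: "real \<Rightarrow> params \<Rightarrow> nat \<Rightarrow> hist \<Rightarrow> (hist \<times> nat list) list \<Rightarrow> nat \<Rightarrow> real prog"
  where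
  "gradientM \<theta> p k E sts l = do {
     g \<leftarrow> sumM (\<lambda>i. do {
            h \<leftarrow> sumM (\<lambda>(S', ts). do {
                   w \<leftarrow> sumM (\<lambda>t. sumM (\<lambda>r. do {
                          x \<leftarrow> extrapolateM p k (take t S') r;
                          mulM (a r i (take t S')) x }) [1..<q]) ts;
                   c \<leftarrow> divM T (num_indices p);
                   w' \<leftarrow> mulM c w;
                   d \<leftarrow> subM w' (b i);
                   \<phi>'M \<theta> d }) sts;
            h' \<leftarrow> divM h (num_sims p);
            mulM (a l i E) h' }) (sorted_list_of_set (aplus l E));
     c \<leftarrow> divM 2 \<iota>;
     g' \<leftarrow> mulM c g;
     subM (Z l E) g' }"

text \<open>The routine \<open>R(E, k)\<close>, with the arguments in the order \<open>k E\<close>.\<close>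

primrec R :: "real \<Rightarrow> params \<Rightarrow> nat \<Rightarrow> hist \<Rightarrow> unit prog" where
  "R \<theta> p 0 = (\<lambda>E. ret ())"
| "R \<theta> p (Suc k) = (\<lambda>E. do {
     e \<leftarrow> emptyM E (Suc k);
     if \<not> e then ret ()
     else do {
       sims \<leftarrow> mapM (\<lambda>j. simM E) [0..<num_sims p];
       e' \<leftarrow> emptyM E k;
       (if e' then R \<theta> p k E else ret ());
       sts \<leftarrow> mapM (\<lambda>S'. do {
                B \<leftarrow> relevant_timesM E S';
                s \<leftarrow> get;
                ts \<leftarrow> filterM (\<lambda>t. memberM t B) (index_sets s k);
                mapM (\<lambda>t. do {
                  e'' \<leftarrow> emptyM (take t S') k;
                  if e'' then R \<theta> p k (take t S') else ret () }) ts;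
                ret (S', ts) }) sims;
       y \<leftarrow> mapM (\<lambda>l. do {
              x \<leftarrow> extrapolateM p k E l;
              g \<leftarrow> gradientM \<theta> p k E sts l;
              g' \<leftarrow> mulM (step_size p) g;
              addM x g' }) [0..<q];
       x \<leftarrow> projM y;
       storeM E (Suc k) x } })"

text \<open>The sets \<open>\<aleph>\<^sup>k\<close> are sampled once and charged to the first decision.\<close>

definition decide_params :: "real \<Rightarrow> params \<Rightarrow> hist \<Rightarrow> real list prog" where
  "decide_params \<theta> p E = do {
     (if length E = 1
     then do {
       als \<leftarrow> mapM (\<lambda>k. index_setM (num_indices p)) [0..<rounds p];
       update (\<lambda>s. s\<lparr>index_sets := (\<lambda>k. als ! k)\<rparr>) }
     else ret ());
     R \<theta> p (rounds p) E;
     if averaged p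
     then mapM (\<lambda>l. do {
            h \<leftarrow> sumM (\<lambda>j. do { x \<leftarrow> entryM E j; ret (x ! l) }) [1..<Suc (rounds p)];
            divM h (rounds p) }) [0..<q]
     else entryM E (rounds p) }"

definition run :: "(hist \<Rightarrow> real list prog) \<Rightarrow> hist \<Rightarrow> (real list \<times> real) list pmf" where
  "run dec S = map_pmf fst (timed_run dec (map (\<lambda>t. take t S) [1..<Suc T]) initial)"

definition worst_time :: "(hist \<Rightarrow> real list prog) \<Rightarrow> real" where
  "worst_time dec = Sup {c. \<exists>S\<in>trajectories. \<exists>xs\<in>set_pmf (run dec S). c \<in> snd ` set xs}"

text \<open>The setting with the least worst-case time per decision.\<close>

definition chosen :: "real \<Rightarrow> real \<Rightarrow> params" where
  "chosen \<theta> \<delta> = settings \<theta> \<delta>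
     (arg_min (\<lambda>c. worst_time (decide_params \<theta> (settings \<theta> \<delta> c))) (\<lambda>_. True))"

section \<open>The policies \<open>A\<^sub>p\<^sub>e\<^sub>n\<close> and \<open>A\<^sub>N\<^sub>R\<^sub>M\<close>\<close>

text \<open>
  If \<open>V = 0\<close>, the paper's formula for \<open>\<theta>\<close> divides by zero; \<open>V\<close> is then replaced by \<open>1\<close>.
\<close>

definition \<theta>_pen :: "real \<Rightarrow> real" where
  "\<theta>_pen \<epsilon>' = \<epsilon>' * T * \<iota> / (4 * max 1 V)"

definition params_pen :: "real \<Rightarrow> params" where
  "params_pen \<epsilon>' = chosen (\<theta>_pen \<epsilon>') (\<epsilon>' / 2)"

definition A_pen :: "real \<Rightarrow> (hist \<Rightarrow> nat \<Rightarrow> real) pmf" where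
  "A_pen \<epsilon>' = A_params (\<theta>_pen \<epsilon>') (params_pen \<epsilon>')"

definition H :: "(hist \<Rightarrow> nat \<Rightarrow> real) \<Rightarrow> (hist \<Rightarrow> nat \<Rightarrow> real) pmf" where
  "H X = map_pmf (\<lambda>rh E r. if r = rh E then 1 else 0)
     (Pi_pmf histories 0 (\<lambda>E. embed_pmf (\<lambda>l. if l < q then X E l else 0)))"

text \<open>\<open>F_pos\<close> gives the components \<open>r \<ge> 1\<close> of the patching map.\<close>

function F_pos :: "(hist \<Rightarrow> nat \<Rightarrow> real) \<Rightarrow> hist \<Rightarrow> nat \<Rightarrow> real" where
  "F_pos X E r =
     (if aplus r E = {} then X E r
      else min (X E r) (Min ((\<lambda>i.
        (b i - (\<Sum>u=1..<length E. \<Sum>l=1..<q. a l i (take u E) * F_pos X (take u E) l)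
             - (\<Sum>l=1..<r. a l i E * F_pos X E l)) / a r i E) ` aplus r E)))"
  by pat_completeness auto
termination
  by (relation "measures [\<lambda>(X, E, r). length E, \<lambda>(X, E, r). r]") auto

declare F_pos.simps [simp del]

definition F :: "(hist \<Rightarrow> nat \<Rightarrow> real) \<Rightarrow> hist \<Rightarrow> nat \<Rightarrow> real" where
  "F X E r = (if r = 0 then 1 - (\<Sum>l=1..<q. F_pos X E l) else F_pos X E r)"

definition J :: "(hist \<Rightarrow> nat \<Rightarrow> real) \<Rightarrow> hist \<Rightarrow> nat \<Rightarrow> real" where
  "J X E = (if \<forall>r<q. X E r \<in> {0, 1} then X E else null_choice)"

definition A_NRM :: "real \<Rightarrow> (hist \<Rightarrow> nat \<Rightarrow> real) pmf" where
  "A_NRM \<epsilon> = bind_pmf (A_pen (0.45 * \<epsilon>)) (\<lambda>X. map_pmf (\<lambda>Y. J (F Y)) (H X))"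

definition patchM :: "hist \<Rightarrow> nat \<Rightarrow> real \<Rightarrow> real prog" where
  "patchM E r x = do {
     f \<leftarrow> foldM (\<lambda>f i. do {
            s \<leftarrow> get;
            d \<leftarrow> subM (b i) (used s i);
            c \<leftarrow> divM d (a r i E);
            minM f c }) x (sorted_list_of_set (aplus r E));
     mapM (\<lambda>i. do {
       s \<leftarrow> get;
       c \<leftarrow> mulM (a r i E) f;
       u \<leftarrow> addM (used s i) c;
       update (\<lambda>s. s\<lparr>used := (used s)(i := u)\<rparr>) }) (sorted_list_of_set (aplus r E));
     ret f }"

definition decide_NRM :: "real \<Rightarrow> hist \<Rightarrow> real list prog" where
  "decide_NRM \<epsilon> E = do {
     x \<leftarrow> decide_params (\<theta>_pen (0.45 * \<epsilon>)) (params_pen (0.45 * \<epsilon>)) E;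
     rh \<leftarrow> categoricalM 0 1 x;
     fs \<leftarrow> mapM (\<lambda>r. do { c \<leftarrow> op1 (r = rh); patchM E r (if c then 1 else 0) }) [1..<q];
     h \<leftarrow> sumM ret fs;
     f0 \<leftarrow> subM 1 h;
     cs \<leftarrow> mapM (\<lambda>f. do { c \<leftarrow> eqM f 0; c' \<leftarrow> eqM f 1; op1 (c \<or> c') }) (f0 # fs);
     c \<leftarrow> foldM (\<lambda>c c'. op1 (c \<and> c')) True cs;
     ret (if c then f0 # fs else null_list) }"

text \<open>
  On every trajectory, the decisions produced by the program are those of \<open>A\<^sub>N\<^sub>R\<^sub>M\<close>, and
  no decision ever takes longer than \<open>bound\<close>.
\<close>

definition computed_within :: "real \<Rightarrow> real \<Rightarrow> bool" where
  "computed_within \<epsilon> bound \<longleftrightarrow>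
     (\<forall>S\<in>trajectories.
        map_pmf (map fst) (run (decide_NRM \<epsilon>) S) =
          map_pmf (\<lambda>A. map (\<lambda>t. map (A (take t S)) [0..<q]) [1..<Suc T]) (A_NRM \<epsilon>) \<and>
        (\<forall>xs\<in>set_pmf (run (decide_NRM \<epsilon>) S). \<forall>(x, c)\<in>set xs. c \<le> bound))"

end

end

theory Submission
  imports Defs
begin

text \<open>
  Reward.  Budgets are replaced by a penalty: \<open>penalized \<theta>\<close> subtracts from the reward \<open>2 / \<iota>\<close> times a
  smoothed overload of the resources, averaged over trajectories.  It is concave on \<open>\<Q>\<^sup>2\<close>, agrees with the
  objective on feasible selections (\<open>OPT_le\<close>), and \<open>A\<^sup>\<theta>\<close> is a gradient method for it.  The sampled
  gradients are biased, so the regret bounds \<open>projected_gradient_regret\<close> and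
  \<open>accelerated_gradient_regret\<close> allow arbitrary errors, whose mean square is bounded in
  \<open>expected_grad_error\<close>; together they give \<open>value_settings\<close>.  Independent rounding keeps the expected
  reward and changes the load of a resource by a sum of independent bounded terms
  (\<open>excess_rounding\<close>).  Patching then loses at most one unit per exhausted resource and \<open>1 / \<iota>\<close> per unit of
  overload (\<open>card_cuts_le\<close>), which half of the penalty pays for; the other terms are at most
  \<open>\<epsilon> T\<close> if \<open>T\<close> is large (\<open>reward_few_resources\<close>, \<open>reward_large_budgets\<close>).

  Law of the program.  The routine draws trajectories only for the table entries that it fills.  Let
  the completion of a partly filled table be what one obtains by drawing the missing trajectories and
  computing the missing entries from them.  Filling an entry does not change the law of the
  completion (\<open>safe_R\<close>): the draws for the entry are fresh, and afterwards the entry stands for them.  Hence the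
  outputs on a trajectory are distributed as if everything had been drawn in advance (\<open>outputs_law\<close>).

  Time.  A call in round \<open>k\<close> makes at most \<open>1 + \<eta>\<^sub>1 \<eta>\<^sub>2\<close> calls in round \<open>k - 1\<close>, so a decision takes time
  \<open>\<C> M\<^sup>1\<^sup>2\<^sup>K\<close> if \<open>M\<close> bounds the parameters (\<open>decision_time_le\<close>).  Here \<open>M\<close> is polynomial in the data
  of the problem, and \<open>K\<close> is \<open>O((L q / \<iota>)\<^sup>2 / \<epsilon>\<^sup>2)\<close> in the first setting and, for positive \<open>\<kappa>\<close> and \<open>V\<close>,
  \<open>O(\<surd>(\<kappa> L V) / (\<iota> \<epsilon>))\<close> in the second.  The policy runs the setting with the least worst-case time
  before rounding, which is at most the time of either.
\<close>


section \<open>Expectations over finitely supported distributions\<close>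

abbreviation ex :: "'a pmf \<Rightarrow> ('a \<Rightarrow> real) \<Rightarrow> real" where
  "ex \<equiv> measure_pmf.expectation"

lemma ex_eq_sum: "finite (set_pmf p) \<Longrightarrow> ex p f = (\<Sum>x\<in>set_pmf p. pmf p x * f x)"
  by (subst integral_measure_pmf[of "set_pmf p"]) auto

lemma ex_bind:
  assumes "finite (set_pmf p)" "\<And>x. x \<in> set_pmf p \<Longrightarrow> finite (set_pmf (f x))"
  shows "ex (bind_pmf p f) h = ex p (\<lambda>x. ex (f x) h)"
  by (subst pmf_expectation_bind[of "set_pmf p"]) (use assms in \<open>auto simp: ex_eq_sum\<close>)

lemma ex_mono:
  assumes "finite (set_pmf p)" "\<And>x. x \<in> set_pmf p \<Longrightarrow> f x \<le> g x"
  shows "ex p f \<le> ex p g"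
  using assms by (auto simp: ex_eq_sum intro!: sum_mono mult_left_mono)

lemma ex_cong:
  assumes "\<And>x. x \<in> set_pmf p \<Longrightarrow> f x = g x"
  shows "ex p f = ex p g"
  using assms by (intro integral_cong_AE) (auto simp: AE_measure_pmf_iff)

lemma ex_le_const:
  assumes "finite (set_pmf p)" "\<And>x. x \<in> set_pmf p \<Longrightarrow> f x \<le> c"
  shows "ex p f \<le> c"
  using ex_mono[OF assms(1), of f "\<lambda>_. c"] assms(2) by simp

lemma ex_ge_const:
  assumes "finite (set_pmf p)" "\<And>x. x \<in> set_pmf p \<Longrightarrow> c \<le> f x"
  shows "c \<le> ex p f"
  using ex_mono[OF assms(1), of "\<lambda>_. c" f] assms(2) by simp

lemma ex_add: "finite (set_pmf p) \<Longrightarrow> ex p (\<lambda>x. f x + g x) = ex p f + ex p g"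
  by (simp add: ex_eq_sum algebra_simps sum.distrib)

lemma ex_diff: "finite (set_pmf p) \<Longrightarrow> ex p (\<lambda>x. f x - g x) = ex p f - ex p g"
  by (simp add: ex_eq_sum algebra_simps sum_subtractf)

lemma ex_cmult: "ex p (\<lambda>x. c * f x) = c * ex p f"
  by simp

lemma ex_sum: "finite (set_pmf p) \<Longrightarrow> ex p (\<lambda>x. \<Sum>i\<in>A. f i x) = (\<Sum>i\<in>A. ex p (f i))"
  by (simp add: ex_eq_sum sum_distrib_left) (rule sum.swap)

lemma ex_sum_list: "finite (set_pmf p) \<Longrightarrow> ex p (\<lambda>x. \<Sum>i\<leftarrow>xs. f i x) = (\<Sum>i\<leftarrow>xs. ex p (f i))"
  by (induction xs) (simp_all add: ex_add)

lemma finite_set_replicate_pmf: "finite (set_pmf p) \<Longrightarrow> finite (set_pmf (replicate_pmf n p))"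
  unfolding set_replicate_pmf using finite_lists_length_eq[of "set_pmf p" n] by (simp add: lists_eq_set)

lemma finite_set_Pi_pmf:
  assumes "finite A" "\<And>x. x \<in> A \<Longrightarrow> finite (set_pmf (p x))"
  shows "finite (set_pmf (Pi_pmf A d p))"
  unfolding set_Pi_pmf[OF assms(1)] by (rule finite_PiE_dflt) (use assms in auto)

section \<open>Product distributions\<close>

lemma Pi_pmf_resample:
  assumes "finite A" "x \<in> A"
  shows "Pi_pmf A d p = bind_pmf (p x) (\<lambda>v. map_pmf (\<lambda>f. f(x := v)) (Pi_pmf A d p))"
proof -
  obtain B where B: "A = insert x B" "x \<notin> B" using assms(2) by (meson mk_disjoint_insert)
  have fB: "finite B" using B assms by simp
  show ?thesis
    unfolding B(1) Pi_pmf_insert'[OF fB B(2)]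
    by (simp add: map_bind_pmf bind_return_pmf)
qed

lemma Pi_pmf_split_coordinate:
  assumes "finite A" "x \<in> A"
  shows "Pi_pmf A d p = bind_pmf (p x) (\<lambda>v. Pi_pmf A d (p(x := return_pmf v)))"
proof -
  obtain B where B: "A = insert x B" "x \<notin> B" using assms(2) by (meson mk_disjoint_insert)
  have fB: "finite B" using B assms by simp
  have "Pi_pmf B d (p(x := return_pmf v)) = Pi_pmf B d p" for v
    by (rule Pi_pmf_cong) (use B in auto)
  thus ?thesis
    unfolding B(1) Pi_pmf_insert'[OF fB B(2)] by (simp add: bind_return_pmf)
qed

section \<open>Second moments of sample averages\<close>

lemma mean_square_replicate:
  fixes h :: "'a \<Rightarrow> real"
  assumes fin: "finite (set_pmf p)" and mean: "ex p h = 0"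
    and bd: "\<And>x. x \<in> set_pmf p \<Longrightarrow> \<bar>h x\<bar> \<le> 1"
  shows "ex (replicate_pmf n p) (\<lambda>xs. (\<Sum>x\<leftarrow>xs. h x)^2) \<le> n"
    and "ex (replicate_pmf n p) (\<lambda>xs. (\<Sum>x\<leftarrow>xs. h x)) = 0"
proof (induction n)
  case (Suc n)
  let ?P = "replicate_pmf n p"
  note f2 = finite_set_replicate_pmf[OF fin, of n]
  have step: "ex (replicate_pmf (Suc n) p) F = ex p (\<lambda>x. ex ?P (\<lambda>xs. F (x # xs)))" for F :: "_ \<Rightarrow> real"
    unfolding replicate_pmf.simps
    by (subst ex_bind[OF fin]) (auto simp: f2 map_pmf_def[symmetric])
  { case 1
    have sq: "ex ?P (\<lambda>xs. (\<Sum>y\<leftarrow>x # xs. h y)^2) = (h x)^2 + ex ?P (\<lambda>xs. (\<Sum>y\<leftarrow>xs. h y)^2)" for x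
    proof -
      have "ex ?P (\<lambda>xs. (\<Sum>y\<leftarrow>x # xs. h y)^2)
          = ex ?P (\<lambda>xs. (h x)^2 + (2 * h x * (\<Sum>y\<leftarrow>xs. h y) + (\<Sum>y\<leftarrow>xs. h y)^2))"
        by (rule ex_cong) (simp add: power2_sum algebra_simps)
      thus ?thesis using Suc(2) by (simp add: ex_add[OF f2])
    qed
    have "(h x)^2 \<le> 1" if "x \<in> set_pmf p" for x
      using bd[OF that] by (simp add: abs_square_le_1)
    hence "ex p (\<lambda>x. (h x)^2) \<le> 1" by (intro ex_le_const[OF fin])
    thus ?case unfolding step sq using Suc(1) by (simp add: ex_add[OF fin])
  next
    case 2
    show ?case unfolding step using Suc(2) mean by (simp add: ex_add[OF fin] ex_add[OF f2])
  }
qed simp_all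

lemma card_subsets_containing:
  assumes "finite U" "B \<subseteq> U" "card B \<le> n"
  shows "card {A. A \<subseteq> U \<and> card A = n \<and> B \<subseteq> A} = (card U - card B) choose (n - card B)"
proof -
  have fB: "finite B" using assms finite_subset by blast
  have "bij_betw (\<lambda>A. A \<union> B) {A. A \<subseteq> U - B \<and> card A = n - card B} {A. A \<subseteq> U \<and> card A = n \<and> B \<subseteq> A}"
  proof (rule bij_betw_byWitness[where f' = "\<lambda>A. A - B"])
    show "(\<lambda>A. A \<union> B) ` {A. A \<subseteq> U - B \<and> card A = n - card B} \<subseteq> {A. A \<subseteq> U \<and> card A = n \<and> B \<subseteq> A}"
    proof safe
      fix A assume A: "A \<subseteq> U - B" "card A = n - card B"
      have "finite A" using A(1) assms(1) by (meson finite_Diff finite_subset)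
      moreover have "A \<inter> B = {}" using A by auto
      ultimately have "card (A \<union> B) = card A + card B" using fB by (intro card_Un_disjoint) auto
      thus "card (A \<union> B) = n" using A assms by simp
    qed (use assms in auto)
    show "(\<lambda>A. A - B) ` {A. A \<subseteq> U \<and> card A = n \<and> B \<subseteq> A} \<subseteq> {A. A \<subseteq> U - B \<and> card A = n - card B}"
      using fB by (auto simp: card_Diff_subset)
  qed auto
  hence "card {A. A \<subseteq> U \<and> card A = n \<and> B \<subseteq> A} = card {A. A \<subseteq> U - B \<and> card A = n - card B}"
    by (rule bij_betw_same_card[symmetric])
  also have "\<dots> = card (U - B) choose (n - card B)" using assms by (intro n_subsets) auto
  also have "card (U - B) = card U - card B" using assms fB by (simp add: card_Diff_subset)
  finally show ?thesis .
qed

text \<open>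
  After centring, all pairs of distinct elements have the same weight \<open>p2\<close>, and their products add up
  to minus the sum of squares.  So sampling without replacement has no larger second moment than
  independent sampling.
\<close>

lemma mean_square_subset_sample:
  fixes c :: "'a \<Rightarrow> real"
  assumes U: "finite U" "card U = N" and n: "1 \<le> n" "n \<le> N"
    and bd: "\<And>t. t \<in> U \<Longrightarrow> \<bar>c t\<bar> \<le> B"
  shows "ex (pmf_of_set {A. A \<subseteq> U \<and> card A = n}) (\<lambda>A. (real N / n * (\<Sum>t\<in>A. c t) - (\<Sum>t\<in>U. c t))^2)
           \<le> (real N)^2 * B^2 / n"
proof -
  define AA where "AA = {A. A \<subseteq> U \<and> card A = n}"
  have finAA: "finite AA" unfolding AA_def using U by auto
  have cardAA: "card AA = N choose n" unfolding AA_def using n_subsets[OF U(1)] U(2) by simp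
  hence ne: "AA \<noteq> {}" using n by (metis card.empty binomial_eq_0_iff not_le)
  have N: "N \<ge> 1" using n by simp
  define \<mu> where "\<mu> = (\<Sum>t\<in>U. c t) / N"
  define d where "d t = c t - \<mu>" for t
  have sd: "(\<Sum>t\<in>U. d t) = 0" unfolding d_def \<mu>_def using U N by (simp add: sum_subtractf)
  have dc: "(\<Sum>t\<in>U. (d t)^2) \<le> N * B^2"
  proof -
    have "(\<Sum>t\<in>U. (d t)^2) = (\<Sum>t\<in>U. (c t)^2) - N * \<mu>^2"
    proof -
      have "(\<Sum>t\<in>U. (d t)^2) = (\<Sum>t\<in>U. (c t)^2 - 2 * \<mu> * c t + \<mu>^2)"
        by (rule sum.cong) (simp_all add: d_def power2_diff)
      also have "\<dots> = (\<Sum>t\<in>U. (c t)^2) - 2 * \<mu> * (\<Sum>t\<in>U. c t) + N * \<mu>^2"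
        using U by (simp add: sum.distrib sum_subtractf sum_distrib_left)
      also have "(\<Sum>t\<in>U. c t) = N * \<mu>" using N by (simp add: \<mu>_def)
      finally show ?thesis by (simp add: power2_eq_square)
    qed
    also have "\<dots> \<le> (\<Sum>t\<in>U. (c t)^2)" by simp
    also have "\<dots> \<le> (\<Sum>t\<in>U. B^2)"
      by (intro sum_mono) (use bd in \<open>metis abs_ge_zero power2_abs power_mono\<close>)
    finally show ?thesis using U by simp
  qed
  have centre: "real N / n * (\<Sum>t\<in>A. c t) - (\<Sum>t\<in>U. c t) = real N / n * (\<Sum>t\<in>A. d t)" if "A \<in> AA" for A
  proof -
    have "(\<Sum>t\<in>A. d t) = (\<Sum>t\<in>A. c t) - n * \<mu>" using that by (simp add: AA_def d_def sum_subtractf)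
    thus ?thesis using n N by (simp add: \<mu>_def field_simps)
  qed
  define p1 where "p1 = real ((N - 1) choose (n - 1))"
  define p2 where "p2 = (if 2 \<le> n then real ((N - 2) choose (n - 2)) else 0)"
  have p2: "p2 \<ge> 0" by (simp add: p2_def)
  have c1: "real (card {A\<in>AA. t \<in> A}) = p1" if "t \<in> U" for t
  proof -
    have "{A\<in>AA. t \<in> A} = {A. A \<subseteq> U \<and> card A = n \<and> {t} \<subseteq> A}" by (auto simp: AA_def)
    thus ?thesis using card_subsets_containing[of U "{t}" n] U n that by (simp add: p1_def)
  qed
  have c2: "real (card {A\<in>AA. t \<in> A \<and> u \<in> A}) = p2" if "t \<in> U" "u \<in> U" "t \<noteq> u" for t u
  proof (cases "2 \<le> n")
    case True
    have "{A\<in>AA. t \<in> A \<and> u \<in> A} = {A. A \<subseteq> U \<and> card A = n \<and> {t,u} \<subseteq> A}" by (auto simp: AA_def)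
    thus ?thesis using card_subsets_containing[of U "{t,u}" n] U True that by (simp add: p2_def numeral_2_eq_2)
  next
    case False
    have "{A\<in>AA. t \<in> A \<and> u \<in> A} = {}"
    proof (safe, goal_cases)
      case (1 A)
      hence "finite A" "{t,u} \<subseteq> A" "card A = n" using U by (auto simp: AA_def intro: finite_subset)
      hence "card {t,u} \<le> n" using card_mono[of A "{t,u}"] by simp
      thus ?case using that False by simp
    qed
    thus ?thesis using False unfolding p2_def by (metis card.empty of_nat_0)
  qed
  have "(\<Sum>A\<in>AA. (\<Sum>t\<in>A. d t)^2) = (\<Sum>A\<in>AA. \<Sum>t\<in>U. \<Sum>u\<in>U. d t * d u * (if t \<in> A \<and> u \<in> A then 1 else 0))"
  proof (rule sum.cong[OF refl])
    fix A assume "A \<in> AA"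
    hence A: "A = U \<inter> A" "finite A" using U by (auto simp: AA_def intro: finite_subset)
    have "(\<Sum>t\<in>A. d t) = (\<Sum>t\<in>U. if t \<in> A then d t else 0)"
      using A U by (metis sum.inter_restrict)
    hence "(\<Sum>t\<in>A. d t)^2 = (\<Sum>t\<in>U. \<Sum>u\<in>U. (if t \<in> A then d t else 0) * (if u \<in> A then d u else 0))"
      by (simp add: power2_eq_square sum_product)
    also have "\<dots> = (\<Sum>t\<in>U. \<Sum>u\<in>U. d t * d u * (if t \<in> A \<and> u \<in> A then 1 else 0))"
      by (intro sum.cong) auto
    finally show "(\<Sum>t\<in>A. d t)^2 = \<dots>" .
  qed
  also have "\<dots> = (\<Sum>t\<in>U. \<Sum>u\<in>U. d t * d u * real (card {A\<in>AA. t \<in> A \<and> u \<in> A}))"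
  proof -
    have "(\<Sum>A\<in>AA. d t * d u * (if t \<in> A \<and> u \<in> A then 1 else 0)) = d t * d u * real (card {A\<in>AA. t \<in> A \<and> u \<in> A})" for t u
      using finAA by (simp add: sum_distrib_left[symmetric] sum.If_cases Int_def)
    hence "(\<Sum>t\<in>U. \<Sum>u\<in>U. d t * d u * real (card {A\<in>AA. t \<in> A \<and> u \<in> A}))
        = (\<Sum>t\<in>U. \<Sum>u\<in>U. \<Sum>A\<in>AA. d t * d u * (if t \<in> A \<and> u \<in> A then 1 else 0))" by simp
    also have "\<dots> = (\<Sum>t\<in>U. \<Sum>A\<in>AA. \<Sum>u\<in>U. d t * d u * (if t \<in> A \<and> u \<in> A then 1 else 0))"
      by (intro sum.cong refl sum.swap)
    also have "\<dots> = (\<Sum>A\<in>AA. \<Sum>t\<in>U. \<Sum>u\<in>U. d t * d u * (if t \<in> A \<and> u \<in> A then 1 else 0))"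
      by (rule sum.swap)
    finally show ?thesis by simp
  qed
  also have "\<dots> = (\<Sum>t\<in>U. \<Sum>u\<in>U. d t * d u * p2 + (if u = t then (d t)^2 * (p1 - p2) else 0))"
    by (intro sum.cong refl) (auto simp: c1 c2 power2_eq_square algebra_simps)
  also have "\<dots> = p2 * (\<Sum>t\<in>U. d t)^2 + (p1 - p2) * (\<Sum>t\<in>U. (d t)^2)"
    using U by (simp add: sum.distrib power2_eq_square sum_product sum_distrib_left mult_ac)
  also have "\<dots> \<le> p1 * (N * B^2)"
  proof -
    have "(p1 - p2) * (\<Sum>t\<in>U. (d t)^2) \<le> p1 * (\<Sum>t\<in>U. (d t)^2)"
      using p2 by (intro mult_right_mono sum_nonneg) auto
    also have "\<dots> \<le> p1 * (N * B^2)" using dc by (intro mult_left_mono) (auto simp: p1_def)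
    finally show ?thesis using sd by simp
  qed
  finally have main: "(\<Sum>A\<in>AA. (\<Sum>t\<in>A. d t)^2) \<le> p1 * (N * B^2)" .
  have ratio: "p1 * N = n * real (card AA)"
  proof -
    obtain N' n' where "N = Suc N'" "n = Suc n'" using N n by (cases N; cases n) auto
    thus ?thesis using arg_cong[OF Suc_times_binomial_eq[of N' n'], of real]
      unfolding cardAA p1_def by (simp add: algebra_simps del: binomial_Suc_Suc)
  qed
  have cpos: "real (card AA) > 0" using ne finAA by (simp add: card_gt_0_iff)
  have "ex (pmf_of_set AA) (\<lambda>A. (real N / n * (\<Sum>t\<in>A. c t) - (\<Sum>t\<in>U. c t))^2)
      = (\<Sum>A\<in>AA. (real N / n * (\<Sum>t\<in>A. d t))^2) / card AA"
    using centre by (subst integral_pmf_of_set[OF ne finAA]) (simp add: power_mult_distrib)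
  also have "\<dots> = (real N / n)^2 * (\<Sum>A\<in>AA. (\<Sum>t\<in>A. d t)^2) / card AA"
    by (simp only: power_mult_distrib sum_distrib_left[symmetric])
  also have "\<dots> \<le> (real N / n)^2 * (p1 * (N * B^2)) / card AA"
    using main by (intro divide_right_mono mult_left_mono) auto
  also have "p1 * (N * B^2) = n * real (card AA) * B^2" using ratio by simp
  also have "(real N / n)^2 * (n * real (card AA) * B^2) / card AA = (real N)^2 * B^2 / n"
    using cpos n by (simp add: power2_eq_square field_simps)
  finally show ?thesis unfolding AA_def .
qed

section \<open>First-order methods with adversarial gradient noise\<close>

definition dot :: "('j \<Rightarrow> real) \<Rightarrow> 'j set \<Rightarrow> ('j \<Rightarrow> real) \<Rightarrow> ('j \<Rightarrow> real) \<Rightarrow> real" where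
  "dot w J x y = (\<Sum>j\<in>J. w j * (x j * y j))"

abbreviation nsq :: "('j \<Rightarrow> real) \<Rightarrow> 'j set \<Rightarrow> ('j \<Rightarrow> real) \<Rightarrow> real" where
  "nsq w J x \<equiv> dot w J x x"

lemma nsq_nonneg: "(\<And>j. j \<in> J \<Longrightarrow> 0 \<le> w j) \<Longrightarrow> 0 \<le> nsq w J x"
  by (auto simp: dot_def intro!: sum_nonneg)

lemma dot_young:
  assumes "\<And>j. j \<in> J \<Longrightarrow> 0 \<le> w j" "0 < c"
  shows "dot w J x y \<le> nsq w J x / (2 * c) + c / 2 * nsq w J y"
proof -
  have "x j * y j \<le> x j * x j / (2 * c) + c / 2 * (y j * y j)" for j
  proof -
    have "0 \<le> (x j - c * y j)^2" by simp
    hence "2 * c * (x j * y j) \<le> x j * x j + c * c * (y j * y j)" by (simp add: power2_eq_square algebra_simps)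
    thus ?thesis using assms(2) by (simp add: field_simps)
  qed
  hence "dot w J x y \<le> (\<Sum>j\<in>J. w j * (x j * x j / (2 * c) + c / 2 * (y j * y j)))"
    unfolding dot_def by (intro sum_mono mult_left_mono) (use assms in auto)
  also have "\<dots> = nsq w J x / (2 * c) + c / 2 * nsq w J y"
    unfolding dot_def by (simp add: algebra_simps sum.distrib sum_distrib_left sum_divide_distrib)
  finally show ?thesis .
qed

lemma dot_cauchy_schwarz:
  assumes "\<And>j. j \<in> J \<Longrightarrow> 0 \<le> w j"
  shows "\<bar>dot w J x y\<bar> \<le> sqrt (nsq w J x) * sqrt (nsq w J y)"
proof -
  have s: "w j = sqrt (w j) * sqrt (w j)" if "j \<in> J" for j using assms[OF that] by simp
  have n: "nsq w J x = (\<Sum>j\<in>J. (sqrt (w j) * x j)^2)" for x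
    unfolding dot_def by (rule sum.cong) (use assms in \<open>auto simp: power2_eq_square\<close>)
  have "dot w J x y = (\<Sum>j\<in>J. (sqrt (w j) * x j) * (sqrt (w j) * y j))"
    unfolding dot_def by (rule sum.cong) (use assms in auto)
  hence "(dot w J x y)^2 \<le> nsq w J x * nsq w J y"
    unfolding n by (simp only: Cauchy_Schwarz_ineq_sum)
  hence "sqrt ((dot w J x y)^2) \<le> sqrt (nsq w J x * nsq w J y)" by (rule real_sqrt_le_mono)
  thus ?thesis by (simp add: real_sqrt_mult)
qed

lemma nsq_step:
  "nsq w J (\<lambda>j. x j + c * g j - u j)
     = nsq w J (\<lambda>j. x j - u j) + 2 * c * dot w J g (\<lambda>j. x j - u j) + c^2 * nsq w J g"
  unfolding dot_def sum_distrib_left sum.distrib[symmetric]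
  by (rule sum.cong) (auto simp: power2_eq_square algebra_simps)

lemma dot_add_left: "dot w J (\<lambda>j. x j + y j) z = dot w J x z + dot w J y z"
  unfolding dot_def by (simp add: algebra_simps sum.distrib)

lemma dot_diff_right: "dot w J z (\<lambda>j. x j - y j) = dot w J z x - dot w J z y"
  unfolding dot_def by (simp add: algebra_simps sum_subtractf)

lemma dot_minus: "dot w J z (\<lambda>j. x j - y j) = - dot w J z (\<lambda>j. y j - x j)"
  unfolding dot_def by (simp add: algebra_simps sum_negf[symmetric] flip: sum_subtractf)

text \<open>
  The standard telescoping argument for projected gradient ascent.  Only the squared
  distance to the comparator is tracked; the noise enters linearly.  The last iterate needs
  no further step: the term that a step would telescope against is supplied by Young's
  inequality.
\<close>

lemma projected_gradient_regret:
  fixes x g e :: "nat \<Rightarrow> 'j \<Rightarrow> real"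
  assumes w: "\<And>j. j \<in> J \<Longrightarrow> 0 \<le> w j" and \<alpha>: "0 < \<alpha>" and K: "1 \<le> K"
    and first_order: "\<And>k. 1 \<le> k \<Longrightarrow> k \<le> K \<Longrightarrow> f u - f (x k) \<le> dot w J (g k) (\<lambda>j. u j - x k j)"
    and step: "\<And>k. 1 \<le> k \<Longrightarrow> k < K \<Longrightarrow> nsq w J (\<lambda>j. x (Suc k) j - u j)
                  \<le> nsq w J (\<lambda>j. x k j + \<alpha> * (g k j + e k j) - u j)"
    and G2: "\<And>k. 1 \<le> k \<Longrightarrow> k < K \<Longrightarrow> nsq w J (\<lambda>j. g k j + e k j) \<le> G2" "nsq w J (g K) \<le> G2"
    and D2: "nsq w J (\<lambda>j. x 1 j - u j) \<le> D2"
  shows "2 * \<alpha> * (\<Sum>k=1..K. f u - f (x k))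
           \<le> D2 + \<alpha>^2 * (K * G2) + 2 * \<alpha> * (\<Sum>k=1..<K. dot w J (e k) (\<lambda>j. x k j - u j))"
proof -
  have tele: "2 * \<alpha> * (\<Sum>k=1..n. f u - f (x k)) \<le> D2 - nsq w J (\<lambda>j. x (Suc n) j - u j) + \<alpha>^2 * (n * G2)
           + 2 * \<alpha> * (\<Sum>k=1..n. dot w J (e k) (\<lambda>j. x k j - u j))" if "n < K" for n
    using that
  proof (induction n)
    case 0
    thus ?case using D2 by simp
  next
    case (Suc n)
    let ?k = "Suc n"
    have "nsq w J (\<lambda>j. x (Suc ?k) j - u j) \<le> nsq w J (\<lambda>j. x ?k j + \<alpha> * (g ?k j + e ?k j) - u j)"
      using step[of ?k] Suc.prems by simp
    also have "\<dots> = nsq w J (\<lambda>j. x ?k j - u j)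
        + 2 * \<alpha> * (dot w J (g ?k) (\<lambda>j. x ?k j - u j) + dot w J (e ?k) (\<lambda>j. x ?k j - u j))
        + \<alpha>^2 * nsq w J (\<lambda>j. g ?k j + e ?k j)"
      by (simp only: nsq_step dot_add_left)
    also have "\<dots> \<le> nsq w J (\<lambda>j. x ?k j - u j)
        + 2 * \<alpha> * (f (x ?k) - f u + dot w J (e ?k) (\<lambda>j. x ?k j - u j)) + \<alpha>^2 * G2"
      using first_order[of ?k] G2(1)[of ?k] Suc.prems \<alpha>
      by (intro add_mono mult_left_mono) (auto simp: dot_minus[of w J "g ?k" "x ?k"])
    finally show ?case using Suc by (simp add: algebra_simps)
  qed
  obtain n where n: "K = Suc n" using K by (cases K) auto
  have "f u - f (x K) \<le> dot w J (g K) (\<lambda>j. u j - x K j)" using first_order[of K] K by simp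
  also have "\<dots> \<le> nsq w J (g K) / (2 * (1/\<alpha>)) + (1/\<alpha>) / 2 * nsq w J (\<lambda>j. u j - x K j)"
    by (rule dot_young) (use w \<alpha> in auto)
  also have "nsq w J (\<lambda>j. u j - x K j) = nsq w J (\<lambda>j. x K j - u j)"
    unfolding dot_def by (rule sum.cong) (auto simp: algebra_simps)
  finally have "2 * \<alpha> * (f u - f (x K)) \<le> \<alpha>^2 * nsq w J (g K) + nsq w J (\<lambda>j. x K j - u j)"
    using \<alpha> by (simp add: field_simps power2_eq_square)
  also have "\<dots> \<le> \<alpha>^2 * G2 + nsq w J (\<lambda>j. x K j - u j)"
    using G2(2) by (intro add_mono mult_left_mono) auto
  finally have last: "2 * \<alpha> * (f u - f (x K)) \<le> \<alpha>^2 * G2 + nsq w J (\<lambda>j. x K j - u j)" .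
  have "(\<Sum>k=1..K. f u - f (x k)) = (\<Sum>k=1..n. f u - f (x k)) + (f u - f (x K))" unfolding n by simp
  moreover have "{1..<K} = {1..n}" using n by auto
  ultimately show ?thesis using tele[of n] last n by (simp add: algebra_simps)
qed

lemma le_add_of_square_le:
  fixes s p c :: real
  assumes "0 \<le> p" "0 \<le> c" "s^2 \<le> p^2 + c * s"
  shows "s \<le> p + c"
proof (rule ccontr)
  assume "\<not> ?thesis"
  hence a: "p + c < s" by simp
  have "p * p \<le> p * s" using a assms by (intro mult_left_mono) auto
  moreover have "(p + c) * s < s * s" using a assms by (intro mult_strict_right_mono) auto
  ultimately show False using assms(3) by (simp add: power2_eq_square algebra_simps)
qed

text \<open>
  One step of the accelerated method compares the new iterate with the point that divides the
  segment from the old iterate to the comparator \<open>u\<close> in the ratio \<open>1/t\<close>.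
\<close>

lemma accelerated_step:
  fixes x x' y g e u :: "'j \<Rightarrow> real"
  assumes w: "\<And>j. j \<in> J \<Longrightarrow> 0 \<le> w j" and \<alpha>: "0 < \<alpha>" and t: "1 \<le> t" and M: "\<alpha> * M \<le> 1"
    and v: "v = (\<lambda>j. (1 - 1/t) * x j + 1/t * u j)"
    and above: "f v \<le> f y + dot w J g (\<lambda>j. v j - y j)"
    and below: "f x' \<ge> f y + dot w J g (\<lambda>j. x' j - y j) - M / 2 * nsq w J (\<lambda>j. x' j - y j)"
    and proj: "dot w J (\<lambda>j. y j + \<alpha> * (g j + e j) - x' j) (\<lambda>j. v j - x' j) \<le> 0"
    and conc: "f v \<ge> (1 - 1/t) * f x + 1/t * f u"
  shows "2 * \<alpha> * t^2 * (f u - f x') + nsq w J (\<lambda>j. t * x' j - (t - 1) * x j - u j)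
     \<le> 2 * \<alpha> * (t^2 - t) * (f u - f x) + nsq w J (\<lambda>j. t * y j - (t - 1) * x j - u j)
       + 2 * \<alpha> * t * dot w J e (\<lambda>j. t * x' j - (t - 1) * x j - u j)"
proof -
  have tv: "t * v j = (t - 1) * x j + u j" for j using t unfolding v by (simp add: field_simps)
  have id: "2 * dot w J (\<lambda>j. y j + \<alpha> * (g j + e j) - x' j) (\<lambda>j. v j - x' j)
      = 2 * \<alpha> * (dot w J g (\<lambda>j. v j - x' j) + dot w J e (\<lambda>j. v j - x' j))
        + nsq w J (\<lambda>j. x' j - y j) + nsq w J (\<lambda>j. v j - x' j) - nsq w J (\<lambda>j. v j - y j)"
    unfolding dot_def sum_distrib_left sum.distrib[symmetric] sum_subtractf[symmetric]
    by (rule sum.cong) (auto simp: algebra_simps)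
  have gd: "dot w J g (\<lambda>j. v j - y j) - dot w J g (\<lambda>j. x' j - y j) = dot w J g (\<lambda>j. v j - x' j)"
    by (simp only: dot_diff_right)
  have "2 * \<alpha> * (f v - f x') \<le> 2 * \<alpha> * (dot w J g (\<lambda>j. v j - x' j) + M / 2 * nsq w J (\<lambda>j. x' j - y j))"
    using above below gd \<alpha> by (intro mult_left_mono) auto
  also have "\<dots> = 2 * \<alpha> * dot w J g (\<lambda>j. v j - x' j) + (\<alpha> * M) * nsq w J (\<lambda>j. x' j - y j)"
    by (simp add: algebra_simps)
  also have "\<dots> \<le> 2 * \<alpha> * dot w J g (\<lambda>j. v j - x' j) + 1 * nsq w J (\<lambda>j. x' j - y j)"
    using M nsq_nonneg[OF w] by (intro add_left_mono mult_right_mono) auto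
  finally have "2 * \<alpha> * (f v - f x')
      \<le> nsq w J (\<lambda>j. v j - y j) - nsq w J (\<lambda>j. v j - x' j) - 2 * \<alpha> * dot w J e (\<lambda>j. v j - x' j)"
    using proj id by (simp add: algebra_simps)
  hence "t^2 * (2 * \<alpha> * (f v - f x'))
      \<le> t^2 * (nsq w J (\<lambda>j. v j - y j) - nsq w J (\<lambda>j. v j - x' j) - 2 * \<alpha> * dot w J e (\<lambda>j. v j - x' j))"
    by (intro mult_left_mono) auto
  also have "\<dots> = nsq w J (\<lambda>j. t * y j - (t - 1) * x j - u j) - nsq w J (\<lambda>j. t * x' j - (t - 1) * x j - u j)
       + 2 * \<alpha> * t * dot w J e (\<lambda>j. t * x' j - (t - 1) * x j - u j)"
  proof -
    have "nsq w J (\<lambda>j. t * y j - (t - 1) * x j - u j) = t^2 * nsq w J (\<lambda>j. v j - y j)" for y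
    proof -
      have *: "t * y j - (t - 1) * x j - u j = t * (y j - v j)" for j
        using tv[of j] by (simp add: algebra_simps)
      show ?thesis unfolding dot_def sum_distrib_left *
        by (intro sum.cong) (simp_all add: power2_eq_square algebra_simps)
    qed
    moreover have "dot w J e (\<lambda>j. t * x' j - (t - 1) * x j - u j) = - t * dot w J e (\<lambda>j. v j - x' j)"
    proof -
      have *: "t * x' j - (t - 1) * x j - u j = t * (x' j - v j)" for j
        using tv[of j] by (simp add: algebra_simps)
      show ?thesis unfolding dot_def sum_distrib_left *
        by (intro sum.cong) (simp_all add: algebra_simps)
    qed
    ultimately show ?thesis by (simp add: power2_eq_square algebra_simps)
  qed
  finally have 1: "2 * \<alpha> * t^2 * (f v - f x') \<le> \<dots>" by (simp add: algebra_simps)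
  have "t^2 * f v \<ge> t^2 * ((1 - 1/t) * f x + 1/t * f u)" using conc by (intro mult_left_mono) auto
  also have "t^2 * ((1 - 1/t) * f x + 1/t * f u) = (t^2 - t) * f x + t * f u"
    using t by (simp add: field_simps power2_eq_square)
  finally have "2 * \<alpha> * ((t^2 - t) * f x + t * f u) \<le> 2 * \<alpha> * (t^2 * f v)"
    using \<alpha> by (intro mult_left_mono) auto
  thus ?thesis using 1 by (simp add: algebra_simps)
qed

text \<open>
  Accelerated projected gradient ascent with arbitrary errors \<open>e k\<close> in the gradients.  The
  potential \<open>2 \<alpha> t\<^sup>2 (f u - f x) + \<parallel>z - u\<parallel>^2\<close> dominates the squared distance by which an error is
  multiplied, so that its square root grows by at most \<open>2 \<alpha> t \<parallel>e k\<parallel>\<close> per step: errors do not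
  accumulate.  This needs \<open>f u \<ge> f (x k)\<close> along the path, which is achieved by comparing with the
  best of \<open>u\<close> and all iterates instead of \<open>u\<close>.
\<close>

lemma accelerated_gradient_regret:
  fixes x y g e :: "nat \<Rightarrow> 'j \<Rightarrow> real" and u :: "'j \<Rightarrow> real"
  assumes w: "\<And>j. j \<in> J \<Longrightarrow> 0 \<le> w j" and \<alpha>: "0 < \<alpha>" and M: "\<alpha> * M \<le> 1" and K: "1 \<le> K"
    and convex: "\<And>x v s. x \<in> Q \<Longrightarrow> v \<in> Q \<Longrightarrow> 0 \<le> s \<Longrightarrow> s \<le> 1 \<Longrightarrow> (\<lambda>j. (1 - s) * x j + s * v j) \<in> Q"
    and concave: "\<And>x v s. x \<in> Q \<Longrightarrow> v \<in> Q \<Longrightarrow> 0 \<le> s \<Longrightarrow> s \<le> 1 \<Longrightarrow>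
                   (1 - s) * f x + s * f v \<le> f (\<lambda>j. (1 - s) * x j + s * v j)"
    and xQ: "\<And>k. k \<le> K \<Longrightarrow> x k \<in> Q" and uQ: "u \<in> Q"
    and y: "\<And>k. k < K \<Longrightarrow> y k = (\<lambda>j. (1 + \<beta> k) * x k j - \<beta> k * x (k - 1) j)"
    and \<beta>: "\<And>k. \<beta> k = (if k = 0 then 0 else (real k - 1) / (real k + 2))"
    and above: "\<And>k v. k < K \<Longrightarrow> v \<in> Q \<Longrightarrow> f v \<le> f (y k) + dot w J (g k) (\<lambda>j. v j - y k j)"
    and below: "\<And>k. k < K \<Longrightarrow> f (x (Suc k)) \<ge> f (y k) + dot w J (g k) (\<lambda>j. x (Suc k) j - y k j)
                  - M / 2 * nsq w J (\<lambda>j. x (Suc k) j - y k j)"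
    and proj: "\<And>k v. k < K \<Longrightarrow> v \<in> Q \<Longrightarrow>
                 dot w J (\<lambda>j. y k j + \<alpha> * (g k j + e k j) - x (Suc k) j) (\<lambda>j. v j - x (Suc k) j) \<le> 0"
    and D2: "\<And>v. v \<in> Q \<Longrightarrow> nsq w J (\<lambda>j. x 0 j - v j) \<le> D2"
  shows "2 * \<alpha> * ((real K + 1) / 2)^2 * (f u - f (x K))
     \<le> 2 * D2 + 8 * \<alpha>^2 * (\<Sum>k<K. (real k + 2) / 2) * (\<Sum>k<K. (real k + 2) / 2 * nsq w J (e k))"
proof -
  obtain u' where u'Q: "u' \<in> Q" and u'max: "f u \<le> f u'" "\<And>k. k \<le> K \<Longrightarrow> f (x k) \<le> f u'"
  proof -
    let ?S = "insert u (x ` {..K})"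
    have "finite (f ` ?S)" "f ` ?S \<noteq> {}" by auto
    from Max_in[OF this] obtain v where v: "Max (f ` ?S) = f v" "v \<in> ?S" by (rule imageE)
    have "f z \<le> f v" if "z \<in> ?S" for z
      unfolding v(1)[symmetric] by (rule Max_ge) (use that in auto)
    moreover have "v \<in> Q" using v(2) xQ uQ by auto
    ultimately show ?thesis using that[of v] by auto
  qed
  define t where "t k = (real k + 1) / 2" for k :: nat
  define z where "z k j = t k * x k j - (t k - 1) * x (k - 1) j" for k j
  define N where "N k = nsq w J (\<lambda>j. z k j - u' j)" for k
  define \<Phi> where "\<Phi> k = 2 * \<alpha> * ((t (Suc k))^2 - t (Suc k)) * (f u' - f (x k)) + N k" for k
  define \<Psi> where "\<Psi> k = 2 * \<alpha> * (t k)^2 * (f u' - f (x k)) + N k" for k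
  define E where "E k = sqrt (nsq w J (e k))" for k
  have N0: "N k \<ge> 0" for k unfolding N_def by (rule nsq_nonneg) (use w in auto)
  have E0: "E k \<ge> 0" for k unfolding E_def using nsq_nonneg[OF w] by simp
  have N\<Psi>: "N k \<le> \<Psi> k" if "k \<le> K" for k
    unfolding \<Psi>_def using u'max(2)[OF that] \<alpha> by simp
  have \<Phi>\<Psi>: "\<Phi> k \<le> \<Psi> k" if "k \<le> K" for k
  proof -
    have "(t (Suc k))^2 - t (Suc k) \<le> (t k)^2" unfolding t_def by (simp add: power2_eq_square field_simps)
    thus ?thesis unfolding \<Phi>_def \<Psi>_def using u'max(2)[OF that] \<alpha>
      by (intro add_right_mono mult_right_mono mult_left_mono) auto
  qed
  have step: "\<Psi> (Suc k) \<le> \<Phi> k + 2 * \<alpha> * t (Suc k) * E k * sqrt (N (Suc k))" if k: "k < K" for k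
  proof -
    let ?t = "t (Suc k)"
    let ?v = "\<lambda>j. (1 - 1/?t) * x k j + 1/?t * u' j"
    have t1: "1 \<le> ?t" unfolding t_def by simp
    hence s: "0 \<le> 1/?t" "1/?t \<le> 1" by auto
    have vQ: "?v \<in> Q" using convex[OF xQ[of k] u'Q s] k by simp
    have zy: "?t * y k j - (?t - 1) * x k j = z k j" for j
    proof (cases "k = 0")
      case True
      thus ?thesis using y[OF k] \<beta>[of k] unfolding z_def t_def by (simp add: field_simps)
    next
      case False
      hence "?t * (\<beta> k) = t k - 1" using \<beta>[of k] unfolding t_def by (simp add: field_simps)
      moreover have "?t = t k + 1 / 2" unfolding t_def by (simp add: field_simps)
      moreover have "?t * y k j - (?t - 1) * x k j = (1 + ?t * \<beta> k) * x k j - (?t * \<beta> k) * x (k - 1) j"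
        using y[OF k] by (simp add: algebra_simps)
      ultimately show ?thesis unfolding z_def by simp
    qed
    have "2 * \<alpha> * ?t^2 * (f u' - f (x (Suc k))) + nsq w J (\<lambda>j. ?t * x (Suc k) j - (?t - 1) * x k j - u' j)
       \<le> 2 * \<alpha> * (?t^2 - ?t) * (f u' - f (x k)) + nsq w J (\<lambda>j. ?t * y k j - (?t - 1) * x k j - u' j)
         + 2 * \<alpha> * ?t * dot w J (e k) (\<lambda>j. ?t * x (Suc k) j - (?t - 1) * x k j - u' j)"
      by (rule accelerated_step[where v = ?v and M = M and y = "y k" and g = "g k"])
         (use w \<alpha> t1 M above[OF k vQ] below[OF k] proj[OF k vQ] concave[OF xQ[of k] u'Q s] k in auto)
    hence "\<Psi> (Suc k) \<le> \<Phi> k + 2 * \<alpha> * ?t * dot w J (e k) (\<lambda>j. z (Suc k) j - u' j)"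
      unfolding \<Psi>_def \<Phi>_def N_def zy by (simp add: z_def)
    also have "dot w J (e k) (\<lambda>j. z (Suc k) j - u' j) \<le> E k * sqrt (N (Suc k))"
      using dot_cauchy_schwarz[where w = w and J = J and x = "e k" and y = "\<lambda>j. z (Suc k) j - u' j"] w
      unfolding E_def N_def by simp
    finally show ?thesis using t1 \<alpha> by (simp add: mult_left_mono mult.assoc)
  qed
  have root: "sqrt (\<Psi> (Suc k)) \<le> sqrt (\<Phi> k) + 2 * \<alpha> * t (Suc k) * E k" if k: "k < K" for k
  proof -
    let ?c = "2 * \<alpha> * t (Suc k) * E k" and ?s = "sqrt (\<Psi> (Suc k))"
    have c0: "?c \<ge> 0" using \<alpha> E0 unfolding t_def by simp
    have t2: "(t (Suc k))^2 - t (Suc k) \<ge> 0" unfolding t_def by (simp add: power2_eq_square field_simps)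
    have \<Phi>0: "\<Phi> k \<ge> 0" unfolding \<Phi>_def using t2 u'max(2)[of k] \<alpha> N0[of k] k by simp
    have \<Psi>0: "\<Psi> (Suc k) \<ge> 0" using N0[of "Suc k"] N\<Psi>[of "Suc k"] k by simp
    have "\<Psi> (Suc k) \<le> \<Phi> k + ?c * ?s"
      using step[OF k] mult_left_mono[OF real_sqrt_le_mono[OF N\<Psi>[of "Suc k"]] c0] k by simp
    hence *: "?s^2 \<le> (sqrt (\<Phi> k))^2 + ?c * ?s" using \<Phi>0 \<Psi>0 by simp
    show ?thesis using le_add_of_square_le[OF _ c0 *] \<Phi>0 by simp
  qed
  have acc: "sqrt (\<Phi> k) \<le> sqrt D2 + 2 * \<alpha> * (\<Sum>i<k. t (Suc i) * E i)" if "k < K" for k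
    using that
  proof (induction k)
    case 0
    have "\<Phi> 0 = nsq w J (\<lambda>j. x 0 j - u' j)"
      unfolding \<Phi>_def N_def z_def t_def by (simp add: field_simps)
    thus ?case using D2[OF u'Q] by simp
  next
    case (Suc k)
    have "sqrt (\<Phi> (Suc k)) \<le> sqrt (\<Psi> (Suc k))" using \<Phi>\<Psi>[of "Suc k"] Suc.prems by simp
    also have "\<dots> \<le> sqrt (\<Phi> k) + 2 * \<alpha> * t (Suc k) * E k" using root[of k] Suc.prems by simp
    finally show ?case using Suc by (simp add: algebra_simps)
  qed
  obtain n where n: "K = Suc n" using K by (cases K) auto
  let ?S = "\<Sum>k<K. t (Suc k) * E k"
  have "sqrt (\<Psi> K) \<le> sqrt D2 + 2 * \<alpha> * ?S"
    using root[of n] acc[of n] n by (simp add: algebra_simps)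
  moreover have \<Psi>0: "\<Psi> K \<ge> 0" using N0[of K] N\<Psi>[of K] by simp
  ultimately have "\<Psi> K \<le> (sqrt D2 + 2 * \<alpha> * ?S)^2"
    using power_mono[of "sqrt (\<Psi> K)" "sqrt D2 + 2 * \<alpha> * ?S" 2] by simp
  also have "\<dots> \<le> 2 * (sqrt D2)^2 + 2 * (2 * \<alpha> * ?S)^2"
  proof -
    have "0 \<le> (sqrt D2 - 2 * \<alpha> * ?S)^2" by simp
    thus ?thesis by (simp add: power2_sum power2_diff)
  qed
  also have "(sqrt D2)^2 = D2" using D2[OF uQ] nsq_nonneg[of J w "\<lambda>j. x 0 j - u j"] w by simp
  also have "2 * (2 * \<alpha> * ?S)^2 = 8 * \<alpha>^2 * ?S^2" by (simp add: power_mult_distrib)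
  also have "?S^2 \<le> (\<Sum>k<K. t (Suc k)) * (\<Sum>k<K. t (Suc k) * nsq w J (e k))"
  proof -
    have "?S = (\<Sum>k<K. sqrt (t (Suc k)) * (sqrt (t (Suc k)) * E k))"
      by (rule sum.cong) (auto simp: t_def simp flip: mult.assoc)
    hence "?S^2 \<le> (\<Sum>k<K. (sqrt (t (Suc k)))^2) * (\<Sum>k<K. (sqrt (t (Suc k)) * E k)^2)"
      by (simp only: Cauchy_Schwarz_ineq_sum)
    also have "(\<Sum>k<K. (sqrt (t (Suc k)))^2) = (\<Sum>k<K. t (Suc k))" by (rule sum.cong) (auto simp: t_def)
    also have "(\<Sum>k<K. (sqrt (t (Suc k)) * E k)^2) = (\<Sum>k<K. t (Suc k) * nsq w J (e k))"
      by (rule sum.cong) (use nsq_nonneg[OF w] in \<open>auto simp: t_def E_def power_mult_distrib\<close>)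
    finally show ?thesis .
  qed
  finally have "\<Psi> K \<le> 2 * D2 + 8 * \<alpha>^2 * ((\<Sum>k<K. t (Suc k)) * (\<Sum>k<K. t (Suc k) * nsq w J (e k)))"
    by (simp add: mult_left_mono)
  moreover have "2 * \<alpha> * (t K)^2 * (f u - f (x K)) \<le> \<Psi> K"
  proof -
    have "2 * \<alpha> * (t K)^2 * (f u - f (x K)) \<le> 2 * \<alpha> * (t K)^2 * (f u' - f (x K))"
      using u'max(1) \<alpha> by (intro mult_left_mono) auto
    thus ?thesis using N0[of K] unfolding \<Psi>_def by simp
  qed
  ultimately show ?thesis by (simp add: t_def mult.assoc add.commute)
qed

section \<open>Projection onto the simplex\<close>

definition threshold :: "nat \<Rightarrow> (nat \<Rightarrow> real) \<Rightarrow> real" where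
  "threshold q y = Max ((\<lambda>l. ((\<Sum>j\<in>{j\<in>{..<q}. y l \<le> y j}. y j) - 1) / card {j\<in>{..<q}. y l \<le> y j}) ` {..<q})"

text \<open>
  For any entry \<open>l\<close> the entries at least \<open>y l\<close> alone contribute \<open>1 + n (g l - \<tau>)\<close> to the sum of
  the truncated differences, where \<open>g l\<close> is the number of which \<open>\<tau>\<close> is the maximum.  At the maximizer this
  gives the lower bound \<open>1\<close>, and at the smallest entry above \<open>\<tau>\<close> it gives the upper bound.
\<close>

lemma threshold_sum:
  assumes q: "0 < q"
  shows "(\<Sum>r<q. max (y r - threshold q y) 0) = 1"
proof -
  define B where "B l = {j\<in>{..<q}. y l \<le> y j}" for l
  define g where "g l = ((\<Sum>j\<in>B l. y j) - 1) / card (B l)" for l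
  let ?\<tau> = "threshold q y"
  have \<tau>: "?\<tau> = Max (g ` {..<q})" unfolding threshold_def g_def B_def by simp
  have finB: "finite (B l)" for l unfolding B_def by simp
  have cB: "card (B l) > 0" if "l < q" for l
    using that finB[of l] by (auto simp: card_gt_0_iff B_def)
  have part: "(\<Sum>j\<in>B l. y j - ?\<tau>) = card (B l) * (g l - ?\<tau>) + 1" if "l < q" for l
    using cB[OF that] unfolding g_def by (simp add: sum_subtractf field_simps)
  have le: "g l \<le> ?\<tau>" if "l < q" for l unfolding \<tau> by (rule Max_ge) (use that in auto)
  obtain l where l: "l < q" "?\<tau> = g l"
  proof -
    have "Max (g ` {..<q}) \<in> g ` {..<q}" by (rule Max_in) (use q in auto)
    thus ?thesis using that \<tau> by auto
  qed
  have "1 = (\<Sum>j\<in>B l. y j - ?\<tau>)" using part[OF l(1)] l(2) by simp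
  also have "\<dots> \<le> (\<Sum>j\<in>B l. max (y j - ?\<tau>) 0)" by (rule sum_mono) auto
  also have "\<dots> \<le> (\<Sum>r<q. max (y r - ?\<tau>) 0)" by (rule sum_mono2) (auto simp: B_def)
  finally have ge: "1 \<le> (\<Sum>r<q. max (y r - ?\<tau>) 0)" .
  define P where "P = {j\<in>{..<q}. ?\<tau> < y j}"
  have sumP: "(\<Sum>r<q. max (y r - ?\<tau>) 0) = (\<Sum>r\<in>P. y r - ?\<tau>)"
    by (rule sum.mono_neutral_cong_right) (auto simp: P_def max_def)
  have "P \<noteq> {}" using ge unfolding sumP by auto
  moreover have "finite P" unfolding P_def by simp
  ultimately obtain k where k: "k \<in> P" "\<And>j. j \<in> P \<Longrightarrow> y k \<le> y j"
    using ex_min_if_finite[of "y ` P"] by (auto simp: not_less)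
  have kq: "k < q" using k(1) unfolding P_def by simp
  have "P = B k" using k unfolding P_def B_def by force
  hence "(\<Sum>r<q. max (y r - ?\<tau>) 0) = card (B k) * (g k - ?\<tau>) + 1"
    using part[OF kq] sumP by simp
  also have "\<dots> \<le> 1" using le[of k] k(1) by (simp add: P_def mult_nonneg_nonpos)
  finally show ?thesis using ge by simp
qed

context nrm
begin

lemma threshold_Q0:
  assumes "0 < q"
  shows "(\<lambda>r. if r < q then max (y r - threshold q y) 0 else 0) \<in> Q0"
proof -
  have s: "(\<Sum>r<q. max (y r - threshold q y) 0) = 1" by (rule threshold_sum) (rule assms)
  have "max (y r - threshold q y) 0 \<le> 1" if "r < q" for r
  proof -
    have "max (y r - threshold q y) 0 \<le> (\<Sum>r<q. max (y r - threshold q y) 0)"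
      by (rule member_le_sum) (use that in auto)
    thus ?thesis using s by simp
  qed
  thus ?thesis using s by (auto simp: Q0_def)
qed

lemma threshold_variational:
  assumes q: "0 < q" and u: "u \<in> Q0" and x: "x = (\<lambda>r. if r < q then max (y r - threshold q y) 0 else 0)"
  shows "(\<Sum>r<q. (y r - x r) * (u r - x r)) \<le> 0"
proof -
  let ?\<tau> = "threshold q y"
  have xQ: "x \<in> Q0" unfolding x by (rule threshold_Q0[OF q])
  have "(\<Sum>r<q. (y r - x r) * (u r - x r)) = (\<Sum>r<q. (y r - x r - ?\<tau>) * (u r - x r)) + ?\<tau> * (\<Sum>r<q. u r - x r)"
    by (simp add: sum.distrib[symmetric] sum_distrib_left algebra_simps)
  also have "(\<Sum>r<q. u r - x r) = 0" using xQ u by (simp add: Q0_def sum_subtractf)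
  also have "(\<Sum>r<q. (y r - x r - ?\<tau>) * (u r - x r)) \<le> 0"
  proof (rule sum_nonpos)
    fix r assume r: "r \<in> {..<q}"
    show "(y r - x r - ?\<tau>) * (u r - x r) \<le> 0"
      using r u by (cases "y r \<le> ?\<tau>") (auto simp: x max_def Q0_def mult_nonpos_nonneg)
  qed
  finally show ?thesis by simp
qed

text \<open>
  By the variational inequality, every point of the simplex is farther from \<open>y\<close>, and strictly so
  unless it is the truncated difference; hence the choice of a minimizer in \<open>proj\<close> is unique.
\<close>

lemma proj_eq:
  assumes q: "0 < q"
  shows "proj y = (\<lambda>r. if r < q then max (y r - threshold q y) 0 else 0)" (is "_ = ?x")
proof -
  have closer: "(\<Sum>r<q. (?x r - y r)^2) + (\<Sum>r<q. (u r - ?x r)^2) \<le> (\<Sum>r<q. (u r - y r)^2)" if u: "u \<in> Q0" for u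
  proof -
    have "(\<Sum>r<q. (u r - y r)^2) = (\<Sum>r<q. (?x r - y r)^2) + (\<Sum>r<q. (u r - ?x r)^2)
        - 2 * (\<Sum>r<q. (y r - ?x r) * (u r - ?x r))"
      unfolding sum_distrib_left sum.distrib[symmetric] sum_subtractf[symmetric]
      by (rule sum.cong[OF refl]) (simp only: power2_eq_square, simp only: algebra_simps)
    thus ?thesis using threshold_variational[OF q u refl, of y] by simp
  qed
  have "is_arg_min (\<lambda>x. L2_set (\<lambda>r. x r - y r) {..<q}) (\<lambda>x. x \<in> Q0) u \<longleftrightarrow> u = ?x" for u
  proof
    assume u: "is_arg_min (\<lambda>x. L2_set (\<lambda>r. x r - y r) {..<q}) (\<lambda>x. x \<in> Q0) u"
    hence uQ: "u \<in> Q0" by (simp add: is_arg_min_def)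
    have "L2_set (\<lambda>r. u r - y r) {..<q} \<le> L2_set (\<lambda>r. ?x r - y r) {..<q}"
      using u threshold_Q0[OF q, of y] by (auto simp: is_arg_min_def not_less)
    hence "(\<Sum>r<q. (u r - y r)^2) \<le> (\<Sum>r<q. (?x r - y r)^2)" by (simp add: L2_set_def)
    hence "(\<Sum>r<q. (u r - ?x r)^2) \<le> 0" using closer[OF uQ] by simp
    hence "(\<Sum>r<q. (u r - ?x r)^2) = 0" by (simp add: sum_nonneg antisym)
    hence "\<forall>r<q. u r = ?x r" by (subst (asm) sum_nonneg_eq_0_iff) auto
    thus "u = ?x" using uQ by (auto simp: Q0_def)
  next
    assume u: "u = ?x"
    have "L2_set (\<lambda>r. ?x r - y r) {..<q} \<le> L2_set (\<lambda>r. v r - y r) {..<q}" if "v \<in> Q0" for v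
    proof -
      have "0 \<le> (\<Sum>r<q. (v r - ?x r)^2)" by (intro sum_nonneg) simp
      thus ?thesis unfolding L2_set_def by (intro real_sqrt_le_mono) (use closer[OF that] in linarith)
    qed
    thus "is_arg_min (\<lambda>x. L2_set (\<lambda>r. x r - y r) {..<q}) (\<lambda>x. x \<in> Q0) u"
      using threshold_Q0[OF q, of y] by (auto simp: u is_arg_min_def not_less)
  qed
  thus ?thesis unfolding proj_def arg_min_def by (intro some_equality) auto
qed

lemma proj_Q0: "0 < q \<Longrightarrow> proj y \<in> Q0"
  using threshold_Q0 proj_eq by simp

lemma proj_variational: "0 < q \<Longrightarrow> u \<in> Q0 \<Longrightarrow> (\<Sum>r<q. (y r - proj y r) * (u r - proj y r)) \<le> 0"
  using threshold_variational[OF _ _ proj_eq] by simp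

lemma proj_cong: "(\<And>r. r < q \<Longrightarrow> y r = y' r) \<Longrightarrow> proj y = proj y'"
  unfolding proj_def by (metis (no_types, lifting) L2_set_cong lessThan_iff)

end

section \<open>Counting the periods in which patching cuts an accepted option\<close>

text \<open>
  A resource whose budget is used up stays so, and from then on every cut that it causes adds at
  least \<open>\<iota>\<close> to its unserved demand.  Hence the sum over the exhausted resources of \<open>1\<close> plus the
  unserved demand divided by \<open>\<iota>\<close> grows by at least one with every cut.
\<close>

lemma card_cuts_le:
  fixes c :: "nat \<Rightarrow> nat \<Rightarrow> real" and f :: "nat \<Rightarrow> real" and u :: "nat \<Rightarrow> nat \<Rightarrow> real"
  assumes fin: "finite Rs" and \<iota>: "0 < \<iota>"
    and c: "\<And>t i. t \<in> {1..n} \<Longrightarrow> i \<in> Rs \<Longrightarrow> c t i = 0 \<or> \<iota> \<le> c t i"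
    and f: "\<And>t. t \<in> {1..n} \<Longrightarrow> 0 \<le> f t \<and> f t \<le> 1"
    and u: "\<And>t i. u t i = (\<Sum>s=1..t. c s i * f s)"
    and cap: "\<And>t i. t \<le> n \<Longrightarrow> i \<in> Rs \<Longrightarrow> u t i \<le> B i"
    and cut: "\<And>t. t < n \<Longrightarrow> f (Suc t) < 1 \<Longrightarrow> \<exists>i\<in>Rs. 0 < c (Suc t) i \<and> c (Suc t) i * f (Suc t) = B i - u t i"
  shows "real (card {t\<in>{1..n}. f t < 1})
     \<le> (\<Sum>i\<in>{i\<in>Rs. u n i = B i}. 1 + max 0 ((\<Sum>t=1..n. c t i) - B i) / \<iota>)"
proof -
  define \<psi> where "\<psi> t i = (if u t i = B i then 1 + ((\<Sum>s=1..t. c s i) - u t i) / \<iota> else 0)" for t i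
  have c0: "0 \<le> c t i" if "t \<in> {1..n}" "i \<in> Rs" for t i using c[OF that] \<iota> by auto
  have main: "real (card {s\<in>{1..t}. f s < 1}) \<le> (\<Sum>i\<in>Rs. \<psi> t i)" if "t \<le> n" for t
    using that
  proof (induction t)
    case 0
    have "0 \<le> \<psi> 0 i" for i unfolding \<psi>_def u by simp
    thus ?case by (simp add: sum_nonneg)
  next
    case (Suc t)
    have t: "Suc t \<in> {1..n}" using Suc by simp
    have us: "u (Suc t) i = u t i + c (Suc t) i * f (Suc t)" for i unfolding u by simp
    have ws: "(\<Sum>s=1..Suc t. c s i) - u (Suc t) i = ((\<Sum>s=1..t. c s i) - u t i) + c (Suc t) i * (1 - f (Suc t))" for i
      unfolding us by (simp add: algebra_simps)
    have w0: "0 \<le> (\<Sum>s=1..t'. c s i) - u t' i" if "i \<in> Rs" "t' \<le> n" for i t'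
    proof -
      have "u t' i \<le> (\<Sum>s=1..t'. c s i)" unfolding u
        by (rule sum_mono, rule mult_left_le) (use f c0 that in auto)
      thus ?thesis by simp
    qed
    have mono: "\<psi> t i \<le> \<psi> (Suc t) i" if i: "i \<in> Rs" for i
    proof (cases "u t i = B i")
      case True
      have "0 \<le> c (Suc t) i * f (Suc t)" using c0[OF t i] f[OF t] by simp
      hence "u (Suc t) i = B i" using us[of i] cap[OF Suc.prems i] True by simp
      moreover have "0 \<le> c (Suc t) i * (1 - f (Suc t))" using c0[OF t i] f[OF t] by simp
      ultimately show ?thesis unfolding \<psi>_def ws using True \<iota> by (simp add: divide_right_mono)
    next
      case False
      thus ?thesis using w0[OF i Suc.prems] \<iota> unfolding \<psi>_def by simp
    qed
    show ?case
    proof (cases "f (Suc t) < 1")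
      case False
      hence "{s\<in>{1..Suc t}. f s < 1} = {s\<in>{1..t}. f s < 1}" by (auto simp: le_Suc_eq)
      thus ?thesis using Suc mono sum_mono[of Rs "\<psi> t" "\<psi> (Suc t)"] by simp
    next
      case True
      from cut[of t] True Suc.prems obtain i where i: "i \<in> Rs" "0 < c (Suc t) i"
        "c (Suc t) i * f (Suc t) = B i - u t i" by auto
      have uB: "u (Suc t) i = B i" using us[of i] i(3) by simp
      have "\<psi> t i + 1 \<le> \<psi> (Suc t) i"
      proof (cases "u t i = B i")
        case True
        hence "f (Suc t) = 0" using i by simp
        moreover have "\<iota> \<le> c (Suc t) i" using c[OF t i(1)] i(2) by auto
        ultimately show ?thesis unfolding \<psi>_def ws using True uB \<iota> by (simp add: field_simps)
      next
        case False
        thus ?thesis using w0[OF i(1) Suc.prems] uB \<iota> unfolding \<psi>_def by simp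
      qed
      moreover have "(\<Sum>j\<in>Rs - {i}. \<psi> t j) \<le> (\<Sum>j\<in>Rs - {i}. \<psi> (Suc t) j)"
        by (rule sum_mono) (use mono in auto)
      ultimately have "(\<Sum>j\<in>Rs. \<psi> t j) + 1 \<le> (\<Sum>j\<in>Rs. \<psi> (Suc t) j)"
        using fin i(1) by (simp add: sum.remove)
      moreover have "{s\<in>{1..Suc t}. f s < 1} = insert (Suc t) {s\<in>{1..t}. f s < 1}"
        using True by (auto simp: le_Suc_eq)
      ultimately show ?thesis using Suc by simp
    qed
  qed
  have "(\<Sum>i\<in>Rs. \<psi> n i) = (\<Sum>i\<in>{i\<in>Rs. u n i = B i}. \<psi> n i)"
    by (rule sum.mono_neutral_right) (use fin in \<open>auto simp: \<psi>_def\<close>)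
  also have "\<dots> \<le> (\<Sum>i\<in>{i\<in>Rs. u n i = B i}. 1 + max 0 ((\<Sum>t=1..n. c t i) - B i) / \<iota>)"
    by (rule sum_mono) (use \<iota> in \<open>auto simp: \<psi>_def intro!: divide_right_mono\<close>)
  finally show ?thesis using main[of n] by simp
qed

section \<open>Concentration of independent roundings\<close>

lemma exp_le_quadratic:
  fixes x :: real
  assumes "\<bar>x\<bar> \<le> 1"
  shows "exp x \<le> 1 + x + x^2"
proof (cases "0 \<le> x")
  case True
  thus ?thesis using assms by (intro exp_bound) auto
next
  case False
  define z where "z = - x"
  have z: "0 \<le> z" "z \<le> 1" using False assms by (auto simp: z_def)
  have "(1 - z + z^2) * (1 + z + z^2 / 2) = 1 + (z^2 + z ^ 3 + z ^ 4) / 2"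
    by (simp add: field_simps power2_eq_square power3_eq_cube power4_eq_xxxx)
  hence 1: "1 \<le> (1 - z + z^2) * (1 + z + z^2 / 2)" using z by simp
  have "1 + z + z^2 / 2 \<le> exp z" using z by (rule_tac exp_lower_Taylor_quadratic) auto
  moreover have "0 \<le> 1 - z + z^2" using z by (simp add: add_nonneg_nonneg)
  ultimately have "1 \<le> (1 - z + z^2) * exp z" using 1 by (meson mult_left_mono order_trans)
  hence "exp (- z) \<le> 1 - z + z^2" by (simp add: exp_minus field_simps)
  thus ?thesis by (simp add: z_def)
qed

text \<open>
  On \<open>[-1, 1]\<close> the exponential is at most \<open>1 + x + x\<^sup>2\<close>, and \<open>h\<^sup>2 \<le> h\<close>, so that each factor is bounded
  in terms of the mean of \<open>h\<close> alone.
\<close>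

lemma mgf_centred_le:
  fixes h :: "'a \<Rightarrow> 'b \<Rightarrow> real"
  assumes A: "finite A" "B \<subseteq> A" and fin: "\<And>E. E \<in> A \<Longrightarrow> finite (set_pmf (p E))"
    and h: "\<And>E v. E \<in> B \<Longrightarrow> v \<in> set_pmf (p E) \<Longrightarrow> 0 \<le> h E v \<and> h E v \<le> 1"
    and s: "s = (\<Sum>E\<in>B. ex (p E) (h E))" and l: "\<bar>l\<bar> \<le> 1"
  shows "ex (Pi_pmf A d p) (\<lambda>y. exp (l * ((\<Sum>E\<in>B. h E (y E)) - s))) \<le> exp (l^2 * s)"
proof -
  define m where "m E = ex (p E) (h E)" for E
  have B: "finite B" using A finite_subset by blast
  have "ex (Pi_pmf A d p) (\<lambda>y. exp (l * ((\<Sum>E\<in>B. h E (y E)) - s)))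
      = ex (Pi_pmf A d p) (\<lambda>y. \<Prod>E\<in>A. if E \<in> B then exp (l * (h E (y E) - m E)) else 1)"
  proof (rule ex_cong)
    fix y
    have "exp (l * ((\<Sum>E\<in>B. h E (y E)) - s)) = (\<Prod>E\<in>B. exp (l * (h E (y E) - m E)))"
      unfolding s m_def by (simp add: exp_sum[OF B, symmetric] sum_distrib_left sum_subtractf right_diff_distrib)
    also have "\<dots> = (\<Prod>E\<in>A. if E \<in> B then exp (l * (h E (y E) - m E)) else 1)"
      using A by (simp add: prod.inter_restrict[symmetric] Int_absorb1)
    finally show "exp (l * ((\<Sum>E\<in>B. h E (y E)) - s)) = \<dots>" .
  qed
  also have "\<dots> = (\<Prod>E\<in>A. ex (p E) (\<lambda>v. if E \<in> B then exp (l * (h E v - m E)) else 1))"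
    by (rule expectation_prod_Pi_pmf[OF A(1)])
       (use fin in \<open>auto intro!: integrable_measure_pmf_finite\<close>)
  also have "\<dots> \<le> (\<Prod>E\<in>A. if E \<in> B then exp (l^2 * m E) else 1)"
  proof (rule prod_mono, safe)
    fix E assume E: "E \<in> A"
    show "0 \<le> ex (p E) (\<lambda>v. if E \<in> B then exp (l * (h E v - m E)) else 1)"
      by (rule ex_ge_const[OF fin[OF E]]) auto
    show "ex (p E) (\<lambda>v. if E \<in> B then exp (l * (h E v - m E)) else 1) \<le> (if E \<in> B then exp (l^2 * m E) else 1)"
    proof (cases "E \<in> B")
      case True
      have "ex (p E) (\<lambda>v. exp (l * (h E v - m E))) \<le> ex (p E) (\<lambda>v. exp (- l * m E) * (1 + (l + l^2) * h E v))"
      proof (rule ex_mono[OF fin[OF E]])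
        fix v assume v: "v \<in> set_pmf (p E)"
        have hv: "0 \<le> h E v" "h E v \<le> 1" using h[OF True v] by auto
        have "\<bar>l * h E v\<bar> \<le> 1" using l hv by (simp add: abs_mult mult_le_one)
        hence "exp (l * h E v) \<le> 1 + l * h E v + (l * h E v)^2" by (rule exp_le_quadratic)
        also have "(l * h E v)^2 \<le> l^2 * h E v"
          using hv by (simp add: power_mult_distrib power2_eq_square[of "h E v"] mult_left_mono mult_left_le)
        finally have "exp (l * h E v) \<le> 1 + (l + l^2) * h E v" by (simp add: algebra_simps)
        moreover have "exp (l * (h E v - m E)) = exp (- l * m E) * exp (l * h E v)"
          by (simp add: exp_add[symmetric] algebra_simps)
        ultimately show "exp (l * (h E v - m E)) \<le> exp (- l * m E) * (1 + (l + l^2) * h E v)" by simp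
      qed
      also have "\<dots> = exp (- l * m E) * (1 + (l + l^2) * m E)"
        by (simp only: ex_cmult ex_add[OF fin[OF E]] m_def) simp
      also have "\<dots> \<le> exp (- l * m E) * exp ((l + l^2) * m E)" by (intro mult_left_mono exp_ge_add_one_self) auto
      also have "\<dots> = exp (l^2 * m E)" by (simp add: exp_add[symmetric] algebra_simps)
      finally show ?thesis using True by simp
    qed simp
  qed
  also have "\<dots> = (\<Prod>E\<in>B. exp (l^2 * m E))" using A by (simp add: prod.inter_restrict[symmetric] Int_absorb1)
  also have "\<dots> = exp (l^2 * s)" unfolding s m_def by (simp add: exp_sum[OF B, symmetric] sum_distrib_left)
  finally show ?thesis .
qed

text \<open>
  The second moment is read off the moment generating function at \<open>\<plusminus>\<lambda>\<close>, with \<open>\<lambda>\<close> so small that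
  \<open>\<lambda>\<^sup>2 s \<le> 1\<close>.
\<close>

lemma second_moment_le:
  fixes h :: "'a \<Rightarrow> 'b \<Rightarrow> real"
  assumes A: "finite A" "B \<subseteq> A" and fin: "\<And>E. E \<in> A \<Longrightarrow> finite (set_pmf (p E))"
    and h: "\<And>E v. E \<in> B \<Longrightarrow> v \<in> set_pmf (p E) \<Longrightarrow> 0 \<le> h E v \<and> h E v \<le> 1"
    and s: "s = (\<Sum>E\<in>B. ex (p E) (h E))"
  shows "ex (Pi_pmf A d p) (\<lambda>y. ((\<Sum>E\<in>B. h E (y E)) - s)^2) \<le> 8 * s"
proof -
  let ?P = "Pi_pmf A d p" and ?D = "\<lambda>y. (\<Sum>E\<in>B. h E (y E)) - s"
  have finP: "finite (set_pmf ?P)" by (rule finite_set_Pi_pmf) (use A fin in auto)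
  have s0: "0 \<le> s" unfolding s by (intro sum_nonneg ex_ge_const) (use fin A h in auto)
  define l where "l = (if s \<le> 1 then 1 else 1 / sqrt s)"
  have l: "0 < l" "\<bar>l\<bar> \<le> 1" "\<bar>- l\<bar> \<le> 1" "l^2 * s \<le> 1" using s0 by (auto simp: l_def power_divide)
  have quad: "z^2 \<le> 2 / l^2 * (exp (l * z) + exp (- l * z) - 2)" for z
  proof -
    have *: "(l * \<bar>z\<bar>)^2 / 2 \<le> exp (l * \<bar>z\<bar>) + exp (- (l * \<bar>z\<bar>)) - 2"
      using exp_lower_Taylor_quadratic[of "l * \<bar>z\<bar>"] exp_ge_add_one_self[of "- (l * \<bar>z\<bar>)"] l by simp
    have "exp (l * \<bar>z\<bar>) + exp (- (l * \<bar>z\<bar>)) = exp (l * z) + exp (- l * z)" by (simp add: abs_if)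
    hence "l^2 * z^2 / 2 \<le> exp (l * z) + exp (- l * z) - 2" using * by (simp add: power_mult_distrib)
    thus ?thesis using l by (simp add: field_simps)
  qed
  have "ex ?P (\<lambda>y. (?D y)^2) \<le> ex ?P (\<lambda>y. 2 / l^2 * (exp (l * ?D y) + exp (- l * ?D y) - 2))"
    by (rule ex_mono[OF finP]) (rule quad)
  also have "\<dots> = 2 / l^2 * (ex ?P (\<lambda>y. exp (l * ?D y)) + ex ?P (\<lambda>y. exp (- l * ?D y)) - 2)"
    by (simp only: ex_cmult ex_add[OF finP] ex_diff[OF finP]) simp
  also have "\<dots> \<le> 2 / l^2 * (exp (l^2 * s) + exp ((- l)^2 * s) - 2)"
    using mgf_centred_le[OF A fin h s l(2), where d = d] mgf_centred_le[OF A fin h s l(3), where d = d]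
    by (intro mult_left_mono) auto
  also have "\<dots> \<le> 2 / l^2 * (4 * (l^2 * s))"
  proof (intro mult_left_mono)
    have v: "0 \<le> l^2 * s" using s0 by simp
    have "exp (l^2 * s) \<le> 1 + l^2 * s + (l^2 * s)^2" using v l(4) by (intro exp_le_quadratic) auto
    also have "(l^2 * s)^2 \<le> l^2 * s" using v l(4) by (simp add: power2_eq_square[of "l^2 * s"] mult_left_le)
    finally show "exp (l^2 * s) + exp ((- l)^2 * s) - 2 \<le> 4 * (l^2 * s)"
      unfolding power2_minus by linarith
  qed (use l in auto)
  also have "\<dots> = 8 * s" using l by simp
  finally show ?thesis .
qed

text \<open>
  A fluctuation \<open>D\<close> is at most \<open>g / 2 + D\<^sup>2 / (2 g)\<close>; the choice of \<open>g\<close> is left to the application.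
\<close>

lemma expected_excess_le:
  fixes h :: "'a \<Rightarrow> 'b \<Rightarrow> real"
  assumes A: "finite A" "B \<subseteq> A" and fin: "\<And>E. E \<in> A \<Longrightarrow> finite (set_pmf (p E))"
    and h: "\<And>E v. E \<in> B \<Longrightarrow> v \<in> set_pmf (p E) \<Longrightarrow> 0 \<le> h E v \<and> h E v \<le> 1"
    and s: "s = (\<Sum>E\<in>B. ex (p E) (h E))" and g: "0 < g"
  shows "ex (Pi_pmf A d p) (\<lambda>y. max 0 ((\<Sum>E\<in>B. h E (y E)) - \<beta>)) \<le> max 0 (s - \<beta>) + g / 2 + 4 * s / g"
proof -
  let ?P = "Pi_pmf A d p" and ?D = "\<lambda>y. (\<Sum>E\<in>B. h E (y E)) - s"
  have finP: "finite (set_pmf ?P)" by (rule finite_set_Pi_pmf) (use A fin in auto)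
  have "ex ?P (\<lambda>y. max 0 ((\<Sum>E\<in>B. h E (y E)) - \<beta>))
      \<le> ex ?P (\<lambda>y. (max 0 (s - \<beta>) + g / 2) + 1 / (2 * g) * (?D y)^2)"
  proof (rule ex_mono[OF finP])
    fix y
    have "0 \<le> (?D y - g)^2" by simp
    hence "2 * g * ?D y \<le> g * g + (?D y)^2" by (simp add: power2_diff power2_eq_square algebra_simps)
    hence "?D y \<le> g / 2 + 1 / (2 * g) * (?D y)^2" using g by (simp add: field_simps)
    moreover have "0 \<le> g / 2 + 1 / (2 * g) * (?D y)^2" using g by simp
    ultimately show "max 0 ((\<Sum>E\<in>B. h E (y E)) - \<beta>) \<le> (max 0 (s - \<beta>) + g / 2) + 1 / (2 * g) * (?D y)^2"
      by linarith
  qed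
  also have "\<dots> = (max 0 (s - \<beta>) + g / 2) + 1 / (2 * g) * ex ?P (\<lambda>y. (?D y)^2)"
    by (simp only: ex_add[OF finP] ex_cmult) simp
  also have "\<dots> \<le> (max 0 (s - \<beta>) + g / 2) + 1 / (2 * g) * (8 * s)"
    using second_moment_le[OF A fin h s, where d = d] g by (intro add_left_mono mult_left_mono) auto
  finally show ?thesis by simp
qed

text \<open>
  The excess is dominated by an exponential, whose mean is small if the budget is at least twice the mean load.
\<close>

lemma expected_excess_tail:
  fixes h :: "'a \<Rightarrow> 'b \<Rightarrow> real"
  assumes A: "finite A" "B \<subseteq> A" and fin: "\<And>E. E \<in> A \<Longrightarrow> finite (set_pmf (p E))"
    and h: "\<And>E v. E \<in> B \<Longrightarrow> v \<in> set_pmf (p E) \<Longrightarrow> 0 \<le> h E v \<and> h E v \<le> 1"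
    and s: "s = (\<Sum>E\<in>B. ex (p E) (h E))" and \<beta>: "s \<le> \<beta> / 2"
  shows "ex (Pi_pmf A d p) (\<lambda>y. max 0 ((\<Sum>E\<in>B. h E (y E)) - \<beta>)) \<le> 2 * exp (- \<beta> / 8)"
proof -
  let ?P = "Pi_pmf A d p" and ?D = "\<lambda>y. (\<Sum>E\<in>B. h E (y E)) - s"
  have finP: "finite (set_pmf ?P)" by (rule finite_set_Pi_pmf) (use A fin in auto)
  have exp_half: "max 0 z \<le> 2 * exp (z / 2)" for z :: real
  proof -
    have "z \<le> 2 * exp (z / 2)" using exp_ge_add_one_self[of "z / 2"] by linarith
    moreover have "0 \<le> 2 * exp (z / 2)" by simp
    ultimately show ?thesis by (simp only: max.bounded_iff)
  qed
  have "ex ?P (\<lambda>y. max 0 ((\<Sum>E\<in>B. h E (y E)) - \<beta>)) \<le> ex ?P (\<lambda>y. 2 * exp ((s - \<beta>) / 2) * exp (1/2 * ?D y))"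
  proof (rule ex_mono[OF finP])
    fix y
    have e: "2 * exp ((s - \<beta>) / 2) * exp (1/2 * ?D y) = 2 * exp (((\<Sum>E\<in>B. h E (y E)) - \<beta>) / 2)"
      by (simp add: exp_add[symmetric] field_simps)
    show "max 0 ((\<Sum>E\<in>B. h E (y E)) - \<beta>) \<le> 2 * exp ((s - \<beta>) / 2) * exp (1/2 * ?D y)"
      unfolding e by (rule exp_half)
  qed
  also have "\<dots> = 2 * exp ((s - \<beta>) / 2) * ex ?P (\<lambda>y. exp (1/2 * ?D y))" by (simp only: ex_cmult)
  also have "\<dots> \<le> 2 * exp ((s - \<beta>) / 2) * exp ((1/2)^2 * s)"
    by (intro mult_left_mono mgf_centred_le[OF A fin h s]) auto
  also have "\<dots> = 2 * exp (3 / 4 * s - \<beta> / 2)" by (simp add: exp_add[symmetric] power2_eq_square field_simps)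
  also have "\<dots> \<le> 2 * exp (- \<beta> / 8)" using \<beta> by simp
  finally show ?thesis .
qed

section \<open>Histories and paths\<close>

locale wf_nrm = nrm +
  assumes wf: well_formed
begin

lemma wf_simps: "1 \<le> T" "2 \<le> q" "0 < q" "1 \<le> m" "1 \<le> L" "0 < \<iota>" "\<iota> \<le> 1" "1 \<le> sim_cost I"
  using wf unfolding well_formed_def by auto

lemma budget_pos: "i \<in> {1..m} \<Longrightarrow> 0 < b i"
  using wf unfolding well_formed_def by auto

lemma length_trajectory: "S \<in> trajectories \<Longrightarrow> length S = T"
  using wf unfolding well_formed_def by auto

lemma finite_histories: "finite histories"
  using wf unfolding well_formed_def by auto

lemma take_history: "S \<in> trajectories \<Longrightarrow> t \<in> {1..T} \<Longrightarrow> take t S \<in> histories"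
  unfolding histories_def trajectories_def by auto

lemma historyE:
  assumes "E \<in> histories"
  obtains S t where "S \<in> trajectories" "t \<in> {1..T}" "E = take t S" "length E = t"
  using assms length_trajectory unfolding histories_def trajectories_def by fastforce

lemma finite_trajectories: "finite trajectories"
proof (rule finite_subset[OF _ finite_histories])
  show "trajectories \<subseteq> histories"
    using take_history[of _ T] length_trajectory wf_simps by fastforce
qed

lemma trajectories_nonempty: "trajectories \<noteq> {}"
  unfolding trajectories_def by (simp add: set_pmf_not_empty)

lemma
  assumes "E \<in> histories"
  shows Z_null: "Z 0 E = 0" and a_null: "i \<in> {1..m} \<Longrightarrow> a 0 i E = 0"
    and Z_bounds: "r < q \<Longrightarrow> 0 \<le> Z r E" "r < q \<Longrightarrow> Z r E \<le> 1"
    and a_nonneg: "r < q \<Longrightarrow> i \<in> {1..m} \<Longrightarrow> 0 \<le> a r i E"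
    and a_le_1: "r < q \<Longrightarrow> i \<in> {1..m} \<Longrightarrow> a r i E \<le> 1"
    and a_granular: "r < q \<Longrightarrow> i \<in> {1..m} \<Longrightarrow> a r i E = 0 \<or> \<iota> \<le> a r i E"
    and card_consumed: "r < q \<Longrightarrow> card {i\<in>{1..m}. a r i E \<noteq> 0} \<le> L"
  using wf assms unfolding well_formed_def by auto

lemma card_aplus: "E \<in> histories \<Longrightarrow> r < q \<Longrightarrow> card (aplus r E) \<le> L"
  by (rule order_trans[OF card_mono card_consumed]) (auto simp: aplus_def)

lemma finite_aplus: "finite (aplus r E)"
  unfolding aplus_def by simp

lemma sum_consumption_le:
  assumes "E \<in> histories" "r < q"
  shows "(\<Sum>i=1..m. a r i E) \<le> L"
proof -
  have "(\<Sum>i=1..m. a r i E) = (\<Sum>i\<in>aplus r E. a r i E)"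
    by (rule sum.mono_neutral_right) (use a_nonneg[OF assms] in \<open>force simp: aplus_def\<close>)+
  also have "\<dots> \<le> (\<Sum>i\<in>aplus r E. 1)"
    by (rule sum_mono) (use a_le_1[OF assms] in \<open>auto simp: aplus_def\<close>)
  finally show ?thesis using card_aplus[OF assms] by simp
qed

text \<open>Sums over options may include option \<open>0\<close>, which neither earns nor consumes anything.\<close>

lemma sum_choices: "f 0 = 0 \<Longrightarrow> (\<Sum>r=1..<q. f r) = (\<Sum>r<q. f r)" for f :: "nat \<Rightarrow> real"
  using wf_simps by (intro sum.mono_neutral_left) (auto simp: not_less_eq_eq less_Suc_eq_le intro: ccontr)

abbreviation pr :: "hist \<Rightarrow> real" where "pr S \<equiv> pmf (law I) S"

lemma prefixes_of: 
  assumes "S \<in> trajectories"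
  shows "{E\<in>histories. take (length E) S = E} = (\<lambda>t. take t S) ` {1..T}"
    and "inj_on (\<lambda>t. take t S) {1..T}"
proof -
  have len: "length (take t S) = t" if "t \<in> {1..T}" for t using length_trajectory[OF assms] that by simp
  show "inj_on (\<lambda>t. take t S) {1..T}" by (rule inj_onI) (metis len)
  show "{E\<in>histories. take (length E) S = E} = (\<lambda>t. take t S) ` {1..T}"
  proof safe
    fix E assume "E \<in> histories" "take (length E) S = E"
    thus "E \<in> (\<lambda>t. take t S) ` {1..T}" by (metis historyE imageI)
  next
    fix t assume t: "t \<in> {1..T}"
    show "take t S \<in> histories" by (rule take_history[OF assms t])
    show "take (length (take t S)) S = take t S" by (simp only: len[OF t])
  qed
qed

lemma path_swap:
  fixes h :: "hist \<Rightarrow> hist \<Rightarrow> real"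
  shows "(\<Sum>E\<in>histories. \<Sum>S\<in>{S\<in>trajectories. take (length E) S = E}. pr S * h E S)
       = (\<Sum>S\<in>trajectories. pr S * (\<Sum>t=1..T. h (take t S) S))"
proof -
  have "(\<Sum>E\<in>histories. \<Sum>S\<in>{S\<in>trajectories. take (length E) S = E}. pr S * h E S)
      = (\<Sum>S\<in>trajectories. \<Sum>E\<in>{E\<in>histories. take (length E) S = E}. pr S * h E S)"
    by (rule sum.swap_restrict) (use finite_histories finite_trajectories in auto)
  also have "\<dots> = (\<Sum>S\<in>trajectories. pr S * (\<Sum>t=1..T. h (take t S) S))"
    by (rule sum.cong[OF refl])
       (simp only: prefixes_of(1) sum.reindex[OF prefixes_of(2)] o_def sum_distrib_left)
  finally show ?thesis .
qed

lemma \<mu>_eq: "\<mu> E = (\<Sum>S\<in>{S\<in>trajectories. take (length E) S = E}. pr S)"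
proof -
  have "\<mu> E = measure (law I) {S. take (length E) S = E}" unfolding \<mu>_def pmf_map vimage_def by simp
  also have "\<dots> = measure (law I) {S\<in>trajectories. take (length E) S = E}"
    by (subst measure_Int_set_pmf[symmetric]) (simp add: trajectories_def Int_def conj_commute)
  finally show ?thesis using finite_trajectories by (simp add: measure_measure_pmf_finite)
qed

lemma \<mu>_nonneg: "0 \<le> \<mu> E"
  unfolding \<mu>_def by simp

lemma path_sum: "(\<Sum>E\<in>histories. \<mu> E * g E) = (\<Sum>S\<in>trajectories. pr S * (\<Sum>t=1..T. g (take t S)))"
  unfolding \<mu>_eq sum_distrib_right by (rule path_swap)

lemma sum_pr: "(\<Sum>S\<in>trajectories. pr S) = 1"
  using finite_trajectories unfolding trajectories_def by (rule sum_pmf_eq_1) simp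

lemma sum_\<mu>: "(\<Sum>E\<in>histories. \<mu> E) = T"
  using path_sum[of "\<lambda>_. 1"] by (simp add: sum_distrib_right[symmetric] sum_pr)

lemma
  assumes E: "E \<in> histories"
  shows set_SIM: "set_pmf (SIM E) = {S\<in>trajectories. take (length E) S = E}"
    and ex_SIM: "\<mu> E * ex (SIM E) \<psi> = (\<Sum>S\<in>{S\<in>trajectories. take (length E) S = E}. pr S * \<psi> S)"
proof -
  obtain S t where S: "S \<in> trajectories" "t \<in> {1..T}" "E = take t S" "length E = t" using E by (rule historyE)
  hence ne: "set_pmf (law I) \<inter> {S. take (length E) S = E} \<noteq> {}" unfolding trajectories_def by auto
  show set: "set_pmf (SIM E) = {S\<in>trajectories. take (length E) S = E}"
    unfolding SIM_def set_cond_pmf[OF ne] trajectories_def by auto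
  have meas: "measure (law I) {S. take (length E) S = E} = \<mu> E" unfolding \<mu>_def pmf_map vimage_def by simp
  have pos: "0 < \<mu> E" unfolding meas[symmetric]
    by (rule measure_pmf_posI[of S]) (use S in \<open>auto simp: trajectories_def\<close>)
  have fin: "finite (set_pmf (SIM E))" using set finite_trajectories by simp
  have "pmf (SIM E) S' = pr S' / \<mu> E" if "S' \<in> set_pmf (SIM E)" for S'
  proof -
    have "take (length E) S' = E" using that unfolding set by simp
    thus ?thesis unfolding SIM_def pmf_cond[OF ne] meas by simp
  qed
  hence "ex (SIM E) \<psi> = (\<Sum>S\<in>set_pmf (SIM E). pr S / \<mu> E * \<psi> S)"
    unfolding ex_eq_sum[OF fin] by (intro sum.cong) auto
  also have "\<mu> E * \<dots> = (\<Sum>S\<in>{S\<in>trajectories. take (length E) S = E}. pr S * \<psi> S)"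
    unfolding set using pos by (simp add: sum_distrib_left)
  finally show "\<mu> E * ex (SIM E) \<psi> = \<dots>" .
qed

lemma finite_SIM: "E \<in> histories \<Longrightarrow> finite (set_pmf (SIM E))"
  using finite_trajectories by (simp add: set_SIM)

section \<open>The penalized objective\<close>

definition load :: "nat \<Rightarrow> hist \<Rightarrow> (hist \<Rightarrow> nat \<Rightarrow> real) \<Rightarrow> real" where
  "load i S X = (\<Sum>t=1..T. \<Sum>r=1..<q. a r i (take t S) * X (take t S) r)"

text \<open>
  The antiderivative of \<open>\<phi>' \<theta>\<close>, in the form of a Legendre transform: it is the maximum over
  \<open>s \<in> [0, 1]\<close> of \<open>s x - \<theta> s\<^sup>2 / 2\<close>, and \<open>\<phi>' \<theta> x\<close> is the maximizer.
\<close>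

definition pen :: "real \<Rightarrow> real \<Rightarrow> real" where
  "pen \<theta> x = \<phi>' \<theta> x * x - \<theta> / 2 * (\<phi>' \<theta> x)^2"

definition penalized :: "real \<Rightarrow> (hist \<Rightarrow> nat \<Rightarrow> real) \<Rightarrow> real" where
  "penalized \<theta> X = objective X - 2 / \<iota> * (\<Sum>S\<in>trajectories. pr S * (\<Sum>i=1..m. pen \<theta> (load i S X - b i)))"

definition pgrad :: "real \<Rightarrow> (hist \<Rightarrow> nat \<Rightarrow> real) \<Rightarrow> hist \<Rightarrow> nat \<Rightarrow> real" where
  "pgrad \<theta> X E l = Z l E - 2 / \<iota> * (\<Sum>i=1..m. a l i E * ex (SIM E) (\<lambda>S. \<phi>' \<theta> (load i S X - b i)))"

abbreviation wt :: "hist \<times> nat \<Rightarrow> real" where "wt \<equiv> (\<lambda>(E, r). \<mu> E)"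
abbreviation idx :: "(hist \<times> nat) set" where "idx \<equiv> histories \<times> {..<q}"

lemma dot_eq: "dot wt idx (\<lambda>(E, r). X E r) (\<lambda>(E, r). Y E r) = (\<Sum>E\<in>histories. \<mu> E * (\<Sum>r<q. X E r * Y E r))"
  unfolding dot_def sum.cartesian_product[symmetric]
  by (simp add: sum.cartesian_product' sum_distrib_left)

lemma \<phi>'_bounds: "0 < \<theta> \<Longrightarrow> 0 \<le> \<phi>' \<theta> x" "\<phi>' \<theta> x \<le> 1"
  unfolding \<phi>'_def by auto

lemma \<phi>'_lipschitz: "0 < \<theta> \<Longrightarrow> \<bar>\<phi>' \<theta> x - \<phi>' \<theta> y\<bar> \<le> \<bar>x - y\<bar> / \<theta>"
  unfolding \<phi>'_def by (auto simp: min_def max_def field_simps abs_if)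

lemma pen_ge:
  assumes "0 < \<theta>" "0 \<le> s" "s \<le> 1"
  shows "s * x - \<theta> / 2 * s^2 \<le> pen \<theta> x"
proof -
  define X where "X = x / \<theta>"
  have x: "x = \<theta> * X" using assms by (simp add: X_def)
  have p: "\<phi>' \<theta> x = min (max 0 X) 1" unfolding \<phi>'_def x using assms by (auto simp: max_def zero_le_mult_iff)
  have "(X - min (max 0 X) 1)^2 \<le> (X - s)^2"
    by (rule abs_le_square_iff[THEN iffD1]) (use assms in \<open>auto simp: min_def max_def\<close>)
  hence "\<theta> / 2 * (X - min (max 0 X) 1)^2 \<le> \<theta> / 2 * (X - s)^2" using assms by (intro mult_left_mono) auto
  thus ?thesis unfolding pen_def p unfolding x by (simp add: power2_diff algebra_simps power2_eq_square)
qed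

lemma pen_convex: "0 < \<theta> \<Longrightarrow> pen \<theta> y + \<phi>' \<theta> y * (x - y) \<le> pen \<theta> x"
  using pen_ge[of \<theta> "\<phi>' \<theta> y" x] \<phi>'_bounds[of \<theta> y] by (simp add: pen_def algebra_simps)

lemma pen_smooth:
  assumes "0 < \<theta>"
  shows "pen \<theta> x \<le> pen \<theta> y + \<phi>' \<theta> y * (x - y) + 1 / (2 * \<theta>) * (x - y)^2"
proof -
  define X Y where "X = x / \<theta>" and "Y = y / \<theta>"
  have x: "x = \<theta> * X" "y = \<theta> * Y" using assms by (simp_all add: X_def Y_def)
  define s t where "s = min (max 0 X) 1" and "t = min (max 0 Y) 1"
  have p: "\<phi>' \<theta> x = s" "\<phi>' \<theta> y = t"
    unfolding \<phi>'_def x s_def t_def using assms by (auto simp: max_def zero_le_mult_iff)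
  have "(s - t) * (X - (s + t) / 2) \<le> (X - Y)^2 / 2"
  proof -
    have "0 \<le> (s - X)^2 + (X - Y)^2 - (t - X)^2"
    proof -
      have "\<bar>t - X\<bar> \<le> \<bar>X - Y\<bar> \<or> (t = s \<and> True)"
        unfolding s_def t_def by (auto simp: min_def max_def)
      thus ?thesis
      proof
        assume "\<bar>t - X\<bar> \<le> \<bar>X - Y\<bar>"
        hence "(t - X)^2 \<le> (X - Y)^2" by (simp add: abs_le_square_iff)
        thus ?thesis using zero_le_power2[of "s - X"] by linarith
      qed simp
    qed
    thus ?thesis by (simp add: power2_eq_square field_simps)
  qed
  hence "\<theta> * ((s - t) * (X - (s + t) / 2)) \<le> \<theta> * ((X - Y)^2 / 2)" using assms by (intro mult_left_mono) auto
  moreover have "1 / (2 * \<theta>) * (x - y)^2 = \<theta> * ((X - Y)^2 / 2)"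
    unfolding x using assms by (simp add: power2_eq_square field_simps)
  moreover have "s * x - \<theta> / 2 * s^2
      = t * y - \<theta> / 2 * t^2 + t * (x - y) + \<theta> * ((s - t) * (X - (s + t) / 2))"
    unfolding x by (simp add: field_simps power2_eq_square)
  ultimately show ?thesis unfolding pen_def p by linarith
qed

lemma pen_nonneg: "0 < \<theta> \<Longrightarrow> 0 \<le> pen \<theta> x"
  using pen_ge[of \<theta> 0 x] by simp

lemma pen_zero: "0 < \<theta> \<Longrightarrow> x \<le> 0 \<Longrightarrow> pen \<theta> x = 0"
  unfolding pen_def \<phi>'_def by (simp add: max_def)

lemma load_diff: "load i S (\<lambda>E r. X E r - Y E r) = load i S X - load i S Y"
  unfolding load_def by (simp add: right_diff_distrib sum_subtractf)

lemma objective_diff: "objective (\<lambda>E r. X E r - Y E r) = objective X - objective Y"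
  unfolding objective_def by (simp add: right_diff_distrib sum_subtractf)

text \<open>
  The conditional laws given the histories combine to the law of the trajectories.  Hence \<open>pgrad\<close> is the
  gradient of \<open>penalized\<close> for the inner product in which a history has weight \<open>\<mu>\<close>.
\<close>

lemma dot_pgrad:
  "dot wt idx (\<lambda>(E, l). pgrad \<theta> Y E l) (\<lambda>(E, l). D E l)
     = objective D - 2 / \<iota> * (\<Sum>S\<in>trajectories. pr S * (\<Sum>i=1..m. \<phi>' \<theta> (load i S Y - b i) * load i S D))"
proof -
  let ?\<psi> = "\<lambda>i S. \<phi>' \<theta> (load i S Y - b i)"
  have "(\<Sum>E\<in>histories. \<mu> E * (\<Sum>l<q. (\<Sum>i=1..m. a l i E * ex (SIM E) (?\<psi> i)) * D E l))
      = (\<Sum>E\<in>histories. \<Sum>S\<in>{S\<in>trajectories. take (length E) S = E}. pr S * (\<Sum>i=1..m. ?\<psi> i S * (\<Sum>l<q. a l i E * D E l)))"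
  proof (rule sum.cong[OF refl])
    fix E assume E: "E \<in> histories"
    let ?A = "{S\<in>trajectories. take (length E) S = E}"
    have "\<mu> E * (\<Sum>l<q. (\<Sum>i=1..m. a l i E * ex (SIM E) (?\<psi> i)) * D E l)
        = (\<Sum>l<q. \<Sum>i=1..m. a l i E * D E l * (\<mu> E * ex (SIM E) (?\<psi> i)))"
      by (simp add: sum_distrib_left sum_distrib_right mult_ac)
    also have "\<dots> = (\<Sum>l<q. \<Sum>i=1..m. \<Sum>S\<in>?A. a l i E * D E l * (pr S * ?\<psi> i S))"
      unfolding ex_SIM[OF E] by (simp only: sum_distrib_left)
    also have "\<dots> = (\<Sum>l<q. \<Sum>S\<in>?A. \<Sum>i=1..m. a l i E * D E l * (pr S * ?\<psi> i S))"
      by (intro sum.cong refl sum.swap)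
    also have "\<dots> = (\<Sum>S\<in>?A. \<Sum>l<q. \<Sum>i=1..m. a l i E * D E l * (pr S * ?\<psi> i S))" by (rule sum.swap)
    also have "\<dots> = (\<Sum>S\<in>?A. \<Sum>i=1..m. \<Sum>l<q. a l i E * D E l * (pr S * ?\<psi> i S))"
      by (intro sum.cong refl sum.swap)
    also have "\<dots> = (\<Sum>S\<in>?A. pr S * (\<Sum>i=1..m. ?\<psi> i S * (\<Sum>l<q. a l i E * D E l)))"
      by (simp add: sum_distrib_left mult_ac)
    finally show "\<mu> E * (\<Sum>l<q. (\<Sum>i=1..m. a l i E * ex (SIM E) (?\<psi> i)) * D E l) = \<dots>" .
  qed
  also have "\<dots> = (\<Sum>S\<in>trajectories. pr S * (\<Sum>t=1..T. \<Sum>i=1..m. ?\<psi> i S * (\<Sum>l<q. a l i (take t S) * D (take t S) l)))"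
    by (rule path_swap)
  also have "\<dots> = (\<Sum>S\<in>trajectories. pr S * (\<Sum>i=1..m. ?\<psi> i S * load i S D))"
  proof -
    have "(\<Sum>t=1..T. \<Sum>i=1..m. ?\<psi> i S * (\<Sum>l<q. a l i (take t S) * D (take t S) l)) = (\<Sum>i=1..m. ?\<psi> i S * load i S D)"
      if S: "S \<in> trajectories" for S
    proof -
    have "(\<Sum>l<q. a l i (take t S) * D (take t S) l) = (\<Sum>l=1..<q. a l i (take t S) * D (take t S) l)"
      if "t \<in> {1..T}" "i \<in> {1..m}" for t i
      by (rule sum_choices[symmetric]) (use a_null take_history[OF S that(1)] that in simp)
    hence "(\<Sum>t=1..T. \<Sum>i=1..m. ?\<psi> i S * (\<Sum>l<q. a l i (take t S) * D (take t S) l))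
        = (\<Sum>t=1..T. \<Sum>i=1..m. ?\<psi> i S * (\<Sum>l=1..<q. a l i (take t S) * D (take t S) l))"
      by (intro sum.cong refl) auto
    also have "\<dots> = (\<Sum>i=1..m. ?\<psi> i S * load i S D)"
      unfolding load_def by (subst sum.swap) (simp add: sum_distrib_left)
    finally show ?thesis .
    qed
    thus ?thesis by (intro sum.cong refl) simp
  qed
  finally have part: "(\<Sum>E\<in>histories. \<mu> E * (\<Sum>l<q. (\<Sum>i=1..m. a l i E * ex (SIM E) (?\<psi> i)) * D E l)) = \<dots>" .
  have obj: "(\<Sum>E\<in>histories. \<mu> E * (\<Sum>l<q. Z l E * D E l)) = objective D"
    unfolding objective_def
    by (intro sum.cong refl arg_cong2[where f = "(*)"] sum_choices[symmetric]) (simp add: Z_null)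
  have "dot wt idx (\<lambda>(E, l). pgrad \<theta> Y E l) (\<lambda>(E, l). D E l)
      = (\<Sum>E\<in>histories. \<mu> E * (\<Sum>l<q. Z l E * D E l))
        - 2 / \<iota> * (\<Sum>E\<in>histories. \<mu> E * (\<Sum>l<q. (\<Sum>i=1..m. a l i E * ex (SIM E) (?\<psi> i)) * D E l))"
    unfolding dot_eq pgrad_def left_diff_distrib sum_subtractf right_diff_distrib
    by (simp add: sum_distrib_left mult_ac)
  thus ?thesis unfolding part obj .
qed

lemma penalized_above:
  assumes "0 < \<theta>"
  shows "penalized \<theta> X \<le> penalized \<theta> Y + dot wt idx (\<lambda>(E, l). pgrad \<theta> Y E l) (\<lambda>(E, l). X E l - Y E l)"
proof -
  have "(\<Sum>S\<in>trajectories. pr S * (\<Sum>i=1..m. pen \<theta> (load i S Y - b i) + \<phi>' \<theta> (load i S Y - b i) * (load i S X - load i S Y)))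
      \<le> (\<Sum>S\<in>trajectories. pr S * (\<Sum>i=1..m. pen \<theta> (load i S X - b i)))" (is "?l \<le> ?r")
  proof (intro sum_mono mult_left_mono)
    fix i S
    show "pen \<theta> (load i S Y - b i) + \<phi>' \<theta> (load i S Y - b i) * (load i S X - load i S Y) \<le> pen \<theta> (load i S X - b i)"
      using pen_convex[OF assms, of "load i S Y - b i" "load i S X - b i"] by simp
  qed simp
  hence "2 / \<iota> * ?l \<le> 2 / \<iota> * ?r" using wf_simps by (intro mult_left_mono) auto
  thus ?thesis unfolding dot_pgrad penalized_def load_diff objective_diff sum.distrib distrib_left
    by linarith
qed

text \<open>
  The matrix that maps a policy to its loads along \<open>S\<close> has at most \<open>L\<close> nonzero entries per column
  and \<open>U\<^sub>r\<close> per row, and its Gram matrix has row sums at most \<open>W\<close>.  Both bound the same quantity,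
  the sum of the row sizes \<open>|\<R>\<T>\<^sub>i|\<close> over the resources \<open>i\<close> that meet a column.
\<close>

lemma sum_option_times_le:
  assumes S: "S \<in> trajectories" and t: "t \<in> {1..T}" and r: "r < q"
  shows "(\<Sum>i\<in>aplus r (take t S). real (card (option_times i S))) \<le> sqrt (real (U\<^sub>r * L * W))"
proof -
  let ?A = "aplus r (take t S)"
  have E: "take t S \<in> histories" by (rule take_history[OF S t])
  have "card (option_times i S) \<le> U\<^sub>r" if "i \<in> {1..m}" for i
  proof -
    have "finite {card (option_times i S) | S i. S \<in> trajectories \<and> i \<in> {1..m}}"
      using finite_trajectories by (rule_tac finite_image_set2) auto
    thus ?thesis unfolding U\<^sub>r_def by (rule Max_ge) (use S that in auto)
  qed
  hence "(\<Sum>i\<in>?A. card (option_times i S)) \<le> (\<Sum>i\<in>?A. U\<^sub>r)" by (intro sum_mono) (auto simp: aplus_def)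
  also have "\<dots> \<le> L * U\<^sub>r" using card_aplus[OF E r] by simp
  finally have 1: "(\<Sum>i\<in>?A. card (option_times i S)) \<le> L * U\<^sub>r" .
  have "card (option_times i S) = (\<Sum>u=1..T. \<Sum>l=1..<q. if 0 < a l i (take u S) then 1 else 0)" if i: "i \<in> {1..m}" for i
  proof -
    have "option_times i S = Sigma {1..<q} (\<lambda>l. {u\<in>{1..T}. 0 < a l i (take u S)})"
    proof -
      have "l \<noteq> 0" if "u \<in> {1..T}" "0 < a l i (take u S)" for l u
        using a_null[OF take_history[OF S that(1)] i] that(2) by (cases "l = 0") auto
      thus ?thesis unfolding option_times_def by (auto simp: Suc_le_eq)
    qed
    hence "card (option_times i S) = (\<Sum>l=1..<q. card {u\<in>{1..T}. 0 < a l i (take u S)})" by simp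
    also have "\<dots> = (\<Sum>l=1..<q. \<Sum>u=1..T. if 0 < a l i (take u S) then 1 else 0)"
      by (simp add: sum.If_cases Int_def)
    also have "\<dots> = (\<Sum>u=1..T. \<Sum>l=1..<q. if 0 < a l i (take u S) then 1 else 0)" by (rule sum.swap)
    finally show ?thesis .
  qed
  hence "(\<Sum>i\<in>?A. card (option_times i S)) = (\<Sum>i\<in>?A. \<Sum>u=1..T. \<Sum>l=1..<q. if 0 < a l i (take u S) then 1 else 0)"
    by (intro sum.cong) (auto simp: aplus_def)
  also have "\<dots> = (\<Sum>u=1..T. \<Sum>i\<in>?A. \<Sum>l=1..<q. if 0 < a l i (take u S) then 1 else 0)" by (rule sum.swap)
  also have "\<dots> = (\<Sum>u=1..T. \<Sum>l=1..<q. \<Sum>i\<in>?A. if 0 < a l i (take u S) then 1 else 0)"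
    by (intro sum.cong refl sum.swap)
  also have "\<dots> = (\<Sum>u=1..T. \<Sum>l=1..<q. card (aplus l (take u S) \<inter> ?A))"
  proof (intro sum.cong refl)
    fix u l
    have "?A \<inter> {i. 0 < a l i (take u S)} = aplus l (take u S) \<inter> ?A" by (auto simp: aplus_def)
    thus "(\<Sum>i\<in>?A. if 0 < a l i (take u S) then 1 else 0) = card (aplus l (take u S) \<inter> ?A)"
      using finite_aplus by (simp add: sum.If_cases)
  qed
  also have "\<dots> \<le> W"
  proof -
    let ?w = "\<lambda>(S, u, r). \<Sum>t=1..T. \<Sum>l=1..<q. card (aplus l (take t S) \<inter> aplus r (take u S))"
    have "finite {\<Sum>t=1..T. \<Sum>l=1..<q. card (aplus l (take t S) \<inter> aplus r (take u S)) | S u r.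
        S \<in> trajectories \<and> u \<in> {1..T} \<and> r < q}"
    proof (rule finite_subset)
      show "{\<Sum>t=1..T. \<Sum>l=1..<q. card (aplus l (take t S) \<inter> aplus r (take u S)) | S u r.
        S \<in> trajectories \<and> u \<in> {1..T} \<and> r < q} \<subseteq> ?w ` (trajectories \<times> {1..T} \<times> {..<q})"
      proof safe
        fix S u r assume "S \<in> trajectories" "u \<in> {1..T}" "r < q"
        thus "(\<Sum>t=1..T. \<Sum>l=1..<q. card (aplus l (take t S) \<inter> aplus r (take u S)))
            \<in> ?w ` (trajectories \<times> {1..T} \<times> {..<q})"
          by (intro image_eqI[of _ _ "(S, u, r)"]) auto
      qed
    qed (use finite_trajectories in simp)
    thus ?thesis unfolding W_def by (rule Max_ge) (use S t r in auto)
  qed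
  finally have 2: "(\<Sum>i\<in>?A. card (option_times i S)) \<le> W" .
  have "(\<Sum>i\<in>?A. card (option_times i S)) * (\<Sum>i\<in>?A. card (option_times i S)) \<le> L * U\<^sub>r * W"
    by (rule mult_mono[OF 1 2]) auto
  hence "(real (\<Sum>i\<in>?A. card (option_times i S)))^2 \<le> real (U\<^sub>r * L * W)"
    unfolding power2_eq_square of_nat_mult[symmetric] of_nat_le_iff by (simp add: mult_ac)
  thus ?thesis by (simp add: real_le_rsqrt)
qed

lemma sum_load_squares:
  assumes S: "S \<in> trajectories"
  shows "(\<Sum>i=1..m. (load i S D)^2) \<le> sqrt (real (U\<^sub>r * L * W)) * (\<Sum>t=1..T. \<Sum>r<q. (D (take t S) r)^2)"
proof -
  let ?RT = "\<lambda>i. option_times i S" and ?N = "\<lambda>i. real (card (option_times i S))"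
  have fin: "finite (?RT i)" for i
    by (rule finite_subset[of _ "{..<q} \<times> {1..T}"]) (auto simp: option_times_def)
  have one: "(load i S D)^2 \<le> ?N i * (\<Sum>(r, t)\<in>?RT i. (D (take t S) r)^2)" if i: "i \<in> {1..m}" for i
  proof -
    have "load i S D = (\<Sum>t=1..T. \<Sum>r<q. a r i (take t S) * D (take t S) r)"
      unfolding load_def
      by (intro sum.cong refl sum_choices) (use a_null take_history[OF S] i in simp)
    also have "\<dots> = (\<Sum>r<q. \<Sum>t=1..T. a r i (take t S) * D (take t S) r)" by (rule sum.swap)
    also have "\<dots> = (\<Sum>(r, t)\<in>{..<q} \<times> {1..T}. a r i (take t S) * D (take t S) r)"
      by (simp add: sum.cartesian_product)
    also have "\<dots> = (\<Sum>(r, t)\<in>?RT i. a r i (take t S) * D (take t S) r)"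
    proof (rule sum.mono_neutral_right)
      show "\<forall>x\<in>{..<q} \<times> {1..T} - ?RT i. (case x of (r, t) \<Rightarrow> a r i (take t S) * D (take t S) r) = 0"
      proof (safe, goal_cases)
        case (1 r t)
        hence "\<not> 0 < a r i (take t S)" by (auto simp: option_times_def)
        thus ?case using a_nonneg[OF take_history[OF S], of t r i] 1 i by force
      qed
    qed (auto simp: option_times_def)
    finally have "(load i S D)^2 = (\<Sum>x\<in>?RT i. 1 * (case x of (r, t) \<Rightarrow> a r i (take t S) * D (take t S) r))^2" by simp
    also have "\<dots> \<le> (\<Sum>x\<in>?RT i. 1^2) * (\<Sum>x\<in>?RT i. (case x of (r, t) \<Rightarrow> a r i (take t S) * D (take t S) r)^2)"
      by (rule Cauchy_Schwarz_ineq_sum)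
    also have "\<dots> \<le> ?N i * (\<Sum>(r, t)\<in>?RT i. (D (take t S) r)^2)"
    proof -
      have "(a r i (take t S) * D (take t S) r)^2 \<le> (D (take t S) r)^2" if "(r, t) \<in> ?RT i" for r t
      proof -
        have "0 \<le> a r i (take t S)" "a r i (take t S) \<le> 1"
          using that i a_nonneg a_le_1 take_history[OF S] by (auto simp: option_times_def)
        hence "(a r i (take t S))^2 \<le> 1" by (simp add: power_le_one)
        thus ?thesis by (simp add: power_mult_distrib mult_left_le_one_le)
      qed
      thus ?thesis by (auto intro!: mult_left_mono sum_mono)
    qed
    finally show ?thesis .
  qed
  have "(\<Sum>i=1..m. (load i S D)^2) \<le> (\<Sum>i=1..m. \<Sum>(r, t)\<in>?RT i. ?N i * (D (take t S) r)^2)"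
    by (rule sum_mono) (use one in \<open>simp add: sum_distrib_left case_prod_unfold\<close>)
  also have "\<dots> = (\<Sum>i=1..m. \<Sum>(r, t)\<in>{..<q} \<times> {1..T}. if 0 < a r i (take t S) then ?N i * (D (take t S) r)^2 else 0)"
  proof (rule sum.cong[OF refl])
    fix i
    show "(\<Sum>(r, t)\<in>?RT i. ?N i * (D (take t S) r)^2)
        = (\<Sum>(r, t)\<in>{..<q} \<times> {1..T}. if 0 < a r i (take t S) then ?N i * (D (take t S) r)^2 else 0)"
      by (rule sum.mono_neutral_cong_left) (auto simp: option_times_def split: if_splits)
  qed
  also have "\<dots> = (\<Sum>(r, t)\<in>{..<q} \<times> {1..T}. \<Sum>i=1..m. if 0 < a r i (take t S) then ?N i * (D (take t S) r)^2 else 0)"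
    by (subst sum.swap) (simp add: case_prod_unfold)
  also have "\<dots> = (\<Sum>(r, t)\<in>{..<q} \<times> {1..T}. (D (take t S) r)^2 * (\<Sum>i\<in>aplus r (take t S). ?N i))"
  proof (rule sum.cong[OF refl], clarify)
    fix r t
    have "(\<Sum>i=1..m. if 0 < a r i (take t S) then ?N i * (D (take t S) r)^2 else 0)
        = (\<Sum>i\<in>aplus r (take t S). ?N i * (D (take t S) r)^2)"
      unfolding aplus_def by (rule sum.inter_filter[symmetric]) simp
    thus "(\<Sum>i=1..m. if 0 < a r i (take t S) then ?N i * (D (take t S) r)^2 else 0)
        = (D (take t S) r)^2 * (\<Sum>i\<in>aplus r (take t S). ?N i)"
      by (simp add: sum_distrib_left mult.commute)
  qed
  also have "\<dots> \<le> (\<Sum>(r, t)\<in>{..<q} \<times> {1..T}. (D (take t S) r)^2 * sqrt (real (U\<^sub>r * L * W)))"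
    by (rule sum_mono) (auto intro!: mult_left_mono sum_option_times_le[OF S] simp del: of_nat_mult)
  also have "\<dots> = sqrt (real (U\<^sub>r * L * W)) * (\<Sum>r<q. \<Sum>t=1..T. (D (take t S) r)^2)"
    by (simp add: sum.cartesian_product sum_distrib_left case_prod_unfold mult.commute)
  also have "(\<Sum>r<q. \<Sum>t=1..T. (D (take t S) r)^2) = (\<Sum>t=1..T. \<Sum>r<q. (D (take t S) r)^2)" by (rule sum.swap)
  finally show ?thesis .
qed

lemma penalized_below:
  assumes "0 < \<theta>"
  shows "penalized \<theta> X \<ge> penalized \<theta> Y + dot wt idx (\<lambda>(E, l). pgrad \<theta> Y E l) (\<lambda>(E, l). X E l - Y E l)
     - (2 * sqrt (real (U\<^sub>r * L * W)) / (\<iota> * \<theta>)) / 2 * nsq wt idx (\<lambda>(E, l). X E l - Y E l)"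
proof -
  let ?D = "\<lambda>E r. X E r - Y E r" and ?c = "sqrt (real (U\<^sub>r * L * W))"
  have "(\<Sum>S\<in>trajectories. pr S * (\<Sum>i=1..m. pen \<theta> (load i S X - b i)))
      \<le> (\<Sum>S\<in>trajectories. pr S * (\<Sum>i=1..m. pen \<theta> (load i S Y - b i) + \<phi>' \<theta> (load i S Y - b i) * (load i S X - load i S Y)
             + 1 / (2 * \<theta>) * (load i S ?D)^2))"
  proof (intro sum_mono mult_left_mono)
    fix i S
    show "pen \<theta> (load i S X - b i) \<le> pen \<theta> (load i S Y - b i) + \<phi>' \<theta> (load i S Y - b i) * (load i S X - load i S Y)
             + 1 / (2 * \<theta>) * (load i S ?D)^2"
      using pen_smooth[OF assms, of "load i S X - b i" "load i S Y - b i"] unfolding load_diff by simp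
  qed simp
  also have "\<dots> = (\<Sum>S\<in>trajectories. pr S * (\<Sum>i=1..m. pen \<theta> (load i S Y - b i)))
       + (\<Sum>S\<in>trajectories. pr S * (\<Sum>i=1..m. \<phi>' \<theta> (load i S Y - b i) * load i S ?D))
       + 1 / (2 * \<theta>) * (\<Sum>S\<in>trajectories. pr S * (\<Sum>i=1..m. (load i S ?D)^2))"
    unfolding load_diff sum.distrib distrib_left by (simp add: sum_distrib_left mult_ac)
  also have "(\<Sum>S\<in>trajectories. pr S * (\<Sum>i=1..m. (load i S ?D)^2))
      \<le> (\<Sum>S\<in>trajectories. pr S * (?c * (\<Sum>t=1..T. \<Sum>r<q. (?D (take t S) r)^2)))"
    by (intro sum_mono mult_left_mono sum_load_squares) auto
  also have "\<dots> = ?c * nsq wt idx (\<lambda>(E, l). X E l - Y E l)"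
    unfolding dot_eq path_sum by (simp add: sum_distrib_left power2_eq_square mult_ac)
  finally have "(\<Sum>S\<in>trajectories. pr S * (\<Sum>i=1..m. pen \<theta> (load i S X - b i)))
      \<le> (\<Sum>S\<in>trajectories. pr S * (\<Sum>i=1..m. pen \<theta> (load i S Y - b i)))
       + (\<Sum>S\<in>trajectories. pr S * (\<Sum>i=1..m. \<phi>' \<theta> (load i S Y - b i) * load i S ?D))
       + 1 / (2 * \<theta>) * (?c * nsq wt idx (\<lambda>(E, l). X E l - Y E l))" (is "?p \<le> ?y + ?z + _ * ?w")
    using assms by (simp add: divide_right_mono)
  hence "2 / \<iota> * ?p \<le> 2 / \<iota> * (?y + ?z + 1 / (2 * \<theta>) * ?w)" using wf_simps by (intro mult_left_mono) auto
  also have "\<dots> = 2 / \<iota> * ?y + 2 / \<iota> * ?z + ?w / (\<iota> * \<theta>)" using wf_simps assms by (simp add: field_simps)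
  finally show ?thesis unfolding dot_pgrad penalized_def objective_diff by (simp add: algebra_simps)
qed

lemma penalized_concave:
  assumes \<theta>: "0 < \<theta>" and w: "\<And>k. k \<in> A \<Longrightarrow> 0 \<le> w k" "(\<Sum>k\<in>A. w k) = 1"
  shows "(\<Sum>k\<in>A. w k * penalized \<theta> (x k)) \<le> penalized \<theta> (\<lambda>E r. \<Sum>k\<in>A. w k * x k E r)"
proof -
  let ?c = "\<lambda>E r. \<Sum>k\<in>A. w k * x k E r"
  have "(\<Sum>k\<in>A. w k * penalized \<theta> (x k))
      \<le> (\<Sum>k\<in>A. w k * (penalized \<theta> ?c + dot wt idx (\<lambda>(E, l). pgrad \<theta> ?c E l) (\<lambda>(E, l). x k E l - ?c E l)))"
    by (intro sum_mono mult_left_mono penalized_above[OF \<theta>] w)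
  also have "\<dots> = penalized \<theta> ?c + (\<Sum>k\<in>A. w k * dot wt idx (\<lambda>(E, l). pgrad \<theta> ?c E l) (\<lambda>(E, l). x k E l - ?c E l))"
    using w(2) by (simp add: distrib_left sum.distrib sum_distrib_right[symmetric])
  also have "(\<Sum>k\<in>A. w k * dot wt idx (\<lambda>(E, l). pgrad \<theta> ?c E l) (\<lambda>(E, l). x k E l - ?c E l))
      = (\<Sum>j\<in>idx. wt j * ((\<lambda>(E, l). pgrad \<theta> ?c E l) j * (\<Sum>k\<in>A. w k * (\<lambda>(E, l). x k E l - ?c E l) j)))"
    unfolding dot_def sum_distrib_left by (subst sum.swap) (simp add: mult_ac)
  also have "\<dots> = 0"
    using w(2) by (intro sum.neutral)
      (auto simp: right_diff_distrib sum_subtractf sum_distrib_right[symmetric])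
  finally show ?thesis by simp
qed

end

lemma ex_swap:
  assumes "finite (set_pmf p)" "finite (set_pmf r)"
  shows "ex p (\<lambda>x. ex r (h x)) = ex r (\<lambda>y. ex p (\<lambda>x. h x y))"
  unfolding ex_eq_sum[OF assms(1)] ex_eq_sum[OF assms(2)] sum_distrib_left
  by (subst sum.swap) (simp add: mult_ac)

lemma ex_pair:
  assumes "finite (set_pmf p)" "finite (set_pmf r)"
  shows "ex (pair_pmf p r) h = ex p (\<lambda>x. ex r (\<lambda>y. h (x, y)))"
  unfolding pair_pmf_def by (subst ex_bind) (use assms in \<open>auto simp: map_pmf_def[symmetric]\<close>)

lemma ex_resample:
  assumes "finite A" "x \<in> A" "\<And>y. y \<in> A \<Longrightarrow> finite (set_pmf (p y))"
  shows "ex (Pi_pmf A d p) h = ex (Pi_pmf A d p) (\<lambda>f. ex (p x) (\<lambda>v. h (f(x := v))))"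
proof -
  have fin: "finite (set_pmf (Pi_pmf A d p))" by (rule finite_set_Pi_pmf) (use assms in auto)
  have "ex (Pi_pmf A d p) h = ex (p x) (\<lambda>v. ex (Pi_pmf A d p) (\<lambda>f. h (f(x := v))))"
    by (subst Pi_pmf_resample[OF assms(1,2)], subst ex_bind) (use assms fin in auto)
  thus ?thesis using ex_swap[OF assms(3)[OF assms(2)] fin] by simp
qed

lemma square_le_of_abs_le: "\<bar>x\<bar> \<le> y \<Longrightarrow> x^2 \<le> y^2" for x y :: real
  using power_mono[of "\<bar>x\<bar>" y 2] by simp

context wf_nrm
begin

section \<open>Noise of the gradient estimates\<close>

definition Q2 :: "(hist \<Rightarrow> nat \<Rightarrow> real) set" where
  "Q2 = {X. \<forall>E\<in>histories. X E \<in> Q0}"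

lemma Q0_sum_eq: "x \<in> Q0 \<Longrightarrow> (\<Sum>r<q. x r) = 1"
  unfolding Q0_def by simp

lemma Q0_bounds: "x \<in> Q0 \<Longrightarrow> 0 \<le> x r \<and> x r \<le> 1"
  unfolding Q0_def by (cases "r < q") auto

lemma sum_Q0_le:
  assumes x: "x \<in> Q0" and c: "\<And>r. r < q \<Longrightarrow> 0 \<le> c r \<and> c r \<le> (1::real)"
  shows "0 \<le> (\<Sum>r=1..<q. c r * x r)" "(\<Sum>r=1..<q. c r * x r) \<le> 1"
proof -
  show "0 \<le> (\<Sum>r=1..<q. c r * x r)" by (intro sum_nonneg) (use c Q0_bounds[OF x] in auto)
  have "(\<Sum>r=1..<q. c r * x r) \<le> (\<Sum>r=1..<q. x r)"
    by (rule sum_mono, rule mult_left_le_one_le) (use c Q0_bounds[OF x] in auto)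
  also have "\<dots> \<le> (\<Sum>r<q. x r)" by (rule sum_mono2) (use Q0_bounds[OF x] in auto)
  finally show "(\<Sum>r=1..<q. c r * x r) \<le> 1" using Q0_sum_eq[OF x] by simp
qed

lemma null_choice_Q0: "null_choice \<in> Q0"
  using wf_simps by (auto simp: Q0_def null_choice_def sum.delta)

lemma iterate_Q0: "iterate \<theta> p sims al k E \<in> Q0"
  using proj_Q0[OF wf_simps(3)] null_choice_Q0 by (cases k) (auto simp: Let_def)

lemma iterate_cong:
  assumes "\<And>E j. j < k \<Longrightarrow> sims (E, j) = sims' (E, j)" "\<And>j. j < k \<Longrightarrow> al j = al' j"
  shows "iterate \<theta> p sims al k E = iterate \<theta> p sims' al' k E"
  using assms
proof (induction k arbitrary: E rule: less_induct)
  case (less k)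
  show ?case
  proof (cases k)
    case (Suc j)
    have "iterate \<theta> p sims al i = iterate \<theta> p sims' al' i" if "i < k" for i
      by (rule ext, rule less.IH) (use less.prems that in auto)
    hence "iterate \<theta> p sims al j = iterate \<theta> p sims' al' j"
      "iterate \<theta> p sims al (j - 1) = iterate \<theta> p sims' al' (j - 1)" using Suc by auto
    moreover have "sims (E, j) = sims' (E, j)" "al j = al' j" using less.prems Suc by auto
    ultimately show ?thesis unfolding Suc by (simp add: gradient_def)
  qed simp
qed

definition extrap :: "real \<Rightarrow> params \<Rightarrow> (hist \<times> nat \<Rightarrow> hist list) \<Rightarrow> (nat \<Rightarrow> nat set) \<Rightarrow> nat \<Rightarrow> hist \<Rightarrow> nat \<Rightarrow> real" where
  "extrap \<theta> p sims al k E r = (1 + momentum p k) * iterate \<theta> p sims al k E r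
     - momentum p k * iterate \<theta> p sims al (k - 1) E r"

lemma iterate_Suc:
  "iterate \<theta> p sims al (Suc k) E = proj (\<lambda>l. extrap \<theta> p sims al k E l
     + step_size p * gradient \<theta> p sims al k (extrap \<theta> p sims al k) E l)"
proof -
  have "extrap \<theta> p sims al k = (\<lambda>E' r. (1 + momentum p k) * iterate \<theta> p sims al k E' r
                      - momentum p k * iterate \<theta> p sims al (k - 1) E' r)"
    by (intro ext) (simp add: extrap_def)
  thus ?thesis by (simp add: Let_def)
qed

definition tame :: "(hist \<Rightarrow> nat \<Rightarrow> real) \<Rightarrow> bool" where
  "tame Y \<longleftrightarrow> (\<forall>E\<in>histories. \<forall>i\<in>{1..m}. \<bar>\<Sum>r=1..<q. a r i E * Y E r\<bar> \<le> 2)"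

lemma extrap_tame:
  assumes "0 \<le> momentum p k" "momentum p k \<le> 1"
  shows "tame (extrap \<theta> p sims al k)"
  unfolding tame_def
proof (intro ballI)
  fix E i assume E: "E \<in> histories" and i: "i \<in> {1..m}"
  let ?c = "\<lambda>x. \<Sum>r=1..<q. a r i E * x r" and ?b = "momentum p k"
  let ?x = "iterate \<theta> p sims al k E" and ?x' = "iterate \<theta> p sims al (k - 1) E"
  have "?c (extrap \<theta> p sims al k E) = (1 + ?b) * ?c ?x - ?b * ?c ?x'"
    by (simp add: extrap_def right_diff_distrib sum_subtractf sum_distrib_left mult_ac)
  moreover have c: "0 \<le> ?c x" "?c x \<le> 1" if "x \<in> Q0" for x
    using sum_Q0_le[OF that, of "\<lambda>r. a r i E"] a_nonneg[OF E] a_le_1[OF E] i by auto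
  moreover have "(1 + ?b) * ?c ?x \<le> 2 * 1"
    by (rule mult_mono) (use assms c[OF iterate_Q0] in auto)
  moreover have "?b * ?c ?x' \<le> 1 * 1"
    by (rule mult_mono) (use assms c[OF iterate_Q0] in auto)
  moreover have "0 \<le> (1 + ?b) * ?c ?x" "0 \<le> ?b * ?c ?x'"
    by (rule mult_nonneg_nonneg; use assms c[OF iterate_Q0] in force)+
  ultimately show "\<bar>?c (extrap \<theta> p sims al k E)\<bar> \<le> 2" by linarith
qed

abbreviation sim_dist :: "params \<Rightarrow> hist \<Rightarrow> hist list pmf" where
  "sim_dist p E \<equiv> replicate_pmf (num_sims p) (SIM E)"

abbreviation index_dist :: "params \<Rightarrow> nat set pmf" where
  "index_dist p \<equiv> pmf_of_set {A. A \<subseteq> {1..T} \<and> card A = num_indices p}"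

definition subsample_variance :: "params \<Rightarrow> real" where
  "subsample_variance p = (if num_indices p = T then 0 else 4 * T^2 / num_indices p)"

definition noise :: "real \<Rightarrow> params \<Rightarrow> real" where
  "noise \<theta> p = 8 * L^2 / \<iota>^2 * (1 / num_sims p + subsample_variance p / \<theta>^2)"

definition sampled :: "params \<Rightarrow> bool" where
  "sampled p \<longleftrightarrow> 1 \<le> num_sims p \<and> 1 \<le> num_indices p \<and> num_indices p \<le> T"

lemma index_sets_nonempty:
  assumes "num_indices p \<le> T"
  shows "{A. A \<subseteq> {1..T} \<and> card A = num_indices p} \<noteq> {}" "finite {A. A \<subseteq> {1..T} \<and> card A = num_indices p}"
proof -
  have "card {A. A \<subseteq> {1..T} \<and> card A = num_indices p} = T choose num_indices p"
    using n_subsets[of "{1..T}"] by simp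
  moreover have "T choose num_indices p \<noteq> 0" using assms by (simp add: binomial_eq_0_iff)
  ultimately show "{A. A \<subseteq> {1..T} \<and> card A = num_indices p} \<noteq> {}" by (metis card.empty)
qed simp

lemma finite_index_dist: "num_indices p \<le> T \<Longrightarrow> finite (set_pmf (index_dist p))"
  using index_sets_nonempty by (subst set_pmf_of_set)

lemma subsample_error:
  assumes p: "sampled p" and c: "\<And>t. t \<in> {1..T} \<Longrightarrow> \<bar>c t\<bar> \<le> 2"
  shows "ex (index_dist p) (\<lambda>A. (T / num_indices p * (\<Sum>t\<in>A. c t) - (\<Sum>t=1..T. c t))^2) \<le> subsample_variance p"
proof (cases "num_indices p = T")
  case True
  have "A \<subseteq> {1..T} \<and> card A = T \<longleftrightarrow> A = {1..T}" for A
    using card_subset_eq[of "{1..T}" A] by auto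
  hence "{A. A \<subseteq> {1..T} \<and> card A = T} = {{1..T}}" by simp
  hence "index_dist p = return_pmf {1..T}" using True by (simp add: pmf_of_set_singleton)
  thus ?thesis using True wf_simps by (simp add: subsample_variance_def)
next
  case False
  thus ?thesis
    using mean_square_subset_sample[of "{1..T}" T "num_indices p" c 2] p c
    by (simp add: subsample_variance_def sampled_def mult.commute)
qed

text \<open>
  The estimate of one component of the gradient, as a function of the trajectories and the
  index set that it uses.
\<close>

definition estimate :: "real \<Rightarrow> params \<Rightarrow> (hist \<Rightarrow> nat \<Rightarrow> real) \<Rightarrow> hist \<Rightarrow> nat \<Rightarrow> hist list \<Rightarrow> nat set \<Rightarrow> real" where
  "estimate \<theta> p Y E l ss A = Z l E - 2 / \<iota> * (\<Sum>i=1..m. a l i E * (1 / num_sims p *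
       (\<Sum>S'\<leftarrow>ss. \<phi>' \<theta> (T / num_indices p * (\<Sum>t\<in>A. \<Sum>r=1..<q. a r i (take t S') * Y (take t S') r) - b i))))"

lemma gradient_eq_estimate: "gradient \<theta> p sims al k Y E l = estimate \<theta> p Y E l (sims (E, k)) (al k)"
  unfolding gradient_def estimate_def ..

lemma square_sum_list_le: "(\<Sum>x\<leftarrow>xs. f x)^2 \<le> length xs * (\<Sum>x\<leftarrow>xs. (f x)^2)" for f :: "'z \<Rightarrow> real"
proof -
  have s: "(\<Sum>x\<leftarrow>xs. g x) = (\<Sum>j<length xs. g (xs ! j))" for g :: "'z \<Rightarrow> real"
    by (simp add: sum_list_sum_nth atLeast0LessThan)
  have "(\<Sum>j<length xs. 1 * f (xs ! j))^2 \<le> (\<Sum>j<length xs. 1^2) * (\<Sum>j<length xs. (f (xs ! j))^2)"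
    by (rule Cauchy_Schwarz_ineq_sum)
  thus ?thesis unfolding s by simp
qed

text \<open>
  The error has two sources: averaging over \<open>\<eta>\<^sub>1\<close> simulated trajectories instead of taking the
  conditional expectation, and replacing the load by its estimate from \<open>\<eta>\<^sub>2\<close> periods inside \<open>\<phi>' \<theta>\<close>,
  which has Lipschitz constant \<open>1 / \<theta>\<close>.  The latter is a bias, which averaging does not remove.
\<close>

lemma estimate_error:
  assumes p: "sampled p" and \<theta>: "0 < \<theta>" and E: "E \<in> histories" and l: "l < q" and Y: "tame Y"
  shows "ex (sim_dist p E) (\<lambda>ss. ex (index_dist p) (\<lambda>A. (estimate \<theta> p Y E l ss A - pgrad \<theta> Y E l)^2)) \<le> noise \<theta> p"
proof -
  let ?n = "real (num_sims p)" and ?P = "sim_dist p E" and ?I = "index_dist p"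
  have n: "1 \<le> num_sims p" using p by (simp add: sampled_def)
  note fS = finite_SIM[OF E]
  note fP = finite_set_replicate_pmf[OF fS, of "num_sims p"]
  have fI: "finite (set_pmf ?I)" using p finite_index_dist by (simp add: sampled_def)
  define full where "full i S' = \<phi>' \<theta> (load i S' Y - b i)" for i S'
  define sub where "sub i A S' = \<phi>' \<theta> (T / num_indices p * (\<Sum>t\<in>A. \<Sum>r=1..<q. a r i (take t S') * Y (take t S') r) - b i)" for i A S'
  define mean where "mean i = ex (SIM E) (full i)" for i
  define avg where "avg i ss A = 1 / ?n * (\<Sum>S'\<leftarrow>ss. sub i A S')" for i ss A
  have err: "(estimate \<theta> p Y E l ss A - pgrad \<theta> Y E l)^2 \<le> 4 / \<iota>^2 * L * (\<Sum>i\<in>aplus l E. (avg i ss A - mean i)^2)" for ss A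
  proof -
    have "estimate \<theta> p Y E l ss A - pgrad \<theta> Y E l = - (2 / \<iota>) * (\<Sum>i=1..m. a l i E * (avg i ss A - mean i))"
      unfolding estimate_def pgrad_def avg_def mean_def full_def sub_def
      by (simp add: right_diff_distrib sum_subtractf)
    also have "(\<Sum>i=1..m. a l i E * (avg i ss A - mean i)) = (\<Sum>i\<in>aplus l E. a l i E * (avg i ss A - mean i))"
      by (rule sum.mono_neutral_right) (use a_nonneg[OF E l] in \<open>force simp: aplus_def\<close>)+
    finally have "(estimate \<theta> p Y E l ss A - pgrad \<theta> Y E l)^2 = 4 / \<iota>^2 * (\<Sum>i\<in>aplus l E. a l i E * (avg i ss A - mean i))^2"
      by (simp add: power_mult_distrib power_divide)
    also have "(\<Sum>i\<in>aplus l E. a l i E * (avg i ss A - mean i))^2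
        \<le> (\<Sum>i\<in>aplus l E. (a l i E)^2) * (\<Sum>i\<in>aplus l E. (avg i ss A - mean i)^2)"
      by (rule Cauchy_Schwarz_ineq_sum)
    also have "(\<Sum>i\<in>aplus l E. (a l i E)^2) \<le> (\<Sum>i\<in>aplus l E. 1)"
      by (rule sum_mono) (use a_nonneg[OF E l] a_le_1[OF E l] in \<open>auto simp: aplus_def intro!: power_le_one\<close>)
    also have "\<dots> \<le> L" using card_aplus[OF E l] by simp
    finally show ?thesis using wf_simps by (simp add: mult_left_mono mult_right_mono sum_nonneg mult.assoc divide_right_mono)
  qed
  have comp: "ex ?P (\<lambda>ss. ex ?I (\<lambda>A. (avg i ss A - mean i)^2)) \<le> 2 / ?n + 2 * subsample_variance p / \<theta>^2"
    if i: "i \<in> {1..m}" for i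
  proof -
    define h where "h S' = full i S' - mean i" for S'
    have full01: "0 \<le> full i S'" "full i S' \<le> 1" for S' unfolding full_def using \<phi>'_bounds(1)[OF \<theta>] \<phi>'_bounds(2) by auto
    have mean01: "0 \<le> mean i" "mean i \<le> 1" unfolding mean_def
      using full01 by (auto intro!: ex_ge_const ex_le_const fS)
    have h1: "\<bar>h S'\<bar> \<le> 1" for S' unfolding h_def using full01[of S'] mean01 by linarith
    have h0: "ex (SIM E) h = 0" unfolding h_def by (simp add: ex_diff[OF fS] mean_def)
    have split: "(avg i ss A - mean i)^2 \<le> 2 / ?n^2 * (\<Sum>S'\<leftarrow>ss. h S')^2 + 2 / ?n * (\<Sum>S'\<leftarrow>ss. (sub i A S' - full i S')^2)"
      if "ss \<in> set_pmf ?P" for ss A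
    proof -
      have len: "length ss = num_sims p" using that by (simp add: set_replicate_pmf)
      have "avg i ss A - mean i = 1 / ?n * (\<Sum>S'\<leftarrow>ss. h S') + 1 / ?n * (\<Sum>S'\<leftarrow>ss. sub i A S' - full i S')"
        using n len unfolding avg_def h_def by (simp add: sum_list_subtractf sum_list_triv field_simps)
      hence "(avg i ss A - mean i)^2 = (1 / ?n * (\<Sum>S'\<leftarrow>ss. h S') + 1 / ?n * (\<Sum>S'\<leftarrow>ss. sub i A S' - full i S'))^2" by simp
      also have "\<dots> \<le> 2 * (1 / ?n * (\<Sum>S'\<leftarrow>ss. h S'))^2 + 2 * (1 / ?n * (\<Sum>S'\<leftarrow>ss. sub i A S' - full i S'))^2"
        (is "(?x + ?y)^2 \<le> _")
      proof -
        have "0 \<le> (?x - ?y)^2" by simp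
        thus ?thesis unfolding power2_sum power2_diff by linarith
      qed
      also have "\<dots> = 2 / ?n^2 * (\<Sum>S'\<leftarrow>ss. h S')^2 + 2 / ?n^2 * (\<Sum>S'\<leftarrow>ss. sub i A S' - full i S')^2"
        by (simp add: power_mult_distrib power_divide)
      also have "(\<Sum>S'\<leftarrow>ss. sub i A S' - full i S')^2 \<le> ?n * (\<Sum>S'\<leftarrow>ss. (sub i A S' - full i S')^2)"
        using square_sum_list_le[of "\<lambda>S'. sub i A S' - full i S'" ss] len by simp
      finally show ?thesis using n by (simp add: divide_right_mono power2_eq_square)
    qed
    have b: "ex ?I (\<lambda>A. (sub i A S' - full i S')^2) \<le> subsample_variance p / \<theta>^2" if S': "S' \<in> trajectories" for S'
    proof -
      let ?c = "\<lambda>t. \<Sum>r=1..<q. a r i (take t S') * Y (take t S') r"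
      let ?d = "\<lambda>A. T / num_indices p * (\<Sum>t\<in>A. ?c t) - (\<Sum>t=1..T. ?c t)"
      have "ex ?I (\<lambda>A. (sub i A S' - full i S')^2)
          \<le> ex ?I (\<lambda>A. 1 / \<theta>^2 * (?d A)^2)"
      proof (rule ex_mono[OF fI])
        fix A
        have "\<bar>sub i A S' - full i S'\<bar> \<le> \<bar>?d A\<bar> / \<theta>"
          unfolding sub_def full_def load_def by (rule order_trans[OF \<phi>'_lipschitz[OF \<theta>]]) simp
        hence "(sub i A S' - full i S')^2 \<le> (\<bar>?d A\<bar> / \<theta>)^2"
          by (rule square_le_of_abs_le)
        thus "(sub i A S' - full i S')^2 \<le> 1 / \<theta>^2 * (?d A)^2"
          by (simp add: power_divide)
      qed
      also have "\<dots> = 1 / \<theta>^2 * ex ?I (\<lambda>A. (?d A)^2)" by (rule ex_cmult)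
      also have "\<dots> \<le> 1 / \<theta>^2 * subsample_variance p"
        by (intro mult_left_mono subsample_error[OF p]) (use Y take_history[OF S'] i in \<open>auto simp: tame_def\<close>)
      finally show ?thesis by simp
    qed
    have "ex ?P (\<lambda>ss. ex ?I (\<lambda>A. (avg i ss A - mean i)^2))
        \<le> ex ?P (\<lambda>ss. 2 / ?n^2 * (\<Sum>S'\<leftarrow>ss. h S')^2 + 2 * subsample_variance p / \<theta>^2)"
    proof (rule ex_mono[OF fP])
      fix ss assume ss: "ss \<in> set_pmf ?P"
      have len: "length ss = num_sims p" and el: "set ss \<subseteq> trajectories"
        using ss set_SIM[OF E] by (auto simp: set_replicate_pmf)
      have "ex ?I (\<lambda>A. (avg i ss A - mean i)^2)
          \<le> ex ?I (\<lambda>A. 2 / ?n^2 * (\<Sum>S'\<leftarrow>ss. h S')^2 + 2 / ?n * (\<Sum>S'\<leftarrow>ss. (sub i A S' - full i S')^2))"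
        by (rule ex_mono[OF fI]) (rule split[OF ss])
      also have "\<dots> = 2 / ?n^2 * (\<Sum>S'\<leftarrow>ss. h S')^2 + 2 / ?n * (\<Sum>S'\<leftarrow>ss. ex ?I (\<lambda>A. (sub i A S' - full i S')^2))"
        by (simp only: ex_add[OF fI] ex_cmult ex_sum_list[OF fI]) simp
      also have "(\<Sum>S'\<leftarrow>ss. ex ?I (\<lambda>A. (sub i A S' - full i S')^2)) \<le> (\<Sum>S'\<leftarrow>ss. subsample_variance p / \<theta>^2)"
        by (rule sum_list_mono) (use b el in auto)
      also have "\<dots> = ?n * (subsample_variance p / \<theta>^2)" using len by (simp add: sum_list_triv)
      finally show "ex ?I (\<lambda>A. (avg i ss A - mean i)^2) \<le> 2 / ?n^2 * (\<Sum>S'\<leftarrow>ss. h S')^2 + 2 * subsample_variance p / \<theta>^2"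
        using n by (simp add: divide_right_mono)
    qed
    also have "\<dots> = 2 / ?n^2 * ex ?P (\<lambda>ss. (\<Sum>S'\<leftarrow>ss. h S')^2) + 2 * subsample_variance p / \<theta>^2"
      by (simp only: ex_add[OF fP] ex_cmult) simp
    also have "\<dots> \<le> 2 / ?n^2 * ?n + 2 * subsample_variance p / \<theta>^2"
      by (intro add_right_mono mult_left_mono mean_square_replicate(1)[OF fS h0 h1]) auto
    also have "2 / ?n^2 * ?n = 2 / ?n" using n by (simp add: power2_eq_square)
    finally show ?thesis .
  qed
  have "ex ?P (\<lambda>ss. ex ?I (\<lambda>A. (estimate \<theta> p Y E l ss A - pgrad \<theta> Y E l)^2))
      \<le> ex ?P (\<lambda>ss. ex ?I (\<lambda>A. 4 / \<iota>^2 * L * (\<Sum>i\<in>aplus l E. (avg i ss A - mean i)^2)))"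
    by (intro ex_mono fP fI err)
  also have "\<dots> = 4 / \<iota>^2 * L * (\<Sum>i\<in>aplus l E. ex ?P (\<lambda>ss. ex ?I (\<lambda>A. (avg i ss A - mean i)^2)))"
    by (simp only: ex_cmult ex_sum[OF fI] ex_sum[OF fP])
  also have "\<dots> \<le> 4 / \<iota>^2 * L * (\<Sum>i\<in>aplus l E. 2 / ?n + 2 * subsample_variance p / \<theta>^2)"
    by (intro mult_left_mono sum_mono comp) (auto simp: aplus_def)
  also have "\<dots> \<le> 4 / \<iota>^2 * L * (L * (2 / ?n + 2 * subsample_variance p / \<theta>^2))"
  proof (intro mult_left_mono)
    have "0 \<le> 2 / ?n + 2 * subsample_variance p / \<theta>^2" by (simp add: subsample_variance_def)
    thus "(\<Sum>i\<in>aplus l E. 2 / ?n + 2 * subsample_variance p / \<theta>^2) \<le> L * (2 / ?n + 2 * subsample_variance p / \<theta>^2)"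
      using card_aplus[OF E l] by (simp add: mult_right_mono)
  qed auto
  also have "\<dots> = noise \<theta> p" unfolding noise_def by (simp add: power2_eq_square field_simps)
  finally show ?thesis .
qed

lemma
  assumes "num_indices p \<le> T"
  shows finite_draws: "finite (set_pmf (draws p))"
    and draws_sims: "(sims, al) \<in> set_pmf (draws p) \<Longrightarrow> E \<in> histories \<Longrightarrow> k < rounds p \<Longrightarrow>
      length (sims (E, k)) = num_sims p \<and> set (sims (E, k)) \<subseteq> trajectories"
proof -
  let ?D1 = "Pi_pmf (histories \<times> {..<rounds p}) [] (\<lambda>(E, k). sim_dist p E)"
  have f1: "finite (set_pmf ?D1)"
    by (rule finite_set_Pi_pmf) (auto intro!: finite_histories finite_set_replicate_pmf finite_SIM)
  have f2: "finite (set_pmf (Pi_pmf {..<rounds p} {} (\<lambda>k. index_dist p)))"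
    by (rule finite_set_Pi_pmf, simp) (rule finite_index_dist, rule assms)
  show "finite (set_pmf (draws p))" unfolding draws_def using f1 f2 by simp
  assume "(sims, al) \<in> set_pmf (draws p)" and E: "E \<in> histories" and k: "k < rounds p"
  hence "sims \<in> set_pmf ?D1" by (simp add: draws_def)
  hence "sims (E, k) \<in> set_pmf (sim_dist p E)"
    using E k finite_histories by (auto simp: set_Pi_pmf PiE_dflt_def)
  thus "length (sims (E, k)) = num_sims p \<and> set (sims (E, k)) \<subseteq> trajectories"
    using set_SIM[OF E] by (auto simp: set_replicate_pmf)
qed

definition grad_error :: "real \<Rightarrow> params \<Rightarrow> (hist \<times> nat \<Rightarrow> hist list) \<Rightarrow> (nat \<Rightarrow> nat set) \<Rightarrow> nat \<Rightarrow> hist \<Rightarrow> nat \<Rightarrow> real" where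
  "grad_error \<theta> p sims al k E l = gradient \<theta> p sims al k (extrap \<theta> p sims al k) E l - pgrad \<theta> (extrap \<theta> p sims al k) E l"

abbreviation error :: "real \<Rightarrow> params \<Rightarrow> (hist \<times> nat \<Rightarrow> hist list) \<Rightarrow> (nat \<Rightarrow> nat set) \<Rightarrow> nat \<Rightarrow> real" where
  "error \<theta> p sims al k \<equiv> nsq wt idx (\<lambda>(E, l). grad_error \<theta> p sims al k E l)"

text \<open>
  The point at which round \<open>k\<close> evaluates the gradient depends on the draws of earlier rounds only,
  so that the draws of round \<open>k\<close> may be replaced by fresh ones.
\<close>

lemma expected_grad_error:
  assumes p: "sampled p" and \<theta>: "0 < \<theta>" and k: "k < rounds p"
    and mom: "0 \<le> momentum p k" "momentum p k \<le> 1"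
  shows "ex (draws p) (\<lambda>(sims, al). error \<theta> p sims al k) \<le> T * (q * noise \<theta> p)"
proof -
  let ?K = "rounds p"
  let ?D1 = "Pi_pmf (histories \<times> {..<?K}) [] (\<lambda>(E, k). sim_dist p E)"
  let ?D2 = "Pi_pmf {..<?K} {} (\<lambda>k. index_dist p)"
  have NT: "num_indices p \<le> T" using p by (simp add: sampled_def)
  have f1: "finite (set_pmf ?D1)"
    by (rule finite_set_Pi_pmf) (auto intro!: finite_histories finite_set_replicate_pmf finite_SIM)
  have f2: "finite (set_pmf ?D2)"
    by (rule finite_set_Pi_pmf, simp) (rule finite_index_dist, rule NT)
  have one: "ex (draws p) (\<lambda>(sims, al). (grad_error \<theta> p sims al k E l)^2) \<le> noise \<theta> p"
    if E: "E \<in> histories" and l: "l < q" for E l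
  proof -
    let ?e = "\<lambda>s a. (grad_error \<theta> p s a k E l)^2"
    have fs: "finite (set_pmf (sim_dist p E))" by (intro finite_set_replicate_pmf finite_SIM E)
    have "ex (draws p) (\<lambda>(sims, al). ?e sims al) = ex ?D1 (\<lambda>s. ex ?D2 (\<lambda>a. ?e s a))"
      unfolding draws_def by (subst ex_pair[OF f1 f2]) simp
    also have "\<dots> = ex ?D1 (\<lambda>s. ex ?D2 (\<lambda>a. ex (index_dist p) (\<lambda>A. ?e s (a(k := A)))))"
      by (rule ex_cong, rule ex_resample) (use k finite_index_dist[OF NT] in auto)
    also have "\<dots> = ex ?D1 (\<lambda>s. ex (sim_dist p E) (\<lambda>v. ex ?D2 (\<lambda>a. ex (index_dist p) (\<lambda>A. ?e (s((E, k) := v)) (a(k := A))))))"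
      using ex_resample[of "histories \<times> {..<?K}" "(E, k)" "\<lambda>(E, k). sim_dist p E" "[]"
          "\<lambda>s. ex ?D2 (\<lambda>a. ex (index_dist p) (\<lambda>A. ?e s (a(k := A))))"]
        E k finite_histories finite_set_replicate_pmf[OF finite_SIM] by fastforce
    also have "\<dots> = ex ?D1 (\<lambda>s. ex ?D2 (\<lambda>a. ex (sim_dist p E) (\<lambda>v. ex (index_dist p) (\<lambda>A. ?e (s((E, k) := v)) (a(k := A))))))"
      by (simp only: ex_swap[OF fs f2])
    also have "\<dots> = ex ?D1 (\<lambda>s. ex ?D2 (\<lambda>a. ex (sim_dist p E) (\<lambda>v. ex (index_dist p)
        (\<lambda>A. (estimate \<theta> p (extrap \<theta> p s a k) E l v A - pgrad \<theta> (extrap \<theta> p s a k) E l)^2))))"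
    proof -
      have "extrap \<theta> p (s((E, k) := v)) (a(k := A)) k = extrap \<theta> p s a k" for s a v A
      proof (intro ext)
        fix E' r
        have "iterate \<theta> p (s((E, k) := v)) (a(k := A)) j E' = iterate \<theta> p s a j E'" if "j \<le> k" for j
          by (rule iterate_cong) (use that in auto)
        from this[of k] this[of "k - 1"] show "extrap \<theta> p (s((E, k) := v)) (a(k := A)) k E' r = extrap \<theta> p s a k E' r"
          by (simp add: extrap_def)
      qed
      thus ?thesis by (simp add: grad_error_def gradient_eq_estimate)
    qed
    also have "\<dots> \<le> noise \<theta> p"
      by (intro ex_le_const[OF f1] ex_le_const[OF f2] estimate_error[OF p \<theta> E l] extrap_tame mom)
    finally show ?thesis .
  qed
  note fd = finite_draws[OF NT]
  have "ex (draws p) (\<lambda>(sims, al). error \<theta> p sims al k)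
      = ex (draws p) (\<lambda>x. \<Sum>E\<in>histories. \<mu> E * (\<Sum>l<q. (\<lambda>(sims, al). (grad_error \<theta> p sims al k E l)^2) x))"
    unfolding dot_eq by (simp add: case_prod_unfold power2_eq_square)
  also have "\<dots> = (\<Sum>E\<in>histories. \<mu> E * (\<Sum>l<q. ex (draws p) (\<lambda>(sims, al). (grad_error \<theta> p sims al k E l)^2)))"
    by (simp only: ex_sum[OF fd] ex_cmult)
  also have "\<dots> \<le> (\<Sum>E\<in>histories. \<mu> E * (\<Sum>l<q. noise \<theta> p))"
    by (intro sum_mono mult_left_mono one \<mu>_nonneg) auto
  also have "\<dots> = T * (q * noise \<theta> p)" by (simp add: sum_distrib_right[symmetric] sum_\<mu>)
  finally show ?thesis .
qed

section \<open>The value of the penalized objective that is reached\<close>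

lemma nsq_Q2_le:
  assumes "X \<in> Q2" "Y \<in> Q2"
  shows "nsq wt idx (\<lambda>(E, r). X E r - Y E r) \<le> 2 * T"
proof -
  have "(\<Sum>r<q. (X E r - Y E r) * (X E r - Y E r)) \<le> 2" if E: "E \<in> histories" for E
  proof -
    have Q: "X E \<in> Q0" "Y E \<in> Q0" using assms E by (auto simp: Q2_def)
    have "(X E r - Y E r) * (X E r - Y E r) \<le> X E r + Y E r" for r
    proof -
      note B = Q0_bounds[OF Q(1), of r] Q0_bounds[OF Q(2), of r]
      have "\<bar>X E r - Y E r\<bar> * \<bar>X E r - Y E r\<bar> \<le> 1 * (X E r + Y E r)"
        by (rule mult_mono) (use B in auto)
      thus ?thesis by simp
    qed
    hence "(\<Sum>r<q. (X E r - Y E r) * (X E r - Y E r)) \<le> (\<Sum>r<q. X E r + Y E r)" by (intro sum_mono)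
    thus ?thesis using Q0_sum_eq[OF Q(1)] Q0_sum_eq[OF Q(2)] by (simp add: sum.distrib)
  qed
  hence "(\<Sum>E\<in>histories. \<mu> E * (\<Sum>r<q. (X E r - Y E r) * (X E r - Y E r))) \<le> (\<Sum>E\<in>histories. \<mu> E * 2)"
    by (intro sum_mono mult_left_mono \<mu>_nonneg)
  thus ?thesis unfolding dot_eq by (simp add: sum_distrib_right[symmetric] sum_\<mu>)
qed

lemma iterate_Q2: "iterate \<theta> p sims al k \<in> Q2"
  using iterate_Q0 by (simp add: Q2_def)

lemma iterate_variational:
  assumes "X \<in> Q2"
  shows "dot wt idx (\<lambda>(E, l). extrap \<theta> p sims al k E l + step_size p * gradient \<theta> p sims al k (extrap \<theta> p sims al k) E l
              - iterate \<theta> p sims al (Suc k) E l)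
           (\<lambda>(E, l). X E l - iterate \<theta> p sims al (Suc k) E l) \<le> 0"
  unfolding dot_eq
proof (rule sum_nonpos)
  fix E assume "E \<in> histories"
  hence "X E \<in> Q0" using assms by (simp add: Q2_def)
  from proj_variational[OF wf_simps(3) this, of "\<lambda>l. extrap \<theta> p sims al k E l
     + step_size p * gradient \<theta> p sims al k (extrap \<theta> p sims al k) E l"]
  show "\<mu> E * (\<Sum>r<q. (extrap \<theta> p sims al k E r + step_size p * gradient \<theta> p sims al k (extrap \<theta> p sims al k) E r
              - iterate \<theta> p sims al (Suc k) E r) * (X E r - iterate \<theta> p sims al (Suc k) E r)) \<le> 0"
    unfolding iterate_Suc by (intro mult_nonneg_nonpos \<mu>_nonneg)
qed

lemma component_bound:
  assumes E: "E \<in> histories" and l: "l < q" and x: "\<And>i. i \<in> {1..m} \<Longrightarrow> 0 \<le> x i \<and> x i \<le> 1"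
  shows "(Z l E - 2 / \<iota> * (\<Sum>i=1..m. a l i E * x i))^2 \<le> 4 * L^2 / \<iota>^2"
proof -
  let ?s = "\<Sum>i=1..m. a l i E * x i"
  have s0: "0 \<le> ?s" by (intro sum_nonneg mult_nonneg_nonneg) (use x a_nonneg[OF E l] in auto)
  have "?s \<le> (\<Sum>i=1..m. a l i E)" by (intro sum_mono mult_right_le_one_le) (use x a_nonneg[OF E l] in auto)
  also have "\<dots> \<le> L" by (rule sum_consumption_le[OF E l])
  finally have s1: "?s \<le> L" .
  have "2 / \<iota> * ?s \<le> 2 / \<iota> * L" using s1 wf_simps by (intro mult_left_mono) auto
  moreover have "0 \<le> 2 / \<iota> * ?s" using s0 wf_simps by simp
  moreover have "1 \<le> 2 / \<iota> * L"
  proof -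
    have "1 * 1 \<le> 2 / \<iota> * real L" using wf_simps by (intro mult_mono) auto
    thus ?thesis by simp
  qed
  ultimately have "\<bar>Z l E - 2 / \<iota> * ?s\<bar> \<le> 2 / \<iota> * L" using Z_bounds[OF E l] by linarith
  hence "(Z l E - 2 / \<iota> * ?s)^2 \<le> (2 / \<iota> * L)^2" by (rule square_le_of_abs_le)
  thus ?thesis by (simp add: power_mult_distrib power_divide)
qed

lemma nsq_le_components:
  fixes c :: real
  assumes "\<And>E l. E \<in> histories \<Longrightarrow> l < q \<Longrightarrow> (G E l)^2 \<le> c"
  shows "nsq wt idx (\<lambda>(E, l). G E l) \<le> T * (q * c)"
proof -
  have "nsq wt idx (\<lambda>(E, l). G E l) \<le> (\<Sum>E\<in>histories. \<mu> E * (\<Sum>l<q. c))"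
    unfolding dot_eq by (intro sum_mono mult_left_mono \<mu>_nonneg) (use assms in \<open>auto simp: power2_eq_square\<close>)
  thus ?thesis by (simp add: sum_distrib_right[symmetric] sum_\<mu>)
qed

lemma wt_nonneg: "j \<in> idx \<Longrightarrow> 0 \<le> wt j"
  using \<mu>_nonneg by auto

end

lemma projection_nonexpansive:
  assumes w: "\<And>j. j \<in> J \<Longrightarrow> 0 \<le> w j" and vi: "dot w J (\<lambda>j. z j - x j) (\<lambda>j. u j - x j) \<le> 0"
  shows "nsq w J (\<lambda>j. x j - u j) \<le> nsq w J (\<lambda>j. z j - u j)"
proof -
  have "nsq w J (\<lambda>j. z j - u j) = nsq w J (\<lambda>j. z j - x j) + nsq w J (\<lambda>j. x j - u j)
      - 2 * dot w J (\<lambda>j. z j - x j) (\<lambda>j. u j - x j)"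
    unfolding dot_def sum_distrib_left sum.distrib[symmetric] sum_subtractf[symmetric]
    by (rule sum.cong[OF refl]) (simp only: algebra_simps)
  thus ?thesis using vi nsq_nonneg[of J w "\<lambda>j. z j - x j"] w by simp
qed

lemma le_nat_ceiling: "x \<le> real (nat \<lceil>x\<rceil>)"
  by linarith

lemma nat_ceiling_pos: "0 < x \<Longrightarrow> 1 \<le> nat \<lceil>x\<rceil>"
  using zero_less_ceiling[of x] by (simp add: Suc_le_eq)

lemma nat_ceiling_min:
  fixes x :: real and N :: nat
  assumes "0 < x" "1 \<le> N"
  shows "1 \<le> nat \<lceil>min x N\<rceil>" "nat \<lceil>min x N\<rceil> \<le> N" "nat \<lceil>min x N\<rceil> = N \<or> x \<le> real (nat \<lceil>min x N\<rceil>)"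
proof -
  show "1 \<le> nat \<lceil>min x N\<rceil>" by (rule nat_ceiling_pos) (use assms in auto)
  show "nat \<lceil>min x N\<rceil> \<le> N" by (simp add: nat_le_iff ceiling_le_iff)
  show "nat \<lceil>min x N\<rceil> = N \<or> x \<le> real (nat \<lceil>min x N\<rceil>)"
    using le_nat_ceiling[of "min x N"] by (cases "x \<le> N") (auto simp: min_def)
qed

context wf_nrm
begin

lemma noise_le:
  fixes c1 c2 \<delta> \<theta> :: real
  assumes c: "0 < c1" "0 < c2" and \<delta>: "0 < \<delta>" and \<theta>: "0 < \<theta>" and p: "sampled p"
    and n1: "c1 * L^2 * q / (\<iota>^2 * \<delta>^2) \<le> num_sims p"
    and n2: "num_indices p = T \<or> c2 * L^2 * T^2 * q / (\<iota>^2 * \<theta>^2 * \<delta>^2) \<le> num_indices p"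
  shows "q * noise \<theta> p \<le> (8 / c1 + 32 / c2) * \<delta>^2"
proof -
  have pos: "0 < real L" "0 < real q" "0 < \<iota>" "0 < real T" "0 < real (num_sims p)" "0 < real (num_indices p)"
    using wf_simps p by (auto simp: sampled_def)
  have 1: "1 / real (num_sims p) \<le> \<iota>^2 * \<delta>^2 / (c1 * L^2 * q)"
    using n1 pos c \<delta> by (simp add: field_simps)
  have 2: "subsample_variance p / \<theta>^2 \<le> 4 * (\<iota>^2 * \<delta>^2 / (c2 * L^2 * q))"
  proof (cases "num_indices p = T")
    case True
    thus ?thesis using pos c \<delta> by (simp add: subsample_variance_def)
  next
    case False
    hence "c2 * L^2 * T^2 * q / (\<iota>^2 * \<theta>^2 * \<delta>^2) \<le> num_indices p" using n2 by simp
    thus ?thesis using False pos c \<delta> \<theta> by (simp add: subsample_variance_def field_simps)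
  qed
  have "q * noise \<theta> p = q * (8 * L^2 / \<iota>^2) * (1 / num_sims p + subsample_variance p / \<theta>^2)"
    by (simp add: noise_def)
  also have "\<dots> \<le> q * (8 * L^2 / \<iota>^2) * (\<iota>^2 * \<delta>^2 / (c1 * L^2 * q) + 4 * (\<iota>^2 * \<delta>^2 / (c2 * L^2 * q)))"
    using 1 2 by (intro mult_left_mono add_mono) auto
  also have "\<dots> = (8 / c1 + 32 / c2) * \<delta>^2" using pos c by (simp add: field_simps)
  finally show ?thesis .
qed

lemma ex_A_params: "ex (A_params \<theta> p) h = ex (draws p) (\<lambda>(sims, al). h (policy_output \<theta> p sims al))"
  unfolding A_params_def by (simp add: case_prod_unfold)

lemma gradient_bound:
  assumes \<theta>: "0 < \<theta>" and d: "(sims, al) \<in> set_pmf (draws p)" and p: "sampled p" and k: "k < rounds p"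
    and E: "E \<in> histories" and l: "l < q"
  shows "(gradient \<theta> p sims al k Y E l)^2 \<le> 4 * L^2 / \<iota>^2"
  unfolding gradient_def
proof (rule component_bound[OF E l])
  fix i
  let ?s = "\<Sum>S'\<leftarrow>sims (E, k). \<phi>' \<theta> (T / num_indices p * (\<Sum>t\<in>al k. \<Sum>r=1..<q. a r i (take t S') * Y (take t S') r) - b i)"
  have len: "length (sims (E, k)) = num_sims p" using draws_sims[of p sims al E k] d p E k by (simp add: sampled_def)
  have "0 \<le> ?s" by (intro sum_list_nonneg) (use \<phi>'_bounds(1)[OF \<theta>] in auto)
  moreover have "?s \<le> (\<Sum>S'\<leftarrow>sims (E, k). 1)" by (intro sum_list_mono \<phi>'_bounds(2))
  ultimately show "0 \<le> 1 / num_sims p * ?s \<and> 1 / num_sims p * ?s \<le> 1"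
    using len p by (simp add: sum_list_triv sampled_def)
qed

lemma pgrad_bound:
  assumes \<theta>: "0 < \<theta>" and E: "E \<in> histories" and l: "l < q"
  shows "(pgrad \<theta> Y E l)^2 \<le> 4 * L^2 / \<iota>^2"
  unfolding pgrad_def
  by (rule component_bound[OF E l])
     (use \<phi>'_bounds(1)[OF \<theta>] \<phi>'_bounds(2) in \<open>auto intro!: ex_ge_const ex_le_const finite_SIM E\<close>)

text \<open>
  The number of rounds and the step size keep the two noiseless terms of the regret at \<open>\<delta> T / 12\<close> each.
  The noise is separated from the distance to the comparator by Young's inequality with weight
  \<open>\<delta> / 10\<close>, and adds \<open>2 / 15 \<delta> T\<close>.
\<close>

lemma value_setting_i:
  fixes \<delta> :: real
  assumes \<theta>: "0 < \<theta>" and \<delta>: "0 < \<delta>" and u: "u \<in> Q2"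
  shows "penalized \<theta> u - \<delta> * T \<le> ex (A_params \<theta> (params_i \<theta> \<delta>)) (penalized \<theta>)"
proof -
  define p where "p = params_i \<theta> \<delta>"
  define K where "K = rounds p"
  define \<alpha> where "\<alpha> = step_size p"
  have pos: "0 < real L" "0 < real q" "0 < \<iota>" "0 < real T" using wf_simps by auto
  have \<alpha>: "\<alpha> = \<iota>^2 * \<delta> / (24 * L^2 * q)" by (simp add: \<alpha>_def p_def params_i_def)
  have \<alpha>0: "0 < \<alpha>" using pos \<delta> by (simp add: \<alpha>)
  have mom: "momentum p k = 0" for k by (simp add: p_def params_i_def)
  have Kge: "288 * L^2 * q / (\<delta>^2 * \<iota>^2) \<le> K" unfolding K_def p_def params_i_def by (simp add: le_nat_ceiling)
  have "0 < 288 * L^2 * q / (\<delta>^2 * \<iota>^2)" using pos \<delta> by simp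
  hence K0: "0 < real K" using Kge by linarith
  hence K1: "1 \<le> K" by simp
  have X: "0 < 20736 * L^2 * T^2 * q / (\<iota>^2 * \<theta>^2 * \<delta>^2)" using pos \<delta> \<theta> by simp
  have ns: "num_sims p = nat \<lceil>2304 * L^2 * q / (\<iota>^2 * \<delta>^2)\<rceil>"
    and ni: "num_indices p = nat \<lceil>min (20736 * L^2 * T^2 * q / (\<iota>^2 * \<theta>^2 * \<delta>^2)) T\<rceil>"
    by (simp_all add: p_def params_i_def)
  have "1 \<le> num_sims p" unfolding ns by (rule nat_ceiling_pos) (use pos \<delta> in simp)
  hence sp: "sampled p" unfolding sampled_def using nat_ceiling_min[OF X wf_simps(1)] by (simp add: ni)
  have s2: "q * noise \<theta> p \<le> \<delta>^2 / 150"
  proof -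
    have "q * noise \<theta> p \<le> (8 / 2304 + 32 / 20736) * \<delta>^2"
      by (rule noise_le[OF _ _ \<delta> \<theta> sp]) (use nat_ceiling_min[OF X wf_simps(1)] in \<open>auto simp: ns ni le_nat_ceiling\<close>)
    also have "\<dots> \<le> \<delta>^2 / 150" by simp
    finally show ?thesis .
  qed
  note fd = finite_draws[of p] sp[unfolded sampled_def]
  have fd: "finite (set_pmf (draws p))" using finite_draws[of p] sp by (simp add: sampled_def)
  have path: "penalized \<theta> u - penalized \<theta> (policy_output \<theta> p sims al)
      \<le> \<delta> * T / 6 + 1 / K * (\<Sum>k=1..<K. 5 / \<delta> * error \<theta> p sims al k + \<delta> / 10 * T)"
    if d: "(sims, al) \<in> set_pmf (draws p)" for sims al
  proof -
    define X where "X k = iterate \<theta> p sims al k" for k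
    define x where "x k = (\<lambda>(E, r). X k E r)" for k
    define g where "g k = (\<lambda>(E, l). pgrad \<theta> (X k) E l)" for k
    define e where "e k = (\<lambda>(E, l). grad_error \<theta> p sims al k E l)" for k
    define f where "f y = penalized \<theta> (\<lambda>E r. y (E, r))" for y :: "hist \<times> nat \<Rightarrow> real"
    define v where "v = (\<lambda>(E, r). u E r)"
    have no_extrap: "extrap \<theta> p sims al k = X k" for k
      by (intro ext) (simp add: extrap_def mom X_def)
    have fx: "f (x k) = penalized \<theta> (X k)" and fv: "f v = penalized \<theta> u" for k
      unfolding f_def x_def v_def by auto
    have XQ: "X k \<in> Q2" for k unfolding X_def by (rule iterate_Q2)
    have ge: "g k (E, l) + e k (E, l) = gradient \<theta> p sims al k (X k) E l" for k E l
      by (simp add: g_def e_def grad_error_def no_extrap)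
    have main: "2 * \<alpha> * (\<Sum>k=1..K. f v - f (x k))
           \<le> 2 * T + \<alpha>^2 * (K * (T * (q * (4 * L^2 / \<iota>^2)))) + 2 * \<alpha> * (\<Sum>k=1..<K. dot wt idx (e k) (\<lambda>j. x k j - v j))"
    proof (rule projected_gradient_regret[OF wt_nonneg \<alpha>0 K1, where g = g])
      fix k assume "1 \<le> k" "k \<le> K"
      show "f v - f (x k) \<le> dot wt idx (g k) (\<lambda>j. v j - x k j)"
        using penalized_above[OF \<theta>, of u "X k"] unfolding fx fv
        by (simp add: g_def v_def x_def case_prod_unfold)
    next
      fix k assume k: "1 \<le> k" "k < K"
      have vi: "dot wt idx (\<lambda>j. x k j + \<alpha> * (g k j + e k j) - x (Suc k) j) (\<lambda>j. v j - x (Suc k) j) \<le> 0"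
        using iterate_variational[OF u, of \<theta> p sims al k] unfolding no_extrap
        by (simp add: x_def v_def g_def e_def grad_error_def no_extrap \<alpha>_def case_prod_unfold flip: X_def)
      show "nsq wt idx (\<lambda>j. x (Suc k) j - v j) \<le> nsq wt idx (\<lambda>j. x k j + \<alpha> * (g k j + e k j) - v j)"
        by (rule projection_nonexpansive[OF wt_nonneg vi])
      have "nsq wt idx (\<lambda>(E, l). gradient \<theta> p sims al k (X k) E l) \<le> T * (q * (4 * L^2 / \<iota>^2))"
        by (rule nsq_le_components) (use gradient_bound[OF \<theta> d sp] k in \<open>auto simp: K_def\<close>)
      moreover have "(\<lambda>j. g k j + e k j) = (\<lambda>(E, l). gradient \<theta> p sims al k (X k) E l)"
        using ge by auto
      ultimately show "nsq wt idx (\<lambda>j. g k j + e k j) \<le> T * (q * (4 * L^2 / \<iota>^2))" by simp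
    next
      show "nsq wt idx (g K) \<le> T * (q * (4 * L^2 / \<iota>^2))"
        unfolding g_def by (rule nsq_le_components) (rule pgrad_bound[OF \<theta>])
      show "nsq wt idx (\<lambda>j. x 1 j - v j) \<le> 2 * T"
        using nsq_Q2_le[OF XQ[of 1] u] by (simp add: x_def v_def case_prod_unfold)
    qed
    have dk: "dot wt idx (e k) (\<lambda>j. x k j - v j) \<le> 5 / \<delta> * error \<theta> p sims al k + \<delta> / 10 * T" for k
    proof -
      have "dot wt idx (e k) (\<lambda>j. x k j - v j) \<le> nsq wt idx (e k) / (2 * (\<delta> / 10)) + (\<delta> / 10) / 2 * nsq wt idx (\<lambda>j. x k j - v j)"
        by (rule dot_young[OF wt_nonneg]) (use \<delta> in auto)
      also have "nsq wt idx (\<lambda>j. x k j - v j) \<le> 2 * T"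
        using nsq_Q2_le[OF XQ[of k] u] by (simp add: x_def v_def case_prod_unfold)
      finally show ?thesis using \<delta> by (simp add: e_def field_simps)
    qed
    have out: "policy_output \<theta> p sims al = (\<lambda>E l. \<Sum>k=1..K. 1 / K * X k E l)"
    proof (intro ext)
      fix E l
      have "averaged p" by (simp add: p_def params_i_def)
      thus "policy_output \<theta> p sims al E l = (\<Sum>k=1..K. 1 / K * X k E l)"
        unfolding policy_output_def X_def K_def by (simp add: sum_distrib_left)
    qed
    have "(\<Sum>k=1..K. 1 / K * penalized \<theta> (X k)) \<le> penalized \<theta> (policy_output \<theta> p sims al)"
      unfolding out by (rule penalized_concave[OF \<theta>]) (use K1 in auto)
    moreover have "(\<Sum>k=1..K. 1 / K * penalized \<theta> (X k)) = penalized \<theta> u - 1 / K * (\<Sum>k=1..K. f v - f (x k))"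
    proof -
      have "(\<Sum>k=1..K. f v - f (x k)) = K * penalized \<theta> u - (\<Sum>k=1..K. penalized \<theta> (X k))"
        by (simp add: fx fv sum_subtractf)
      thus ?thesis unfolding sum_distrib_left[symmetric] using K0 by (simp add: field_simps)
    qed
    ultimately have 1: "penalized \<theta> u - penalized \<theta> (policy_output \<theta> p sims al) \<le> 1 / K * (\<Sum>k=1..K. f v - f (x k))"
      by linarith
    have divide_out: "z \<le> T / \<alpha> + \<alpha> / 2 * c + z'" if "2 * \<alpha> * z \<le> 2 * T + \<alpha>^2 * c + 2 * \<alpha> * z'" for z c z'
      using that \<alpha>0 by (simp add: field_simps power2_eq_square)
    have "2 * \<alpha> * (\<Sum>k=1..K. f v - f (x k))
           \<le> 2 * T + \<alpha>^2 * (K * (T * (q * (4 * L^2 / \<iota>^2)))) + 2 * \<alpha> * (\<Sum>k=1..<K. 5 / \<delta> * error \<theta> p sims al k + \<delta> / 10 * T)"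
      by (rule order_trans[OF main]) (use \<alpha>0 dk in \<open>auto intro!: sum_mono\<close>)
    hence "(\<Sum>k=1..K. f v - f (x k))
           \<le> T / \<alpha> + \<alpha> / 2 * (K * (T * (q * (4 * L^2 / \<iota>^2)))) + (\<Sum>k=1..<K. 5 / \<delta> * error \<theta> p sims al k + \<delta> / 10 * T)"
      by (rule divide_out)
    hence "1 / K * (\<Sum>k=1..K. f v - f (x k))
           \<le> 1 / K * (T / \<alpha> + \<alpha> / 2 * (K * (T * (q * (4 * L^2 / \<iota>^2)))) + (\<Sum>k=1..<K. 5 / \<delta> * error \<theta> p sims al k + \<delta> / 10 * T))"
      by (rule mult_left_mono) simp
    also have "\<dots> = T / (\<alpha> * K) + \<alpha> / 2 * (T * (q * (4 * L^2 / \<iota>^2))) + 1 / K * (\<Sum>k=1..<K. 5 / \<delta> * error \<theta> p sims al k + \<delta> / 10 * T)"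
      using K0 by (simp add: distrib_left mult.assoc)
    also have "\<alpha> / 2 * (T * (q * (4 * L^2 / \<iota>^2))) = \<delta> * T / 12"
      unfolding \<alpha> using pos by (simp add: field_simps power2_eq_square)
    also have "T / (\<alpha> * K) \<le> \<delta> * T / 12"
    proof -
      have "12 / \<delta> = \<alpha> * (288 * L^2 * q / (\<delta>^2 * \<iota>^2))" unfolding \<alpha> using pos \<delta> by (simp add: field_simps power2_eq_square)
      also have "\<dots> \<le> \<alpha> * K" using Kge \<alpha>0 by (intro mult_left_mono) auto
      finally have "12 \<le> \<delta> * (\<alpha> * K)" using \<delta> by (simp add: field_simps)
      hence "real T * 12 \<le> real T * (\<delta> * (\<alpha> * K))" by (rule mult_left_mono) simp
      thus ?thesis using \<alpha>0 K0 by (simp add: field_simps)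
    qed
    finally show ?thesis using 1 by simp
  qed
  have "penalized \<theta> u - ex (draws p) (\<lambda>(sims, al). penalized \<theta> (policy_output \<theta> p sims al))
      = ex (draws p) (\<lambda>(sims, al). penalized \<theta> u - penalized \<theta> (policy_output \<theta> p sims al))"
    by (simp add: case_prod_unfold ex_diff[OF fd])
  also have "\<dots> \<le> ex (draws p) (\<lambda>x. \<delta> * T / 6 + 1 / K * (\<Sum>k=1..<K. 5 / \<delta> * (\<lambda>(sims, al). error \<theta> p sims al k) x + \<delta> / 10 * T))"
    by (rule ex_mono[OF fd]) (use path in auto)
  also have "\<dots> = \<delta> * T / 6 + 1 / K * (\<Sum>k=1..<K. 5 / \<delta> * ex (draws p) (\<lambda>(sims, al). error \<theta> p sims al k) + \<delta> / 10 * T)"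
    by (simp only: ex_add[OF fd] ex_cmult ex_sum[OF fd]) simp
  also have "\<dots> \<le> \<delta> * T / 6 + 1 / K * (\<Sum>k=1..<K. 5 / \<delta> * (T * (\<delta>^2 / 150)) + \<delta> / 10 * T)"
  proof (intro add_left_mono mult_left_mono sum_mono add_right_mono)
    fix k assume "k \<in> {1..<K}"
    hence "ex (draws p) (\<lambda>(sims, al). error \<theta> p sims al k) \<le> T * (q * noise \<theta> p)"
      by (intro expected_grad_error[OF sp \<theta>]) (auto simp: K_def mom)
    also have "\<dots> \<le> T * (\<delta>^2 / 150)" by (intro mult_left_mono s2) auto
    finally show "ex (draws p) (\<lambda>(sims, al). error \<theta> p sims al k) \<le> T * (\<delta>^2 / 150)" .
  qed (use \<delta> in auto)
  also have "\<dots> = \<delta> * T / 6 + (K - 1) / K * (2 / 15 * \<delta> * T)"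
    using \<delta> K1 by (simp add: field_simps power2_eq_square of_nat_diff)
  also have "\<dots> \<le> \<delta> * T / 6 + 1 * (2 / 15 * \<delta> * T)"
    using \<delta> K1 by (intro add_left_mono mult_right_mono) auto
  also have "\<dots> \<le> \<delta> * T" using \<delta> by simp
  finally show ?thesis unfolding ex_A_params p_def[symmetric] by simp
qed

text \<open>
  With \<open>y = \<alpha> (K + 1)\<^sup>2\<close> the regret bound says that \<open>y / 2\<close> times the gap is at most \<open>4 T\<close> plus
  \<open>2 y\<^sup>2\<close> times the noise level.  The choice of \<open>K\<close> keeps \<open>y \<delta>\<close> between \<open>49\<close> and \<open>841 / 4\<close>: large enough for
  the first term, small enough for the second.
\<close>

lemma value_accelerated:
  fixes \<delta> :: real
  assumes \<theta>: "0 < \<theta>" and \<delta>: "0 < \<delta>" "\<delta> \<le> 1" and u: "u \<in> Q2" and sp: "sampled p"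
    and mom: "momentum p = (\<lambda>k. if k = 0 then 0 else (real k - 1) / (real k + 2))"
    and step: "step_size p = 1 / 4 * (1 / (\<rho> \<theta>)^2)"
    and rounds: "rounds p = 14 * \<rho> \<theta> * nat \<lceil>1 / sqrt \<delta>\<rceil>" and last: "\<not> averaged p"
    and s2: "q * noise \<theta> p \<le> \<delta>^2 / 9000"
  shows "penalized \<theta> u - \<delta> * T \<le> ex (A_params \<theta> p) (penalized \<theta>)"
proof -
  define K where "K = rounds p"
  define \<alpha> where "\<alpha> = step_size p"
  define M where "M = 2 * sqrt (real (U\<^sub>r * L * W)) / (\<iota> * \<theta>)"
  have pos: "0 < \<iota>" "0 < real T" using wf_simps by auto
  have \<rho>1: "1 \<le> \<rho> \<theta>" by (simp add: \<rho>_def)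
  have \<alpha>: "\<alpha> = 1 / (4 * (real (\<rho> \<theta>))^2)" by (simp add: \<alpha>_def step)
  have \<alpha>0: "0 < \<alpha>" using \<rho>1 by (simp add: \<alpha>)
  have M: "\<alpha> * M \<le> 1"
  proof -
    have "root 4 (U\<^sub>r * L * W) / sqrt (\<iota> * \<theta>) \<le> \<rho> \<theta>"
      unfolding \<rho>_def using le_nat_ceiling[of "root 4 (U\<^sub>r * L * W) / sqrt (\<iota> * \<theta>)"] by simp
    hence "(root 4 (U\<^sub>r * L * W) / sqrt (\<iota> * \<theta>))^2 \<le> (real (\<rho> \<theta>))^2"
      using pos \<theta> by (intro power_mono) auto
    also have "(root 4 (U\<^sub>r * L * W) / sqrt (\<iota> * \<theta>))^2 = sqrt (real (U\<^sub>r * L * W)) / (\<iota> * \<theta>)"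
    proof -
      have "root 4 x = sqrt (sqrt x)" for x :: real
        unfolding sqrt_def by (simp add: real_root_mult_exp[symmetric])
      thus ?thesis using pos \<theta> by (simp add: power_divide)
    qed
    finally have "M \<le> 2 * (real (\<rho> \<theta>))^2" by (simp add: M_def)
    hence "\<alpha> * M \<le> \<alpha> * (2 * (real (\<rho> \<theta>))^2)" using \<alpha>0 by (intro mult_left_mono) auto
    also have "\<dots> \<le> 1" using \<rho>1 by (simp add: \<alpha>)
    finally show ?thesis .
  qed
  have c1: "1 / sqrt \<delta> \<le> nat \<lceil>1 / sqrt \<delta>\<rceil>" by (rule le_nat_ceiling)
  have sq1: "1 \<le> 1 / sqrt \<delta>" using \<delta> by simp
  have c2: "nat \<lceil>1 / sqrt \<delta>\<rceil> \<le> 2 / sqrt \<delta>" using sq1 by linarith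
  have Klo: "14 * real (\<rho> \<theta>) / sqrt \<delta> \<le> K"
  proof -
    have "14 * real (\<rho> \<theta>) * (1 / sqrt \<delta>) \<le> 14 * real (\<rho> \<theta>) * nat \<lceil>1 / sqrt \<delta>\<rceil>" by (intro mult_left_mono c1) auto
    thus ?thesis by (simp add: K_def rounds)
  qed
  have Khi: "real K + 1 \<le> 29 * real (\<rho> \<theta>) / sqrt \<delta>"
  proof -
    have "14 * real (\<rho> \<theta>) * nat \<lceil>1 / sqrt \<delta>\<rceil> \<le> 14 * real (\<rho> \<theta>) * (2 / sqrt \<delta>)" by (intro mult_left_mono c2) auto
    moreover have "1 * 1 \<le> \<rho> \<theta> * (1 / sqrt \<delta>)" by (rule mult_mono) (use sq1 \<rho>1 in auto)
    ultimately show ?thesis by (simp add: K_def rounds)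
  qed
  have "1 * 1 \<le> 14 * real (\<rho> \<theta>) * (1 / sqrt \<delta>)" by (rule mult_mono) (use sq1 \<rho>1 in auto)
  hence K1: "1 \<le> K" using Klo by simp
  define y where "y = \<alpha> * (real K + 1)^2"
  have ylo: "49 / \<delta> \<le> y"
  proof -
    have "\<alpha> * (14 * real (\<rho> \<theta>) / sqrt \<delta>)^2 \<le> \<alpha> * (real K + 1)^2"
      using Klo \<alpha>0 \<delta> by (intro mult_left_mono power_mono) auto
    also have "\<alpha> * (14 * real (\<rho> \<theta>) / sqrt \<delta>)^2 = 49 / \<delta>" using \<rho>1 \<delta> by (simp add: \<alpha> power_divide power_mult_distrib)
    finally show ?thesis by (simp add: y_def)
  qed
  have yhi: "y \<le> 841 / 4 / \<delta>"
  proof -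
    have "\<alpha> * (real K + 1)^2 \<le> \<alpha> * (29 * real (\<rho> \<theta>) / sqrt \<delta>)^2"
      using Khi \<alpha>0 \<delta> by (intro mult_left_mono power_mono) auto
    also have "\<alpha> * (29 * real (\<rho> \<theta>) / sqrt \<delta>)^2 = 841 / 4 / \<delta>" using \<rho>1 \<delta> by (simp add: \<alpha> power_divide power_mult_distrib)
    finally show ?thesis by (simp add: y_def)
  qed
  have fd: "finite (set_pmf (draws p))" using finite_draws[of p] sp by (simp add: sampled_def)
  define P where "P = (\<Sum>k<K. (real k + 2) / 2)"
  have path: "2 * \<alpha> * ((real K + 1) / 2)^2 * (penalized \<theta> u - penalized \<theta> (policy_output \<theta> p sims al))
      \<le> 2 * real (2 * T) + 8 * \<alpha>^2 * P * (\<Sum>k<K. (real k + 2) / 2 * error \<theta> p sims al k)" for sims al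
  proof -
    define X where "X k = iterate \<theta> p sims al k" for k
    define x where "x k = (\<lambda>(E, r). X k E r)" for k
    define y where "y k = (\<lambda>(E, r). extrap \<theta> p sims al k E r)" for k
    define g where "g k = (\<lambda>(E, l). pgrad \<theta> (extrap \<theta> p sims al k) E l)" for k
    define e where "e k = (\<lambda>(E, l). grad_error \<theta> p sims al k E l)" for k
    define f where "f y = penalized \<theta> (\<lambda>E r. y (E, r))" for y :: "hist \<times> nat \<Rightarrow> real"
    define v where "v = (\<lambda>(E, r). u E r)"
    define Q where "Q = {z. (\<lambda>E r. z (E, r)) \<in> Q2}"
    have XQ: "X k \<in> Q2" for k unfolding X_def by (rule iterate_Q2)
    have uncurry: "z = (\<lambda>(E, r). z (E, r))" for z :: "hist \<times> nat \<Rightarrow> real" by auto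
    have "2 * \<alpha> * ((real K + 1) / 2)^2 * (f v - f (x K))
        \<le> 2 * real (2 * T) + 8 * \<alpha>^2 * P * (\<Sum>k<K. (real k + 2) / 2 * nsq wt idx (e k))"
      unfolding P_def
    proof (rule accelerated_gradient_regret[OF wt_nonneg \<alpha>0 M K1, where Q = Q and y = y and g = g and e = e and x = x and u = v and f = f and \<beta> = "momentum p" and ?D2.0 = "real (2 * T)"])
      fix z z' :: "hist \<times> nat \<Rightarrow> real" and s :: real
      assume z: "z \<in> Q" "z' \<in> Q" and s: "0 \<le> s" "s \<le> 1"
      have "(\<lambda>r. (1 - s) * z (E, r) + s * z' (E, r)) \<in> Q0" if "E \<in> histories" for E
      proof -
        have Q: "(\<lambda>r. z (E, r)) \<in> Q0" "(\<lambda>r. z' (E, r)) \<in> Q0" using z that by (auto simp: Q_def Q2_def)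
        have "(1 - s) * z (E, r) + s * z' (E, r) \<le> (1 - s) * 1 + s * 1" for r
          using Q0_bounds[OF Q(1), of r] Q0_bounds[OF Q(2), of r] s by (intro add_mono mult_left_mono) auto
        moreover have "(\<Sum>r<q. (1 - s) * z (E, r) + s * z' (E, r)) = 1"
          using Q0_sum_eq[OF Q(1)] Q0_sum_eq[OF Q(2)] by (simp add: sum.distrib sum_distrib_left[symmetric])
        ultimately show ?thesis using Q s by (auto simp: Q0_def)
      qed
      thus "(\<lambda>j. (1 - s) * z j + s * z' j) \<in> Q" by (simp add: Q_def Q2_def)
      have "(\<Sum>k\<in>{0::nat,1}. (if k = 0 then 1 - s else s) * penalized \<theta> ((\<lambda>k E r. (if k = 0 then z else z') (E, r)) k))
          \<le> penalized \<theta> (\<lambda>E r. \<Sum>k\<in>{0::nat,1}. (if k = 0 then 1 - s else s) * (\<lambda>k E r. (if k = 0 then z else z') (E, r)) k E r)"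
        by (rule penalized_concave[OF \<theta>]) (use s in auto)
      thus "(1 - s) * f z + s * f z' \<le> f (\<lambda>j. (1 - s) * z j + s * z' j)" by (simp add: f_def)
    next
      show "x k \<in> Q" for k using XQ[of k] by (simp add: Q_def x_def)
      show "v \<in> Q" using u by (simp add: Q_def v_def)
      show "y k = (\<lambda>j. (1 + momentum p k) * x k j - momentum p k * x (k - 1) j)" for k
        by (auto simp: y_def x_def extrap_def X_def)
      show "momentum p k = (if k = 0 then 0 else (real k - 1) / (real k + 2))" for k by (simp add: mom)
    next
      fix k and z :: "hist \<times> nat \<Rightarrow> real" assume "z \<in> Q"
      show "f z \<le> f (y k) + dot wt idx (g k) (\<lambda>j. z j - y k j)"
        using penalized_above[OF \<theta>, of "\<lambda>E r. z (E, r)" "extrap \<theta> p sims al k"]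
        by (simp add: f_def y_def g_def case_prod_unfold)
      show "dot wt idx (\<lambda>j. y k j + \<alpha> * (g k j + e k j) - x (Suc k) j) (\<lambda>j. z j - x (Suc k) j) \<le> 0"
        using iterate_variational[of "\<lambda>E r. z (E, r)" \<theta> p sims al k] \<open>z \<in> Q\<close>
        by (simp add: Q_def x_def y_def g_def e_def grad_error_def \<alpha>_def X_def case_prod_unfold)
      show "nsq wt idx (\<lambda>j. x 0 j - z j) \<le> 2 * T"
        using nsq_Q2_le[OF XQ[of 0], of "\<lambda>E r. z (E, r)"] \<open>z \<in> Q\<close>
        by (simp add: Q_def x_def case_prod_unfold)
    next
      fix k
      show "f (y k) + dot wt idx (g k) (\<lambda>j. x (Suc k) j - y k j) - M / 2 * nsq wt idx (\<lambda>j. x (Suc k) j - y k j) \<le> f (x (Suc k))"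
        using penalized_below[OF \<theta>, of "extrap \<theta> p sims al k" "X (Suc k)"]
        by (simp add: f_def y_def g_def x_def M_def case_prod_unfold)
    qed
    moreover have "f (x K) = penalized \<theta> (policy_output \<theta> p sims al)"
    proof -
      have "policy_output \<theta> p sims al = X K" by (intro ext) (simp add: policy_output_def last X_def K_def)
      thus ?thesis by (simp add: f_def x_def)
    qed
    ultimately show ?thesis by (simp add: f_def v_def e_def)
  qed
  let ?gap = "penalized \<theta> u - ex (draws p) (\<lambda>(sims, al). penalized \<theta> (policy_output \<theta> p sims al))"
  have P0: "0 \<le> P" unfolding P_def by (intro sum_nonneg) auto
  have P: "P \<le> (real K + 1)^2 / 2"
  proof -
    have square: "(x * x + 3 * x) / 4 \<le> (x + 1)^2 / 2" if "0 \<le> x" for x :: real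
    proof -
      have "0 \<le> x * x + x + 2" using that by simp
      thus ?thesis by (simp add: power2_eq_square field_simps)
    qed
    have "P = (real K * real K + 3 * real K) / 4" unfolding P_def by (induction K) (auto simp: field_simps)
    thus ?thesis using square[of "real K"] by simp
  qed
  have "2 * \<alpha> * ((real K + 1) / 2)^2 * ?gap
      = ex (draws p) (\<lambda>x. 2 * \<alpha> * ((real K + 1) / 2)^2 * (penalized \<theta> u - (\<lambda>(sims, al). penalized \<theta> (policy_output \<theta> p sims al)) x))"
    by (simp only: ex_cmult ex_diff[OF fd]) simp
  also have "\<dots> \<le> ex (draws p) (\<lambda>x. 2 * real (2 * T) + 8 * \<alpha>^2 * P * (\<Sum>k<K. (real k + 2) / 2 * (\<lambda>(sims, al). error \<theta> p sims al k) x))"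
    by (rule ex_mono[OF fd]) (use path in auto)
  also have "\<dots> = 2 * real (2 * T) + 8 * \<alpha>^2 * P * (\<Sum>k<K. (real k + 2) / 2 * ex (draws p) (\<lambda>(sims, al). error \<theta> p sims al k))"
    by (simp only: ex_add[OF fd] ex_cmult ex_sum[OF fd]) simp
  also have "\<dots> \<le> 2 * real (2 * T) + 8 * \<alpha>^2 * P * (\<Sum>k<K. (real k + 2) / 2 * (T * (\<delta>^2 / 9000)))"
  proof (intro add_left_mono mult_left_mono sum_mono)
    fix k assume "k \<in> {..<K}"
    hence "ex (draws p) (\<lambda>(sims, al). error \<theta> p sims al k) \<le> T * (q * noise \<theta> p)"
      by (intro expected_grad_error[OF sp \<theta>]) (auto simp: K_def mom)
    also have "\<dots> \<le> T * (\<delta>^2 / 9000)" by (intro mult_left_mono s2) auto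
    finally show "ex (draws p) (\<lambda>(sims, al). error \<theta> p sims al k) \<le> T * (\<delta>^2 / 9000)" .
  qed (use P0 in auto)
  also have "\<dots> = 4 * T + 8 * \<alpha>^2 * (P * P) * (T * (\<delta>^2 / 9000))"
    unfolding sum_distrib_right[symmetric] P_def[symmetric] by simp
  also have "\<dots> \<le> 4 * T + 8 * \<alpha>^2 * ((real K + 1)^2 / 2 * ((real K + 1)^2 / 2)) * (T * (\<delta>^2 / 9000))"
    using P P0 by (intro add_left_mono mult_left_mono mult_right_mono mult_mono) auto
  also have "\<dots> = 4 * T + 2 * y * y * (T * (\<delta>^2 / 9000))"
    by (simp add: y_def power2_eq_square algebra_simps)
  also have "\<dots> \<le> 4 * T + 2 * y * (841 / 4 / \<delta>) * (T * (\<delta>^2 / 9000))"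
    using yhi \<alpha>0 by (intro add_left_mono mult_right_mono mult_left_mono) (auto simp: y_def)
  also have "\<dots> = (4 + 841 / 18000 * (y * \<delta>)) * T" using \<delta> by (simp add: power2_eq_square field_simps)
  also have "\<dots> \<le> (y * \<delta> / 2) * T"
  proof (rule mult_right_mono)
    have "49 \<le> y * \<delta>" using ylo \<delta> by (simp add: field_simps)
    thus "4 + 841 / 18000 * (y * \<delta>) \<le> y * \<delta> / 2" by linarith
  qed simp
  finally have "y / 2 * ?gap \<le> y / 2 * (\<delta> * T)" by (simp add: y_def power2_eq_square field_simps)
  moreover have "0 < y / 2" using \<alpha>0 by (simp add: y_def)
  ultimately have "?gap \<le> \<delta> * T" by (rule mult_left_le_imp_le)
  thus ?thesis unfolding ex_A_params by simp
qed

theorem value_settings: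
  fixes \<delta> :: real
  assumes \<theta>: "0 < \<theta>" and \<delta>: "0 < \<delta>" "\<delta> \<le> 1" and u: "u \<in> Q2"
  shows "penalized \<theta> u - \<delta> * T \<le> ex (A_params \<theta> (settings \<theta> \<delta> c)) (penalized \<theta>)"
proof -
  have pos: "0 < real L" "0 < real q" "0 < \<iota>" "0 < real T" using wf_simps by auto
  have X: "0 < 691200 * L^2 * T^2 * q / (\<iota>^2 * \<theta>^2 * \<delta>^2)" using pos \<delta> \<theta> by simp
  have acc: "penalized \<theta> u - \<delta> * T \<le> ex (A_params \<theta> p) (penalized \<theta>)"
    if p: "p = (params_ii \<theta> \<delta>)\<lparr>num_indices := n\<rparr>" and n: "1 \<le> n" "n \<le> T"
      "n = T \<or> 691200 * L^2 * T^2 * q / (\<iota>^2 * \<theta>^2 * \<delta>^2) \<le> n" for p n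
  proof -
    have ns: "num_sims p = nat \<lceil>142800 * L^2 * q / (\<iota>^2 * \<delta>^2)\<rceil>" and ni: "num_indices p = n"
      by (simp_all add: p params_ii_def)
    have "1 \<le> num_sims p" unfolding ns by (rule nat_ceiling_pos) (use pos \<delta> in simp)
    hence sp: "sampled p" unfolding sampled_def ni using n by simp
    have "q * noise \<theta> p \<le> (8 / 142800 + 32 / 691200) * \<delta>^2"
      by (rule noise_le[OF _ _ \<delta>(1) \<theta> sp]) (use n in \<open>auto simp: ns ni le_nat_ceiling\<close>)
    hence "q * noise \<theta> p \<le> \<delta>^2 / 9000" by (rule order_trans) simp
    thus ?thesis by (intro value_accelerated[OF \<theta> \<delta> u sp]) (simp_all add: p params_ii_def)
  qed
  show ?thesis
  proof (cases c)
    case Setting_i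
    thus ?thesis using value_setting_i[OF \<theta> \<delta>(1) u] by (simp add: settings_def)
  next
    case Setting_ii
    have "params_ii \<theta> \<delta> = (params_ii \<theta> \<delta>)\<lparr>num_indices := nat \<lceil>min (691200 * L^2 * T^2 * q / (\<iota>^2 * \<theta>^2 * \<delta>^2)) T\<rceil>\<rparr>"
      by (simp add: params_ii_def)
    from acc[OF this] show ?thesis using nat_ceiling_min[OF X wf_simps(1)] Setting_ii by (simp add: settings_def)
  next
    case Setting_iii
    thus ?thesis using acc[OF refl, of T] wf_simps by (simp add: settings_def)
  qed
qed

end

context wf_nrm
begin

section \<open>Patching\<close>

definition patched_use :: "(hist \<Rightarrow> nat \<Rightarrow> real) \<Rightarrow> hist \<Rightarrow> nat \<Rightarrow> nat \<Rightarrow> real" where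
  "patched_use Y S t i = (\<Sum>u=1..t. \<Sum>l=1..<q. a l i (take u S) * F_pos Y (take u S) l)"

lemma F_pos_path:
  assumes S: "S \<in> trajectories" and t: "t \<in> {1..T}"
  shows "F_pos Y (take t S) r = (if aplus r (take t S) = {} then Y (take t S) r
      else min (Y (take t S) r) (Min ((\<lambda>i. (b i - patched_use Y S (t - 1) i
          - (\<Sum>l=1..<r. a l i (take t S) * F_pos Y (take t S) l)) / a r i (take t S)) ` aplus r (take t S))))"
proof -
  have len: "length (take t S) = t" using length_trajectory[OF S] t by simp
  have "(\<Sum>u=1..<length (take t S). \<Sum>l=1..<q. a l i (take u (take t S)) * F_pos Y (take u (take t S)) l)
      = patched_use Y S (t - 1) i" for i
    unfolding patched_use_def len using t
    by (intro sum.cong) (auto simp: min_def)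
  thus ?thesis by (subst F_pos.simps) simp
qed

text \<open>
  Each component of \<open>F\<close> is cut to what the options before it, in this and in earlier periods, have left.
\<close>

lemma patched_use_le:
  assumes S: "S \<in> trajectories" and Y: "\<And>E r. 0 \<le> Y E r" and t: "t \<le> T"
  shows "i \<in> {1..m} \<Longrightarrow> patched_use Y S t i \<le> b i"
    and "u \<in> {1..t} \<Longrightarrow> r < q \<Longrightarrow> 0 \<le> F_pos Y (take u S) r"
proof -
  have "(\<forall>i\<in>{1..m}. patched_use Y S t i \<le> b i) \<and> (\<forall>u\<in>{1..t}. \<forall>r<q. 0 \<le> F_pos Y (take u S) r)"
    using t
  proof (induction t)
    case 0
    thus ?case using budget_pos by (auto simp: patched_use_def less_imp_le)
  next
    case (Suc t)
    let ?E = "take (Suc t) S"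
    have tT: "Suc t \<in> {1..T}" using Suc.prems by simp
    have E: "?E \<in> histories" by (rule take_history[OF S tT])
    have IH: "\<And>i. i \<in> {1..m} \<Longrightarrow> patched_use Y S t i \<le> b i" using Suc by auto
    let ?part = "\<lambda>r i. \<Sum>l=1..<r. a l i ?E * F_pos Y ?E l"
    have inner: "(\<forall>l<r. 0 \<le> F_pos Y ?E l) \<and> (\<forall>i\<in>{1..m}. patched_use Y S t i + ?part r i \<le> b i)" if "r \<le> q" for r
      using that
    proof (induction r)
      case 0
      thus ?case using IH by simp
    next
      case (Suc r)
      have r: "r < q" using Suc.prems by simp
      have rest: "0 \<le> b i - patched_use Y S t i - ?part r i" if i: "i \<in> {1..m}" for i
      proof -
        have "patched_use Y S t i + ?part r i \<le> b i" using Suc i by auto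
        thus ?thesis by simp
      qed
      have F: "F_pos Y ?E r = (if aplus r ?E = {} then Y ?E r
        else min (Y ?E r) (Min ((\<lambda>i. (b i - patched_use Y S t i - ?part r i) / a r i ?E) ` aplus r ?E)))"
        using F_pos_path[OF S tT, of Y r] by simp
      have nn: "0 \<le> F_pos Y ?E r"
      proof (cases "aplus r ?E = {}")
        case False
        have "0 \<le> Min ((\<lambda>i. (b i - patched_use Y S t i - ?part r i) / a r i ?E) ` aplus r ?E)"
          using False finite_aplus rest by (subst Min_ge_iff) (auto simp: aplus_def)
        thus ?thesis unfolding F using Y by simp
      qed (simp add: F Y)
      have "a r i ?E * F_pos Y ?E r \<le> b i - patched_use Y S t i - ?part r i" if i: "i \<in> {1..m}" for i
      proof (cases "i \<in> aplus r ?E")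
        case True
        hence "F_pos Y ?E r \<le> Min ((\<lambda>i. (b i - patched_use Y S t i - ?part r i) / a r i ?E) ` aplus r ?E)"
          unfolding F by auto
        also have "\<dots> \<le> (b i - patched_use Y S t i - ?part r i) / a r i ?E"
          by (rule Min_le) (use True finite_aplus in auto)
        finally show ?thesis using True by (simp add: aplus_def field_simps)
      next
        case False
        hence "a r i ?E = 0" using a_nonneg[OF E r i] i by (auto simp: aplus_def)
        thus ?thesis using rest[OF i] by simp
      qed
      moreover have "?part (Suc r) i = ?part r i + a r i ?E * F_pos Y ?E r" if "i \<in> {1..m}" for i
        using a_null[OF E that] by (cases "r = 0") auto
      moreover have "(\<forall>l<Suc r. 0 \<le> F_pos Y ?E l)" using Suc nn by (auto simp: less_Suc_eq)
      ultimately show ?case by (auto simp: algebra_simps)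
    qed
    have "patched_use Y S (Suc t) i = patched_use Y S t i + ?part q i" for i by (simp add: patched_use_def)
    moreover have "0 \<le> F_pos Y (take u S) r" if "u \<in> {1..Suc t}" "r < q" for u r
      using that Suc inner[of q] by (cases "u = Suc t") auto
    ultimately show ?case using inner[of q] by auto
  qed
  thus "i \<in> {1..m} \<Longrightarrow> patched_use Y S t i \<le> b i"
    and "u \<in> {1..t} \<Longrightarrow> r < q \<Longrightarrow> 0 \<le> F_pos Y (take u S) r" by auto
qed

lemma F_pos_nonneg: "E \<in> histories \<Longrightarrow> (\<And>E r. 0 \<le> Y E r) \<Longrightarrow> r < q \<Longrightarrow> 0 \<le> F_pos Y E r"
  using patched_use_le(2)[of _ Y T] by (metis historyE order_refl)

lemma sum_F: "(\<Sum>r<q. F Y E r) = 1"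
proof -
  have "(\<Sum>r<q. F Y E r) = F Y E 0 + (\<Sum>r=1..<q. F Y E r)"
    using wf_simps by (simp add: lessThan_atLeast0 sum.atLeast_Suc_lessThan)
  thus ?thesis by (simp add: F_def)
qed

lemma J_F_selection: "selection (J (F Y))"
  using sum_F null_choice_Q0 by (auto simp: selection_def J_def null_choice_def Q0_def)

lemma J_F_le:
  assumes "E \<in> histories" "\<And>E r. 0 \<le> Y E r" "r \<in> {1..<q}"
  shows "0 \<le> J (F Y) E r" "J (F Y) E r \<le> F_pos Y E r"
  using F_pos_nonneg[of E Y r] assms by (auto simp: J_def F_def null_choice_def)

lemma J_F_within_budgets:
  assumes Y: "\<And>E r. 0 \<le> Y E r"
  shows "within_budgets (J (F Y))"
  unfolding within_budgets_def
proof (intro ballI)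
  fix S i assume S: "S \<in> trajectories" and i: "i \<in> {1..m}"
  have "(\<Sum>t=1..T. \<Sum>r=1..<q. a r i (take t S) * J (F Y) (take t S) r) \<le> patched_use Y S T i"
    unfolding patched_use_def
    by (intro sum_mono mult_left_mono J_F_le Y) (use take_history[OF S] a_nonneg i in auto)
  also have "\<dots> \<le> b i" by (rule patched_use_le(1)[OF S Y _ i]) auto
  finally show "(\<Sum>t=1..T. \<Sum>r=1..<q. a r i (take t S) * J (F Y) (take t S) r) \<le> b i" .
qed

definition pick :: "(hist \<Rightarrow> nat) \<Rightarrow> hist \<Rightarrow> nat \<Rightarrow> real" where
  "pick rh E r = (if r = rh E then 1 else 0)"

definition choices :: "(hist \<Rightarrow> nat) \<Rightarrow> bool" where
  "choices rh \<longleftrightarrow> (\<forall>E\<in>histories. rh E < q)"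

lemma load_indicator:
  assumes S: "S \<in> trajectories" and rh: "choices rh" and i: "i \<in> {1..m}"
  shows "load i S (pick rh) = (\<Sum>t=1..T. a (rh (take t S)) i (take t S))"
  unfolding load_def
proof (rule sum.cong[OF refl])
  fix t assume "t \<in> {1..T}"
  hence E: "take t S \<in> histories" by (rule take_history[OF S])
  have "(\<Sum>r=1..<q. a r i (take t S) * pick rh (take t S) r)
      = (\<Sum>r<q. a r i (take t S) * pick rh (take t S) r)"
    by (rule sum_choices) (simp add: a_null[OF E i])
  also have "\<dots> = (\<Sum>r<q. if r = rh (take t S) then a r i (take t S) else 0)"
    by (rule sum.cong) (auto simp: pick_def)
  also have "\<dots> = a (rh (take t S)) i (take t S)" using rh E by (simp add: choices_def)
  finally show "(\<Sum>r=1..<q. a r i (take t S) * pick rh (take t S) r) = \<dots>" .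
qed

text \<open>
  Along a trajectory a 0/1 selection asks for one option per period, and patching reduces this
  option to a fraction, here \<open>kept t\<close>; the reward of the period is lost unless the fraction is \<open>1\<close>.
  The budgets of the exhausted resources add up to at most \<open>L T\<close>, so that there are at most \<open>N\<close> of these.
\<close>

lemma patching_loss:
  assumes S: "S \<in> trajectories" and rh: "choices rh"
    and N: "\<And>X. X \<subseteq> {1..m} \<Longrightarrow> (\<Sum>i\<in>X. b i) \<le> L * T \<Longrightarrow> card X \<le> N"
  shows "(\<Sum>t=1..T. \<Sum>r=1..<q. Z r (take t S) * pick rh (take t S) r)
    - (\<Sum>t=1..T. \<Sum>r=1..<q. Z r (take t S) * J (F (pick rh)) (take t S) r)
    \<le> N + 1 / \<iota> * (\<Sum>i=1..m. max 0 (load i S (pick rh) - b i))" (is "_ \<le> ?loss")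
    and "(\<And>E r i. E \<in> histories \<Longrightarrow> r < q \<Longrightarrow> i \<in> aplus r E \<Longrightarrow> T \<le> b i) \<Longrightarrow>
      (\<Sum>t=1..T. \<Sum>r=1..<q. Z r (take t S) * pick rh (take t S) r)
    \<le> (\<Sum>t=1..T. \<Sum>r=1..<q. Z r (take t S) * J (F (pick rh)) (take t S) r)"
proof -
  let ?Y = "pick rh"
  define k where "k t = rh (take t S)" for t
  define kept where "kept t = (if k t = 0 then 1 else F_pos ?Y (take t S) (k t))" for t
  define c where "c t i = a (k t) i (take t S)" for t i
  have Y0: "0 \<le> ?Y E r" for E r by (simp add: pick_def)
  have E: "take t S \<in> histories" if "t \<in> {1..T}" for t by (rule take_history[OF S that])
  have kq: "k t < q" if "t \<in> {1..T}" for t using rh E[OF that] by (simp add: choices_def k_def)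
  have F0: "0 \<le> F_pos ?Y (take t S) r" if "t \<in> {1..T}" "r < q" for t r
    by (rule F_pos_nonneg[OF E[OF that(1)] Y0 that(2)])
  have F_le: "F_pos ?Y E r \<le> ?Y E r" for E r by (subst F_pos.simps) auto
  have Fz: "F_pos ?Y (take t S) r = 0" if "t \<in> {1..T}" "r < q" "r \<noteq> k t" for t r
    using F0[OF that(1,2)] F_le[of "take t S" r] that(3) by (simp add: pick_def k_def)
  have use: "(\<Sum>l=1..<q. a l i (take t S) * F_pos ?Y (take t S) l) = c t i * kept t" if t: "t \<in> {1..T}" and i: "i \<in> {1..m}" for t i
  proof (cases "k t = 0")
    case True
    thus ?thesis using Fz[OF t] a_null[OF E[OF t] i] by (simp add: c_def)
  next
    case False
    have "(\<Sum>l=1..<q. a l i (take t S) * F_pos ?Y (take t S) l)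
        = (\<Sum>l=1..<q. if l = k t then a l i (take t S) * F_pos ?Y (take t S) l else 0)"
      by (rule sum.cong) (use Fz[OF t] in auto)
    thus ?thesis using False kq[OF t] by (simp add: c_def kept_def)
  qed
  have u: "patched_use ?Y S t i = (\<Sum>s=1..t. c s i * kept s)" if "t \<le> T" "i \<in> {1..m}" for t i
    unfolding patched_use_def by (rule sum.cong[OF refl]) (use use that in auto)
  have kept01: "0 \<le> kept t \<and> kept t \<le> 1" if t: "t \<in> {1..T}" for t
    using F0[OF t kq[OF t]] F_le[of "take t S" "k t"] by (simp add: kept_def pick_def k_def)
  have c01: "0 \<le> c t i" "c t i \<le> 1" "c t i = 0 \<or> \<iota> \<le> c t i" if "t \<in> {1..T}" "i \<in> {1..m}" for t i
    using a_nonneg[OF E kq] a_le_1[OF E kq] a_granular[OF E kq] that by (auto simp: c_def)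
  have cut: "\<exists>i\<in>{1..m}. 0 < c (Suc t) i \<and> c (Suc t) i * kept (Suc t) = b i - patched_use ?Y S t i"
    if t: "t < T" and cut: "kept (Suc t) < 1" for t
  proof -
    have tT: "Suc t \<in> {1..T}" using t by simp
    let ?E = "take (Suc t) S" and ?k = "k (Suc t)"
    have k0: "?k \<noteq> 0" using cut by (cases "?k = 0") (auto simp: kept_def)
    have "(\<Sum>l=1..<?k. a l i ?E * F_pos ?Y ?E l) = 0" for i
      by (rule sum.neutral) (use Fz[OF tT] kq[OF tT] in auto)
    hence Fp: "F_pos ?Y ?E ?k = (if aplus ?k ?E = {} then 1
        else min 1 (Min ((\<lambda>i. (b i - patched_use ?Y S t i) / a ?k i ?E) ` aplus ?k ?E)))"
      using F_pos_path[OF S tT, of ?Y ?k] by (simp add: pick_def k_def)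
    have ne: "aplus ?k ?E \<noteq> {}" and lt: "F_pos ?Y ?E ?k < 1" using cut k0 Fp by (auto simp: kept_def split: if_splits)
    have "Min ((\<lambda>i. (b i - patched_use ?Y S t i) / a ?k i ?E) ` aplus ?k ?E)
        \<in> (\<lambda>i. (b i - patched_use ?Y S t i) / a ?k i ?E) ` aplus ?k ?E"
      by (rule Min_in) (use ne finite_aplus in auto)
    then obtain i where i: "i \<in> aplus ?k ?E"
      "Min ((\<lambda>i. (b i - patched_use ?Y S t i) / a ?k i ?E) ` aplus ?k ?E) = (b i - patched_use ?Y S t i) / a ?k i ?E" by auto
    have "F_pos ?Y ?E ?k = (b i - patched_use ?Y S t i) / a ?k i ?E"
      using Fp ne lt i(2) by (auto simp: min_def split: if_splits)
    thus ?thesis using i(1) k0 by (intro bexI[of _ i]) (auto simp: kept_def c_def aplus_def)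
  qed
  let ?cuts = "{t\<in>{1..T}. kept t < 1}"
  have gain: "(\<Sum>r=1..<q. Z r (take t S) * ?Y (take t S) r) - (\<Sum>r=1..<q. Z r (take t S) * J (F ?Y) (take t S) r)
      \<le> (if kept t < 1 then 1 else 0)" if t: "t \<in> {1..T}" for t
  proof (cases "kept t < 1")
    case True
    have "0 \<le> (\<Sum>r=1..<q. Z r (take t S) * J (F ?Y) (take t S) r)"
      by (intro sum_nonneg mult_nonneg_nonneg J_F_le Y0) (use Z_bounds[OF E[OF t]] E[OF t] in auto)
    moreover have "(\<Sum>r=1..<q. Z r (take t S) * ?Y (take t S) r) \<le> (\<Sum>r=1..<q. if r = k t then 1 else 0)"
      by (rule sum_mono) (use Z_bounds[OF E[OF t]] in \<open>auto simp: pick_def k_def\<close>)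
    moreover have "(\<Sum>r=1..<q. if r = k t then 1 else 0) \<le> (1::real)" by (simp add: sum.delta)
    ultimately show ?thesis using True by simp
  next
    case False
    hence k1: "kept t = 1" using kept01[OF t] by simp
    have pos: "F_pos ?Y (take t S) r = ?Y (take t S) r" if "r \<in> {1..<q}" for r
      using that Fz[OF t, of r] k1 by (cases "r = k t") (auto simp: kept_def pick_def k_def split: if_splits)
    have "(\<Sum>l=1..<q. ?Y (take t S) l) = (if k t = 0 then 0 else 1)"
      using kq[OF t] by (auto simp: pick_def k_def[symmetric] sum.delta)
    hence eq: "F ?Y (take t S) r = ?Y (take t S) r" if "r < q" for r
      using pos that by (cases "r = 0") (auto simp: F_def pick_def k_def)
    hence "\<forall>r<q. F ?Y (take t S) r \<in> {0, 1}" by (auto simp: pick_def)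
    hence "J (F ?Y) (take t S) r = ?Y (take t S) r" if "r < q" for r using eq that by (simp add: J_def)
    thus ?thesis using False by simp
  qed
  have "(\<Sum>t=1..T. \<Sum>r=1..<q. Z r (take t S) * ?Y (take t S) r)
    - (\<Sum>t=1..T. \<Sum>r=1..<q. Z r (take t S) * J (F ?Y) (take t S) r) \<le> (\<Sum>t=1..T. if kept t < 1 then 1 else 0)"
    using sum_mono[OF gain, of "{1..T}" "\<lambda>t. t"] by (simp add: sum_subtractf)
  also have "\<dots> = real (card ?cuts)" by (simp add: sum.If_cases Int_def)
  finally have loss: "(\<Sum>t=1..T. \<Sum>r=1..<q. Z r (take t S) * ?Y (take t S) r)
    - (\<Sum>t=1..T. \<Sum>r=1..<q. Z r (take t S) * J (F ?Y) (take t S) r) \<le> real (card ?cuts)" .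
  let ?X = "{i\<in>{1..m}. patched_use ?Y S T i = b i}"
  have cap': "(\<Sum>s=1..t. c s i * kept s) \<le> b i" if "t \<le> T" "i \<in> {1..m}" for t i
    using patched_use_le(1)[OF S, where Y = ?Y and t = t and i = i] Y0 u[OF that] that by simp
  have cut': "\<exists>i\<in>{1..m}. 0 < c (Suc t) i \<and> c (Suc t) i * kept (Suc t) = b i - (\<Sum>s=1..t. c s i * kept s)"
    if "t < T" "kept (Suc t) < 1" for t
  proof -
    from cut[OF that] obtain i where i: "i \<in> {1..m}" "0 < c (Suc t) i"
      "c (Suc t) i * kept (Suc t) = b i - patched_use ?Y S t i" by blast
    thus ?thesis using u[of t i] that by (intro bexI[of _ i]) auto
  qed
  have "real (card ?cuts) \<le> (\<Sum>i\<in>{i\<in>{1..m}. (\<Sum>s=1..T. c s i * kept s) = b i}. 1 + max 0 ((\<Sum>t=1..T. c t i) - b i) / \<iota>)"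
    by (rule card_cuts_le[OF _ wf_simps(6) c01(3) kept01 refl cap' cut']) auto
  also have "{i\<in>{1..m}. (\<Sum>s=1..T. c s i * kept s) = b i} = ?X" using u by auto
  also have "(\<Sum>i\<in>?X. 1 + max 0 ((\<Sum>t=1..T. c t i) - b i) / \<iota>)
      = card ?X + 1 / \<iota> * (\<Sum>i\<in>?X. max 0 ((\<Sum>t=1..T. c t i) - b i))"
    by (simp add: sum.distrib sum_divide_distrib)
  also have "(\<Sum>i\<in>?X. max 0 ((\<Sum>t=1..T. c t i) - b i)) \<le> (\<Sum>i=1..m. max 0 ((\<Sum>t=1..T. c t i) - b i))"
    by (rule sum_mono2) auto
  also have "\<dots> = (\<Sum>i=1..m. max 0 (load i S ?Y - b i))"
    by (rule sum.cong) (auto simp: load_indicator[OF S rh] c_def k_def)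
  also have "card ?X \<le> N"
  proof (rule N)
    have "(\<Sum>i\<in>?X. b i) = (\<Sum>i\<in>?X. \<Sum>s=1..T. c s i * kept s)"
      by (rule sum.cong) (use u in auto)
    also have "\<dots> \<le> (\<Sum>i=1..m. \<Sum>s=1..T. c s i * kept s)"
      by (rule sum_mono2) (use c01 kept01 in \<open>auto intro!: sum_nonneg mult_nonneg_nonneg\<close>)
    also have "\<dots> = (\<Sum>s=1..T. \<Sum>i=1..m. c s i * kept s)" by (rule sum.swap)
    also have "\<dots> \<le> (\<Sum>s=1..T. \<Sum>i=1..m. c s i)"
      by (intro sum_mono mult_left_le) (use c01 kept01 in auto)
    also have "\<dots> \<le> (\<Sum>s=1..T. L)"
      unfolding c_def of_nat_sum by (intro sum_mono sum_consumption_le E kq)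
    finally show "(\<Sum>i\<in>?X. b i) \<le> L * T" by (simp add: mult.commute)
  qed auto
  finally have "real (card ?cuts) \<le> N + 1 / \<iota> * (\<Sum>i=1..m. max 0 (load i S ?Y - b i))"
    using wf_simps by (simp add: divide_right_mono)
  thus "(\<Sum>t=1..T. \<Sum>r=1..<q. Z r (take t S) * ?Y (take t S) r)
    - (\<Sum>t=1..T. \<Sum>r=1..<q. Z r (take t S) * J (F ?Y) (take t S) r) \<le> ?loss" using loss by linarith
  assume big: "\<And>E r i. E \<in> histories \<Longrightarrow> r < q \<Longrightarrow> i \<in> aplus r E \<Longrightarrow> T \<le> b i"
  have "\<not> kept t < 1" if t: "t \<in> {1..T}" for t
  proof
    assume lt: "kept t < 1"
    obtain t' where t': "t = Suc t'" using t by (cases t) auto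
    obtain i where i: "i \<in> {1..m}" "0 < c t i" "c t i * kept t = b i - patched_use ?Y S t' i"
      using cut[of t'] lt t t' by auto
    have "real T \<le> b i" by (rule big[OF E[OF t] kq[OF t]]) (use i in \<open>auto simp: aplus_def c_def\<close>)
    moreover have "(\<Sum>s=1..t'. c s i * kept s) \<le> (\<Sum>s=1..t'. 1)"
      by (intro sum_mono mult_le_one) (use c01 kept01 i(1) t t' in auto)
    moreover have "patched_use ?Y S t' i = (\<Sum>s=1..t'. c s i * kept s)" by (rule u) (use t t' i in auto)
    ultimately have "1 \<le> c t i * kept t" using i(3) t t' by simp
    moreover have "c t i * kept t \<le> 1 * kept t" using c01(2)[OF t i(1)] kept01[OF t] by (intro mult_right_mono) auto
    ultimately show False using lt by simp
  qed
  hence "?cuts = {}" by auto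
  hence "real (card ?cuts) = 0" by (simp only: card.empty of_nat_0)
  thus "(\<Sum>t=1..T. \<Sum>r=1..<q. Z r (take t S) * ?Y (take t S) r)
    \<le> (\<Sum>t=1..T. \<Sum>r=1..<q. Z r (take t S) * J (F ?Y) (take t S) r)" using loss by linarith
qed

section \<open>Rounding\<close>

abbreviation cat :: "(nat \<Rightarrow> real) \<Rightarrow> nat pmf" where
  "cat x \<equiv> embed_pmf (\<lambda>l. if l < q then x l else 0)"

lemma pmf_cat:
  assumes "x \<in> Q0"
  shows "pmf (cat x) l = x l"
proof -
  have "(\<integral>\<^sup>+l. ennreal (if l < q then x l else 0) \<partial>count_space UNIV) = (\<Sum>l<q. ennreal (x l))"
    by (subst nn_integral_count_space'[of "{..<q}"]) auto
  also have "\<dots> = ennreal (\<Sum>l<q. x l)" using Q0_bounds[OF assms] by (intro sum_ennreal) auto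
  finally have "(\<integral>\<^sup>+l. ennreal (if l < q then x l else 0) \<partial>count_space UNIV) = 1"
    using Q0_sum_eq[OF assms] by simp
  thus ?thesis using Q0_bounds[OF assms] assms by (subst pmf_embed_pmf) (auto simp: Q0_def)
qed

lemma set_cat: "x \<in> Q0 \<Longrightarrow> set_pmf (cat x) \<subseteq> {..<q}"
  by (auto simp: set_pmf_eq pmf_cat Q0_def not_less[symmetric])

lemma finite_cat: "x \<in> Q0 \<Longrightarrow> finite (set_pmf (cat x))"
  using set_cat finite_subset by blast

lemma ex_cat: "x \<in> Q0 \<Longrightarrow> ex (cat x) h = (\<Sum>l<q. x l * h l)"
  by (subst integral_measure_pmf[of "{..<q}"]) (use set_cat in \<open>auto simp: pmf_cat\<close>)

definition rounding :: "(hist \<Rightarrow> nat \<Rightarrow> real) \<Rightarrow> (hist \<Rightarrow> nat) pmf" where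
  "rounding X = Pi_pmf histories 0 (\<lambda>E. cat (X E))"

abbreviation kept_reward :: "(hist \<Rightarrow> nat \<Rightarrow> real) \<Rightarrow> real" where
  "kept_reward X \<equiv> ex (rounding X) (\<lambda>rh. objective (J (F (pick rh))))"

abbreviation overflow :: "nat \<Rightarrow> hist \<Rightarrow> (hist \<Rightarrow> nat \<Rightarrow> real) \<Rightarrow> real" where
  "overflow i S X \<equiv> ex (rounding X) (\<lambda>rh. max 0 (load i S (pick rh) - b i))"

lemma H_eq: "H X = map_pmf pick (rounding X)"
  unfolding H_def rounding_def by (intro map_pmf_cong refl ext) (simp add: pick_def)

context
  fixes X assumes X: "X \<in> Q2"
begin

lemma finite_rounding: "finite (set_pmf (rounding X))"
  unfolding rounding_def
  by (rule finite_set_Pi_pmf[OF finite_histories]) (use X finite_cat in \<open>auto simp: Q2_def\<close>)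

lemma rounding_choices: "rh \<in> set_pmf (rounding X) \<Longrightarrow> choices rh"
  unfolding rounding_def choices_def using X set_cat finite_histories
  by (fastforce simp: set_Pi_pmf PiE_dflt_def Q2_def)

lemma ex_rounding_component:
  assumes "E \<in> histories"
  shows "ex (rounding X) (\<lambda>rh. h (rh E)) = (\<Sum>l<q. X E l * h l)"
proof -
  have "ex (rounding X) (\<lambda>rh. h (rh E)) = ex (map_pmf (\<lambda>rh. rh E) (rounding X)) h" by simp
  also have "map_pmf (\<lambda>rh. rh E) (rounding X) = cat (X E)"
    unfolding rounding_def using Pi_pmf_component[OF finite_histories, of E 0 "\<lambda>E. cat (X E)"] assms by simp
  finally show ?thesis using X assms by (simp add: ex_cat Q2_def)
qed

lemma ex_objective_rounding: "ex (rounding X) (\<lambda>rh. objective (pick rh)) = objective X"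
proof -
  have "ex (rounding X) (\<lambda>rh. objective (pick rh))
      = (\<Sum>E\<in>histories. \<mu> E * (\<Sum>r=1..<q. Z r E * ex (rounding X) (\<lambda>rh. pick rh E r)))"
    unfolding objective_def by (simp only: ex_sum[OF finite_rounding] ex_cmult)
  also have "\<dots> = objective X"
    unfolding objective_def
  proof (intro sum.cong refl arg_cong2[where f = "(*)"])
    fix E r assume E: "E \<in> histories" "r \<in> {1..<q}"
    have "ex (rounding X) (\<lambda>rh. pick rh E r) = (\<Sum>l<q. X E l * (if r = l then 1 else 0))"
      unfolding pick_def by (rule ex_rounding_component[OF E(1)])
    also have "\<dots> = X E r" using E(2) by (simp add: if_distrib cong: if_cong)
    finally show "ex (rounding X) (\<lambda>rh. pick rh E r) = X E r" .
  qed
  finally show ?thesis .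
qed

lemma excess_rounding:
  assumes S: "S \<in> trajectories" and i: "i \<in> {1..m}"
  shows "0 < g \<Longrightarrow> overflow i S X
           \<le> max 0 (load i S X - b i) + g / 2 + 4 * load i S X / g"
    and "load i S X \<le> b i / 2 \<Longrightarrow> overflow i S X
           \<le> 2 * exp (- b i / 8)"
proof -
  let ?B = "(\<lambda>t. take t S) ` {1..T}"
  let ?h = "\<lambda>E v. a v i E"
  have B: "?B \<subseteq> histories" using take_history[OF S] by auto
  have inj: "inj_on (\<lambda>t. take t S) {1..T}" by (rule prefixes_of(2)[OF S])
  have XE: "X E \<in> Q0" if "E \<in> histories" for E using X that by (simp add: Q2_def)
  have fin: "finite (set_pmf (cat (X E)))" if "E \<in> histories" for E using finite_cat XE that by simp
  have h: "0 \<le> ?h E v \<and> ?h E v \<le> 1" if "E \<in> ?B" "v \<in> set_pmf (cat (X E))" for E v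
  proof -
    have E: "E \<in> histories" using that(1) B by auto
    have "v < q" using that(2) set_cat[OF XE[OF E]] by auto
    thus ?thesis using a_nonneg[OF E _ i] a_le_1[OF E _ i] by simp
  qed
  have s: "load i S X = (\<Sum>E\<in>?B. ex (cat (X E)) (?h E))"
  proof -
    have "(\<Sum>E\<in>?B. ex (cat (X E)) (?h E)) = (\<Sum>t=1..T. \<Sum>l<q. X (take t S) l * a l i (take t S))"
      unfolding sum.reindex[OF inj] o_def by (rule sum.cong) (use ex_cat XE take_history[OF S] in auto)
    also have "\<dots> = (\<Sum>t=1..T. \<Sum>l=1..<q. X (take t S) l * a l i (take t S))"
      by (intro sum.cong refl sum_choices[symmetric]) (use a_null take_history[OF S] i in simp)
    finally show ?thesis by (simp add: load_def mult.commute)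
  qed
  have "overflow i S X
      = ex (Pi_pmf histories 0 (\<lambda>E. cat (X E))) (\<lambda>y. max 0 ((\<Sum>E\<in>?B. ?h E (y E)) - b i))"
    unfolding rounding_def[symmetric]
    by (rule ex_cong) (simp only: sum.reindex[OF inj] o_def load_indicator[OF S rounding_choices i])
  note eq = this
  show "overflow i S X
           \<le> max 0 (load i S X - b i) + g / 2 + 4 * load i S X / g" if "0 < g"
    unfolding eq by (rule expected_excess_le[OF finite_histories B fin h s that])
  show "overflow i S X \<le> 2 * exp (- b i / 8)"
    if "load i S X \<le> b i / 2"
    unfolding eq by (rule expected_excess_tail[OF finite_histories B fin h s that])
qed

lemma load_nonneg: "S \<in> trajectories \<Longrightarrow> i \<in> {1..m} \<Longrightarrow> 0 \<le> load i S X"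
  unfolding load_def using X take_history Q0_bounds a_nonneg
  by (auto intro!: sum_nonneg mult_nonneg_nonneg simp: Q2_def)

lemma sum_load_le:
  assumes S: "S \<in> trajectories"
  shows "(\<Sum>i=1..m. load i S X) \<le> L * T"
proof -
  have "(\<Sum>i=1..m. load i S X) = (\<Sum>t=1..T. \<Sum>r=1..<q. (\<Sum>i=1..m. a r i (take t S)) * X (take t S) r)"
    unfolding load_def sum_distrib_right by (subst sum.swap) (intro sum.cong refl sum.swap)
  also have "\<dots> \<le> (\<Sum>t=1..T. \<Sum>r=1..<q. L * X (take t S) r)"
    using sum_consumption_le take_history[OF S] X Q0_bounds
    by (intro sum_mono mult_right_mono) (auto simp: Q2_def)
  also have "\<dots> \<le> (\<Sum>t=1..T. real L)"
  proof (rule sum_mono)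
    fix t assume "t \<in> {1..T}"
    hence "X (take t S) \<in> Q0" using X take_history[OF S] by (simp add: Q2_def)
    hence "(\<Sum>r=1..<q. X (take t S) r) \<le> 1" using sum_Q0_le(2)[of "X (take t S)" "\<lambda>_. 1"] by simp
    thus "(\<Sum>r=1..<q. L * X (take t S) r) \<le> L"
      unfolding sum_distrib_left[symmetric] by (simp add: mult_left_le)
  qed
  finally show ?thesis by (simp add: mult.commute)
qed

definition demanding :: "hist \<Rightarrow> nat set" where
  "demanding S = {i\<in>{1..m}. b i / 2 \<le> load i S X}"

lemma card_demanding_le_V: "S \<in> trajectories \<Longrightarrow> card (demanding S) \<le> V"
proof -
  assume S: "S \<in> trajectories"
  let ?P = "{card {i\<in>{1..m}. (\<Sum>t=1..T. \<Sum>r=1..<q. X t r * a r i (take t S)) \<ge> b i / 2} | S X. S \<in> trajectories \<and> X \<in> Q1}"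
  have le: "card {i\<in>{1..m}. P i} \<le> m" for P
  proof -
    have "card {i\<in>{1..m}. P i} \<le> card {1..m}" by (rule card_mono) auto
    thus ?thesis by simp
  qed
  have "?P \<subseteq> {..m}"
  proof (rule subsetI)
    fix x assume "x \<in> ?P"
    then obtain S X where "x = card {i\<in>{1..m}. (\<Sum>t=1..T. \<Sum>r=1..<q. X t r * a r i (take t S)) \<ge> b i / 2}" by blast
    thus "x \<in> {..m}" using le by simp
  qed
  hence "finite ?P" by (rule finite_subset) simp
  moreover have "card (demanding S) \<in> ?P"
  proof -
    let ?X = "\<lambda>t. X (take t S)"
    have "?X \<in> Q1" using X take_history[OF S] by (auto simp: Q1_def Q2_def)
    moreover have "demanding S = {i\<in>{1..m}. (\<Sum>t=1..T. \<Sum>r=1..<q. ?X t r * a r i (take t S)) \<ge> b i / 2}"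
      by (simp add: demanding_def load_def mult.commute)
    ultimately show ?thesis unfolding mem_Collect_eq using S by (intro exI[of _ S] exI[of _ ?X]) simp
  qed
  ultimately show "card (demanding S) \<le> V" unfolding V_def by (rule Max_ge)
qed

text \<open>
  For an overloaded resource the penalty falls short of the overload by at most \<open>\<theta> / 2\<close>, and no more
  than \<open>V\<close> resources are overloaded.
\<close>

lemma overload_le_penalty:
  fixes \<theta> :: real
  assumes S: "S \<in> trajectories" and \<theta>: "0 < \<theta>"
  shows "(\<Sum>i=1..m. max 0 (load i S X - b i)) \<le> (\<Sum>i=1..m. pen \<theta> (load i S X - b i)) + V * \<theta> / 2"
proof -
  have "max 0 (load i S X - b i) \<le> pen \<theta> (load i S X - b i) + (if i \<in> demanding S then \<theta> / 2 else 0)"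
    if i: "i \<in> {1..m}" for i
  proof (cases "load i S X \<le> b i")
    case True
    thus ?thesis using pen_nonneg[OF \<theta>, of "load i S X - b i"] \<theta> by simp
  next
    case False
    hence "i \<in> demanding S" using i budget_pos[OF i] by (simp add: demanding_def)
    thus ?thesis using pen_ge[OF \<theta>, of 1 "load i S X - b i"] False by simp
  qed
  hence "(\<Sum>i=1..m. max 0 (load i S X - b i))
      \<le> (\<Sum>i=1..m. pen \<theta> (load i S X - b i) + (if i \<in> demanding S then \<theta> / 2 else 0))" by (rule sum_mono)
  also have "\<dots> = (\<Sum>i=1..m. pen \<theta> (load i S X - b i)) + card (demanding S) * (\<theta> / 2)"
  proof -
    have "{1..m} \<inter> demanding S = demanding S" by (auto simp: demanding_def)
    thus ?thesis by (simp add: sum.distrib sum.If_cases)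
  qed
  also have "\<dots> \<le> (\<Sum>i=1..m. pen \<theta> (load i S X - b i)) + V * (\<theta> / 2)"
    using card_demanding_le_V[OF S] \<theta> by (intro add_left_mono mult_right_mono) auto
  finally show ?thesis by simp
qed

lemma objective_path: "objective Y = (\<Sum>S\<in>trajectories. pr S * (\<Sum>t=1..T. \<Sum>r=1..<q. Z r (take t S) * Y (take t S) r))"
  unfolding objective_def by (rule path_sum)

text \<open>
  Penalizing, rounding and patching together.  \<open>D\<close> bounds what rounding adds to the expected
  total overload of the resources.
\<close>

lemma rounding_loss:
  fixes \<theta> D :: real
  assumes \<theta>: "0 < \<theta>"
    and N: "\<And>X. X \<subseteq> {1..m} \<Longrightarrow> (\<Sum>i\<in>X. b i) \<le> L * T \<Longrightarrow> card X \<le> N"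
    and D: "\<And>S. S \<in> trajectories \<Longrightarrow> (\<Sum>i=1..m. overflow i S X)
              \<le> (\<Sum>i=1..m. max 0 (load i S X - b i)) + D"
  shows "penalized \<theta> X \<le> kept_reward X + N + 1 / \<iota> * (D + V * \<theta> / 2)"
proof -
  note fin = finite_rounding
  let ?ex = "\<lambda>S rh. \<Sum>i=1..m. max 0 (load i S (pick rh) - b i)"
  have "objective X - kept_reward X
      = ex (rounding X) (\<lambda>rh. objective (pick rh) - objective (J (F (pick rh))))"
    by (simp add: ex_diff[OF fin] ex_objective_rounding)
  also have "\<dots> \<le> ex (rounding X) (\<lambda>rh. \<Sum>S\<in>trajectories. pr S * (N + 1 / \<iota> * ?ex S rh))"
  proof (rule ex_mono[OF fin])
    fix rh assume "rh \<in> set_pmf (rounding X)"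
    hence rh: "choices rh" by (rule rounding_choices)
    show "objective (pick rh) - objective (J (F (pick rh)))
        \<le> (\<Sum>S\<in>trajectories. pr S * (N + 1 / \<iota> * ?ex S rh))"
    proof -
      let ?A = "\<lambda>Y S. \<Sum>t=1..T. \<Sum>r=1..<q. Z r (take t S) * Y (take t S) r"
      have "objective (pick rh) - objective (J (F (pick rh)))
          = (\<Sum>S\<in>trajectories. pr S * (?A (pick rh) S - ?A (J (F (pick rh))) S))"
        by (simp only: objective_path right_diff_distrib sum_subtractf)
      also have "\<dots> \<le> (\<Sum>S\<in>trajectories. pr S * (N + 1 / \<iota> * ?ex S rh))"
        by (rule sum_mono, rule mult_left_mono, rule patching_loss(1)[OF _ rh N]) auto
      finally show ?thesis .
    qed
  qed
  also have "\<dots> = (\<Sum>S\<in>trajectories. pr S * (N + 1 / \<iota> * (\<Sum>i=1..m. overflow i S X)))"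
    by (simp only: ex_sum[OF fin] ex_cmult ex_add[OF fin]) simp
  also have "\<dots> \<le> (\<Sum>S\<in>trajectories. pr S * (N + 1 / \<iota> * ((\<Sum>i=1..m. pen \<theta> (load i S X - b i)) + V * \<theta> / 2 + D)))"
  proof (intro sum_mono mult_left_mono add_left_mono)
    fix S assume S: "S \<in> trajectories"
    show "(\<Sum>i=1..m. overflow i S X)
        \<le> (\<Sum>i=1..m. pen \<theta> (load i S X - b i)) + V * \<theta> / 2 + D"
      using D[OF S] overload_le_penalty[OF S \<theta>] by linarith
  qed (use wf_simps in auto)
  also have "\<dots> = N + 1 / \<iota> * (\<Sum>S\<in>trajectories. pr S * (\<Sum>i=1..m. pen \<theta> (load i S X - b i))) + 1 / \<iota> * (D + V * \<theta> / 2)"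
    using sum_pr by (simp add: distrib_left sum.distrib sum_distrib_right[symmetric] sum_distrib_left[symmetric] sum_divide_distrib[symmetric] add_divide_distrib)
  also have "1 / \<iota> * (\<Sum>S\<in>trajectories. pr S * (\<Sum>i=1..m. pen \<theta> (load i S X - b i)))
      \<le> 2 / \<iota> * (\<Sum>S\<in>trajectories. pr S * (\<Sum>i=1..m. pen \<theta> (load i S X - b i)))"
    using wf_simps pen_nonneg[OF \<theta>]
    by (intro mult_right_mono sum_nonneg mult_nonneg_nonneg) (auto simp: divide_right_mono)
  finally show ?thesis unfolding penalized_def by linarith
qed

text \<open>
  A budget of \<open>T\<close> or more never binds, as a period takes at most one unit of a resource.
\<close>

lemma rounding_no_loss:
  fixes \<theta> :: real
  assumes \<theta>: "0 < \<theta>" and big: "\<And>E r i. E \<in> histories \<Longrightarrow> r < q \<Longrightarrow> i \<in> aplus r E \<Longrightarrow> T \<le> b i"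
  shows "penalized \<theta> X \<le> kept_reward X"
proof -
  have "penalized \<theta> X \<le> objective X"
    unfolding penalized_def using wf_simps pen_nonneg[OF \<theta>] by (simp add: sum_nonneg)
  also have "\<dots> = ex (rounding X) (\<lambda>rh. objective (pick rh))" by (rule ex_objective_rounding[symmetric])
  also have "\<dots> \<le> kept_reward X"
  proof (rule ex_mono[OF finite_rounding])
    fix rh assume "rh \<in> set_pmf (rounding X)"
    hence rh: "choices rh" by (rule rounding_choices)
    show "objective (pick rh) \<le> objective (J (F (pick rh)))"
      unfolding objective_path
    proof (rule sum_mono, rule mult_left_mono, rule patching_loss(2)[OF _ rh _ big, where N = m])
      fix X assume "X \<subseteq> {1..m}"
      thus "card X \<le> m" using card_mono[of "{1..m}" X] by simp
    qed auto
  qed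
  finally show ?thesis .
qed

end

end

section \<open>Deterministic programs\<close>

text \<open>
  Between two random draws a program of the policy changes nothing but the clock.  For such a
  program the result and a bound on its time are established together.
\<close>

definition computes :: "real \<Rightarrow> 'a prog \<Rightarrow> machine \<Rightarrow> 'a \<Rightarrow> bool" where
  "computes n P s v \<longleftrightarrow> (\<forall>c. \<exists>c'. c' \<le> c + n \<and> P (s\<lparr>clock := c\<rparr>) = return_pmf (v, s\<lparr>clock := c'\<rparr>))"

lemma computesD:
  assumes "computes n P s v"
  obtains c where "c \<le> clock s + n" "P s = return_pmf (v, s\<lparr>clock := c\<rparr>)"
proof -
  have "s = s\<lparr>clock := clock s\<rparr>" by simp
  thus ?thesis using assms that unfolding computes_def by metis
qed

lemma computes_weaken: "computes n P s v \<Longrightarrow> n \<le> n' \<Longrightarrow> computes n' P s v"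
  unfolding computes_def by (meson add_left_mono order_trans)

lemma computes_ret: "computes 0 (ret v) s v"
  unfolding computes_def ret_def by auto

lemma computes_tick: "computes c (tick c) s ()"
  unfolding computes_def tick_def update_def by (auto intro!: exI[of _ "_ + c"])

lemma computes_bind:
  assumes "computes n1 P s v" "computes n2 (f v) s w"
  shows "computes (n1 + n2) (bind_prog P f) s w"
  unfolding computes_def
proof
  fix c
  obtain c1 where c1: "c1 \<le> c + n1" "P (s\<lparr>clock := c\<rparr>) = return_pmf (v, s\<lparr>clock := c1\<rparr>)"
    using assms(1) unfolding computes_def by blast
  obtain c2 where c2: "c2 \<le> c1 + n2" "f v (s\<lparr>clock := c1\<rparr>) = return_pmf (w, s\<lparr>clock := c2\<rparr>)"
    using assms(2) unfolding computes_def by blast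
  show "\<exists>c'. c' \<le> c + (n1 + n2) \<and> bind_prog P f (s\<lparr>clock := c\<rparr>) = return_pmf (w, s\<lparr>clock := c'\<rparr>)"
    using c1 c2 by (intro exI[of _ c2]) (simp add: bind_prog_def bind_return_pmf)
qed

lemma computes_op1: "computes 1 (op1 v) s v"
  unfolding op1_def using computes_bind[OF computes_tick computes_ret] by fastforce

lemma computes_get:
  assumes "\<And>c. computes n (f (s\<lparr>clock := c\<rparr>)) s v"
  shows "computes n (bind_prog get f) s v"
  using assms unfolding computes_def bind_prog_def get_def by (simp add: bind_return_pmf)

lemma computes_mapM:
  fixes n :: real
  assumes "\<And>x. x \<in> set xs \<Longrightarrow> computes n (f x) s (g x)"
  shows "computes (length xs * (n + 1)) (mapM f xs) s (map g xs)"
  using assms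
proof (induction xs)
  case Nil
  thus ?case using computes_ret by simp
next
  case (Cons x xs)
  have "computes (1 + (n + (length xs * (n + 1) + 0))) (mapM f (x # xs)) s (map g (x # xs))"
    unfolding mapM.simps
    by (intro computes_bind[where v = "()"] computes_bind[where v = "g x"] computes_bind[where v = "map g xs"] computes_tick)
       (use Cons computes_ret in auto)
  thus ?case by (simp add: algebra_simps)
qed

lemma computes_foldM:
  fixes n :: real
  assumes "\<And>z x. x \<in> set xs \<Longrightarrow> computes n (f z x) s (h z x)"
  shows "computes (length xs * (n + 1)) (foldM f z xs) s (foldl h z xs)"
  using assms
proof (induction xs arbitrary: z)
  case Nil
  thus ?case using computes_ret by simp
next
  case (Cons x xs)
  have "computes (1 + (n + (length xs * (n + 1)))) (foldM f z (x # xs)) s (foldl h z (x # xs))"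
    unfolding foldM.simps
    by (intro computes_bind[where v = "()"] computes_bind[where v = "h z x"] computes_tick) (use Cons in auto)
  thus ?case by (simp add: algebra_simps)
qed

lemma computes_sumM:
  fixes n :: real
  assumes "\<And>x. x \<in> set xs \<Longrightarrow> computes n (f x) s (g x)"
  shows "computes (length xs * (n + 2)) (sumM f xs) s (\<Sum>x\<leftarrow>xs. g x)"
proof -
  have "computes (length xs * ((n + 1) + 1)) (sumM f xs) s (foldl (\<lambda>s x. s + g x) 0 xs)"
    unfolding sumM_def by (intro computes_foldM computes_bind[OF assms computes_op1])
  moreover have "foldl (\<lambda>s x. s + g x) z xs = z + (\<Sum>x\<leftarrow>xs. g x)" for z
    by (induction xs arbitrary: z) (simp_all add: add.assoc)
  ultimately show ?thesis by (simp add: add.assoc)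
qed

lemma computes_filterM:
  fixes n :: real
  assumes "\<And>x. x \<in> set xs \<Longrightarrow> computes n (P x) s (Q x)"
  shows "computes (length xs * (n + 1)) (filterM P xs) s (filter Q xs)"
  using assms
proof (induction xs)
  case Nil
  thus ?case using computes_ret by simp
next
  case (Cons x xs)
  have "computes (1 + (n + (length xs * (n + 1) + 0))) (filterM P (x # xs)) s (if Q x then x # filter Q xs else filter Q xs)"
    unfolding filterM.simps
    by (intro computes_bind[where v = "()"] computes_bind[where v = "Q x"] computes_bind[where v = "filter Q xs"] computes_tick)
       (use Cons computes_ret in auto)
  thus ?case by (simp add: algebra_simps)
qed

lemma foldl_max: "xs \<noteq> [] \<Longrightarrow> foldl max (hd xs) (tl xs) = Max (set xs)" for xs :: "'a::linorder list"
proof -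
  assume "xs \<noteq> []"
  then obtain y ys where xs: "xs = y # ys" by (cases xs) auto
  have "(\<lambda>x s. max s x) = (max :: 'a \<Rightarrow> 'a \<Rightarrow> 'a)" by (intro ext) (rule max.commute)
  thus ?thesis unfolding xs foldl_conv_fold by (simp add: Max.set_eq_fold[symmetric] del: Max_insert)
qed

lemma projM_computes:
  assumes "length ys = n" "0 < n"
  shows "computes (6 * real n * real n + 8 * n) (projM ys) s (map (\<lambda>y. max (y - threshold n (\<lambda>r. ys ! r)) 0) ys)"
proof -
  let ?s = "\<lambda>v. \<Sum>w\<leftarrow>ys. if v \<le> w then w else 0" and ?n = "\<lambda>v. \<Sum>w\<leftarrow>ys. if v \<le> w then 1 else 0 :: real"
  let ?g = "\<lambda>v. (?s v - 1) / ?n v"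
  let ?l = "real (length ys)"
  have "computes (?l * ((?l * ((1 + 0) + 2) + (?l * ((1 + 0) + 2) + (1 + 1))) + 1)) (mapM (\<lambda>v. do {
            s \<leftarrow> sumM (\<lambda>w. do { c \<leftarrow> leM v w; ret (if c then w else 0) }) ys;
            n \<leftarrow> sumM (\<lambda>w. do { c \<leftarrow> leM v w; ret (if c then 1 else 0) }) ys;
            d \<leftarrow> subM s 1;
            divM d n }) ys) s (map ?g ys)"
    by (rule computes_mapM, (rule computes_bind[OF computes_sumM[OF computes_bind[OF computes_op1 computes_ret]]])+,
        intro computes_bind[OF computes_op1] computes_op1)
  moreover have "computes (real (length (tl (map ?g ys))) * (1 + 1)) (foldM maxM (hd (map ?g ys)) (tl (map ?g ys))) s
        (foldl max (hd (map ?g ys)) (tl (map ?g ys)))"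
    by (intro computes_foldM computes_op1)
  moreover have "computes (?l * ((1 + 1) + 1)) (mapM (\<lambda>y. do { d \<leftarrow> subM y \<tau>; maxM d 0 }) ys) s
        (map (\<lambda>y. max (y - \<tau>) 0) ys)" for \<tau>
    by (intro computes_mapM computes_bind[OF computes_op1] computes_op1)
  ultimately have "computes (?l * ((?l * ((1 + 0) + 2) + (?l * ((1 + 0) + 2) + (1 + 1))) + 1)
        + (real (length (tl (map ?g ys))) * (1 + 1) + ?l * ((1 + 1) + 1)))
      (projM ys) s (map (\<lambda>y. max (y - foldl max (hd (map ?g ys)) (tl (map ?g ys))) 0) ys)"
    unfolding projM_def by (intro computes_bind)
  moreover have "foldl max (hd (map ?g ys)) (tl (map ?g ys)) = threshold n (\<lambda>r. ys ! r)"
  proof -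
    have sum: "(\<Sum>w\<leftarrow>ys. if v \<le> w then h w else 0) = (\<Sum>j\<in>{j\<in>{..<n}. v \<le> ys ! j}. h (ys ! j))" for v and h :: "real \<Rightarrow> real"
      using assms(1) sum.inter_filter[of "{..<n}" "\<lambda>j. h (ys ! j)" "\<lambda>j. v \<le> ys ! j"]
      by (simp add: sum_list_sum_nth atLeast0LessThan)
    have "?g ` set ys = (\<lambda>l. ((\<Sum>j\<in>{j\<in>{..<n}. ys ! l \<le> ys ! j}. ys ! j) - 1) / card {j\<in>{..<n}. ys ! l \<le> ys ! j}) ` {..<n}"
    proof -
      have "set ys = (\<lambda>l. ys ! l) ` {..<n}" using assms(1) by (auto simp: set_conv_nth)
      moreover have "?g v = ((\<Sum>j\<in>{j\<in>{..<n}. v \<le> ys ! j}. ys ! j) - 1) / card {j\<in>{..<n}. v \<le> ys ! j}" for v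
        unfolding sum by simp
      ultimately show ?thesis by (simp add: image_image)
    qed
    moreover have "foldl max (hd (map ?g ys)) (tl (map ?g ys)) = Max (set (map ?g ys))"
      by (rule foldl_max) (use assms in auto)
    ultimately show ?thesis unfolding threshold_def by simp
  qed
  ultimately show ?thesis using assms by (auto elim!: computes_weaken simp: algebra_simps of_nat_diff)
qed

section \<open>Programs that only use time\<close>

text \<open>
  \<open>framed P\<close> says that \<open>P\<close> neither reads nor writes \<open>used\<close> and does not depend on the clock.
\<close>

definition shift :: "real \<Rightarrow> (nat \<Rightarrow> real) \<Rightarrow> machine \<Rightarrow> machine" where
  "shift \<delta> u s = s\<lparr>clock := clock s + \<delta>, used := u\<rparr>"

definition framed :: "'a prog \<Rightarrow> bool" where
  "framed P \<longleftrightarrow> (\<forall>\<delta> u s. P (shift \<delta> u s) = map_pmf (\<lambda>(x, s'). (x, shift \<delta> u s')) (P s))"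

lemma framed_ret: "framed (ret x)"
  unfolding framed_def ret_def by simp

lemma framed_bind:
  assumes "framed P" "\<And>x. framed (f x)"
  shows "framed (bind_prog P f)"
  using assms unfolding framed_def bind_prog_def
  by (simp add: bind_map_pmf map_bind_pmf case_prod_unfold)

lemma framed_tick: "framed (tick c)"
  unfolding framed_def tick_def update_def shift_def by simp

lemma framed_op1: "framed (op1 x)"
  unfolding op1_def by (intro framed_bind framed_tick framed_ret)

lemma framed_timed_draw: "framed (timed_draw c p)"
  unfolding timed_draw_def
  by (intro framed_bind framed_tick) (simp add: framed_def map_pmf_comp)

lemma framed_get:
  assumes "\<And>\<delta> u s. f (shift \<delta> u s) = f s" "\<And>s. framed (f s)"
  shows "framed (bind_prog get f)"
  using assms unfolding framed_def bind_prog_def get_def by (simp add: bind_return_pmf)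

lemma framed_mapM: "(\<And>x. framed (f x)) \<Longrightarrow> framed (mapM f xs)"
  by (induction xs) (auto intro!: framed_bind framed_tick framed_ret)

lemma framed_foldM: "(\<And>z x. framed (f z x)) \<Longrightarrow> framed (foldM f z xs)"
  by (induction xs arbitrary: z) (auto intro!: framed_bind framed_tick framed_ret)

lemma framed_filterM: "(\<And>x. framed (P x)) \<Longrightarrow> framed (filterM P xs)"
  by (induction xs) (auto intro!: framed_bind framed_tick framed_ret)

lemma framed_sumM: "(\<And>x. framed (f x)) \<Longrightarrow> framed (sumM f xs)"
  unfolding sumM_def by (intro framed_foldM framed_bind framed_op1)

lemma framed_if: "framed P \<Longrightarrow> framed Q \<Longrightarrow> framed (if c then P else Q)"
  by simp

lemma framed_update: "(\<And>\<delta> u s. f (shift \<delta> u s) = shift \<delta> u (f s)) \<Longrightarrow> framed (update f)"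
  unfolding framed_def update_def by simp

lemmas framed_intros = framed_ret framed_bind framed_tick framed_op1 framed_timed_draw framed_mapM
  framed_foldM framed_filterM framed_sumM framed_if

lemma table_shift [simp]: "table (shift \<delta> u s) = table s"
  and index_sets_shift [simp]: "index_sets (shift \<delta> u s) = index_sets s"
  unfolding shift_def by simp_all

context nrm
begin

lemma framed_emptyM: "framed (emptyM E k)"
  unfolding emptyM_def by (intro framed_get framed_op1) simp

lemma framed_entryM: "framed (entryM E k)"
  unfolding entryM_def by (intro framed_get framed_ret) simp

lemma framed_storeM: "framed (storeM E k x)"
  unfolding storeM_def by (rule framed_update) (simp add: shift_def)

lemma framed_gradientM: "framed (gradientM \<theta> p k E sts l)"
  unfolding gradientM_def extrapolateM_def \<phi>'M_def case_prod_unfold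
  by (intro framed_intros framed_entryM)

lemma framed_R: "framed (R \<theta> p k E)"
proof (induction k arbitrary: E)
  case (Suc k)
  show ?case
    unfolding R.simps extrapolateM_def simM_def relevant_timesM_def projM_def
    by (intro framed_intros framed_emptyM framed_entryM framed_storeM framed_gradientM framed_get Suc.IH) simp
qed (simp add: framed_ret)

lemma framed_decide_params: "framed (decide_params \<theta> p E)"
  unfolding decide_params_def index_setM_def
  by (intro framed_intros framed_entryM framed_R framed_update) (simp add: shift_def)

end

context nrm
begin

section \<open>The deterministic parts of the routine\<close>

text \<open>
  The values that the program computes, as functions of the table and of the times it visits.
\<close>

definition table_extrap :: "params \<Rightarrow> (hist \<Rightarrow> nat \<Rightarrow> real list option) \<Rightarrow> nat \<Rightarrow> hist \<Rightarrow> nat \<Rightarrow> real" where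
  "table_extrap p tb k E r = (1 + momentum p k) * (the (tb E k) ! r) - momentum p k * (the (tb E (k - 1)) ! r)"

definition table_gradient :: "real \<Rightarrow> params \<Rightarrow> (hist \<Rightarrow> nat \<Rightarrow> real list option) \<Rightarrow> nat \<Rightarrow> hist
    \<Rightarrow> (hist \<times> nat list) list \<Rightarrow> nat \<Rightarrow> real" where
  "table_gradient \<theta> p tb k E sts l = Z l E - 2 / \<iota> * (\<Sum>i\<leftarrow>sorted_list_of_set (aplus l E). a l i E *
     ((\<Sum>(S', ts)\<leftarrow>sts. \<phi>' \<theta> (T / num_indices p *
        (\<Sum>t\<leftarrow>ts. \<Sum>r\<leftarrow>[1..<q]. a r i (take t S') * table_extrap p tb k (take t S') r) - b i)) / num_sims p))"

definition table_step :: "real \<Rightarrow> params \<Rightarrow> (hist \<Rightarrow> nat \<Rightarrow> real list option) \<Rightarrow> nat \<Rightarrow> hist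
    \<Rightarrow> (hist \<times> nat list) list \<Rightarrow> real list" where
  "table_step \<theta> p tb k E sts = (let ys = map (\<lambda>l. table_extrap p tb k E l + step_size p * table_gradient \<theta> p tb k E sts l) [0..<q]
     in map (\<lambda>y. max (y - threshold q (\<lambda>r. ys ! r)) 0) ys)"

lemma computes_entryM: "computes 0 (entryM E k) s (the (table s E k))"
  unfolding entryM_def by (rule computes_get) (simp add: computes_ret)

lemma computes_emptyM: "computes 1 (emptyM E k) s (table s E k = None)"
  unfolding emptyM_def by (rule computes_get) (simp add: computes_op1)

lemma computes_extrapolateM: "computes 4 (extrapolateM p k E r) s (table_extrap p (table s) k E r)"
proof -
  have "computes (0 + (0 + (1 + (1 + (1 + 1))))) (extrapolateM p k E r) s (table_extrap p (table s) k E r)"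
    unfolding extrapolateM_def table_extrap_def
    by (intro computes_bind[OF computes_entryM] computes_bind[OF computes_op1] computes_op1)
  thus ?thesis by simp
qed

lemma computes_\<phi>'M: "computes 3 (\<phi>'M \<theta> x) s (\<phi>' \<theta> x)"
proof -
  have "computes (1 + (1 + 1)) (\<phi>'M \<theta> x) s (\<phi>' \<theta> x)"
    unfolding \<phi>'M_def \<phi>'_def by (intro computes_bind[OF computes_op1] computes_op1)
  thus ?thesis by simp
qed

definition gradient_time :: "real \<Rightarrow> real \<Rightarrow> real" where
  "gradient_time n1 n2 = real L * (n1 * (n2 * (7 * real q + 2) + 8) + 4) + 3"

lemma computes_gradientM:
  fixes n2 :: real
  assumes ts: "\<And>S' ts. (S', ts) \<in> set sts \<Longrightarrow> real (length ts) \<le> n2" and card: "card (aplus l E) \<le> L"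
  shows "computes (gradient_time (real (length sts)) n2) (gradientM \<theta> p k E sts l) s (table_gradient \<theta> p (table s) k E sts l)"
proof -
  let ?x = "\<lambda>i S' t. \<Sum>r\<leftarrow>[1..<q]. a r i (take t S') * table_extrap p (table s) k (take t S') r"
  let ?h = "\<lambda>i (S', ts). \<phi>' \<theta> (T / num_indices p * (\<Sum>t\<leftarrow>ts. ?x i S' t) - b i)"
  have inner: "computes (7 * real q) (sumM (\<lambda>r. do {
                          x \<leftarrow> extrapolateM p k (take t S') r;
                          mulM (a r i (take t S')) x }) [1..<q]) s (?x i S' t)" for i S' t
    by (rule computes_weaken, rule computes_sumM[OF computes_bind[OF computes_extrapolateM computes_op1]]) simp
  have mid: "computes (n2 * (7 * real q + 2) + 6) ((\<lambda>(S', ts). do {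
                   w \<leftarrow> sumM (\<lambda>t. sumM (\<lambda>r. do {
                          x \<leftarrow> extrapolateM p k (take t S') r;
                          mulM (a r i (take t S')) x }) [1..<q]) ts;
                   c \<leftarrow> divM T (num_indices p);
                   w' \<leftarrow> mulM c w;
                   d \<leftarrow> subM w' (b i);
                   \<phi>'M \<theta> d }) z) s (?h i z)" if "z \<in> set sts" for i z
  proof -
    obtain S' ts' where z: "z = (S', ts')" by (cases z)
    have "real (length ts') * (7 * real q + 2) \<le> n2 * (7 * real q + 2)"
      using ts[of S' ts'] that z by (intro mult_right_mono) auto
    thus ?thesis unfolding z prod.case
      by (intro computes_weaken[OF computes_bind[OF computes_sumM[OF inner]
            computes_bind[OF computes_op1 computes_bind[OF computes_op1 computes_bind[OF computes_op1 computes_\<phi>'M]]]]]) simp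
  qed
  have "computes (real (length (sorted_list_of_set (aplus l E))) * ((real (length sts) * ((n2 * (7 * real q + 2) + 6) + 2) + (1 + 1)) + 2)
      + (1 + (1 + 1))) (gradientM \<theta> p k E sts l) s (table_gradient \<theta> p (table s) k E sts l)"
    unfolding gradientM_def table_gradient_def
    by (rule computes_bind[OF computes_sumM[OF computes_bind[OF computes_sumM[OF mid] computes_bind[OF computes_op1 computes_op1]]]],
        assumption, intro computes_bind[OF computes_op1] computes_op1)
  moreover have "real (length (sorted_list_of_set (aplus l E))) * ((real (length sts) * ((n2 * (7 * real q + 2) + 6) + 2) + (1 + 1)) + 2)
      \<le> real L * ((real (length sts) * ((n2 * (7 * real q + 2) + 6) + 2) + (1 + 1)) + 2)"
  proof (cases "sts = []")
    case True
    thus ?thesis using card by (intro mult_right_mono) auto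
  next
    case False
    then obtain S' ts' where "(S', ts') \<in> set sts" by (cases sts) auto
    hence "0 \<le> n2" using ts[of S' ts'] by linarith
    thus ?thesis using card by (intro mult_right_mono) auto
  qed
  ultimately show ?thesis by (elim computes_weaken) (simp add: gradient_time_def algebra_simps)
qed

definition update_time :: "real \<Rightarrow> real \<Rightarrow> real" where
  "update_time n1 n2 = real q * (gradient_time n1 n2 + 7) + (6 * real q * real q + 8 * real q)"

lemma computes_update:
  fixes n2 :: real
  assumes ts: "\<And>S' ts. (S', ts) \<in> set sts \<Longrightarrow> real (length ts) \<le> n2" and card: "\<And>l. l < q \<Longrightarrow> card (aplus l E) \<le> L" and q: "0 < q"
  shows "computes (update_time (real (length sts)) n2) (do {
       y \<leftarrow> mapM (\<lambda>l. do {
              x \<leftarrow> extrapolateM p k E l;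
              g \<leftarrow> gradientM \<theta> p k E sts l;
              g' \<leftarrow> mulM (step_size p) g;
              addM x g' }) [0..<q];
       projM y }) s (table_step \<theta> p (table s) k E sts)"
proof -
  let ?ys = "map (\<lambda>l. table_extrap p (table s) k E l + step_size p * table_gradient \<theta> p (table s) k E sts l) [0..<q]"
  have "computes (real (length [0..<q]) * ((4 + (gradient_time (real (length sts)) n2 + (1 + 1))) + 1)) (mapM (\<lambda>l. do {
              x \<leftarrow> extrapolateM p k E l;
              g \<leftarrow> gradientM \<theta> p k E sts l;
              g' \<leftarrow> mulM (step_size p) g;
              addM x g' }) [0..<q]) s ?ys"
    by (rule computes_mapM, rule computes_bind[OF computes_extrapolateM], rule computes_bind[OF computes_gradientM[OF ts card]],
        assumption, simp, intro computes_bind[OF computes_op1] computes_op1)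
  hence 1: "computes (real q * (gradient_time (real (length sts)) n2 + 7)) (mapM (\<lambda>l. do {
              x \<leftarrow> extrapolateM p k E l;
              g \<leftarrow> gradientM \<theta> p k E sts l;
              g' \<leftarrow> mulM (step_size p) g;
              addM x g' }) [0..<q]) s ?ys" by (simp add: add.commute)
  have 2: "computes (6 * real q * real q + 8 * real q) (projM ?ys) s (table_step \<theta> p (table s) k E sts)"
    using projM_computes[of ?ys q s] q unfolding table_step_def Let_def by simp
  show ?thesis unfolding update_time_def by (rule computes_bind[where f = projM, OF 1 2])
qed

end

section \<open>Lazy sampling\<close>

text \<open>
  The trajectories that the routine draws on demand may as well be drawn in advance.  To show this,
  a table that is filled in part is completed with fresh draws; the law of the completion is
  invariant under the routine.  This needs no account of the draws made in the past, as they
  enter the completion only through the entries that they led to.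
\<close>

locale lazy_sampling = wf_nrm +
  fixes \<theta> :: real and p :: params
  assumes \<theta>: "0 < \<theta>" and sp: "sampled p" and rounds_pos: "1 \<le> rounds p"
begin

abbreviation K :: nat where "K \<equiv> rounds p"

definition vec :: "real list \<Rightarrow> nat \<Rightarrow> real" where
  "vec x = (\<lambda>r. if r < q then x ! r else 0)"

fun completion :: "(hist \<Rightarrow> nat \<Rightarrow> real list option) \<Rightarrow> (nat \<Rightarrow> nat set) \<Rightarrow> (hist \<times> nat \<Rightarrow> hist list) \<Rightarrow> nat \<Rightarrow> hist \<Rightarrow> nat \<Rightarrow> real" where
  "completion tb al sims 0 E = null_choice"
| "completion tb al sims (Suc k) E = (case tb E (Suc k) of Some x \<Rightarrow> vec x | None \<Rightarrow>
     (let Y = (\<lambda>E' r. (1 + momentum p k) * completion tb al sims k E' r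
                      - momentum p k * completion tb al sims (k - 1) E' r)
      in proj (\<lambda>l. Y E l + step_size p * gradient \<theta> p sims al k Y E l)))"

definition al_of :: "machine \<Rightarrow> nat \<Rightarrow> nat set" where
  "al_of s k = set (index_sets s k)"

definition Comp :: "(hist \<times> nat \<Rightarrow> hist list pmf) \<Rightarrow> machine \<Rightarrow> (nat \<Rightarrow> hist \<Rightarrow> nat \<Rightarrow> real) pmf" where
  "Comp d s = map_pmf (completion (table s) (al_of s)) (Pi_pmf (histories \<times> {..<K}) [] d)"

text \<open>
  An entry is filled only after the entries of the same history in earlier rounds: the extrapolation
  reads two rounds back.
\<close>

definition good :: "machine \<Rightarrow> bool" where
  "good s \<longleftrightarrow> (\<forall>E. table s E 0 = Some null_list) \<and> (\<forall>E k x. table s E k = Some x \<longrightarrow> length x = q \<and> vec x \<in> Q0) \<and>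
     (\<forall>E k. table s E (Suc k) \<noteq> None \<longrightarrow> table s E k \<noteq> None) \<and>
     (\<forall>k<K. distinct (index_sets s k) \<and> set (index_sets s k) \<subseteq> {1..T} \<and> length (index_sets s k) \<le> num_indices p)"

definition extends :: "nat \<Rightarrow> machine \<Rightarrow> machine \<Rightarrow> bool" where
  "extends k s s' \<longleftrightarrow> (\<forall>E j x. table s E j = Some x \<longrightarrow> table s' E j = Some x) \<and> (\<forall>E j. k < j \<longrightarrow> table s' E j = table s E j) \<and>
     index_sets s' = index_sets s \<and> used s' = used s"

text \<open>
  The facts about the state that further work of the routine cannot destroy.
\<close>

definition stable :: "(machine \<Rightarrow> bool) \<Rightarrow> bool" where
  "stable Q \<longleftrightarrow> (\<forall>k s s'. Q s \<longrightarrow> extends k s s' \<longrightarrow> Q s')"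

text \<open>
  A Hoare triple with a time bound, which also states that the program preserves the law of the
  completion.  The distributions \<open>d\<close> of the missing draws vary, because while an entry is being computed
  its trajectories are known: they are then point masses in \<open>d\<close>.
\<close>

definition safe :: "nat \<Rightarrow> (hist \<times> nat \<Rightarrow> hist list pmf) \<Rightarrow> (machine \<Rightarrow> bool) \<Rightarrow> real \<Rightarrow> 'a prog \<Rightarrow> ('a \<Rightarrow> machine \<Rightarrow> bool) \<Rightarrow> bool" where
  "safe k d Pre n P Post \<longleftrightarrow> (\<forall>s. good s \<longrightarrow> Pre s \<longrightarrow>
     (\<forall>y\<in>set_pmf (P s). good (snd y) \<and> extends k s (snd y) \<and> clock (snd y) \<le> clock s + n \<and> Post (fst y) (snd y)) \<and>
     bind_pmf (P s) (\<lambda>y. Comp d (snd y)) = Comp d s)"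

lemma good_clock [simp]: "good (s\<lparr>clock := c\<rparr>) = good s"
  and extends_clock [simp]: "extends k s' (s\<lparr>clock := c\<rparr>) = extends k s' s"
  and Comp_clock [simp]: "Comp d (s\<lparr>clock := c\<rparr>) = Comp d s"
  unfolding good_def extends_def Comp_def al_of_def by simp_all

lemma extends_refl: "extends k s s"
  unfolding extends_def by simp

lemma extends_trans: "extends k s s' \<Longrightarrow> extends k s' s'' \<Longrightarrow> extends k s s''"
  unfolding extends_def by simp

lemma stable_nonempty: "stable (\<lambda>s. table s E k \<noteq> None)"
  unfolding stable_def extends_def by (metis not_None_eq)

lemma stable_index_sets: "stable (\<lambda>s. Q (index_sets s))"
  unfolding stable_def extends_def by simp

lemma stable_conj: "stable P \<Longrightarrow> stable Q \<Longrightarrow> stable (\<lambda>s. P s \<and> Q s)"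
  unfolding stable_def by blast

lemma stable_ball: "(\<And>x. x \<in> A \<Longrightarrow> stable (Q x)) \<Longrightarrow> stable (\<lambda>s. \<forall>x\<in>A. Q x s)"
  unfolding stable_def by blast

lemma safe_weaken:
  assumes "safe k d Pre n P Post" "\<And>s. Pre' s \<Longrightarrow> Pre s" "n \<le> n'" "\<And>x s. Post x s \<Longrightarrow> Post' x s"
  shows "safe k d Pre' n' P Post'"
  using assms unfolding safe_def by fastforce

lemma safe_bind:
  assumes P: "safe k d Pre n1 P Q" and f: "\<And>x. safe k d (Q x) n2 (f x) Q'"
  shows "safe k d Pre (n1 + n2) (bind_prog P f) Q'"
  unfolding safe_def
proof (intro allI impI conjI ballI)
  fix s assume s: "good s" "Pre s"
  have 1: "good (snd y) \<and> extends k s (snd y) \<and> clock (snd y) \<le> clock s + n1 \<and> Q (fst y) (snd y)"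
    if "y \<in> set_pmf (P s)" for y using P s that unfolding safe_def by blast
  have 2: "good (snd z) \<and> extends k (snd y) (snd z) \<and> clock (snd z) \<le> clock (snd y) + n2 \<and> Q' (fst z) (snd z)"
    if "y \<in> set_pmf (P s)" "z \<in> set_pmf (f (fst y) (snd y))" for y z
    using f[of "fst y"] 1[OF that(1)] that(2) unfolding safe_def by blast
  have 3: "bind_pmf (f (fst y) (snd y)) (\<lambda>z. Comp d (snd z)) = Comp d (snd y)" if "y \<in> set_pmf (P s)" for y
    using f[of "fst y"] 1[OF that] unfolding safe_def by blast
  { fix z assume "z \<in> set_pmf (bind_prog P f s)"
    then obtain y where y: "y \<in> set_pmf (P s)" "z \<in> set_pmf (f (fst y) (snd y))"
      unfolding bind_prog_def by (auto simp: case_prod_unfold)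
    note 1[OF y(1)] 2[OF y]
    thus "good (snd z)" "extends k s (snd z)" "clock (snd z) \<le> clock s + (n1 + n2)" "Q' (fst z) (snd z)"
      using extends_trans by auto }
  have "bind_pmf (bind_prog P f s) (\<lambda>y. Comp d (snd y)) = bind_pmf (P s) (\<lambda>y. bind_pmf (f (fst y) (snd y)) (\<lambda>z. Comp d (snd z)))"
    unfolding bind_prog_def by (simp add: bind_assoc_pmf case_prod_unfold)
  also have "\<dots> = bind_pmf (P s) (\<lambda>y. Comp d (snd y))" by (rule bind_pmf_cong[OF refl]) (rule 3)
  also have "\<dots> = Comp d s" using P s unfolding safe_def by blast
  finally show "bind_pmf (bind_prog P f s) (\<lambda>y. Comp d (snd y)) = Comp d s" .
qed

lemma safe_frame:
  assumes "safe k d Pre n P Q" "stable G"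
  shows "safe k d (\<lambda>s. Pre s \<and> G s) n P (\<lambda>x s. Q x s \<and> G s)"
  using assms unfolding safe_def stable_def by blast

lemma safe_computes:
  assumes "\<And>s. good s \<Longrightarrow> Pre s \<Longrightarrow> computes n P s (v s)" "\<And>s c. good s \<Longrightarrow> Pre s \<Longrightarrow> Post (v s) (s\<lparr>clock := c\<rparr>)"
  shows "safe k d Pre n P Post"
  unfolding safe_def
proof (intro allI impI)
  fix s assume s: "good s" "Pre s"
  obtain c where c: "c \<le> clock s + n" "P s = return_pmf (v s, s\<lparr>clock := c\<rparr>)"
    using computesD[OF assms(1)[OF s]] .
  show "(\<forall>y\<in>set_pmf (P s). good (snd y) \<and> extends k s (snd y) \<and> clock (snd y) \<le> clock s + n \<and> Post (fst y) (snd y)) \<and>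
     bind_pmf (P s) (\<lambda>y. Comp d (snd y)) = Comp d s"
    using c s assms(2)[OF s] extends_refl by (simp add: bind_return_pmf)
qed

lemma safe_ret: "(\<And>s. Pre s \<Longrightarrow> Post x s) \<Longrightarrow> safe k d Pre 0 (ret x) Post"
  unfolding safe_def ret_def using extends_refl by (simp add: bind_return_pmf)

lemma safe_tick: "(\<And>s c. Pre s \<Longrightarrow> Post (s\<lparr>clock := c\<rparr>)) \<Longrightarrow> safe k d Pre c (tick c) (\<lambda>_. Post)"
  by (rule safe_computes) (auto intro: computes_tick)

lemma safe_get:
  assumes "\<And>s. good s \<Longrightarrow> Pre s \<Longrightarrow> safe k d (\<lambda>s'. s' = s) n (f s) Q"
  shows "safe k d Pre n (bind_prog get f) Q"
  using assms unfolding safe_def bind_prog_def get_def by (auto simp: bind_return_pmf)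

lemma safe_mapM:
  fixes n :: real
  assumes f: "\<And>x. x \<in> set xs \<Longrightarrow> safe k d Pre n (f x) (Q x)"
    and st: "stable Pre" "\<And>x y. stable (Q x y)"
  shows "safe k d Pre (real (length xs) * (n + 1)) (mapM f xs) (\<lambda>ys s. list_all2 (\<lambda>x y. Q x y s) xs ys \<and> Pre s)"
  using f
proof (induction xs)
  case Nil
  show ?case using safe_ret[of Pre "\<lambda>ys s. ys = [] \<and> Pre s" "[]"] by simp
next
  case (Cons x xs)
  have "safe k d Pre (1 + (n + (real (length xs) * (n + 1) + 0))) (mapM f (x # xs)) (\<lambda>ys s. list_all2 (\<lambda>x y. Q x y s) (x # xs) ys \<and> Pre s)"
    unfolding mapM.simps
  proof (rule safe_bind)
    have "stable Pre" by (rule st)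
    hence "Pre s \<Longrightarrow> Pre (s\<lparr>clock := c\<rparr>)" for s c
      unfolding stable_def by (metis extends_clock extends_refl)
    thus "safe k d Pre 1 (tick 1) (\<lambda>_. Pre)" by (rule safe_tick)
    have 1: "safe k d Pre n (f x) (\<lambda>y s. Q x y s \<and> Pre s)"
      using safe_frame[OF Cons.prems[of x] st(1)] by simp
    have 2: "safe k d (\<lambda>s. Q x y s \<and> Pre s) (real (length xs) * (n + 1)) (mapM f xs)
        (\<lambda>ys s. (list_all2 (\<lambda>x y. Q x y s) xs ys \<and> Pre s) \<and> Q x y s)" for y
      using safe_frame[OF Cons.IH[OF Cons.prems] st(2)[of x y]] by (rule safe_weaken) auto
    show "safe k d Pre (n + (real (length xs) * (n + 1) + 0))
        (bind_prog (f x) (\<lambda>y. bind_prog (mapM f xs) (\<lambda>ys. ret (y # ys)))) (\<lambda>ys s. list_all2 (\<lambda>x y. Q x y s) (x # xs) ys \<and> Pre s)" for u :: unit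
      by (rule safe_bind[OF 1], rule safe_bind[OF 2], rule safe_ret) auto
  qed
  thus ?case by (simp add: algebra_simps)
qed

lemma completion_entry: "good s \<Longrightarrow> table s E k = Some x \<Longrightarrow> completion (table s) al sims k E = vec x"
proof (cases k)
  case 0
  assume "good s" "table s E k = Some x"
  hence "x = null_list" using 0 by (simp add: good_def)
  thus ?thesis using 0 wf_simps by (auto simp: vec_def null_list_def null_choice_def)
qed simp

lemma completion_None:
  assumes "table s E (Suc k) = None"
  shows "completion (table s) al sims (Suc k) E = proj (\<lambda>l.
      (1 + momentum p k) * completion (table s) al sims k E l - momentum p k * completion (table s) al sims (k - 1) E l
      + step_size p * gradient \<theta> p sims al k (\<lambda>E' r. (1 + momentum p k) * completion (table s) al sims k E' r
                      - momentum p k * completion (table s) al sims (k - 1) E' r) E l)"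
  using assms by (simp add: Let_def)

lemma good_below: "good s \<Longrightarrow> table s E k \<noteq> None \<Longrightarrow> j \<le> k \<Longrightarrow> table s E j \<noteq> None"
proof (induction "k - j" arbitrary: j)
  case (Suc n)
  have "table s E (Suc j) \<noteq> None" using Suc.hyps(1)[of "Suc j"] Suc.prems Suc.hyps(2) by auto
  thus ?case using Suc.prems unfolding good_def by metis
qed simp

definition relevant :: "hist \<Rightarrow> hist \<Rightarrow> nat set" where
  "relevant E S' = (\<Union>i\<in>(\<Union>r\<in>{1..<q}. aplus r E). times i S')"

text \<open>
  The value that the routine stores is the one that completion assigns, if the trajectories are
  those that the routine has drawn.  Periods outside \<open>\<Union>\<^sub>i \<T>\<^sub>i\<close> are skipped by the program as they
  contribute nothing.
\<close>

lemma table_step_eq: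
  assumes s: "good s" and k: "k < K" and E: "E \<in> histories" and none: "table s E (Suc k) = None" and some: "table s E k \<noteq> None"
    and sims: "set ss \<subseteq> trajectories" "sims (E, k) = ss"
    and sts: "sts = map (\<lambda>S'. (S', filter (\<lambda>t. t \<in> relevant E S') (index_sets s k))) ss"
    and filled: "\<And>S' t. S' \<in> set ss \<Longrightarrow> t \<in> set (index_sets s k) \<Longrightarrow> t \<in> relevant E S' \<Longrightarrow> table s (take t S') k \<noteq> None"
  shows "completion (table s) (al_of s) sims (Suc k) E = vec (table_step \<theta> p (table s) k E sts)"
proof -
  define Y where "Y E' r = (1 + momentum p k) * completion (table s) (al_of s) sims k E' r
                      - momentum p k * completion (table s) (al_of s) sims (k - 1) E' r" for E' r
  have Yeq: "Y E' r = table_extrap p (table s) k E' r" if ne: "table s E' k \<noteq> None" and r: "r < q" for E' r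
  proof -
    have ne': "table s E' (k - 1) \<noteq> None" by (rule good_below[OF s ne]) simp
    from ne ne' obtain x x' where x: "table s E' k = Some x" "table s E' (k - 1) = Some x'" by blast
    show ?thesis
      unfolding Y_def table_extrap_def completion_entry[OF s x(1)] completion_entry[OF s x(2)]
      using x r by (simp add: vec_def)
  qed
  have idx: "distinct (index_sets s k)" "set (index_sets s k) \<subseteq> {1..T}" using s k unfolding good_def by auto
  have grad: "table_gradient \<theta> p (table s) k E sts l = gradient \<theta> p sims (al_of s) k Y E l" if l: "l < q" for l
  proof -
    have load: "(\<Sum>t\<leftarrow>filter (\<lambda>t. t \<in> relevant E S') (index_sets s k). \<Sum>r\<leftarrow>[1..<q]. a r i (take t S') * table_extrap p (table s) k (take t S') r)
        = (\<Sum>t\<in>al_of s k. \<Sum>r=1..<q. a r i (take t S') * Y (take t S') r)"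
      if i: "i \<in> aplus l E" and S': "S' \<in> set ss" for i S'
    proof -
      have S'T: "S' \<in> trajectories" using sims S' by auto
      have im: "i \<in> {1..m}" using i by (simp add: aplus_def)
      have l1: "l \<in> {1..<q}"
      proof -
        have "l \<noteq> 0" using i a_null[OF E im] by (cases "l = 0") (auto simp: aplus_def)
        thus ?thesis using l by simp
      qed
      have "(\<Sum>t\<leftarrow>filter (\<lambda>t. t \<in> relevant E S') (index_sets s k). \<Sum>r\<leftarrow>[1..<q]. a r i (take t S') * table_extrap p (table s) k (take t S') r)
          = (\<Sum>t\<in>{t\<in>al_of s k. t \<in> relevant E S'}. \<Sum>r=1..<q. a r i (take t S') * table_extrap p (table s) k (take t S') r)"
        by (simp only: sum_list_distinct_conv_sum_set[OF distinct_filter[OF idx(1)]] interv_sum_list_conv_sum_set_nat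
              set_filter al_of_def set_upt)
      also have "\<dots> = (\<Sum>t\<in>{t\<in>al_of s k. t \<in> relevant E S'}. \<Sum>r=1..<q. a r i (take t S') * Y (take t S') r)"
        by (intro sum.cong refl arg_cong2[where f = "(*)"]) (use filled[OF S'] Yeq in \<open>auto simp: al_of_def\<close>)
      also have "\<dots> = (\<Sum>t\<in>al_of s k. \<Sum>r=1..<q. a r i (take t S') * Y (take t S') r)"
      proof (rule sum.mono_neutral_left)
        show "\<forall>t\<in>al_of s k - {t\<in>al_of s k. t \<in> relevant E S'}. (\<Sum>r=1..<q. a r i (take t S') * Y (take t S') r) = 0"
        proof
          fix t assume t: "t \<in> al_of s k - {t\<in>al_of s k. t \<in> relevant E S'}"
          hence tT: "t \<in> {1..T}" using idx(2) by (auto simp: al_of_def)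
          have "a r i (take t S') = 0" if r: "r \<in> {1..<q}" for r
          proof (rule ccontr)
            assume "a r i (take t S') \<noteq> 0"
            hence "0 < a r i (take t S')" using a_nonneg[OF take_history[OF S'T tT], of r i] r im by force
            hence "t \<in> times i S'" using r tT by (auto simp: times_def)
            hence "t \<in> relevant E S'" using i l1 by (auto simp: relevant_def)
            thus False using t by auto
          qed
          thus "(\<Sum>r=1..<q. a r i (take t S') * Y (take t S') r) = 0" by simp
        qed
      qed (auto simp: al_of_def)
      finally show ?thesis .
    qed
    let ?\<psi> = "\<lambda>i S'. \<phi>' \<theta> (T / num_indices p * (\<Sum>t\<in>al_of s k. \<Sum>r=1..<q. a r i (take t S') * Y (take t S') r) - b i)"
    have "(\<Sum>i\<leftarrow>sorted_list_of_set (aplus l E). a l i E *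
     ((\<Sum>(S', ts)\<leftarrow>sts. \<phi>' \<theta> (T / num_indices p *
        (\<Sum>t\<leftarrow>ts. \<Sum>r\<leftarrow>[1..<q]. a r i (take t S') * table_extrap p (table s) k (take t S') r) - b i)) / num_sims p))
      = (\<Sum>i\<in>aplus l E. a l i E * (1 / num_sims p * (\<Sum>S'\<leftarrow>ss. ?\<psi> i S')))"
    proof -
      have "(\<Sum>(S', ts)\<leftarrow>sts. \<phi>' \<theta> (T / num_indices p *
        (\<Sum>t\<leftarrow>ts. \<Sum>r\<leftarrow>[1..<q]. a r i (take t S') * table_extrap p (table s) k (take t S') r) - b i))
        = (\<Sum>S'\<leftarrow>ss. ?\<psi> i S')" if "i \<in> aplus l E" for i
        unfolding sts map_map o_def prod.case
        by (intro arg_cong[where f = sum_list] map_cong refl) (simp only: load[OF that])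
      thus ?thesis using finite_aplus
        by (simp add: sum_list_distinct_conv_sum_set cong: sum.cong)
    qed
    also have "\<dots> = (\<Sum>i=1..m. a l i E * (1 / num_sims p * (\<Sum>S'\<leftarrow>ss. ?\<psi> i S')))"
      by (rule sum.mono_neutral_left) (use a_nonneg[OF E l] in \<open>force simp: aplus_def\<close>)+
    finally show ?thesis unfolding table_gradient_def gradient_def sims(2) by simp
  qed
  let ?ys = "map (\<lambda>l. table_extrap p (table s) k E l + step_size p * table_gradient \<theta> p (table s) k E sts l) [0..<q]"
  have "completion (table s) (al_of s) sims (Suc k) E = proj (\<lambda>l. Y E l + step_size p * gradient \<theta> p sims (al_of s) k Y E l)"
    using completion_None[OF none] unfolding Y_def[abs_def] by simp
  also have "\<dots> = proj (\<lambda>r. ?ys ! r)"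
    by (rule proj_cong) (use Yeq[OF some] grad in simp)
  also have "\<dots> = vec (table_step \<theta> p (table s) k E sts)"
    unfolding proj_eq[OF wf_simps(3)] vec_def table_step_def Let_def by (intro ext) simp
  finally show ?thesis .
qed

end

lemma bind_prog_assoc: "bind_prog (bind_prog P f) g = bind_prog P (\<lambda>x. bind_prog (f x) g)"
  unfolding bind_prog_def by (intro ext) (simp add: bind_assoc_pmf case_prod_unfold)

lemma timed_draw_apply: "timed_draw c r s = map_pmf (\<lambda>x. (x, s\<lparr>clock := clock s + c\<rparr>)) r"
  by (simp add: timed_draw_def bind_prog_def tick_def update_def bind_return_pmf)

lemma mapM_timed_draw:
  fixes c :: real
  shows "mapM (\<lambda>_. timed_draw c r) xs s
     = map_pmf (\<lambda>ys. (ys, s\<lparr>clock := clock s + length xs * (c + 1)\<rparr>)) (replicate_pmf (length xs) r)"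
proof (induction xs arbitrary: s)
  case Nil
  show ?case by (simp add: ret_def)
next
  case (Cons x xs)
  have "mapM (\<lambda>_. timed_draw c r) (x # xs) s = bind_pmf r (\<lambda>y. map_pmf (\<lambda>ys. (y # ys, s\<lparr>clock := clock s + length (x # xs) * (c + 1)\<rparr>))
      (replicate_pmf (length xs) r))"
    by (simp add: bind_prog_def tick_def update_def timed_draw_apply Cons ret_def bind_return_pmf bind_map_pmf
        map_pmf_def[symmetric] algebra_simps) (simp add: map_pmf_def bind_assoc_pmf bind_return_pmf)?
  thus ?case by (simp add: map_bind_pmf map_pmf_def bind_return_pmf bind_assoc_pmf)
qed

context lazy_sampling
begin

definition agree :: "(hist \<times> nat \<Rightarrow> hist list pmf) \<Rightarrow> nat \<Rightarrow> bool" where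
  "agree d k \<longleftrightarrow> (\<forall>E\<in>histories. \<forall>j<k. d (E, j) = sim_dist p E)"

abbreviation n1 :: real where "n1 \<equiv> real (num_sims p)"
abbreviation n2 :: real where "n2 \<equiv> real (num_indices p)"

primrec round_time :: "nat \<Rightarrow> real" where
  "round_time 0 = 0"
| "round_time (Suc k) = 1 + (n1 * (sim_cost I + 1) + (1 + (round_time k +
     (n1 * ((1 + (n2 * (1 + 1) + (n2 * ((1 + round_time k) + 1) + 0))) + 1) + update_time n1 n2))))"

lemma update_time_nonneg: "0 \<le> update_time n1 n2"
  unfolding update_time_def gradient_time_def by (intro add_nonneg_nonneg mult_nonneg_nonneg) auto

lemma round_time_nonneg: "0 \<le> round_time k"
  by (induction k) (use wf_simps update_time_nonneg in \<open>auto intro!: add_nonneg_nonneg mult_nonneg_nonneg\<close>)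

definition visit :: "nat \<Rightarrow> hist \<Rightarrow> unit prog" where
  "visit k E = do { e \<leftarrow> emptyM E k; if e then R \<theta> p k E else ret () }"

definition collect :: "nat \<Rightarrow> hist \<Rightarrow> hist \<Rightarrow> (hist \<times> nat list) prog" where
  "collect k E S' = do {
     B \<leftarrow> relevant_timesM E S';
     s \<leftarrow> get;
     ts \<leftarrow> filterM (\<lambda>t. memberM t B) (index_sets s k);
     mapM (\<lambda>t. visit k (take t S')) ts;
     ret (S', ts) }"

definition recompute :: "nat \<Rightarrow> hist \<Rightarrow> hist list \<Rightarrow> real list prog" where
  "recompute k E ss = do {
     visit k E;
     sts \<leftarrow> mapM (collect k E) ss;
     y \<leftarrow> mapM (\<lambda>l. do {
            x \<leftarrow> extrapolateM p k E l;
            g \<leftarrow> gradientM \<theta> p k E sts l;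
            g' \<leftarrow> mulM (step_size p) g;
            addM x g' }) [0..<q];
     projM y }"

lemma R_Suc: "R \<theta> p (Suc k) E = do {
     e \<leftarrow> emptyM E (Suc k);
     if \<not> e then ret ()
     else do {
       ss \<leftarrow> mapM (\<lambda>_. timed_draw (sim_cost I) (SIM E)) [0..<num_sims p];
       x \<leftarrow> recompute k E ss;
       storeM E (Suc k) x } }"
  unfolding R.simps recompute_def collect_def visit_def simM_def by (simp only: bind_prog_assoc)

lemma safe_pre_const: "(c \<Longrightarrow> safe k d (\<lambda>_. True) n P Q) \<Longrightarrow> safe k d (\<lambda>_. c) n P Q"
  unfolding safe_def by auto

lemma safe_visit:
  assumes IH: "safe k d (\<lambda>_. True) (round_time k) (R \<theta> p k E) (\<lambda>_ s. table s E k \<noteq> None)"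
  shows "safe k d (\<lambda>_. True) (1 + round_time k) (visit k E) (\<lambda>_ s. table s E k \<noteq> None)"
  unfolding visit_def
proof (rule safe_bind)
  show "safe k d (\<lambda>_. True) 1 (emptyM E k) (\<lambda>e s. e \<longleftrightarrow> table s E k = None)"
    by (rule safe_computes[OF computes_emptyM]) simp
  fix e
  show "safe k d (\<lambda>s. e \<longleftrightarrow> table s E k = None) (round_time k) (if e then R \<theta> p k E else ret ()) (\<lambda>_ s. table s E k \<noteq> None)"
  proof (cases e)
    case True
    thus ?thesis using safe_weaken[OF IH, where n' = "round_time k"] by simp
  next
    case False
    have "safe k d (\<lambda>s. table s E k \<noteq> None) 0 (ret ()) (\<lambda>_ s. table s E k \<noteq> None)" by (rule safe_ret)
    thus ?thesis using False round_time_nonneg[of k] by (auto elim: safe_weaken)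
  qed
qed

definition collected :: "nat \<Rightarrow> hist \<Rightarrow> hist \<Rightarrow> hist \<times> nat list \<Rightarrow> machine \<Rightarrow> bool" where
  "collected k E S' y s \<longleftrightarrow> y = (S', filter (\<lambda>t. t \<in> relevant E S') (index_sets s k)) \<and>
     (\<forall>t\<in>set (snd y). table s (take t S') k \<noteq> None)"

lemma stable_collected: "stable (collected k E S' y)"
  unfolding collected_def[abs_def] by (intro stable_conj stable_index_sets stable_ball stable_nonempty)

lemma safe_collect:
  assumes IH: "\<And>E. E \<in> histories \<Longrightarrow> safe k d (\<lambda>_. True) (round_time k) (R \<theta> p k E) (\<lambda>_ s. table s E k \<noteq> None)"
    and S': "S' \<in> trajectories" and k: "k < K"
  shows "safe k d (\<lambda>_. True) (1 + (n2 * (1 + 1) + (n2 * ((1 + round_time k) + 1) + 0))) (collect k E S') (collected k E S')"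
  unfolding collect_def
proof (rule safe_bind)
  show "safe k d (\<lambda>_. True) 1 (relevant_timesM E S') (\<lambda>x s. x = relevant E S')"
    unfolding relevant_timesM_def relevant_def by (rule safe_computes[OF computes_op1]) simp
  fix B
  show "safe k d (\<lambda>_. B = relevant E S') (n2 * (1 + 1) + (n2 * ((1 + round_time k) + 1) + 0)) (do {
     s \<leftarrow> get;
     ts \<leftarrow> filterM (\<lambda>t. memberM t B) (index_sets s k);
     mapM (\<lambda>t. visit k (take t S')) ts;
     ret (S', ts) }) (collected k E S')"
  proof (rule safe_pre_const, rule safe_get)
    fix s0 assume B: "B = relevant E S'" and s0: "good s0"
    let ?xs = "index_sets s0 k"
    let ?ts = "filter (\<lambda>t. t \<in> relevant E S') ?xs"
    have len: "real (length ?xs) \<le> n2" and sub: "set ?xs \<subseteq> {1..T}" using s0 k unfolding good_def by auto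
    have len': "real (length ?ts) \<le> n2" using len length_filter_le[of "\<lambda>t. t \<in> relevant E S'" ?xs] by linarith
    show "safe k d (\<lambda>s'. s' = s0) (n2 * (1 + 1) + (n2 * ((1 + round_time k) + 1) + 0)) (do {
       ts \<leftarrow> filterM (\<lambda>t. memberM t B) ?xs;
       mapM (\<lambda>t. visit k (take t S')) ts;
       ret (S', ts) }) (collected k E S')"
    proof (rule safe_bind)
      have "computes (real (length ?xs) * (1 + 1)) (filterM (\<lambda>t. memberM t B) ?xs) s ?ts" for s
        unfolding B by (intro computes_filterM computes_op1)
      hence "computes (n2 * (1 + 1)) (filterM (\<lambda>t. memberM t B) ?xs) s ?ts" for s
        by (rule computes_weaken) (use len in simp)
      thus "safe k d (\<lambda>s'. s' = s0) (n2 * (1 + 1)) (filterM (\<lambda>t. memberM t B) ?xs)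
          (\<lambda>ts s. ts = ?ts \<and> index_sets s = index_sets s0)"
        by (rule safe_computes) simp
      fix ts
      show "safe k d (\<lambda>s. ts = ?ts \<and> index_sets s = index_sets s0) (n2 * ((1 + round_time k) + 1) + 0) (do {
         mapM (\<lambda>t. visit k (take t S')) ts;
         ret (S', ts) }) (collected k E S')"
      proof (cases "ts = ?ts")
        case False
        thus ?thesis by (simp add: safe_def)
      next
        case True
        have st: "stable (\<lambda>s. index_sets s = index_sets s0)" by (rule stable_index_sets)
        have "safe k d (\<lambda>s. index_sets s = index_sets s0) (length ?ts * ((1 + round_time k) + 1)) (mapM (\<lambda>t. visit k (take t S')) ?ts)
           (\<lambda>ys s. list_all2 (\<lambda>t y. table s (take t S') k \<noteq> None) ?ts ys \<and> index_sets s = index_sets s0)"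
        proof (rule safe_mapM[OF _ st])
          fix t assume "t \<in> set ?ts"
          hence "take t S' \<in> histories" using sub take_history[OF S'] by auto
          from safe_visit[OF IH[OF this]]
          show "safe k d (\<lambda>s. index_sets s = index_sets s0) (1 + round_time k) (visit k (take t S')) (\<lambda>y s. table s (take t S') k \<noteq> None)"
            by (rule safe_weaken) auto
        qed (rule stable_nonempty)
        hence loop: "safe k d (\<lambda>s. index_sets s = index_sets s0) (n2 * ((1 + round_time k) + 1)) (mapM (\<lambda>t. visit k (take t S')) ?ts)
           (\<lambda>ys s. collected k E S' (S', ?ts) s)"
        proof (rule safe_weaken)
          show "length ?ts * ((1 + round_time k) + 1) \<le> n2 * ((1 + round_time k) + 1)"
            using len' round_time_nonneg[of k] by (intro mult_right_mono) auto
          fix ys :: "unit list" and s :: machine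
          assume *: "list_all2 (\<lambda>t y. table s (take t S') k \<noteq> None) ?ts ys \<and> index_sets s = index_sets s0"
          have "table s (take t S') k \<noteq> None" if t: "t \<in> set ?ts" for t
          proof -
            obtain j where "j < length ?ts" "?ts ! j = t" using t unfolding in_set_conv_nth by blast
            thus ?thesis using list_all2_nthD[OF conjunct1[OF *]] by blast
          qed
          thus "collected k E S' (S', ?ts) s" unfolding collected_def snd_conv using conjunct2[OF *] by simp
        qed simp_all
        show ?thesis unfolding True
          by (rule safe_weaken[OF safe_bind[OF loop safe_ret]]) auto
      qed
    qed
  qed
qed

lemma safe_recompute:
  assumes IH: "\<And>E. E \<in> histories \<Longrightarrow> safe k d (\<lambda>_. True) (round_time k) (R \<theta> p k E) (\<lambda>_ s. table s E k \<noteq> None)"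
    and E: "E \<in> histories" and k: "k < K" and ss: "set ss \<subseteq> trajectories" "length ss = num_sims p"
  shows "safe k d (\<lambda>_. True) (1 + (round_time k +
     (n1 * ((1 + (n2 * (1 + 1) + (n2 * ((1 + round_time k) + 1) + 0))) + 1) + update_time n1 n2))) (recompute k E ss)
     (\<lambda>x s. length x = q \<and> table s E k \<noteq> None \<and> (table s E (Suc k) = None \<longrightarrow>
        (\<forall>sims. sims (E, k) = ss \<longrightarrow> completion (table s) (al_of s) sims (Suc k) E = vec x)))"
  unfolding recompute_def add.assoc[symmetric, of 1 "round_time k"]
proof (rule safe_bind[OF safe_visit[OF IH[OF E]]])
  fix u :: unit
  let ?upd = "\<lambda>sts. do {
     y \<leftarrow> mapM (\<lambda>l. do {
            x \<leftarrow> extrapolateM p k E l;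
            g \<leftarrow> gradientM \<theta> p k E sts l;
            g' \<leftarrow> mulM (step_size p) g;
            addM x g' }) [0..<q];
     projM y }"
  let ?Post = "\<lambda>x s. length x = q \<and> table s E k \<noteq> None \<and> (table s E (Suc k) = None \<longrightarrow>
        (\<forall>sims. sims (E, k) = ss \<longrightarrow> completion (table s) (al_of s) sims (Suc k) E = vec x))"
  let ?ne = "\<lambda>s. table s E k \<noteq> None"
  have loop: "safe k d ?ne (length ss * ((1 + (n2 * (1 + 1) + (n2 * ((1 + round_time k) + 1) + 0))) + 1)) (mapM (collect k E) ss)
     (\<lambda>sts s. list_all2 (\<lambda>S' y. collected k E S' y s) ss sts \<and> ?ne s)"
    by (intro safe_mapM stable_nonempty stable_collected)
       (rule safe_weaken[OF safe_collect[OF IH _ k]], use ss in auto)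
  show "safe k d ?ne (n1 * ((1 + (n2 * (1 + 1) + (n2 * ((1 + round_time k) + 1) + 0))) + 1) + update_time n1 n2)
     (do { sts \<leftarrow> mapM (collect k E) ss; ?upd sts }) ?Post"
  proof (rule safe_bind[OF loop[unfolded ss(2)]])
    fix sts
    show "safe k d (\<lambda>s. list_all2 (\<lambda>S' y. collected k E S' y s) ss sts \<and> ?ne s) (update_time n1 n2) (?upd sts) ?Post"
    proof (rule safe_computes)
      fix s assume s: "good s" "list_all2 (\<lambda>S' y. collected k E S' y s) ss sts \<and> ?ne s"
      have sts: "sts = map (\<lambda>S'. (S', filter (\<lambda>t. t \<in> relevant E S') (index_sets s k))) ss"
        using s(2) by (auto simp: collected_def list_all2_conv_all_nth intro!: nth_equalityI)
      have len: "real (length ts) \<le> n2" if "(S', ts) \<in> set sts" for S' ts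
      proof -
        have "length ts \<le> length (index_sets s k)" using that unfolding sts by auto
        thus ?thesis using s(1) k unfolding good_def by (meson le_trans of_nat_le_iff)
      qed
      have "length sts = num_sims p" using sts ss by simp
      thus "computes (update_time n1 n2) (?upd sts) s (table_step \<theta> p (table s) k E sts)"
        using computes_update[where sts = sts and p = p and k = k and \<theta> = \<theta> and s = s and E = E, OF len card_aplus[OF E] wf_simps(3)]
        by simp
      have filled: "table s (take t S') k \<noteq> None" if mem: "S' \<in> set ss" "t \<in> set (index_sets s k)" "t \<in> relevant E S'" for S' t
      proof -
        obtain j where j: "j < length ss" "ss ! j = S'" using mem(1) unfolding in_set_conv_nth by blast
        have "collected k E S' (sts ! j) s" using s(2) j by (auto simp: list_all2_conv_all_nth)
        thus ?thesis using mem by (auto simp: collected_def)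
      qed
      fix c
      have "completion (table s) (al_of s) sims (Suc k) E = vec (table_step \<theta> p (table s) k E sts)"
        if "table s E (Suc k) = None" "sims (E, k) = ss" for sims
        by (rule table_step_eq[where ss = ss and sts = sts and s = s and sims = sims,
              OF s(1) k E that(1) conjunct2[OF s(2)] ss(1) that(2) sts filled])
      moreover have "al_of (s\<lparr>clock := c\<rparr>) = al_of s" by (intro ext) (simp add: al_of_def)
      ultimately show "?Post (table_step \<theta> p (table s) k E sts) (s\<lparr>clock := c\<rparr>)"
        using s(2) by (simp add: table_step_def Let_def)
    qed
  qed
qed

text \<open>
  Storing the value that completion assigns turns the point mass at the drawn trajectories back
  into an unused fresh draw.
\<close>

lemma Comp_store:
  assumes E: "E \<in> histories" and k: "k < K" and none: "table s E (Suc k) = None"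
    and x: "\<And>sims. sims (E, k) = ss \<Longrightarrow> completion (table s) (al_of s) sims (Suc k) E = vec x"
    and s': "s' = s\<lparr>table := (table s)(E := (table s E)(Suc k := Some x))\<rparr>"
  shows "Comp d s' = Comp (d((E, k) := return_pmf ss)) s"
proof -
  define B where "B = histories \<times> {..<K} - {(E, k)}"
  have B: "histories \<times> {..<K} = insert (E, k) B" "finite B" "(E, k) \<notin> B"
    unfolding B_def using E k finite_histories by auto
  let ?c = "completion (table s) (al_of s)" and ?c' = "completion (table s') (al_of s)"
  have al: "al_of s' = al_of s" by (intro ext) (simp add: al_of_def s')
  have irr: "?c' (f((E, k) := v)) j E' = ?c' f j E'" for f v j E'
  proof (induction j arbitrary: E' rule: less_induct)
    case (less j)
    show ?case
    proof (cases j)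
      case (Suc i)
      have IH: "?c' (f((E, k) := v)) i = ?c' f i"
        by (rule ext, rule less) (simp add: Suc)
      have IH': "?c' (f((E, k) := v)) (i - 1) = ?c' f (i - 1)"
        by (rule ext, rule less) (simp add: Suc)
      show ?thesis
      proof (cases "(E', i) = (E, k)")
        case True
        thus ?thesis unfolding Suc by (simp add: s')
      next
        case False
        hence "(f((E, k) := v)) (E', i) = f (E', i)" by (rule fun_upd_other)
        thus ?thesis unfolding Suc completion.simps IH IH' gradient_def by (simp only:)
      qed
    qed simp
  qed
  have same: "?c' f j E' = ?c f j E'" if "f (E, k) = ss" for f j E'
  proof (induction j arbitrary: E' rule: less_induct)
    case (less j)
    show ?case
    proof (cases j)
      case (Suc i)
      have IH: "?c' f i = ?c f i" "?c' f (i - 1) = ?c f (i - 1)" using less Suc by auto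
      show ?thesis
      proof (cases "E' = E \<and> i = k")
        case True
        thus ?thesis using x[of f, OF that] Suc by (simp add: s')
      next
        case False
        hence "table s' E' (Suc i) = table s E' (Suc i)" by (auto simp: s')
        thus ?thesis unfolding Suc completion.simps IH by (simp only:)
      qed
    qed simp
  qed
  have cong: "Pi_pmf B [] (d((E, k) := return_pmf ss)) = Pi_pmf B [] d"
    by (rule Pi_pmf_cong) (use B in auto)
  have "Comp d s' = bind_pmf (d (E, k)) (\<lambda>y. map_pmf (\<lambda>f. ?c' (f((E, k) := y))) (Pi_pmf B [] d))"
    unfolding Comp_def al B(1) Pi_pmf_insert'[OF B(2,3)] by (simp add: map_bind_pmf map_pmf_def bind_assoc_pmf bind_return_pmf)
  also have "\<dots> = map_pmf ?c' (Pi_pmf B [] d)"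
  proof -
    have "?c' (f((E, k) := y)) = ?c' f" for f y by (intro ext) (simp only: irr)
    thus ?thesis by simp
  qed
  also have "\<dots> = map_pmf (\<lambda>f. ?c (f((E, k) := ss))) (Pi_pmf B [] d)"
  proof (rule map_pmf_cong[OF refl])
    fix f
    have "?c (f((E, k) := ss)) = ?c' (f((E, k) := ss))" by (intro ext) (simp add: same)
    also have "\<dots> = ?c' f" by (intro ext) (simp only: irr)
    finally show "?c' f = ?c (f((E, k) := ss))" by simp
  qed
  also have "\<dots> = Comp (d((E, k) := return_pmf ss)) s"
    unfolding Comp_def B(1) Pi_pmf_insert'[OF B(2,3)] cong
    by (simp add: map_bind_pmf map_pmf_def bind_assoc_pmf bind_return_pmf)
  finally show ?thesis .
qed

text \<open>
  By induction on the round.  The trajectories drawn for the entry are split off from the completion as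
  point masses, the recursive calls preserve its law for these, and \<open>Comp_store\<close> absorbs them into the entry.
\<close>

theorem safe_R:
  assumes "k \<le> K" "E \<in> histories" "agree d k"
  shows "safe k d (\<lambda>_. True) (round_time k) (R \<theta> p k E) (\<lambda>_ s. table s E k \<noteq> None)"
  using assms
proof (induction k arbitrary: E d)
  case 0
  show ?case unfolding R.simps round_time.simps safe_def ret_def
    using extends_refl by (auto simp: bind_return_pmf good_def)
next
  case (Suc k)
  have k: "k < K" and E: "E \<in> histories" using Suc.prems by auto
  have dE: "d (E, k) = sim_dist p E" using Suc.prems by (simp add: agree_def)
  have agree: "agree (d((E, k) := return_pmf ss)) k" for ss using Suc.prems(3) by (auto simp: agree_def)
  have IH: "safe k (d((E, k) := return_pmf ss)) (\<lambda>_. True) (round_time k) (R \<theta> p k E') (\<lambda>_ s. table s E' k \<noteq> None)"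
    if "E' \<in> histories" for E' ss
    by (rule Suc.IH[OF _ that agree]) (use k in simp)
  define nrec where "nrec = 1 + (round_time k +
     (n1 * ((1 + (n2 * (1 + 1) + (n2 * ((1 + round_time k) + 1) + 0))) + 1) + update_time n1 n2))"
  have time: "round_time (Suc k) = 1 + (n1 * (sim_cost I + 1) + nrec)" by (simp add: nrec_def)
  have nrec: "0 \<le> nrec" unfolding nrec_def
    using round_time_nonneg[of k] update_time_nonneg by (intro add_nonneg_nonneg mult_nonneg_nonneg) auto
  show ?case unfolding safe_def
  proof (intro allI impI)
    fix s assume s: "good s"
    obtain c where c: "c \<le> clock s + 1" "emptyM E (Suc k) s = return_pmf (table s E (Suc k) = None, s\<lparr>clock := c\<rparr>)"
      using computesD[OF computes_emptyM] .
    show "(\<forall>y\<in>set_pmf (R \<theta> p (Suc k) E s). good (snd y) \<and> extends (Suc k) s (snd y) \<and>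
        clock (snd y) \<le> clock s + round_time (Suc k) \<and> table (snd y) E (Suc k) \<noteq> None) \<and>
      bind_pmf (R \<theta> p (Suc k) E s) (\<lambda>y. Comp d (snd y)) = Comp d s"
    proof (cases "table s E (Suc k) = None")
      case False
      have "R \<theta> p (Suc k) E s = return_pmf ((), s\<lparr>clock := c\<rparr>)"
        unfolding R_Suc bind_prog_def c(2) using False by (simp add: bind_return_pmf ret_def)
      moreover have "c \<le> clock s + round_time (Suc k)" proof -
        have "0 \<le> n1 * (sim_cost I + 1)" using wf_simps by simp
        thus ?thesis using c(1) nrec unfolding time by linarith
      qed
      ultimately show ?thesis using False s extends_refl by (auto simp: bind_return_pmf)
    next
      case True
      define s1 where "s1 = s\<lparr>clock := c + num_sims p * (sim_cost I + 1)\<rparr>"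
      define store where "store x t = t\<lparr>table := (table t)(E := (table t E)(Suc k := Some x))\<rparr>" for x and t :: machine
      have run: "R \<theta> p (Suc k) E s = bind_pmf (sim_dist p E) (\<lambda>ss. bind_pmf (recompute k E ss s1) (\<lambda>y. return_pmf ((), store (fst y) (snd y))))"
        unfolding R_Suc bind_prog_def c(2) using True
        by (simp add: bind_return_pmf mapM_timed_draw bind_map_pmf storeM_def update_def case_prod_unfold s1_def store_def)
      have good1: "good s1" using s by (simp add: s1_def)
      have ext1: "extends k s t" if "extends k s1 t" for t using that by (simp add: s1_def extends_def)
      have rc: "good (snd y) \<and> extends k s1 (snd y) \<and> clock (snd y) \<le> clock s1 + nrec \<and>
          length (fst y) = q \<and> table (snd y) E k \<noteq> None \<and> table (snd y) E (Suc k) = None \<and>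
          (\<forall>sims. sims (E, k) = ss \<longrightarrow> completion (table (snd y)) (al_of (snd y)) sims (Suc k) E = vec (fst y))"
        and rcC: "bind_pmf (recompute k E ss s1) (\<lambda>y. Comp (d((E, k) := return_pmf ss)) (snd y)) = Comp (d((E, k) := return_pmf ss)) s1"
        if ss: "ss \<in> set_pmf (sim_dist p E)" "y \<in> set_pmf (recompute k E ss s1)" for ss y
      proof -
        have ss': "set ss \<subseteq> trajectories" "length ss = num_sims p"
          using ss(1) set_SIM[OF E] by (auto simp: set_replicate_pmf)
        note sr = safe_recompute[OF IH E k ss', folded nrec_def, unfolded safe_def, rule_format, OF _ good1 TrueI]
        have ex: "extends k s1 (snd y)" using sr ss(2) by blast
        have "table (snd y) E (Suc k) = table s1 E (Suc k)" using ex by (simp add: extends_def)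
        hence "table (snd y) E (Suc k) = None" using True by (simp add: s1_def)
        thus "good (snd y) \<and> extends k s1 (snd y) \<and> clock (snd y) \<le> clock s1 + nrec \<and>
          length (fst y) = q \<and> table (snd y) E k \<noteq> None \<and> table (snd y) E (Suc k) = None \<and>
          (\<forall>sims. sims (E, k) = ss \<longrightarrow> completion (table (snd y)) (al_of (snd y)) sims (Suc k) E = vec (fst y))"
          using sr ss(2) by blast
        show "bind_pmf (recompute k E ss s1) (\<lambda>y. Comp (d((E, k) := return_pmf ss)) (snd y)) = Comp (d((E, k) := return_pmf ss)) s1"
          using sr by blast
      qed
      show ?thesis
      proof
        show "\<forall>y\<in>set_pmf (R \<theta> p (Suc k) E s). good (snd y) \<and> extends (Suc k) s (snd y) \<and>
          clock (snd y) \<le> clock s + round_time (Suc k) \<and> table (snd y) E (Suc k) \<noteq> None"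
        proof
          fix z assume "z \<in> set_pmf (R \<theta> p (Suc k) E s)"
          then obtain ss y where ss: "ss \<in> set_pmf (sim_dist p E)" "y \<in> set_pmf (recompute k E ss s1)"
            and z: "snd z = store (fst y) (snd y)" unfolding run by auto
          note r = rc[OF ss]
          let ?t = "snd y"
          have "good (store (fst y) ?t)"
          proof -
            have g: "good ?t" using r by blast
            have "table ?t E k \<noteq> None" "length (fst y) = q" using r by auto
            moreover have "vec (fst y) \<in> Q0"
            proof -
              have all: "\<forall>sims. sims (E, k) = ss \<longrightarrow> completion (table ?t) (al_of ?t) sims (Suc k) E = vec (fst y)"
                using r by (elim conjE)
              have "completion (table ?t) (al_of ?t) (\<lambda>_. ss) (Suc k) E = vec (fst y)"
                by (rule all[rule_format]) (rule refl)
              moreover have "completion (table ?t) (al_of ?t) (\<lambda>_. ss) (Suc k) E \<in> Q0"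
                using r by (simp only: completion_None proj_Q0[OF wf_simps(3)])
              ultimately show ?thesis by simp
            qed
            ultimately show ?thesis using g unfolding good_def store_def by (auto simp: fun_upd_def)
          qed
          moreover have "extends (Suc k) s (store (fst y) ?t)"
          proof -
            have "extends k s ?t" using r ext1 by blast
            thus ?thesis using True unfolding extends_def store_def by (auto simp: fun_upd_def)
          qed
          moreover have "clock (store (fst y) ?t) \<le> clock s + round_time (Suc k)"
            using r c(1) unfolding time by (simp add: s1_def store_def)
          ultimately show "good (snd z) \<and> extends (Suc k) s (snd z) \<and>
            clock (snd z) \<le> clock s + round_time (Suc k) \<and> table (snd z) E (Suc k) \<noteq> None"
            unfolding z by (simp add: store_def)
        qed
        have "bind_pmf (R \<theta> p (Suc k) E s) (\<lambda>y. Comp d (snd y))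
            = bind_pmf (sim_dist p E) (\<lambda>ss. bind_pmf (recompute k E ss s1) (\<lambda>y. Comp d (store (fst y) (snd y))))"
          unfolding run by (simp add: bind_assoc_pmf bind_return_pmf)
        also have "\<dots> = bind_pmf (sim_dist p E) (\<lambda>ss. bind_pmf (recompute k E ss s1) (\<lambda>y. Comp (d((E, k) := return_pmf ss)) (snd y)))"
        proof (intro bind_pmf_cong refl)
          fix ss y assume ss: "ss \<in> set_pmf (sim_dist p E)" "y \<in> set_pmf (recompute k E ss s1)"
          note r = rc[OF ss]
          show "Comp d (store (fst y) (snd y)) = Comp (d((E, k) := return_pmf ss)) (snd y)"
            by (rule Comp_store[OF E k _ _ store_def]) (use r in auto)
        qed
        also have "\<dots> = bind_pmf (sim_dist p E) (\<lambda>ss. Comp (d((E, k) := return_pmf ss)) s1)"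
        proof (intro bind_pmf_cong refl)
          fix ss assume ss: "ss \<in> set_pmf (sim_dist p E)"
          obtain y where "y \<in> set_pmf (recompute k E ss s1)" using set_pmf_not_empty by fast
          from rcC[OF ss this]
          show "bind_pmf (recompute k E ss s1) (\<lambda>y. Comp (d((E, k) := return_pmf ss)) (snd y)) = Comp (d((E, k) := return_pmf ss)) s1" .
        qed
        also have "\<dots> = Comp d s"
        proof -
          have "Pi_pmf (histories \<times> {..<K}) [] d = bind_pmf (sim_dist p E) (\<lambda>ss. Pi_pmf (histories \<times> {..<K}) [] (d((E, k) := return_pmf ss)))"
            unfolding dE[symmetric] by (rule Pi_pmf_split_coordinate) (use E k finite_histories in auto)
          hence "Comp d s = bind_pmf (sim_dist p E) (\<lambda>ss. Comp (d((E, k) := return_pmf ss)) s)"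
            unfolding Comp_def by (simp add: map_bind_pmf)
          thus ?thesis by (simp add: s1_def)
        qed
        finally show "bind_pmf (R \<theta> p (Suc k) E s) (\<lambda>y. Comp d (snd y)) = Comp d s" .
      qed
    qed
  qed
qed

section \<open>The decisions before rounding\<close>

definition readout :: "hist \<Rightarrow> real list prog" where
  "readout E = (if averaged p
     then mapM (\<lambda>l. do {
            h \<leftarrow> sumM (\<lambda>j. do { x \<leftarrow> entryM E j; ret (x ! l) }) [1..<Suc (rounds p)];
            divM h (rounds p) }) [0..<q]
     else entryM E (rounds p))"

definition decide_core :: "hist \<Rightarrow> real list prog" where
  "decide_core E = do { R \<theta> p K E; readout E }"

definition out :: "(nat \<Rightarrow> hist \<Rightarrow> nat \<Rightarrow> real) \<Rightarrow> hist \<Rightarrow> nat \<Rightarrow> real" where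
  "out Y E l = (if averaged p then 1 / K * (\<Sum>j=1..K. Y j E l) else Y K E l)"

definition core_time :: real where
  "core_time = round_time K + real q * (2 * real K + 2)"

abbreviation fresh :: "hist \<times> nat \<Rightarrow> hist list pmf" where
  "fresh \<equiv> \<lambda>(E, k). sim_dist p E"

lemma safe_decide_core:
  assumes E: "E \<in> histories"
  shows "safe K fresh (\<lambda>_. True) core_time (decide_core E)
    (\<lambda>x s. length x = q \<and> (\<forall>Y\<in>set_pmf (Comp fresh s). x = map (out Y E) [0..<q]))"
  unfolding decide_core_def core_time_def
proof (rule safe_bind[OF safe_R[OF order_refl E]])
  show "agree fresh K" by (simp add: agree_def)
  fix u :: unit
  show "safe K fresh (\<lambda>s. table s E K \<noteq> None) (real q * (2 * real K + 2)) (readout E)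
    (\<lambda>x s. length x = q \<and> (\<forall>Y\<in>set_pmf (Comp fresh s). x = map (out Y E) [0..<q]))"
  proof (rule safe_computes)
    fix s assume s: "good s" "table s E K \<noteq> None"
    let ?v = "\<lambda>s. if averaged p then map (\<lambda>l. (\<Sum>j\<leftarrow>[1..<Suc K]. the (table s E j) ! l) / K) [0..<q] else the (table s E K)"
    show "computes (real q * (2 * real K + 2)) (readout E) s (?v s)"
    proof (cases "averaged p")
      case True
      have "computes (real (length [0..<q]) * ((real (length [1..<Suc K]) * ((0 + 0) + 2) + 1) + 1))
          (mapM (\<lambda>l. do {
            h \<leftarrow> sumM (\<lambda>j. do { x \<leftarrow> entryM E j; ret (x ! l) }) [1..<Suc K];
            divM h K }) [0..<q]) s (map (\<lambda>l. (\<Sum>j\<leftarrow>[1..<Suc K]. the (table s E j) ! l) / K) [0..<q])"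
        by (rule computes_mapM, rule computes_bind[OF computes_sumM[OF computes_bind[OF computes_entryM computes_ret]] computes_op1])
      thus ?thesis using True unfolding readout_def by (simp add: algebra_simps del: upt_Suc)
    next
      case False
      thus ?thesis unfolding readout_def by (simp, intro computes_weaken[OF computes_entryM]) simp
    qed
    fix c
    have len: "length (the (table s E K)) = q" using s unfolding good_def by auto
    have Y: "Y j E l = the (table s E j) ! l" if Y: "Y \<in> set_pmf (Comp fresh s)" and j: "j \<le> K" and l: "l < q" for Y j l
    proof -
      obtain x where x: "table s E j = Some x" using good_below[OF s j] by auto
      obtain f where "Y = completion (table s) (al_of s) f" using Y by (auto simp: Comp_def)
      hence "Y j E = vec x" using completion_entry[OF s(1) x] by simp
      thus ?thesis using x l by (simp add: vec_def)
    qed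
    have "?v s = map (out Y E) [0..<q]" if "Y \<in> set_pmf (Comp fresh s)" for Y
    proof (cases "averaged p")
      case True
      have "(\<Sum>j\<leftarrow>[1..<Suc K]. the (table s E j) ! l) = (\<Sum>j=1..K. Y j E l)" if "l < q" for l
        unfolding interv_sum_list_conv_sum_set_nat set_upt
        by (rule sum.cong) (use Y[OF \<open>Y \<in> set_pmf (Comp fresh s)\<close>] that in auto)
      thus ?thesis using True by (simp add: out_def del: upt_Suc)
    next
      case False
      thus ?thesis using len Y[OF that, of K] by (auto simp: out_def intro!: nth_equalityI)
    qed
    thus "length (?v s) = q \<and> (\<forall>Y\<in>set_pmf (Comp fresh (s\<lparr>clock := c\<rparr>)). ?v s = map (out Y E) [0..<q])"
      using len by simp
  qed
qed


end

section \<open>Rounding and patching on the fly\<close>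

lemma pmf_bernoulli_bind:
  assumes "0 \<le> c" "c \<le> 1"
  shows "pmf (bind_pmf (bernoulli_pmf c) f) j = c * pmf (f True) j + (1 - c) * pmf (f False) j"
  unfolding pmf_bind using assms by (subst integral_bernoulli_pmf) auto

lemma categoricalM_step:
  "categoricalM l rest (x # y # xs) s = bind_pmf (bernoulli_pmf (x / rest)) (\<lambda>c.
      if c then return_pmf (l, s\<lparr>clock := clock s + 2\<rparr>) else categoricalM (Suc l) (rest - x) (y # xs) (s\<lparr>clock := clock s + 3\<rparr>))"
proof -
  have "categoricalM l rest (x # y # xs) s = bind_pmf (bernoulli_pmf (x / rest)) (\<lambda>c. (if c then ret l
     else do { rest' \<leftarrow> subM rest x; categoricalM (Suc l) rest' (y # xs) }) (s\<lparr>clock := clock s + 2\<rparr>))"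
    by (simp add: bind_prog_def op1_def tick_def update_def ret_def bernoulliM_def timed_draw_apply
        bind_return_pmf bind_map_pmf add.assoc)
  also have "\<dots> = bind_pmf (bernoulli_pmf (x / rest)) (\<lambda>c.
      if c then return_pmf (l, s\<lparr>clock := clock s + 2\<rparr>) else categoricalM (Suc l) (rest - x) (y # xs) (s\<lparr>clock := clock s + 3\<rparr>))"
    by (intro bind_pmf_cong refl) (simp add: ret_def bind_prog_def op1_def tick_def update_def bind_return_pmf add.assoc)
  finally show ?thesis .
qed

lemma categoricalM_clock:
  "z \<in> set_pmf (categoricalM l rest xs s) \<Longrightarrow> \<exists>c\<le>clock s + 3 * length xs. snd z = s\<lparr>clock := c\<rparr>"
proof (induction xs arbitrary: l rest s)
  case Nil
  thus ?case by (intro exI[of _ "clock s"]) (simp add: ret_def)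
next
  case (Cons x xs)
  show ?case
  proof (cases xs)
    case Nil
    thus ?thesis using Cons.prems by (intro exI[of _ "clock s"]) (simp add: ret_def)
  next
    case (Cons y ys)
    obtain c where zc: "z \<in> set_pmf (if c then return_pmf (l, s\<lparr>clock := clock s + 2\<rparr>)
        else categoricalM (Suc l) (rest - x) xs (s\<lparr>clock := clock s + 3\<rparr>))"
      using Cons.prems unfolding Cons categoricalM_step by auto
    show ?thesis
    proof (cases c)
      case True
      thus ?thesis using zc by (intro exI[of _ "clock s + 2"]) simp
    next
      case False
      hence z: "z \<in> set_pmf (categoricalM (Suc l) (rest - x) xs (s\<lparr>clock := clock s + 3\<rparr>))" using zc by simp
      from Cons.IH[OF z] show ?thesis by (auto simp: algebra_simps)
    qed
  qed
qed

text \<open>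
  A trial succeeds with the weight of its option relative to the weight that is left, so that the
  probabilities of the failures before it cancel telescopically.
\<close>

lemma categoricalM_pmf:
  assumes "xs \<noteq> []" "\<And>x. x \<in> set xs \<Longrightarrow> 0 \<le> x" "sum_list xs = rest" "0 < rest"
  shows "pmf (map_pmf fst (categoricalM l rest xs s)) j = (if l \<le> j \<and> j < l + length xs then xs ! (j - l) / rest else 0)"
  using assms
proof (induction xs arbitrary: l rest s)
  case (Cons x xs)
  note x0 = Cons.prems(2)[of x]
  show ?case
  proof (cases xs)
    case Nil
    thus ?thesis using Cons.prems by (auto simp: ret_def indicator_def)
  next
    case (Cons y ys)
    have nn: "\<And>z. z \<in> set xs \<Longrightarrow> 0 \<le> z" using Cons.prems(2) by simp
    have sum: "sum_list xs = rest - x" using Cons.prems(3) by simp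
    have "0 \<le> sum_list xs" using nn by (intro sum_list_nonneg) auto
    hence p: "0 \<le> x / rest" "x / rest \<le> 1" using x0 sum Cons.prems(4) by auto
    let ?rec = "\<lambda>s. pmf (map_pmf fst (categoricalM (Suc l) (rest - x) xs s)) j"
    have "pmf (map_pmf fst (categoricalM l rest (x # xs) s)) j
        = x / rest * pmf (return_pmf l) j + (1 - x / rest) * ?rec (s\<lparr>clock := clock s + 3\<rparr>)"
      unfolding Cons categoricalM_step map_bind_pmf by (subst pmf_bernoulli_bind[OF p]) simp
    also have "(1 - x / rest) * ?rec (s\<lparr>clock := clock s + 3\<rparr>)
        = (if Suc l \<le> j \<and> j < Suc l + length xs then xs ! (j - Suc l) / rest else 0)"
    proof (cases "rest - x = 0")
      case True
      have "xs ! (j - Suc l) = 0" if "j < Suc l + length xs" "Suc l \<le> j"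
      proof -
        have "\<forall>z\<in>set xs. z = 0" using sum True nn sum_list_nonneg_eq_0_iff[of xs] by simp
        moreover have "xs ! (j - Suc l) \<in> set xs" using that by (intro nth_mem) auto
        ultimately show ?thesis by blast
      qed
      thus ?thesis using True Cons.prems(4) by simp
    next
      case False
      hence "0 < rest - x" using \<open>0 \<le> sum_list xs\<close> sum by simp
      moreover have "xs \<noteq> []" using Cons by simp
      ultimately have "?rec (s\<lparr>clock := clock s + 3\<rparr>) = (if Suc l \<le> j \<and> j < Suc l + length xs then xs ! (j - Suc l) / (rest - x) else 0)"
        using Cons.IH[of "rest - x" "Suc l"] nn sum by blast
      thus ?thesis using False Cons.prems(4) by (simp add: field_simps)
    qed
    finally show ?thesis using Cons.prems(4)
      by (cases "j = l") (auto simp: indicator_def nth_Cons' Suc_le_eq)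
  qed
qed simp

text \<open>Programs that are deterministic but may change \<open>used\<close>.\<close>

definition acts :: "real \<Rightarrow> 'a prog \<Rightarrow> machine \<Rightarrow> 'a \<Rightarrow> (nat \<Rightarrow> real) \<Rightarrow> bool" where
  "acts n P s v u \<longleftrightarrow> (\<forall>c. \<exists>c'. c' \<le> c + n \<and> P (s\<lparr>clock := c\<rparr>) = return_pmf (v, s\<lparr>clock := c', used := u\<rparr>))"

lemma actsD:
  assumes "acts n P s v u"
  obtains c where "c \<le> clock s + n" "P s = return_pmf (v, s\<lparr>clock := c, used := u\<rparr>)"
proof -
  have "s = s\<lparr>clock := clock s\<rparr>" by simp
  thus ?thesis using assms that unfolding acts_def by metis
qed

lemma acts_weaken: "acts n P s v u \<Longrightarrow> v = v' \<Longrightarrow> u = u' \<Longrightarrow> n \<le> n' \<Longrightarrow> acts n' P s v' u'"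
  unfolding acts_def by (meson add_left_mono order_trans)

lemma acts_computes: "computes n P s v \<Longrightarrow> acts n P s v (used s)"
  unfolding computes_def acts_def by simp

lemma acts_bind:
  assumes "acts n1 P s v u" "acts n2 (f v) (s\<lparr>used := u\<rparr>) w u'"
  shows "acts (n1 + n2) (bind_prog P f) s w u'"
  unfolding acts_def
proof
  fix c
  obtain c1 where c1: "c1 \<le> c + n1" "P (s\<lparr>clock := c\<rparr>) = return_pmf (v, s\<lparr>clock := c1, used := u\<rparr>)"
    using assms(1) unfolding acts_def by blast
  obtain c2 where c2: "c2 \<le> c1 + n2" "f v (s\<lparr>used := u, clock := c1\<rparr>) = return_pmf (w, s\<lparr>used := u, clock := c2, used := u'\<rparr>)"
    using assms(2) unfolding acts_def by blast
  have eq: "s\<lparr>clock := c1, used := u\<rparr> = s\<lparr>used := u, clock := c1\<rparr>"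
    "s\<lparr>used := u, clock := c2, used := u'\<rparr> = s\<lparr>clock := c2, used := u'\<rparr>" by simp_all
  have "bind_prog P f (s\<lparr>clock := c\<rparr>) = f v (s\<lparr>used := u, clock := c1\<rparr>)"
    unfolding bind_prog_def c1(2) eq(1) bind_return_pmf by (simp only: prod.case)
  hence "bind_prog P f (s\<lparr>clock := c\<rparr>) = return_pmf (w, s\<lparr>clock := c2, used := u'\<rparr>)"
    unfolding c2(2) eq(2) .
  thus "\<exists>c'. c' \<le> c + (n1 + n2) \<and> bind_prog P f (s\<lparr>clock := c\<rparr>) = return_pmf (w, s\<lparr>clock := c', used := u'\<rparr>)"
    using c1(1) c2(1) by (intro exI[of _ c2]) simp
qed

lemma acts_computes_bind: "computes n1 P s v \<Longrightarrow> acts n2 (f v) s w u' \<Longrightarrow> acts (n1 + n2) (bind_prog P f) s w u'"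
  by (rule acts_bind[OF acts_computes, of n1 P s v n2 f]) simp_all

lemma acts_get: "(\<And>c. acts n (f (s\<lparr>clock := c\<rparr>)) s v u) \<Longrightarrow> acts n (bind_prog get f) s v u"
  unfolding acts_def bind_prog_def get_def by (simp add: bind_return_pmf)

lemma acts_update_used: "acts 0 (update (\<lambda>s. s\<lparr>used := (used s)(i := v)\<rparr>)) s () ((used s)(i := v))"
  unfolding acts_def update_def by auto

lemma used_of_update: "used (s\<lparr>used := u\<rparr>) = u"
  by simp

lemma acts_mapM_used:
  fixes g :: "nat \<Rightarrow> real"
  assumes "distinct xs"
  shows "acts (real (length xs) * 3) (mapM (\<lambda>i. do {
       s \<leftarrow> get;
       c \<leftarrow> mulM (g i) f;
       u \<leftarrow> addM (used s i) c;
       update (\<lambda>s. s\<lparr>used := (used s)(i := u)\<rparr>) }) xs) s (replicate (length xs) ())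
     (\<lambda>i. if i \<in> set xs then used s i + g i * f else used s i)"
  using assms
proof (induction xs arbitrary: s)
  case Nil
  thus ?case using acts_computes[OF computes_ret, of "[]" s] by simp
next
  case (Cons x xs)
  let ?body = "\<lambda>i. do {
       s \<leftarrow> get;
       c \<leftarrow> mulM (g i) f;
       u \<leftarrow> addM (used s i) c;
       update (\<lambda>s. s\<lparr>used := (used s)(i := u)\<rparr>) }"
  let ?u = "(used s)(x := used s x + g x * f)"
  let ?u' = "\<lambda>i. if i \<in> set (x # xs) then used s i + g i * f else used s i"
  have 1: "acts (1 + (1 + 0)) (?body x) s () ?u"
    by (rule acts_get, rule acts_computes_bind[OF computes_op1], rule acts_computes_bind[OF computes_op1])
       (use acts_update_used in simp)
  have "(\<lambda>i. if i \<in> set xs then ?u i + g i * f else ?u i) = ?u'"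
    using Cons.prems by (intro ext) auto
  hence 2: "acts (real (length xs) * 3) (mapM ?body xs) (s\<lparr>used := ?u\<rparr>) (replicate (length xs) ()) ?u'"
    using Cons.IH[of "s\<lparr>used := ?u\<rparr>"] Cons.prems
    by (simp only: used_of_update distinct.simps simp_thms)
  have 3: "acts 0 (ret (() # replicate (length xs) ())) (s\<lparr>used := ?u\<rparr>\<lparr>used := ?u'\<rparr>) (replicate (length (x # xs)) ()) ?u'"
    using acts_computes[OF computes_ret, of "() # replicate (length xs) ()" "s\<lparr>used := ?u\<rparr>\<lparr>used := ?u'\<rparr>"] by simp
  have "acts (1 + ((1 + (1 + 0)) + (real (length xs) * 3 + 0))) (mapM ?body (x # xs)) s (replicate (length (x # xs)) ()) ?u'"
    unfolding mapM.simps
    by (rule acts_computes_bind[OF computes_tick], rule acts_bind[OF 1], rule acts_bind[OF 2], rule 3)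
  moreover have "1 + ((1 + (1 + 0)) + (real (length xs) * 3 + 0)) = real (length (x # xs)) * 3" by simp
  ultimately show ?case by (simp only:)
qed

context nrm
begin

definition patch_value :: "(nat \<Rightarrow> real) \<Rightarrow> hist \<Rightarrow> nat \<Rightarrow> real \<Rightarrow> real" where
  "patch_value u E r x = foldl (\<lambda>f i. min f ((b i - u i) / a r i E)) x (sorted_list_of_set (aplus r E))"

definition patch_used :: "(nat \<Rightarrow> real) \<Rightarrow> hist \<Rightarrow> nat \<Rightarrow> real \<Rightarrow> nat \<Rightarrow> real" where
  "patch_used u E r f = (\<lambda>i. if i \<in> aplus r E then u i + a r i E * f else u i)"

primrec run_patches :: "hist \<Rightarrow> nat \<Rightarrow> nat list \<Rightarrow> (nat \<Rightarrow> real) \<Rightarrow> real list \<times> (nat \<Rightarrow> real)" where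
  "run_patches E rh [] u = ([], u)"
| "run_patches E rh (r # rs) u = (let f = patch_value u E r (if r = rh then 1 else 0);
     y = run_patches E rh rs (patch_used u E r f) in (f # fst y, snd y))"

definition decision :: "(nat \<Rightarrow> real) \<Rightarrow> hist \<Rightarrow> nat \<Rightarrow> real list \<times> (nat \<Rightarrow> real)" where
  "decision u E rh = (let y = run_patches E rh [1..<q] u; fs = (1 - sum_list (fst y)) # fst y
     in (if \<forall>f\<in>set fs. f = 0 \<or> f = 1 then fs else null_list, snd y))"

lemma acts_patchM:
  assumes "card (aplus r E) \<le> L" and fin: "finite (aplus r E)"
  shows "acts (7 * real L) (patchM E r x) s (patch_value (used s) E r x) (patch_used (used s) E r (patch_value (used s) E r x))"
proof -
  let ?xs = "sorted_list_of_set (aplus r E)" and ?f = "patch_value (used s) E r x"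
  have 1: "computes (real (length ?xs) * ((1 + (1 + 1)) + 1)) (foldM (\<lambda>f i. do {
            s \<leftarrow> get;
            d \<leftarrow> subM (b i) (used s i);
            c \<leftarrow> divM d (a r i E);
            minM f c }) x ?xs) s ?f"
    unfolding patch_value_def
    by (rule computes_foldM, rule computes_get) (use computes_bind[OF computes_op1 computes_bind[OF computes_op1 computes_op1]] in simp)
  have 2: "acts (real (length ?xs) * 3) (mapM (\<lambda>i. do {
       s \<leftarrow> get;
       c \<leftarrow> mulM (a r i E) ?f;
       u \<leftarrow> addM (used s i) c;
       update (\<lambda>s. s\<lparr>used := (used s)(i := u)\<rparr>) }) ?xs) s (replicate (length ?xs) ()) (patch_used (used s) E r ?f)"
    using acts_mapM_used[of ?xs "\<lambda>i. a r i E" ?f s] fin unfolding patch_used_def by simp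
  have 3: "acts 0 (ret ?f) (s\<lparr>used := patch_used (used s) E r ?f\<rparr>) ?f (patch_used (used s) E r ?f)"
    using acts_computes[OF computes_ret, of ?f "s\<lparr>used := patch_used (used s) E r ?f\<rparr>"] by simp
  have "acts (real (length ?xs) * ((1 + (1 + 1)) + 1) + (real (length ?xs) * 3 + 0)) (patchM E r x) s ?f (patch_used (used s) E r ?f)"
    unfolding patchM_def
    by (rule acts_computes_bind[OF 1], rule acts_bind[OF 2], rule 3)
  thus ?thesis by (rule acts_weaken) (use assms in simp_all)
qed

lemma acts_run_patches:
  assumes "\<And>r. r \<in> set rs \<Longrightarrow> card (aplus r E) \<le> L" "\<And>r. finite (aplus r E)"
  shows "acts (real (length rs) * (7 * real L + 2)) (mapM (\<lambda>r. do { c \<leftarrow> op1 (r = rh); patchM E r (if c then 1 else 0) }) rs) s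
     (fst (run_patches E rh rs (used s))) (snd (run_patches E rh rs (used s)))"
  using assms(1)
proof (induction rs arbitrary: s)
  case Nil
  thus ?case using acts_computes[OF computes_ret, of "[]" s] by simp
next
  case (Cons r rs)
  let ?f = "patch_value (used s) E r (if r = rh then 1 else 0)"
  let ?u = "patch_used (used s) E r ?f"
  let ?y = "run_patches E rh rs ?u"
  have 1: "acts (1 + 7 * real L) (do { c \<leftarrow> op1 (r = rh); patchM E r (if c then 1 else 0) }) s ?f ?u"
    by (rule acts_computes_bind[OF computes_op1], rule acts_patchM) (use Cons.prems assms(2) in auto)
  have 2: "acts (real (length rs) * (7 * real L + 2)) (mapM (\<lambda>r. do { c \<leftarrow> op1 (r = rh); patchM E r (if c then 1 else 0) }) rs)
      (s\<lparr>used := ?u\<rparr>) (fst ?y) (snd ?y)"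
    using Cons.IH[of "s\<lparr>used := ?u\<rparr>"] Cons.prems by simp
  have 3: "acts 0 (ret (?f # fst ?y)) (s\<lparr>used := ?u\<rparr>\<lparr>used := snd ?y\<rparr>) (?f # fst ?y) (snd ?y)"
    using acts_computes[OF computes_ret, of "?f # fst ?y" "s\<lparr>used := ?u\<rparr>\<lparr>used := snd ?y\<rparr>"] by simp
  have "acts (1 + ((1 + 7 * real L) + (real (length rs) * (7 * real L + 2) + 0)))
      (mapM (\<lambda>r. do { c \<leftarrow> op1 (r = rh); patchM E r (if c then 1 else 0) }) (r # rs)) s (?f # fst ?y) (snd ?y)"
    unfolding mapM.simps
    by (rule acts_computes_bind[OF computes_tick], rule acts_bind[OF 1], rule acts_bind[OF 2], rule 3)
  thus ?case by (simp add: Let_def algebra_simps)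
qed

lemma length_run_patches: "length (fst (run_patches E rh rs u)) = length rs"
  by (induction rs arbitrary: u) (simp_all add: Let_def)

definition finish :: "hist \<Rightarrow> nat \<Rightarrow> real list prog" where
  "finish E rh = do {
     fs \<leftarrow> mapM (\<lambda>r. do { c \<leftarrow> op1 (r = rh); patchM E r (if c then 1 else 0) }) [1..<q];
     h \<leftarrow> sumM ret fs;
     f0 \<leftarrow> subM 1 h;
     cs \<leftarrow> mapM (\<lambda>f. do { c \<leftarrow> eqM f 0; c' \<leftarrow> eqM f 1; op1 (c \<or> c') }) (f0 # fs);
     c \<leftarrow> foldM (\<lambda>c c'. op1 (c \<and> c')) True cs;
     ret (if c then f0 # fs else null_list) }"

lemma foldl_and: "foldl (\<and>) c cs \<longleftrightarrow> c \<and> (\<forall>c'\<in>set cs. c')"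
  by (induction cs arbitrary: c) auto

definition finish_time :: real where
  "finish_time = real q * (7 * real L + 10) + 1"

lemma acts_finish:
  assumes "\<And>r. r < q \<Longrightarrow> card (aplus r E) \<le> L" "\<And>r. finite (aplus r E)" "0 < q"
  shows "acts finish_time (finish E rh) s (fst (decision (used s) E rh)) (snd (decision (used s) E rh))"
proof -
  let ?y = "run_patches E rh [1..<q] (used s)"
  let ?fs = "fst ?y" and ?u = "snd ?y"
  let ?all = "(1 - sum_list ?fs) # ?fs"
  let ?cs = "map (\<lambda>f. f = 0 \<or> f = 1) ?all"
  have len: "length ?fs = q - 1" by (simp add: length_run_patches)
  have 1: "acts (real (length [1..<q]) * (7 * real L + 2)) (mapM (\<lambda>r. do { c \<leftarrow> op1 (r = rh); patchM E r (if c then 1 else 0) }) [1..<q]) s ?fs ?u"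
    by (rule acts_run_patches) (use assms in auto)
  have sum: "computes (real (length ?fs) * (0 + 2)) (sumM ret ?fs) s' (sum_list ?fs)" for s'
    using computes_sumM[of ?fs 0 ret s' "\<lambda>x. x", OF computes_ret] by (simp only: list.map_ident)
  have map: "computes (real (length ?all) * ((1 + (1 + 1)) + 1)) (mapM (\<lambda>f. do { c \<leftarrow> eqM f 0; c' \<leftarrow> eqM f 1; op1 (c \<or> c') }) ?all) s' ?cs" for s'
    by (intro computes_mapM computes_bind[OF computes_op1] computes_op1)
  have fold: "computes (real (length ?cs) * (1 + 1)) (foldM (\<lambda>c c'. op1 (c \<and> c')) True ?cs) s' (foldl (\<and>) True ?cs)" for s'
    by (intro computes_foldM computes_op1)
  have *: "acts (real (length [1..<q]) * (7 * real L + 2) + (real (length ?fs) * (0 + 2) + (1 + (real (length ?all) * ((1 + (1 + 1)) + 1) + (real (length ?cs) * (1 + 1) + 0)))))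
     (finish E rh) s (if foldl (\<and>) True ?cs then ?all else null_list) (used (s\<lparr>used := ?u\<rparr>))"
    unfolding finish_def
    by (rule acts_bind[OF 1], rule acts_computes, rule computes_bind[OF sum], rule computes_bind[OF computes_op1],
        rule computes_bind[OF map], rule computes_bind[OF fold], rule computes_ret)
  have v: "(if foldl (\<and>) True ?cs then ?all else null_list) = fst (decision (used s) E rh)"
    unfolding decision_def Let_def foldl_and by simp
  have u: "used (s\<lparr>used := ?u\<rparr>) = snd (decision (used s) E rh)" unfolding decision_def Let_def by simp
  have n: "real (length [1..<q]) * (7 * real L + 2) + (real (length ?fs) * (0 + 2) + (1 + (real (length ?all) * ((1 + (1 + 1)) + 1) + (real (length ?cs) * (1 + 1) + 0))))
      \<le> finish_time"
  proof -
    have q: "real (length ?fs) = real q - 1" "real (length [1..<q]) = real q - 1" "real (length ?all) = real q" "real (length ?cs) = real q"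
      using len assms(3) by (simp_all add: of_nat_diff)
    show ?thesis unfolding q finish_time_def by (simp add: algebra_simps)
  qed
  show ?thesis by (rule acts_weaken[OF * v u n])
qed

definition rest_of :: "hist \<Rightarrow> real list \<Rightarrow> real list prog" where
  "rest_of E x = do { rh \<leftarrow> categoricalM 0 1 x; finish E rh }"

lemma decide_NRM_eq: "decide_NRM \<epsilon> E = do {
    x \<leftarrow> decide_params (\<theta>_pen (0.45 * \<epsilon>)) (params_pen (0.45 * \<epsilon>)) E; rest_of E x }"
  unfolding decide_NRM_def rest_of_def finish_def ..

end

context wf_nrm
begin

definition rest_time :: real where
  "rest_time = 3 * real q + finish_time"

lemma rest_of_support:
  assumes E: "E \<in> histories" and x: "length x = q" and z: "z \<in> set_pmf (rest_of E x s)"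
  shows "table (snd z) = table s \<and> index_sets (snd z) = index_sets s \<and> clock (snd z) \<le> clock s + rest_time"
proof -
  from z obtain w where w: "w \<in> set_pmf (categoricalM 0 1 x s)" "z \<in> set_pmf (finish E (fst w) (snd w))"
    unfolding rest_of_def bind_prog_def by (auto simp: case_prod_unfold)
  obtain c where c: "c \<le> clock s + 3 * length x" "snd w = s\<lparr>clock := c\<rparr>" using categoricalM_clock[OF w(1)] by auto
  obtain c' where c': "c' \<le> clock (snd w) + finish_time"
    "finish E (fst w) (snd w) = return_pmf (fst (decision (used (snd w)) E (fst w)), (snd w)\<lparr>clock := c', used := snd (decision (used (snd w)) E (fst w))\<rparr>)"
    using actsD[OF acts_finish[OF card_aplus[OF E] finite_aplus wf_simps(3)]] .
  thus ?thesis using w(2) c x unfolding rest_time_def by simp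
qed

lemma rest_of_law:
  assumes E: "E \<in> histories" and x: "x = map \<xi> [0..<q]" and \<xi>: "\<xi> \<in> Q0"
  shows "map_pmf (\<lambda>z. (fst z, used (snd z))) (rest_of E x s) = map_pmf (decision (used s) E) (cat \<xi>)"
proof -
  have "map_pmf (\<lambda>z. (fst z, used (snd z))) (rest_of E x s)
      = bind_pmf (categoricalM 0 1 x s) (\<lambda>w. return_pmf (decision (used s) E (fst w)))"
    unfolding rest_of_def bind_prog_def map_bind_pmf case_prod_unfold
  proof (rule bind_pmf_cong[OF refl])
    fix w assume w: "w \<in> set_pmf (categoricalM 0 1 x s)"
    obtain c where c: "snd w = s\<lparr>clock := c\<rparr>" using categoricalM_clock[OF w] by auto
    obtain c' where c':
      "finish E (fst w) (snd w) = return_pmf (fst (decision (used (snd w)) E (fst w)), (snd w)\<lparr>clock := c', used := snd (decision (used (snd w)) E (fst w))\<rparr>)"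
      using actsD[OF acts_finish[OF card_aplus[OF E] finite_aplus wf_simps(3)]] .
    show "map_pmf (\<lambda>z. (fst z, used (snd z))) (finish E (fst w) (snd w)) = return_pmf (decision (used s) E (fst w))"
      unfolding c' using c by simp
  qed
  also have "\<dots> = map_pmf (decision (used s) E) (map_pmf fst (categoricalM 0 1 x s))"
    by (simp add: map_pmf_def bind_assoc_pmf bind_return_pmf)
  also have "map_pmf fst (categoricalM 0 1 x s) = cat \<xi>"
  proof (rule pmf_eqI)
    fix j
    have "sum_list x = 1" using Q0_sum_eq[OF \<xi>] unfolding x by (simp add: interv_sum_list_conv_sum_set_nat atLeast0LessThan)
    thus "pmf (map_pmf fst (categoricalM 0 1 x s)) j = pmf (cat \<xi>) j"
      using Q0_bounds[OF \<xi>] \<xi> wf_simps x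
      by (subst categoricalM_pmf) (auto simp: pmf_cat Q0_def)
  qed
  finally show ?thesis .
qed

text \<open>Along a trajectory \<open>used\<close> holds exactly the amounts that the definition of \<open>F\<close> sums up.\<close>

definition used_at :: "(hist \<Rightarrow> nat \<Rightarrow> real) \<Rightarrow> hist \<Rightarrow> nat \<Rightarrow> nat \<Rightarrow> nat \<Rightarrow> real" where
  "used_at Y S t r = (\<lambda>i. if i \<in> {1..m} then patched_use Y S (t - 1) i
     + (\<Sum>l=1..<r. a l i (take t S) * F_pos Y (take t S) l) else 0)"

lemma foldl_min: "foldl (\<lambda>f i. min f (g i)) x xs = (if xs = [] then x else min x (Min (g ` set xs)))" for g :: "'b \<Rightarrow> real"
proof (induction xs arbitrary: x)
  case (Cons y ys)
  show ?case by (cases "ys = []") (simp_all add: Cons min.assoc)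
qed simp

lemma run_patches_path:
  assumes S: "S \<in> trajectories" and t: "t \<in> {1..T}" and r: "1 \<le> r" "r \<le> q"
  shows "run_patches (take t S) (rh (take t S)) [r..<q] (used_at (pick rh) S t r)
    = (map (F_pos (pick rh) (take t S)) [r..<q], used_at (pick rh) S t q)"
  using r
proof (induction "q - r" arbitrary: r)
  case 0
  thus ?case by simp
next
  case (Suc n)
  let ?Y = "pick rh" and ?E = "take t S"
  have rq: "r < q" using Suc by simp
  have E: "?E \<in> histories" by (rule take_history[OF S t])
  have val: "patch_value (used_at ?Y S t r) ?E r (if r = rh ?E then 1 else 0) = F_pos ?Y ?E r"
  proof -
    have img: "(\<lambda>i. (b i - used_at ?Y S t r i) / a r i ?E) ` aplus r ?E
        = (\<lambda>i. (b i - patched_use ?Y S (t - 1) i - (\<Sum>l=1..<r. a l i ?E * F_pos ?Y ?E l)) / a r i ?E) ` aplus r ?E"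
      by (rule image_cong) (auto simp: used_at_def aplus_def algebra_simps)
    have "set (sorted_list_of_set (aplus r ?E)) = aplus r ?E" using finite_aplus by simp
    moreover have "sorted_list_of_set (aplus r ?E) = [] \<longleftrightarrow> aplus r ?E = {}" using finite_aplus by simp
    ultimately show ?thesis
      unfolding patch_value_def foldl_min by (subst F_pos_path[OF S t]) (simp add: img pick_def)
  qed
  have use: "patch_used (used_at ?Y S t r) ?E r (F_pos ?Y ?E r) = used_at ?Y S t (Suc r)"
  proof
    fix i
    have "a r i ?E = 0" if "i \<in> {1..m}" "i \<notin> aplus r ?E"
      using that a_nonneg[OF E rq that(1)] by (auto simp: aplus_def)
    thus "patch_used (used_at ?Y S t r) ?E r (F_pos ?Y ?E r) i = used_at ?Y S t (Suc r) i"
      using Suc.prems by (auto simp: patch_used_def used_at_def aplus_def)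
  qed
  have "[r..<q] = r # [Suc r..<q]" using rq by (rule upt_conv_Cons)
  thus ?case using Suc.hyps(1)[of "Suc r"] Suc.hyps(2) Suc.prems rq by (simp add: Let_def val use)
qed

lemma decision_path:
  assumes S: "S \<in> trajectories" and t: "t \<in> {1..T}"
  shows "decision (used_at (pick rh) S t 1) (take t S) (rh (take t S))
    = (map (J (F (pick rh)) (take t S)) [0..<q], used_at (pick rh) S (Suc t) 1)"
proof -
  let ?Y = "pick rh" and ?E = "take t S"
  have run: "run_patches ?E (rh ?E) [1..<q] (used_at ?Y S t 1) = (map (F_pos ?Y ?E) [1..<q], used_at ?Y S t q)"
    by (rule run_patches_path[OF S t]) (use wf_simps in auto)
  have "sum_list (map (F_pos ?Y ?E) [1..<q]) = (\<Sum>l=1..<q. F_pos ?Y ?E l)"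
    by (simp add: interv_sum_list_conv_sum_set_nat)
  hence all: "(1 - sum_list (map (F_pos ?Y ?E) [1..<q])) # map (F_pos ?Y ?E) [1..<q] = map (F ?Y ?E) [0..<q]"
    using wf_simps(3) by (simp add: F_def upt_conv_Cons)
  have step: "used_at ?Y S t q = used_at ?Y S (Suc t) 1"
    using t by (intro ext) (cases t, auto simp: used_at_def patched_use_def)
  have "(\<forall>f\<in>set (map (F ?Y ?E) [0..<q]). f = 0 \<or> f = 1) \<longleftrightarrow> (\<forall>r<q. F ?Y ?E r \<in> {0, 1})" by auto
  thus ?thesis unfolding decision_def run Let_def fst_conv snd_conv all step
    by (auto simp: J_def null_list_def)
qed

end

section \<open>The law of the decisions\<close>

lemma map_nth_replicate_pmf:
  "map_pmf (\<lambda>xs k. if k < n then g (xs ! k) else d) (replicate_pmf n r) = Pi_pmf {..<n} d (\<lambda>_. map_pmf g r)"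
proof (induction n)
  case 0
  show ?case by simp
next
  case (Suc n)
  let ?h = "\<lambda>n xs k. if k < n then g (xs ! k) else d"
  have rep: "replicate_pmf (Suc n) r = bind_pmf (replicate_pmf n r) (\<lambda>xs. map_pmf (\<lambda>x. xs @ [x]) r)"
    unfolding Suc_eq_plus1 replicate_pmf_distrib replicate_pmf_1 map_pmf_def bind_assoc_pmf bind_return_pmf ..
  have "map_pmf (?h (Suc n)) (replicate_pmf (Suc n) r)
      = bind_pmf (replicate_pmf n r) (\<lambda>xs. map_pmf (\<lambda>x. ?h (Suc n) (xs @ [x])) r)"
    unfolding rep by (simp add: map_bind_pmf map_pmf_comp)
  also have "\<dots> = bind_pmf (replicate_pmf n r) (\<lambda>xs. map_pmf (\<lambda>x. (?h n xs)(n := g x)) r)"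
  proof (intro bind_pmf_cong map_pmf_cong refl)
    fix xs x assume "xs \<in> set_pmf (replicate_pmf n r)"
    hence "length xs = n" by (simp add: set_replicate_pmf)
    thus "?h (Suc n) (xs @ [x]) = (?h n xs)(n := g x)"
      by (intro ext) (auto simp: nth_append less_Suc_eq)
  qed
  also have "\<dots> = bind_pmf (map_pmf (?h n) (replicate_pmf n r)) (\<lambda>f. map_pmf (\<lambda>v. f(n := v)) (map_pmf g r))"
    by (simp add: bind_map_pmf map_pmf_comp)
  also have "\<dots> = bind_pmf (Pi_pmf {..<n} d (\<lambda>_. map_pmf g r)) (\<lambda>f. map_pmf (\<lambda>v. f(n := v)) (map_pmf g r))"
    by (simp only: Suc.IH)
  also have "\<dots> = Pi_pmf {..<Suc n} d (\<lambda>_. map_pmf g r)"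
    unfolding lessThan_Suc
    by (subst Pi_pmf_insert') (simp_all add: map_pmf_def bind_commute_pmf[of "Pi_pmf _ _ _"] bind_assoc_pmf bind_return_pmf)
  finally show ?case .
qed

definition outputs :: "(hist \<Rightarrow> real list prog) \<Rightarrow> hist list \<Rightarrow> machine \<Rightarrow> real list list pmf" where
  "outputs dec Es s = map_pmf (\<lambda>z. map fst (fst z)) (timed_run dec Es s)"

lemma timed_run_Cons:
  "timed_run dec (E # Es) s = bind_pmf (dec E s) (\<lambda>y. map_pmf (\<lambda>z. ((fst y, clock (snd y) - clock s) # fst z, snd z)) (timed_run dec Es (snd y)))"
  by (simp add: bind_prog_def get_def ret_def bind_return_pmf map_pmf_def case_prod_unfold)

lemma outputs_Nil: "outputs dec [] s = return_pmf []"
  unfolding outputs_def by (simp add: ret_def)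

lemma outputs_Cons: "outputs dec (E # Es) s = bind_pmf (dec E s) (\<lambda>y. map_pmf (Cons (fst y)) (outputs dec Es (snd y)))"
  unfolding outputs_def timed_run_Cons map_bind_pmf by (simp add: map_pmf_comp)

lemma outputs_cong: "(\<And>E. E \<in> set Es \<Longrightarrow> dec E = dec' E) \<Longrightarrow> outputs dec Es s = outputs dec' Es s"
proof (induction Es arbitrary: s)
  case (Cons E Es)
  have "outputs dec Es s = outputs dec' Es s" for s by (rule Cons.IH) (use Cons.prems in simp)
  thus ?case unfolding outputs_Cons using Cons.prems[of E] by simp
qed (simp add: outputs_Nil)

context wf_nrm
begin

text \<open>
  \<open>trace\<close> draws the options when they are needed, \<open>path\<close> takes them from a choice made in advance.
\<close>

primrec trace :: "hist list \<Rightarrow> (nat \<Rightarrow> real) \<Rightarrow> (hist \<Rightarrow> nat \<Rightarrow> real) \<Rightarrow> real list list pmf" where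
  "trace [] u X = return_pmf []"
| "trace (E # Es) u X = bind_pmf (cat (X E)) (\<lambda>rh. map_pmf (Cons (fst (decision u E rh))) (trace Es (snd (decision u E rh)) X))"

primrec path :: "hist list \<Rightarrow> (nat \<Rightarrow> real) \<Rightarrow> (hist \<Rightarrow> nat) \<Rightarrow> real list list" where
  "path [] u rh = []"
| "path (E # Es) u rh = fst (decision u E (rh E)) # path Es (snd (decision u E (rh E))) rh"

lemma path_upd: "E \<notin> set Es \<Longrightarrow> path Es u (rh(E := r)) = path Es u rh"
  by (induction Es arbitrary: u) auto

abbreviation prefixes :: "hist \<Rightarrow> hist list" where
  "prefixes S \<equiv> map (\<lambda>t. take t S) [1..<Suc T]"

text \<open>
  Each history occurs once, so that its component of the rounding may be drawn when it is reached.
\<close>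

lemma trace_eq_path:
  assumes "distinct Es" "set Es \<subseteq> histories"
  shows "trace Es u X = map_pmf (path Es u) (rounding X)"
  using assms
proof (induction Es arbitrary: u)
  case Nil
  show ?case by simp
next
  case (Cons E Es)
  let ?d = "\<lambda>r. decision u E r"
  have IH: "trace Es v X = map_pmf (path Es v) (rounding X)" for v using Cons by simp
  have "map_pmf (path (E # Es) u) (rounding X)
      = bind_pmf (cat (X E)) (\<lambda>r. map_pmf (path (E # Es) u) (map_pmf (\<lambda>f. f(E := r)) (rounding X)))"
    unfolding rounding_def by (subst Pi_pmf_resample[OF finite_histories, of E]) (use Cons.prems in \<open>simp_all add: map_bind_pmf\<close>)
  also have "\<dots> = bind_pmf (cat (X E)) (\<lambda>r. map_pmf (Cons (fst (?d r))) (map_pmf (path Es (snd (?d r))) (rounding X)))"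
    using Cons.prems by (simp add: map_pmf_comp path_upd)
  finally show ?case by (simp only: trace.simps IH)
qed

lemma path_decisions:
  assumes S: "S \<in> trajectories" and t: "1 \<le> t" "t \<le> Suc T"
  shows "path (map (\<lambda>t. take t S) [t..<Suc T]) (used_at (pick rh) S t 1) rh
    = map (\<lambda>t. map (J (F (pick rh)) (take t S)) [0..<q]) [t..<Suc T]"
  using t
proof (induction "Suc T - t" arbitrary: t)
  case 0
  thus ?case by simp
next
  case (Suc n)
  have "t \<in> {1..T}" using Suc by auto
  note d = decision_path[OF S this, of rh]
  have "[t..<Suc T] = t # [Suc t..<Suc T]" using Suc by (intro upt_conv_Cons) auto
  moreover have "path (map (\<lambda>t. take t S) [Suc t..<Suc T]) (used_at (pick rh) S (Suc t) 1) rh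
    = map (\<lambda>t. map (J (F (pick rh)) (take t S)) [0..<q]) [Suc t..<Suc T]"
    by (rule Suc.hyps(1)) (use Suc.hyps(2) Suc.prems in auto)
  ultimately show ?case by (simp add: d del: upt_Suc One_nat_def)
qed

lemma trace_decisions:
  assumes S: "S \<in> trajectories"
  shows "trace (prefixes S) (\<lambda>_. 0) X
    = map_pmf (\<lambda>Y. map (\<lambda>t. map (J (F Y) (take t S)) [0..<q]) [1..<Suc T]) (H X)"
proof -
  have "inj_on (\<lambda>t. take t S) (set [1..<Suc T])"
    using length_trajectory[OF S] by (intro inj_on_inverseI[of _ length]) auto
  hence dist: "distinct (prefixes S)" by (simp add: distinct_map del: upt_Suc)
  have sub: "set (prefixes S) \<subseteq> histories" using take_history[OF S] by auto
  have "used_at Y S 1 1 = (\<lambda>_. 0)" for Y by (intro ext) (simp add: used_at_def patched_use_def)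
  moreover have "path (prefixes S) (used_at (pick rh) S 1 1) rh
      = map (\<lambda>t. map (J (F (pick rh)) (take t S)) [0..<q]) [1..<Suc T]" for rh
    by (rule path_decisions[OF S]) auto
  ultimately have "path (prefixes S) (\<lambda>_. 0) rh
      = map (\<lambda>t. map (J (F (pick rh)) (take t S)) [0..<q]) [1..<Suc T]" for rh
    by (simp only:)
  hence "path (prefixes S) (\<lambda>_. 0)
      = (\<lambda>rh. map (\<lambda>t. map (J (F (pick rh)) (take t S)) [0..<q]) [1..<Suc T])" by (rule ext)
  thus ?thesis unfolding H_eq map_pmf_comp by (simp only: trace_eq_path[OF dist sub])
qed

end

context lazy_sampling
begin

lemma completion_Q0: "good s \<Longrightarrow> completion (table s) al sims k E \<in> Q0"
proof (cases k)
  case (Suc j)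
  assume s: "good s"
  show ?thesis
  proof (cases "table s E (Suc j)")
    case None
    thus ?thesis unfolding Suc by (simp only: completion_None proj_Q0[OF wf_simps(3)])
  next
    case (Some x)
    thus ?thesis using s Suc by (simp add: good_def)
  qed
qed (simp add: null_choice_Q0)

lemma out_Q0:
  assumes "\<And>j. Y j E \<in> Q0"
  shows "out Y E \<in> Q0"
proof (cases "averaged p")
  case True
  have K: "0 < real K" using rounds_pos by simp
  have o: "out Y E r = 1 / K * (\<Sum>j=1..K. Y j E r)" for r using True by (simp add: out_def)
  have "0 \<le> out Y E r" for r unfolding o using Q0_bounds[OF assms] by (intro mult_nonneg_nonneg sum_nonneg) auto
  moreover have "out Y E r \<le> 1" for r
  proof -
    have "(\<Sum>j=1..K. Y j E r) \<le> (\<Sum>j=1..K. 1)" using Q0_bounds[OF assms] by (intro sum_mono) auto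
    thus ?thesis unfolding o using K by (simp add: field_simps)
  qed
  moreover have "(\<Sum>r<q. out Y E r) = 1"
  proof -
    have "(\<Sum>r<q. out Y E r) = 1 / K * (\<Sum>j=1..K. \<Sum>r<q. Y j E r)"
      unfolding o sum_distrib_left[symmetric] by (subst sum.swap) simp
    also have "\<dots> = 1" using Q0_sum_eq[OF assms] K by simp
    finally show ?thesis .
  qed
  moreover have "out Y E r = 0" if "q \<le> r" for r unfolding o using assms that by (simp add: Q0_def)
  ultimately show ?thesis by (simp add: Q0_def)
next
  case False
  hence "out Y E = Y K E" by (intro ext) (simp add: out_def)
  thus ?thesis using assms by simp
qed

lemma out_Comp: "good s \<Longrightarrow> Y \<in> set_pmf (Comp d s) \<Longrightarrow> out Y E \<in> Q0"
  by (rule out_Q0) (auto simp: Comp_def completion_Q0)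

definition decide_later :: "hist \<Rightarrow> real list prog" where
  "decide_later E = do { x \<leftarrow> decide_core E; rest_of E x }"

lemma Comp_cong: "table s = table s' \<Longrightarrow> index_sets s = index_sets s' \<Longrightarrow> Comp d s = Comp d s'"
  unfolding Comp_def al_of_def by simp

lemma good_cong: "table s = table s' \<Longrightarrow> index_sets s = index_sets s' \<Longrightarrow> good s = good s'"
  unfolding good_def by simp

text \<open>
  Jointly with the completion of the table that it leaves, a decision is distributed as if
  the completion had been drawn first.  The amounts used enter only after that.
\<close>

lemma decide_later_law:
  assumes E: "E \<in> histories" and s: "good s"
  shows "bind_pmf (decide_later E s) (\<lambda>z. map_pmf (\<lambda>Y. (fst z, used (snd z), Y)) (Comp fresh (snd z)))
    = bind_pmf (Comp fresh s) (\<lambda>Y. map_pmf (\<lambda>rh. (fst (decision (used s) E rh), snd (decision (used s) E rh), Y)) (cat (out Y E)))"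
proof -
  let ?D = "\<lambda>u rh. (fst (decision u E rh), snd (decision u E rh))"
  define G where "G Y = map_pmf (\<lambda>rh. (fst (decision (used s) E rh), snd (decision (used s) E rh), Y)) (cat (out Y E))" for Y
  note safe = safe_decide_core[OF E, unfolded safe_def, rule_format, OF s TrueI]
  have step: "bind_pmf (rest_of E (fst y) (snd y)) (\<lambda>z. map_pmf (\<lambda>Y. (fst z, used (snd z), Y)) (Comp fresh (snd z)))
      = bind_pmf (Comp fresh (snd y)) G" if y: "y \<in> set_pmf (decide_core E s)" for y
  proof -
    have len: "length (fst y) = q" and good: "good (snd y)" and used: "used (snd y) = used s"
      using safe y by (auto simp: extends_def)
    have "bind_pmf (rest_of E (fst y) (snd y)) (\<lambda>z. map_pmf (\<lambda>Y. (fst z, used (snd z), Y)) (Comp fresh (snd z)))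
        = bind_pmf (rest_of E (fst y) (snd y)) (\<lambda>z. map_pmf (\<lambda>Y. (fst z, used (snd z), Y)) (Comp fresh (snd y)))"
      by (intro bind_pmf_cong refl arg_cong[where f = "map_pmf _"] Comp_cong) (use rest_of_support[OF E len] in auto)
    also have "\<dots> = bind_pmf (Comp fresh (snd y)) (\<lambda>Y. map_pmf (\<lambda>z. (fst z, snd z, Y)) (map_pmf (\<lambda>z. (fst z, used (snd z))) (rest_of E (fst y) (snd y))))"
      unfolding map_pmf_def by (subst bind_commute_pmf) (simp add: bind_assoc_pmf bind_return_pmf)
    also have "\<dots> = bind_pmf (Comp fresh (snd y)) G"
    proof (rule bind_pmf_cong[OF refl])
      fix Y assume Y: "Y \<in> set_pmf (Comp fresh (snd y))"
      have x: "fst y = map (out Y E) [0..<q]" using safe y Y by blast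
      show "map_pmf (\<lambda>z. (fst z, snd z, Y)) (map_pmf (\<lambda>z. (fst z, used (snd z))) (rest_of E (fst y) (snd y))) = G Y"
        unfolding rest_of_law[OF E x out_Comp[OF good Y]] G_def used by (simp add: map_pmf_comp)
    qed
    finally show ?thesis .
  qed
  have "bind_pmf (decide_later E s) (\<lambda>z. map_pmf (\<lambda>Y. (fst z, used (snd z), Y)) (Comp fresh (snd z)))
      = bind_pmf (decide_core E s) (\<lambda>y. bind_pmf (rest_of E (fst y) (snd y)) (\<lambda>z. map_pmf (\<lambda>Y. (fst z, used (snd z), Y)) (Comp fresh (snd z))))"
    unfolding decide_later_def bind_prog_def by (simp add: bind_assoc_pmf case_prod_unfold)
  also have "\<dots> = bind_pmf (decide_core E s) (\<lambda>y. bind_pmf (Comp fresh (snd y)) G)"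
    by (intro bind_pmf_cong refl step)
  also have "\<dots> = bind_pmf (bind_pmf (decide_core E s) (\<lambda>y. Comp fresh (snd y))) G" by (simp add: bind_assoc_pmf)
  also have "bind_pmf (decide_core E s) (\<lambda>y. Comp fresh (snd y)) = Comp fresh s" using safe by blast
  finally show ?thesis unfolding G_def .
qed

lemma good_decide_later:
  assumes E: "E \<in> histories" and s: "good s" and z: "z \<in> set_pmf (decide_later E s)"
  shows "good (snd z)"
proof -
  note safe = safe_decide_core[OF E, unfolded safe_def, rule_format, OF s TrueI]
  from z obtain y where y: "y \<in> set_pmf (decide_core E s)" "z \<in> set_pmf (rest_of E (fst y) (snd y))"
    unfolding decide_later_def bind_prog_def by (auto simp: case_prod_unfold)
  have "length (fst y) = q" "good (snd y)" using safe y by auto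
  thus ?thesis using rest_of_support[OF E _ y(2)] good_cong by metis
qed

lemma outputs_decide_later:
  assumes "set Es \<subseteq> histories" "good s"
  shows "outputs decide_later Es s = bind_pmf (Comp fresh s) (\<lambda>Y. trace Es (used s) (out Y))"
  using assms
proof (induction Es arbitrary: s)
  case Nil
  show ?case by (simp add: outputs_Nil)
next
  case (Cons E Es)
  have E: "E \<in> histories" using Cons.prems by simp
  let ?G = "\<lambda>(x, u, Y). map_pmf (Cons x) (trace Es u (out Y))"
  have "outputs decide_later (E # Es) s
      = bind_pmf (decide_later E s) (\<lambda>z. map_pmf (Cons (fst z)) (bind_pmf (Comp fresh (snd z)) (\<lambda>Y. trace Es (used (snd z)) (out Y))))"
    unfolding outputs_Cons
    by (intro bind_pmf_cong refl arg_cong[where f = "map_pmf _"] Cons.IH) (use Cons.prems good_decide_later[OF E] in auto)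
  also have "\<dots> = bind_pmf (bind_pmf (decide_later E s) (\<lambda>z. map_pmf (\<lambda>Y. (fst z, used (snd z), Y)) (Comp fresh (snd z)))) ?G"
    by (simp add: bind_assoc_pmf bind_map_pmf map_bind_pmf)
  also have "\<dots> = bind_pmf (Comp fresh s) (\<lambda>Y. trace (E # Es) (used s) (out Y))"
    unfolding decide_later_law[OF E Cons.prems(2)] by (simp add: bind_assoc_pmf bind_map_pmf)
  finally show ?case .
qed

abbreviation index_list_dist :: "nat list pmf" where
  "index_list_dist \<equiv> map_pmf sorted_list_of_set (index_dist p)"

definition started :: "machine \<Rightarrow> nat list list \<Rightarrow> machine" where
  "started s als = s\<lparr>clock := clock s + K * (samp_time (num_indices p) + 1), index_sets := (\<lambda>k. als ! k)\<rparr>"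

lemma decide_params_apply:
  "decide_params \<theta> p E s = (if length E = 1 then bind_pmf (replicate_pmf K index_list_dist) (\<lambda>als. decide_core E (started s als))
     else decide_core E s)"
proof -
  have "decide_params \<theta> p E = (if length E = 1 then do {
        als \<leftarrow> mapM (\<lambda>k. index_setM (num_indices p)) [0..<K];
        update (\<lambda>s. s\<lparr>index_sets := (\<lambda>k. als ! k)\<rparr>);
        decide_core E } else decide_core E)"
    unfolding decide_params_def decide_core_def readout_def
    by (simp add: bind_prog_assoc) (simp add: bind_prog_def ret_def bind_return_pmf)
  thus ?thesis
    by (simp add: bind_prog_def index_setM_def mapM_timed_draw bind_map_pmf update_def bind_return_pmf started_def)
qed

lemma set_index_dist: "set_pmf (index_dist p) = {A. A \<subseteq> {1..T} \<and> card A = num_indices p}"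
proof -
  have "num_indices p \<le> T" using sp by (simp add: sampled_def)
  from set_pmf_of_set[OF index_sets_nonempty[OF this]] show ?thesis .
qed

lemma index_lists:
  assumes "als \<in> set_pmf (replicate_pmf K index_list_dist)" "k < K"
  shows "distinct (als ! k)" "set (als ! k) \<subseteq> {1..T}" "length (als ! k) = num_indices p"
proof -
  have "als ! k \<in> set_pmf index_list_dist" using assms by (auto simp: set_replicate_pmf)
  hence "als ! k \<in> sorted_list_of_set ` {A. A \<subseteq> {1..T} \<and> card A = num_indices p}"
    unfolding set_map_pmf set_index_dist .
  then obtain A where A: "als ! k = sorted_list_of_set A" "A \<subseteq> {1..T}" "card A = num_indices p" by auto
  moreover have "finite A" using A(2) finite_subset by blast
  ultimately show "distinct (als ! k)" "set (als ! k) \<subseteq> {1..T}" "length (als ! k) = num_indices p" by auto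
qed

lemma good_started: "good s \<Longrightarrow> als \<in> set_pmf (replicate_pmf K index_list_dist) \<Longrightarrow> good (started s als)"
  unfolding good_def started_def using index_lists by simp

lemma good_initial: "good initial"
proof -
  have "vec null_list = null_choice" using wf_simps by (auto simp: vec_def null_list_def null_choice_def)
  thus ?thesis using null_choice_Q0 by (auto simp: good_def initial_def null_list_def)
qed

lemma completion_started: "completion (table (started initial als)) al sims k E = iterate \<theta> p sims al k E"
proof (induction k arbitrary: E rule: less_induct)
  case (less k)
  show ?case
  proof (cases k)
    case (Suc j)
    have "completion (table (started initial als)) al sims j = iterate \<theta> p sims al j"
      "completion (table (started initial als)) al sims (j - 1) = iterate \<theta> p sims al (j - 1)"
      by (rule ext, rule less.IH, use Suc in simp)+
    moreover have "table (started initial als) E (Suc j) = None" by (simp add: started_def initial_def)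
    ultimately show ?thesis unfolding Suc by simp
  qed simp
qed

lemma index_sets_law: "map_pmf (\<lambda>als k. if k < K then set (als ! k) else {}) (replicate_pmf K index_list_dist)
    = Pi_pmf {..<K} {} (\<lambda>k. index_dist p)"
proof -
  have "map_pmf set index_list_dist = map_pmf (\<lambda>A. A) (index_dist p)"
    unfolding map_pmf_comp
  proof (rule map_pmf_cong[OF refl])
    fix A assume "A \<in> set_pmf (index_dist p)"
    hence "A \<subseteq> {1..T}" unfolding set_index_dist by simp
    hence "finite A" using finite_subset by blast
    thus "set (sorted_list_of_set A) = A" by simp
  qed
  thus ?thesis by (simp add: map_nth_replicate_pmf)
qed

text \<open>
  On the initial table the completion is the iteration of \<open>A\<^sup>\<theta>\<close> itself, for the index lists just drawn.
\<close>

lemma outs_law: "bind_pmf (replicate_pmf K index_list_dist) (\<lambda>als. map_pmf out (Comp fresh (started initial als))) = A_params \<theta> p"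
proof -
  let ?sims = "Pi_pmf (histories \<times> {..<K}) [] fresh"
  have o: "out (completion (table (started initial als)) (al_of (started initial als)) sims)
      = policy_output \<theta> p sims (\<lambda>k. if k < K then set (als ! k) else {})" for als sims
  proof (intro ext)
    fix E l
    have "completion (table (started initial als)) (al_of (started initial als)) sims j E l
        = iterate \<theta> p sims (\<lambda>k. if k < K then set (als ! k) else {}) j E l" if "j \<le> K" for j
    proof -
      have "iterate \<theta> p sims (al_of (started initial als)) j E = iterate \<theta> p sims (\<lambda>k. if k < K then set (als ! k) else {}) j E"
        by (rule iterate_cong) (use that in \<open>auto simp: al_of_def started_def\<close>)
      thus ?thesis by (simp add: completion_started)
    qed
    thus "out (completion (table (started initial als)) (al_of (started initial als)) sims) E l
      = policy_output \<theta> p sims (\<lambda>k. if k < K then set (als ! k) else {}) E l"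
      unfolding out_def policy_output_def by simp
  qed
  have "bind_pmf (replicate_pmf K index_list_dist) (\<lambda>als. map_pmf out (Comp fresh (started initial als)))
      = bind_pmf (map_pmf (\<lambda>als k. if k < K then set (als ! k) else {}) (replicate_pmf K index_list_dist))
          (\<lambda>al. map_pmf (\<lambda>sims. policy_output \<theta> p sims al) ?sims)"
    unfolding Comp_def bind_map_pmf map_pmf_comp by (simp add: o)
  also have "\<dots> = bind_pmf ?sims (\<lambda>sims. map_pmf (policy_output \<theta> p sims) (Pi_pmf {..<K} {} (\<lambda>k. index_dist p)))"
    unfolding index_sets_law by (simp only: map_pmf_def, rule bind_commute_pmf)
  also have "\<dots> = A_params \<theta> p"
    unfolding A_params_def draws_def pair_pmf_def by (simp add: map_bind_pmf map_pmf_def bind_assoc_pmf bind_return_pmf)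
  finally show ?thesis .
qed

theorem outputs_law:
  assumes S: "S \<in> trajectories" and dec: "\<And>E. dec E = do { x \<leftarrow> decide_params \<theta> p E; rest_of E x }"
  shows "outputs dec (prefixes S) initial
    = map_pmf (\<lambda>A. map (\<lambda>t. map (A (take t S)) [0..<q]) [1..<Suc T])
        (bind_pmf (A_params \<theta> p) (\<lambda>X. map_pmf (\<lambda>Y. J (F Y)) (H X)))"
proof -
  let ?Es = "map (\<lambda>t. take t S) [2..<Suc T]" and ?E = "take 1 S"
  have E: "?E \<in> histories" "length ?E = 1" using take_history[OF S, of 1] wf_simps length_trajectory[OF S] by auto
  have Es: "set (prefixes S) \<subseteq> histories" using take_history[OF S] by auto
  have "[1..<Suc T] = 1 # [Suc 1..<Suc T]" using wf_simps by (intro upt_conv_Cons) auto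
  hence split: "prefixes S = ?E # ?Es" by (simp add: numeral_2_eq_2 del: upt_Suc)
  have later: "outputs dec ?Es s = outputs decide_later ?Es s" for s
  proof (rule outputs_cong)
    fix E assume "E \<in> set ?Es"
    hence "length E \<noteq> 1" using length_trajectory[OF S] by auto
    hence "decide_params \<theta> p E = decide_core E" by (intro ext) (simp add: decide_params_apply)
    thus "dec E = decide_later E" unfolding dec decide_later_def by simp
  qed
  have first: "dec ?E initial = bind_pmf (replicate_pmf K index_list_dist) (\<lambda>als. decide_later ?E (started initial als))"
    unfolding dec decide_later_def bind_prog_def by (simp only: decide_params_apply E(2) if_True refl bind_assoc_pmf)
  have "outputs dec (prefixes S) initial
      = bind_pmf (replicate_pmf K index_list_dist) (\<lambda>als. outputs decide_later (prefixes S) (started initial als))"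
    unfolding split outputs_Cons first by (simp add: bind_assoc_pmf later del: upt_Suc)
  also have "\<dots> = bind_pmf (replicate_pmf K index_list_dist) (\<lambda>als.
      bind_pmf (Comp fresh (started initial als)) (\<lambda>Y. trace (prefixes S) (\<lambda>_. 0) (out Y)))"
  proof (rule bind_pmf_cong[OF refl])
    fix als assume "als \<in> set_pmf (replicate_pmf K index_list_dist)"
    hence "good (started initial als)" by (rule good_started[OF good_initial])
    moreover have "used (started initial als) = (\<lambda>_. 0)" by (simp add: started_def initial_def)
    ultimately show "outputs decide_later (prefixes S) (started initial als)
      = bind_pmf (Comp fresh (started initial als)) (\<lambda>Y. trace (prefixes S) (\<lambda>_. 0) (out Y))"
      using outputs_decide_later[OF Es] by simp
  qed
  also have "\<dots> = bind_pmf (bind_pmf (replicate_pmf K index_list_dist) (\<lambda>als. map_pmf out (Comp fresh (started initial als))))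
      (\<lambda>X. trace (prefixes S) (\<lambda>_. 0) X)"
    by (simp add: bind_assoc_pmf bind_map_pmf del: upt_Suc)
  also have "\<dots> = bind_pmf (A_params \<theta> p) (\<lambda>X. map_pmf (\<lambda>Y. map (\<lambda>t. map (J (F Y) (take t S)) [0..<q]) [1..<Suc T]) (H X))"
    unfolding outs_law trace_decisions[OF S] ..
  finally show ?thesis by (simp add: map_bind_pmf map_pmf_comp del: upt_Suc)
qed

section \<open>The time per decision\<close>

definition decide_time :: real where
  "decide_time = K * (samp_time (num_indices p) + 1) + core_time"

lemma decide_params_support:
  assumes E: "E \<in> histories" and s: "good s" and y: "y \<in> set_pmf (decide_params \<theta> p E s)"
    and samp: "0 \<le> samp_time (num_indices p)"
  shows "good (snd y) \<and> length (fst y) = q \<and> clock (snd y) \<le> clock s + decide_time"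
proof -
  obtain s' where s': "good s'" "clock s' \<le> clock s + K * (samp_time (num_indices p) + 1)" "y \<in> set_pmf (decide_core E s')"
  proof (cases "length E = 1")
    case True
    then obtain als where "als \<in> set_pmf (replicate_pmf K index_list_dist)" "y \<in> set_pmf (decide_core E (started s als))"
      using y unfolding decide_params_apply by auto
    thus ?thesis using that[of "started s als"] good_started[OF s] by (simp add: started_def)
  next
    case False
    moreover have "0 \<le> K * (samp_time (num_indices p) + 1)" using samp by simp
    ultimately show ?thesis using that[of s] s y unfolding decide_params_apply by auto
  qed
  have "good (snd y) \<and> clock (snd y) \<le> clock s' + core_time \<and> length (fst y) = q"
    using safe_decide_core[OF E] s' unfolding safe_def by blast
  thus ?thesis using s'(2) unfolding decide_time_def by auto
qed

lemma timed_run_decide_params: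
  assumes samp: "0 \<le> samp_time (num_indices p)"
  shows "set Es \<subseteq> histories \<Longrightarrow> good s \<Longrightarrow> z \<in> set_pmf (timed_run (decide_params \<theta> p) Es s) \<Longrightarrow> (x, c) \<in> set (fst z) \<Longrightarrow> c \<le> decide_time"
proof (induction Es arbitrary: s z x c)
  case Nil
  thus ?case by (simp add: ret_def)
next
  case (Cons E Es)
  from Cons.prems(3) obtain y z' where y: "y \<in> set_pmf (decide_params \<theta> p E s)" "z' \<in> set_pmf (timed_run (decide_params \<theta> p) Es (snd y))"
    and z: "z = ((fst y, clock (snd y) - clock s) # fst z', snd z')"
    unfolding timed_run_Cons by auto
  have E: "E \<in> histories" using Cons.prems by simp
  note d = decide_params_support[OF E Cons.prems(2) y(1) samp]
  show ?case
  proof (cases "(x, c) \<in> set (fst z')")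
    case True
    thus ?thesis using Cons.IH[OF _ _ y(2)] Cons.prems(1) d by auto
  next
    case False
    thus ?thesis using Cons.prems(4) d unfolding z by auto
  qed
qed

text \<open>
  Rounding and patching move the clock and \<open>used\<close> only, on which the decisions before rounding
  do not depend.  So every run of the whole policy has a counterpart without rounding.
\<close>

lemma timed_run_rest:
  assumes samp: "0 \<le> samp_time (num_indices p)" and dec: "\<And>E. dec E = do { x \<leftarrow> decide_params \<theta> p E; rest_of E x }"
  shows "set Es \<subseteq> histories \<Longrightarrow> good s \<Longrightarrow> z \<in> set_pmf (timed_run dec Es s) \<Longrightarrow>
    \<exists>z'\<in>set_pmf (timed_run (decide_params \<theta> p) Es (shift \<delta> u s)). list_all2 (\<lambda>v v'. snd v \<le> snd v' + rest_time) (fst z) (fst z')"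
proof (induction Es arbitrary: s z \<delta>)
  case Nil
  thus ?case by (simp add: ret_def)
next
  case (Cons E Es)
  from Cons.prems(3) obtain w z1 where w: "w \<in> set_pmf (dec E s)" and z1: "z1 \<in> set_pmf (timed_run dec Es (snd w))"
    and z: "z = ((fst w, clock (snd w) - clock s) # fst z1, snd z1)"
    unfolding timed_run_Cons by auto
  from w obtain y where y: "y \<in> set_pmf (decide_params \<theta> p E s)" "w \<in> set_pmf (rest_of E (fst y) (snd y))"
    unfolding dec bind_prog_def by (auto simp: case_prod_unfold)
  have E: "E \<in> histories" using Cons.prems by simp
  note d = decide_params_support[OF E Cons.prems(2) y(1) samp]
  have r: "table (snd w) = table (snd y)" "index_sets (snd w) = index_sets (snd y)" "clock (snd w) \<le> clock (snd y) + rest_time"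
    using rest_of_support[OF E _ y(2)] d by auto
  let ?\<delta> = "\<delta> + clock (snd y) - clock (snd w)"
  have eq: "shift ?\<delta> u (snd w) = shift \<delta> u (snd y)"
    using r(1,2) unfolding shift_def by (intro machine.equality) simp_all
  have "good (snd w)" using good_cong[OF r(1,2)] d by simp
  then obtain z2 where z2: "z2 \<in> set_pmf (timed_run (decide_params \<theta> p) Es (shift \<delta> u (snd y)))"
    "list_all2 (\<lambda>v v'. snd v \<le> snd v' + rest_time) (fst z1) (fst z2)"
    using Cons.IH[OF _ _ z1, of ?\<delta>] Cons.prems(1) unfolding eq by auto
  have "(fst y, shift \<delta> u (snd y)) \<in> set_pmf (decide_params \<theta> p E (shift \<delta> u s))"
    using y(1) framed_decide_params[of \<theta> p E] unfolding framed_def by (force simp: case_prod_unfold)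
  hence "((fst y, clock (shift \<delta> u (snd y)) - clock (shift \<delta> u s)) # fst z2, snd z2)
      \<in> set_pmf (timed_run (decide_params \<theta> p) (E # Es) (shift \<delta> u s))"
    unfolding timed_run_Cons set_bind_pmf using z2(1)
    by (intro UN_I[of "(fst y, shift \<delta> u (snd y))"]) (auto simp: image_iff)
  moreover have "clock (shift \<delta> u (snd y)) - clock (shift \<delta> u s) = clock (snd y) - clock s" by (simp add: shift_def)
  ultimately show ?case using z2(2) r(3) unfolding z by (intro bexI) auto
qed

lemma path_histories: "S \<in> trajectories \<Longrightarrow> set (prefixes S) \<subseteq> histories"
  using take_history by auto

lemma decision_times_le:
  assumes samp: "0 \<le> samp_time (num_indices p)"
    and S: "S \<in> trajectories" and xs: "xs \<in> set_pmf (run (decide_params \<theta> p) S)" and c: "c \<in> snd ` set xs"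
  shows "c \<le> decide_time"
  using timed_run_decide_params[OF samp path_histories[OF S] good_initial] xs c unfolding run_def by force

lemma worst_time_le:
  assumes samp: "0 \<le> samp_time (num_indices p)"
  shows "worst_time (decide_params \<theta> p) \<le> decide_time"
  unfolding worst_time_def
proof (rule cSup_least)
  obtain S where S: "S \<in> trajectories" using trajectories_nonempty by auto
  obtain xs where xs: "xs \<in> set_pmf (run (decide_params \<theta> p) S)" using set_pmf_not_empty by fast
  have "length (fst z) = length Es" if "z \<in> set_pmf (timed_run dec Es s)" for z Es dec s
    using that
  proof (induction Es arbitrary: s z)
    case (Cons E Es)
    thus ?case unfolding timed_run_Cons by auto
  qed (simp add: ret_def)
  hence "length xs = T" using xs unfolding run_def by auto
  hence "xs \<noteq> []" using wf_simps by auto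
  hence "snd (hd xs) \<in> snd ` set xs" by simp
  thus "{c. \<exists>S\<in>trajectories. \<exists>xs\<in>set_pmf (run (decide_params \<theta> p) S). c \<in> snd ` set xs} \<noteq> {}"
    using S xs by blast
qed (use decision_times_le[OF samp] in blast)

lemma le_worst_time:
  assumes samp: "0 \<le> samp_time (num_indices p)"
    and S: "S \<in> trajectories" and xs: "xs \<in> set_pmf (run (decide_params \<theta> p) S)" and c: "c \<in> snd ` set xs"
  shows "c \<le> worst_time (decide_params \<theta> p)"
  unfolding worst_time_def
proof (rule cSup_upper)
  show "bdd_above {c. \<exists>S\<in>trajectories. \<exists>xs\<in>set_pmf (run (decide_params \<theta> p) S). c \<in> snd ` set xs}"
    by (rule bdd_aboveI[of _ decide_time]) (use decision_times_le[OF samp] in blast)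
qed (use assms in blast)

theorem decision_times_rest:
  assumes samp: "0 \<le> samp_time (num_indices p)" and dec: "\<And>E. dec E = do { x \<leftarrow> decide_params \<theta> p E; rest_of E x }"
    and S: "S \<in> trajectories" and xs: "xs \<in> set_pmf (run dec S)" and c: "(x, c) \<in> set xs"
  shows "c \<le> worst_time (decide_params \<theta> p) + rest_time"
proof -
  let ?Es = "prefixes S"
  from xs obtain z where z: "z \<in> set_pmf (timed_run dec ?Es initial)" "xs = fst z" unfolding run_def by auto
  have "shift 0 (used initial) initial = initial" by (simp add: shift_def)
  with timed_run_rest[OF samp dec path_histories[OF S] good_initial z(1), of 0 "used initial"]
  obtain z' where z': "z' \<in> set_pmf (timed_run (decide_params \<theta> p) ?Es initial)"
    "list_all2 (\<lambda>v v'. snd v \<le> snd v' + rest_time) xs (fst z')" unfolding z(2) by auto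
  obtain i where i: "i < length xs" "xs ! i = (x, c)" using c unfolding in_set_conv_nth by auto
  have "c \<le> snd (fst z' ! i) + rest_time" using list_all2_nthD[OF z'(2) i(1)] i(2) by simp
  moreover have "snd (fst z' ! i) \<le> worst_time (decide_params \<theta> p)"
  proof (rule le_worst_time[OF samp S])
    show "fst z' \<in> set_pmf (run (decide_params \<theta> p) S)" using z'(1) unfolding run_def by auto
    show "snd (fst z' ! i) \<in> snd ` set (fst z')" using i(1) list_all2_lengthD[OF z'(2)] by simp
  qed
  ultimately show ?thesis by simp
qed

end

section \<open>The expected reward\<close>

lemma (in lazy_sampling) A_params_Q2:
  assumes "X \<in> set_pmf (A_params \<theta> p)"
  shows "X \<in> Q2"
proof -
  obtain sims al where "X = policy_output \<theta> p sims al" using assms unfolding A_params_def by auto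
  hence "X = out (iterate \<theta> p sims al)" by (intro ext) (simp add: policy_output_def out_def)
  thus ?thesis unfolding Q2_def using out_Q0 iterate_Q0 by blast
qed

context wf_nrm
begin

lemma lazy_settings:
  fixes \<delta> :: real
  assumes \<theta>: "0 < \<theta>" and \<delta>: "0 < \<delta>"
  shows "lazy_sampling I \<theta> (settings \<theta> \<delta> c)"
proof
  have pos: "0 < real L" "0 < real q" "0 < \<iota>" "0 < real T" using wf_simps by auto
  have X: "0 < x * L^2 * T^2 * q / (\<iota>^2 * \<theta>^2 * \<delta>^2)" "0 < x * L^2 * q / (\<iota>^2 * \<delta>^2)" "0 < x * L^2 * q / (\<delta>^2 * \<iota>^2)" if "0 < x" for x :: real
    using pos \<delta> \<theta> that by simp_all
  have one: "0 < 1 / sqrt \<delta>" using \<delta> by simp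
  show "sampled (settings \<theta> \<delta> c)"
    using nat_ceiling_pos[OF X(2)] nat_ceiling_min[OF X(1) wf_simps(1)] wf_simps(1)
    unfolding sampled_def settings_def params_i_def params_ii_def by (cases c) simp_all
  have "1 \<le> \<rho> \<theta>" unfolding \<rho>_def by simp
  hence "1 \<le> 14 * \<rho> \<theta> * nat \<lceil>1 / sqrt \<delta>\<rceil>"
    using mult_mono[of 1 "14 * \<rho> \<theta>" 1 "nat \<lceil>1 / sqrt \<delta>\<rceil>"] nat_ceiling_pos[OF one] by simp
  thus "1 \<le> rounds (settings \<theta> \<delta> c)"
    using nat_ceiling_pos[OF X(3)[of 288]] unfolding settings_def params_i_def params_ii_def by (cases c) simp_all
qed (rule \<theta>)

lemma finite_A_params: "sampled p \<Longrightarrow> finite (set_pmf (A_params \<theta> p))"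
  unfolding A_params_def by (simp add: finite_draws sampled_def)

text \<open>A feasible selection is not penalized.\<close>

lemma OPT_le:
  fixes \<theta> :: real
  assumes \<theta>: "0 < \<theta>" and c: "\<And>u. u \<in> Q2 \<Longrightarrow> penalized \<theta> u \<le> c"
  shows "OPT \<le> c"
  unfolding OPT_def
proof (rule cSup_least)
  have "selection (\<lambda>_. null_choice)" using null_choice_Q0 by (auto simp: selection_def Q0_def null_choice_def)
  moreover have "within_budgets (\<lambda>_. null_choice)"
    unfolding within_budgets_def using budget_pos by (auto simp: null_choice_def intro: less_imp_le)
  ultimately show "{objective X |X. selection X \<and> within_budgets X} \<noteq> {}" by blast
next
  fix x assume "x \<in> {objective X |X. selection X \<and> within_budgets X}"
  then obtain X where X: "x = objective X" "selection X" "within_budgets X" by blast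
  let ?u = "\<lambda>E r. if r < q then X E r else 0"
  have u: "?u \<in> Q2"
    unfolding Q2_def Q0_def using X(2) by (force simp: selection_def)
  have "objective ?u = x" unfolding X(1) objective_def by (intro sum.cong refl arg_cong2[where f = "(*)"]) auto
  moreover have "pen \<theta> (load i S ?u - b i) = 0" if "S \<in> trajectories" "i \<in> {1..m}" for S i
  proof -
    have "load i S ?u = (\<Sum>t=1..T. \<Sum>r=1..<q. a r i (take t S) * X (take t S) r)"
      unfolding load_def by (intro sum.cong refl) auto
    hence "load i S ?u \<le> b i" using X(3) that by (simp add: within_budgets_def)
    thus ?thesis using pen_zero[OF \<theta>] by simp
  qed
  ultimately have "penalized \<theta> ?u = x" unfolding penalized_def by simp
  thus "x \<le> c" using c[OF u] by simp
qed

text \<open>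
  A selection over time along one trajectory extends to all histories by their length.
\<close>

lemma V_le:
  assumes bound: "\<And>S X. S \<in> trajectories \<Longrightarrow> X \<in> Q2 \<Longrightarrow> card (demanding X S) \<le> n"
  shows "V \<le> n"
proof -
  let ?P = "{card {i\<in>{1..m}. (\<Sum>t=1..T. \<Sum>r=1..<q. X t r * a r i (take t S)) \<ge> b i / 2} | S X. S \<in> trajectories \<and> X \<in> Q1}"
  have le: "c \<le> n" if "c \<in> ?P" for c
  proof -
    from that obtain S X where c: "c = card {i\<in>{1..m}. (\<Sum>t=1..T. \<Sum>r=1..<q. X t r * a r i (take t S)) \<ge> b i / 2}"
      and S: "S \<in> trajectories" and X: "X \<in> Q1" by blast
    let ?X = "\<lambda>E. X (length E)"
    have "length E \<in> {1..T}" if "E \<in> histories" for E using that by (rule historyE) auto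
    hence "?X \<in> Q2" using X by (auto simp: Q1_def Q2_def)
    moreover have "load i S ?X = (\<Sum>t=1..T. \<Sum>r=1..<q. X t r * a r i (take t S))" for i
      unfolding load_def using length_trajectory[OF S] by (intro sum.cong refl) simp
    ultimately show ?thesis using bound[OF S, of ?X] unfolding c by (simp add: demanding_def[OF \<open>?X \<in> Q2\<close>])
  qed
  have "finite ?P" by (rule finite_subset[of _ "{..n}"]) (use le in auto)
  moreover have "?P \<noteq> {}"
  proof -
    obtain S where "S \<in> trajectories" using trajectories_nonempty by blast
    moreover have "(\<lambda>_. null_choice) \<in> Q1" using null_choice_Q0 by (simp add: Q1_def)
    ultimately show ?thesis by blast
  qed
  ultimately show ?thesis unfolding V_def using le by (intro Max.boundedI) blast+
qed

lemma V_le_m: "V \<le> m"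
proof (rule V_le)
  fix S X assume X: "X \<in> Q2"
  have "card (demanding X S) \<le> card {1..m}" by (rule card_mono) (auto simp: demanding_def[OF X])
  thus "card (demanding X S) \<le> m" by simp
qed

lemma \<nu>_pos: "0 < \<nu>"
  and \<nu>_le: "i \<in> {1..m} \<Longrightarrow> \<nu> * T \<le> b i"
proof -
  have fin: "finite (b ` {1..m})" "b ` {1..m} \<noteq> {}" using wf_simps by auto
  have T: "0 < real T" using wf_simps by simp
  have "0 < Min (b ` {1..m})" using budget_pos by (subst Min_gr_iff[OF fin]) auto
  thus "0 < \<nu>" unfolding \<nu>_def using T by simp
  show "\<nu> * T \<le> b i" if "i \<in> {1..m}" unfolding \<nu>_def using T Min_le[OF fin(1)] that by simp
qed

lemma card_le_of_sum_budgets: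
  fixes c :: real
  assumes "A \<subseteq> {1..m}" "(\<Sum>i\<in>A. b i) \<le> c * L * T"
  shows "card A \<le> nat \<lfloor>c * L / \<nu>\<rfloor>"
proof -
  have "card A * (\<nu> * T) = (\<Sum>i\<in>A. \<nu> * T)" by simp
  also have "\<dots> \<le> (\<Sum>i\<in>A. b i)" by (rule sum_mono) (use assms(1) \<nu>_le in auto)
  finally have "card A * (\<nu> * T) \<le> c * L * T" using assms(2) by linarith
  hence "card A * \<nu> \<le> c * L" using wf_simps by simp
  hence "card A \<le> c * L / \<nu>" using \<nu>_pos by (simp add: pos_le_divide_eq)
  thus ?thesis by (simp add: le_nat_iff le_floor_iff)
qed

lemma V_le_budgets: "V \<le> nat \<lfloor>2 * real L / \<nu>\<rfloor>"
proof (rule V_le)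
  fix S X assume S: "S \<in> trajectories" and X: "X \<in> Q2"
  have "(\<Sum>i\<in>demanding X S. b i / 2) \<le> (\<Sum>i\<in>demanding X S. load i S X)"
    by (rule sum_mono) (auto simp: demanding_def[OF X])
  also have "\<dots> \<le> (\<Sum>i=1..m. load i S X)"
    by (rule sum_mono2) (use load_nonneg[OF X S] in \<open>auto simp: demanding_def[OF X]\<close>)
  also have "\<dots> \<le> L * T" by (rule sum_load_le[OF X S])
  finally have "(\<Sum>i\<in>demanding X S. b i) \<le> 2 * real L * real T" by (simp add: sum_divide_distrib[symmetric])
  thus "card (demanding X S) \<le> nat \<lfloor>2 * real L / \<nu>\<rfloor>"
    by (intro card_le_of_sum_budgets) (auto simp: demanding_def[OF X])
qed

lemma A_NRM_eq: "A_NRM \<epsilon> = bind_pmf (A_pen (0.45 * \<epsilon>)) (\<lambda>X. map_pmf (\<lambda>rh. J (F (pick rh))) (rounding X))"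
  unfolding A_NRM_def H_eq by (simp add: map_pmf_comp)

lemma admissible_A_NRM: "admissible (A_NRM \<epsilon>)"
  unfolding admissible_def A_NRM_eq
  by (auto simp: AE_measure_pmf_iff J_F_selection intro!: J_F_within_budgets simp: pick_def)

lemma \<theta>_pen_pos: "0 < \<epsilon>' \<Longrightarrow> 0 < \<theta>_pen \<epsilon>'"
  unfolding \<theta>_pen_def using wf_simps by (simp add: zero_less_divide_iff)

text \<open>
  If rounding and patching lose at most \<open>R\<close> against the penalized objective, then the policy
  loses \<open>R\<close> and the accuracy of the optimization.
\<close>

lemma reward_ge:
  fixes \<epsilon> R :: real
  assumes \<epsilon>: "0 < \<epsilon>" "\<epsilon> < 1"
    and R: "\<And>X. X \<in> Q2 \<Longrightarrow> penalized (\<theta>_pen (0.45 * \<epsilon>)) X \<le> kept_reward X + R"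
  shows "OPT \<le> expected_reward (A_NRM \<epsilon>) + R + 9 / 40 * (\<epsilon> * T)"
proof -
  let ?\<epsilon> = "0.45 * \<epsilon>"
  let ?\<theta> = "\<theta>_pen ?\<epsilon>"
  have \<theta>: "0 < ?\<theta>" using \<epsilon> by (intro \<theta>_pen_pos) simp
  have \<delta>: "0 < ?\<epsilon> / 2" "?\<epsilon> / 2 \<le> 1" using \<epsilon> by auto
  obtain c where c: "params_pen ?\<epsilon> = settings ?\<theta> (?\<epsilon> / 2) c" unfolding params_pen_def chosen_def by blast
  interpret lazy_sampling samp_time I ?\<theta> "params_pen ?\<epsilon>" unfolding c by (rule lazy_settings[OF \<theta> \<delta>(1)])
  have Q2: "X \<in> Q2" if "X \<in> set_pmf (A_pen ?\<epsilon>)" for X using A_params_Q2 that unfolding A_pen_def by blast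
  have fin: "finite (set_pmf (A_pen ?\<epsilon>))" unfolding A_pen_def using finite_A_params sp by blast
  have reward: "expected_reward (A_NRM \<epsilon>) = ex (A_pen ?\<epsilon>) (\<lambda>X. kept_reward X)"
    unfolding expected_reward_def A_NRM_eq using finite_rounding[OF Q2]
    by (subst ex_bind[OF fin]) auto
  show ?thesis
  proof (rule OPT_le[OF \<theta>])
    fix u assume u: "u \<in> Q2"
    have "penalized ?\<theta> u - ?\<epsilon> / 2 * T \<le> ex (A_pen ?\<epsilon>) (penalized ?\<theta>)"
      unfolding A_pen_def c by (rule value_settings[OF \<theta> \<delta> u])
    also have "\<dots> \<le> ex (A_pen ?\<epsilon>) (\<lambda>X. kept_reward X + R)"
      by (rule ex_mono[OF fin R[OF Q2]])
    also have "\<dots> = expected_reward (A_NRM \<epsilon>) + R" unfolding reward ex_add[OF fin] by simp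
    finally show "penalized ?\<theta> u \<le> expected_reward (A_NRM \<epsilon>) + R + 9 / 40 * (\<epsilon> * T)" by simp
  qed
qed

lemma V_\<theta>_pen:
  fixes \<epsilon> :: real
  assumes "0 < \<epsilon>"
  shows "1 / \<iota> * (V * \<theta>_pen (0.45 * \<epsilon>) / 2) \<le> 3 / 50 * (\<epsilon> * T)"
proof -
  have "V / max 1 V \<le> 1" by simp
  have "1 / \<iota> * (V * \<theta>_pen (0.45 * \<epsilon>) / 2) = (V / max 1 V) * (0.05625 * \<epsilon> * T)"
    unfolding \<theta>_pen_def using wf_simps by (simp add: field_simps)
  also have "\<dots> \<le> 1 * (0.05625 * \<epsilon> * T)" by (rule mult_right_mono) (use assms in auto)
  also have "\<dots> \<le> 3 / 50 * (\<epsilon> * T)" using assms by (simp add: mult_right_mono)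
  finally show ?thesis .
qed

lemma le_\<kappa>:
  assumes "E \<in> histories" "i \<in> {1..m}"
  shows "card {r\<in>{..<q}. 0 < a r i E} \<le> \<kappa>"
proof -
  let ?P = "{card {r\<in>{..<q}. 0 < a r i E} | E i. E \<in> histories \<and> i \<in> {1..m}}"
  have "?P \<subseteq> (\<lambda>(E, i). card {r\<in>{..<q}. 0 < a r i E}) ` (histories \<times> {1..m})" by force
  hence "finite ?P" by (rule finite_subset) (use finite_histories in simp)
  thus ?thesis unfolding \<kappa>_def by (rule Max_ge) (use assms in blast)
qed

text \<open>
  The losses of penalizing, rounding and patching.  The resources in \<open>D X S\<close> may fluctuate by \<open>g\<close> at
  the usual price, the others overflow by at most \<open>h\<close> in expectation.
\<close>

lemma reward_ge_sum:
  fixes \<epsilon> g h n :: real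
  assumes \<epsilon>: "0 < \<epsilon>" "\<epsilon> < 1" and g: "0 < g" and h: "0 \<le> h"
    and N: "\<And>A. A \<subseteq> {1..m} \<Longrightarrow> (\<Sum>i\<in>A. b i) \<le> L * T \<Longrightarrow> card A \<le> N"
    and D: "\<And>X S. X \<in> Q2 \<Longrightarrow> S \<in> trajectories \<Longrightarrow> D X S \<subseteq> {1..m} \<and> card (D X S) \<le> n"
    and out: "\<And>X S i. X \<in> Q2 \<Longrightarrow> S \<in> trajectories \<Longrightarrow> i \<in> {1..m} \<Longrightarrow> i \<notin> D X S \<Longrightarrow>
        overflow i S X \<le> h"
    and small: "N \<le> 1 / 10 * (\<epsilon> * T)" "1 / \<iota> * (n * (g / 2)) \<le> 1 / 10 * (\<epsilon> * T)"
      "1 / \<iota> * (4 * (real L * real T) / g) \<le> 1 / 10 * (\<epsilon> * T)" "1 / \<iota> * (m * h) \<le> 1 / 10 * (\<epsilon> * T)"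
  shows "OPT - \<epsilon> * T \<le> expected_reward (A_NRM \<epsilon>)"
proof -
  define d where "d = n * (g / 2) + 4 * (real L * real T) / g + m * h"
  let ?\<theta> = "\<theta>_pen (0.45 * \<epsilon>)"
  have \<theta>: "0 < ?\<theta>" using \<epsilon> by (intro \<theta>_pen_pos) simp
  have "OPT \<le> expected_reward (A_NRM \<epsilon>) + (N + 1 / \<iota> * (d + V * ?\<theta> / 2)) + 9 / 40 * (\<epsilon> * T)"
  proof (rule reward_ge[OF \<epsilon>])
    fix X assume X: "X \<in> Q2"
    have "penalized ?\<theta> X \<le> kept_reward X + N + 1 / \<iota> * (d + V * ?\<theta> / 2)"
    proof (rule rounding_loss[OF X \<theta> N])
      fix S assume S: "S \<in> trajectories"
      let ?ex = "\<lambda>i. overflow i S X"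
      have "?ex i \<le> max 0 (load i S X - b i) + (if i \<in> D X S then g / 2 else 0) + 4 * load i S X / g + h"
        if i: "i \<in> {1..m}" for i
      proof (cases "i \<in> D X S")
        case True
        thus ?thesis using excess_rounding(1)[OF X S i g] h unfolding if_P[OF True] by linarith
      next
        case False
        have "0 \<le> 4 * load i S X / g" using load_nonneg[OF X S i] g by simp
        moreover have "0 \<le> max 0 (load i S X - b i)" by simp
        ultimately show ?thesis using out[OF X S i False] unfolding if_not_P[OF False] by linarith
      qed
      hence "(\<Sum>i=1..m. ?ex i) \<le> (\<Sum>i=1..m. max 0 (load i S X - b i) + (if i \<in> D X S then g / 2 else 0) + 4 * load i S X / g + h)"
        by (rule sum_mono)
      also have "\<dots> = (\<Sum>i=1..m. max 0 (load i S X - b i)) + card (D X S) * (g / 2) + 4 * (\<Sum>i=1..m. load i S X) / g + m * h"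
        using D[OF X S] by (simp add: sum.distrib sum_divide_distrib sum_distrib_left sum.If_cases Int_absorb1)
      also have "\<dots> \<le> (\<Sum>i=1..m. max 0 (load i S X - b i)) + d"
      proof -
        have "card (D X S) * (g / 2) \<le> n * (g / 2)" using D[OF X S] g by (intro mult_right_mono) auto
        moreover have "4 * (\<Sum>i=1..m. load i S X) / g \<le> 4 * (real L * real T) / g"
          using sum_load_le[OF X S] g by (simp add: divide_right_mono)
        ultimately show ?thesis unfolding d_def by linarith
      qed
      finally show "(\<Sum>i=1..m. ?ex i) \<le> (\<Sum>i=1..m. max 0 (load i S X - b i)) + d" .
    qed
    thus "penalized ?\<theta> X \<le> kept_reward X + (N + 1 / \<iota> * (d + V * ?\<theta> / 2))"
      by simp
  qed
  moreover have "1 / \<iota> * (d + V * ?\<theta> / 2)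
      = 1 / \<iota> * (n * (g / 2)) + 1 / \<iota> * (4 * (real L * real T) / g) + 1 / \<iota> * (m * h) + 1 / \<iota> * (V * ?\<theta> / 2)"
    unfolding d_def by (simp only: distrib_left)
  moreover have "0 \<le> \<epsilon> * T" using \<epsilon> by simp
  moreover note small V_\<theta>_pen[OF \<epsilon>(1)]
  ultimately show ?thesis by linarith
qed

text \<open>Few resources: all of them may fluctuate, and \<open>g\<close> is such that \<open>m g / (2 \<iota>) = \<epsilon> T / 10\<close>.\<close>

theorem reward_few_resources:
  fixes \<epsilon> :: real
  assumes \<epsilon>: "0 < \<epsilon>" "\<epsilon> < 1" and T: "1000 * (L * q / \<iota>) ^ 3 * m * (1 / \<epsilon>^2) \<le> T"
  shows "OPT - \<epsilon> * T \<le> expected_reward (A_NRM \<epsilon>)"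
proof -
  have pos: "1 \<le> real L" "2 \<le> real q" "0 < \<iota>" "\<iota> \<le> 1" "1 \<le> real m" "0 < real T" using wf_simps by auto
  have inv: "1 \<le> 1 / \<iota>" using pos by simp
  have LQ: "L / \<iota>^2 \<le> (L * q / \<iota>) ^ 3"
  proof -
    have "1 * 1 * 1 \<le> real L ^ 2 * real q ^ 3 * (1 / \<iota>)"
      by (intro mult_mono) (use pos inv one_le_power[of "real L" 2] one_le_power[of "real q" 3] in auto)
    hence "L / \<iota>^2 * 1 \<le> L / \<iota>^2 * (real L ^ 2 * real q ^ 3 * (1 / \<iota>))"
      using pos by (intro mult_left_mono) auto
    also have "\<dots> = (L * q / \<iota>) ^ 3" by (simp add: power_mult_distrib power_divide power2_eq_square power3_eq_cube)
    finally show ?thesis by simp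
  qed
  have TL: "1000 * (L / \<iota>^2) * m * (1 / \<epsilon>^2) \<le> T"
  proof -
    have "1000 * (L / \<iota>^2) * m * (1 / \<epsilon>^2) \<le> 1000 * (L * q / \<iota>) ^ 3 * m * (1 / \<epsilon>^2)"
      using LQ \<epsilon> by (intro mult_right_mono mult_left_mono) auto
    thus ?thesis using T by linarith
  qed
  have m\<epsilon>: "m \<le> 1 / 10 * (\<epsilon> * T)"
  proof -
    have "\<epsilon> * \<iota>^2 \<le> 1 * 1" using \<epsilon> pos by (intro mult_mono) (auto simp: power_le_one)
    hence "m * (\<epsilon> * \<iota>^2) \<le> real m * real L" using pos by (intro mult_left_mono) auto
    hence "m \<le> L / \<iota>^2 * m * (1 / \<epsilon>)" using pos \<epsilon> by (simp add: field_simps)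
    also have "\<dots> = \<epsilon> / 1000 * (1000 * (L / \<iota>^2) * m * (1 / \<epsilon>^2))" using \<epsilon> by (simp add: power2_eq_square)
    also have "\<dots> \<le> \<epsilon> / 1000 * T" using TL \<epsilon> by (intro mult_left_mono) auto
    also have "\<dots> \<le> 1 / 10 * (\<epsilon> * T)" using \<epsilon> by simp
    finally show ?thesis .
  qed
  define g where "g = \<epsilon> * \<iota> * T / (5 * m)"
  have g: "0 < g" using \<epsilon> pos by (simp add: g_def)
  show ?thesis
  proof (rule reward_ge_sum[OF \<epsilon> g, where h = 0 and N = m and n = m and D = "\<lambda>_ _. {1..m}"])
    show "card A \<le> m" if "A \<subseteq> {1..m}" for A using card_mono[of "{1..m}" A] that by simp
    show "1 / \<iota> * (m * (g / 2)) \<le> 1 / 10 * (\<epsilon> * T)" using pos by (simp add: g_def)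
    have "1 / \<iota> * (4 * (real L * real T) / g) = 20 * \<epsilon> / 1000 * (1000 * (L / \<iota>^2) * m * (1 / \<epsilon>^2))"
      using pos \<epsilon> by (simp add: g_def power2_eq_square ac_simps)
    also have "\<dots> \<le> 20 * \<epsilon> / 1000 * T" using TL \<epsilon> by (intro mult_left_mono) auto
    also have "\<dots> \<le> 1 / 10 * (\<epsilon> * T)" using \<epsilon> by simp
    finally show "1 / \<iota> * (4 * (real L * real T) / g) \<le> 1 / 10 * (\<epsilon> * T)" .
  qed (use m\<epsilon> \<epsilon> in simp_all)
qed

text \<open>
  Many resources: only \<open>O(L / \<nu>)\<close> of them are asked for half of their budget, and for the others
  the probability of an overload is exponentially small.
\<close>

theorem reward_large_budgets:
  fixes \<epsilon> :: real
  assumes \<epsilon>: "0 < \<epsilon>" "\<epsilon> < 1" and T: "1000 * (L * \<kappa> / (\<iota> * \<nu>))^2 * ln (2 * m) * (1 / \<epsilon>^2) \<le> T"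
  shows "OPT - \<epsilon> * T \<le> expected_reward (A_NRM \<epsilon>)"
proof (cases "\<kappa> = 0 \<or> 1 \<le> \<nu>")
  case True
  have \<theta>: "0 < \<theta>_pen (0.45 * \<epsilon>)" using \<epsilon> by (intro \<theta>_pen_pos) simp
  have big: "T \<le> b i" if E: "E \<in> histories" and r: "r < q" and i: "i \<in> aplus r E" for E r i
  proof (cases "\<kappa> = 0")
    case True
    have im: "i \<in> {1..m}" "0 < a r i E" using i by (auto simp: aplus_def)
    have "card {r\<in>{..<q}. 0 < a r i E} \<le> \<kappa>" by (rule le_\<kappa>[OF E im(1)])
    hence "card {r\<in>{..<q}. 0 < a r i E} = 0" using True by simp
    hence "{r\<in>{..<q}. 0 < a r i E} = {}" by simp
    thus ?thesis using r im by blast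
  next
    case False
    hence "1 * real T \<le> \<nu> * real T" using True by (intro mult_right_mono) auto
    thus ?thesis using \<nu>_le[of i] i by (simp add: aplus_def)
  qed
  have "OPT \<le> expected_reward (A_NRM \<epsilon>) + 0 + 9 / 40 * (\<epsilon> * T)"
  proof (rule reward_ge[OF \<epsilon>])
    fix X assume "X \<in> Q2"
    from rounding_no_loss[OF this \<theta> big]
    show "penalized (\<theta>_pen (0.45 * \<epsilon>)) X \<le> kept_reward X + 0" by simp
  qed
  moreover have "9 / 40 * (\<epsilon> * T) \<le> \<epsilon> * T" using \<epsilon> by simp
  ultimately show ?thesis by linarith
next
  case False
  have pos: "1 \<le> real L" "0 < \<iota>" "\<iota> \<le> 1" "1 \<le> real m" "0 < real T" "0 < \<nu>" "\<nu> < 1" "1 \<le> real \<kappa>"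
    using wf_simps \<nu>_pos False by auto
  have ln: "1 / 2 \<le> ln (2 * real m)"
  proof -
    have "ln 2 \<le> ln (2 * real m)" using pos by simp
    moreover have "(1 :: real) / 2 \<le> ln 2" using ln_add_one_self_le_self2[of "-1/2"] by (simp add: ln_div)
    ultimately show ?thesis by linarith
  qed
  have TL: "1000 * (L^2 / (\<iota>^2 * \<nu>^2)) * ln (2 * m) * (1 / \<epsilon>^2) \<le> T"
  proof -
    have "L / (\<iota> * \<nu>) \<le> L * \<kappa> / (\<iota> * \<nu>)" using pos by (intro divide_right_mono) auto
    hence "(L / (\<iota> * \<nu>))^2 \<le> (L * \<kappa> / (\<iota> * \<nu>))^2" using pos by (intro power_mono) auto
    hence "1000 * (L / (\<iota> * \<nu>))^2 * ln (2 * m) * (1 / \<epsilon>^2) \<le> 1000 * (L * \<kappa> / (\<iota> * \<nu>))^2 * ln (2 * m) * (1 / \<epsilon>^2)"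
      using ln by (intro mult_right_mono mult_left_mono) auto
    thus ?thesis using T by (simp add: power_divide power_mult_distrib)
  qed
  have base: "500 * (L^2 / (\<iota>^2 * \<nu>^2)) * (1 / \<epsilon>^2) \<le> T"
  proof -
    have "1000 * (L^2 / (\<iota>^2 * \<nu>^2)) * (1 / 2) * (1 / \<epsilon>^2) \<le> 1000 * (L^2 / (\<iota>^2 * \<nu>^2)) * ln (2 * m) * (1 / \<epsilon>^2)"
      using ln by (intro mult_right_mono mult_left_mono) auto
    thus ?thesis using TL by (simp add: mult_ac)
  qed
  have small: "x \<le> 1 / 10 * (\<epsilon> * T)" if x: "x * (\<epsilon> * \<iota>^2 * \<nu>^2) \<le> 50 * (real L)^2" for x
  proof -
    have "x \<le> 50 * (real L)^2 / (\<epsilon> * \<iota>^2 * \<nu>^2)" using x pos \<epsilon> by (simp add: pos_le_divide_eq)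
    also have "\<dots> = \<epsilon> * 1 / 10 * (500 * (L^2 / (\<iota>^2 * \<nu>^2)) * (1 / \<epsilon>^2))" using \<epsilon> by (simp add: power2_eq_square)
    also have "\<dots> \<le> \<epsilon> * 1 / 10 * T" using base \<epsilon> by (intro mult_left_mono) auto
    finally show ?thesis by simp
  qed
  define N where "N = nat \<lfloor>L / \<nu>\<rfloor>"
  have \<epsilon>\<nu>: "\<epsilon> * \<iota>^2 * \<nu> \<le> 1"
  proof -
    have "\<epsilon> * \<iota>^2 * \<nu> \<le> 1 * 1 * 1" using \<epsilon> pos by (intro mult_mono) (auto simp: power_le_one)
    thus ?thesis by simp
  qed
  have N: "N \<le> 1 / 10 * (\<epsilon> * T)"
  proof -
    have "real N \<le> L / \<nu>" unfolding N_def using pos by simp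
    also have "L / \<nu> \<le> 1 / 10 * (\<epsilon> * T)"
    proof (rule small)
      have "L / \<nu> * (\<epsilon> * \<iota>^2 * \<nu>^2) = L * (\<epsilon> * \<iota>^2 * \<nu>)" using pos by (simp add: power2_eq_square)
      also have "\<dots> \<le> real L * 1" using \<epsilon>\<nu> by (intro mult_left_mono) auto
      also have "\<dots> \<le> 50 * (real L)^2" using pos self_le_power[of "real L" 2] by linarith
      finally show "L / \<nu> * (\<epsilon> * \<iota>^2 * \<nu>^2) \<le> 50 * (real L)^2" .
    qed
    finally show ?thesis .
  qed
  define g where "g = \<epsilon> * \<iota> * \<nu> * T / (10 * L)"
  have g: "0 < g" using \<epsilon> pos by (simp add: g_def)
  have D1: "1 / \<iota> * (2 * real L / \<nu> * (g / 2)) = 1 / 10 * (\<epsilon> * T)" using pos by (simp add: g_def)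
  have D2: "1 / \<iota> * (4 * (real L * real T) / g) \<le> 1 / 10 * (\<epsilon> * T)"
  proof (rule small)
    have "1 / \<iota> * (4 * (real L * real T) / g) * (\<epsilon> * \<iota>^2 * \<nu>^2) = 40 * (real L)^2 * \<nu>"
      using pos \<epsilon> by (simp add: g_def power2_eq_square)
    also have "\<dots> \<le> 40 * (real L)^2 * 1" using pos by (intro mult_left_mono) auto
    finally show "1 / \<iota> * (4 * (real L * real T) / g) * (\<epsilon> * \<iota>^2 * \<nu>^2) \<le> 50 * (real L)^2" using zero_le_power2[of "real L"] by linarith
  qed
  have D3: "1 / \<iota> * (m * (2 * exp (- (\<nu> * T) / 8))) \<le> 1 / 10 * (\<epsilon> * T)"
  proof -
    have "ln (2 * m) \<le> \<nu> * T / 8"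
    proof -
      have "\<epsilon>^2 * \<iota>^2 * \<nu> \<le> 1 * 1 * 1" using \<epsilon> pos by (intro mult_mono) (auto simp: power_le_one)
      moreover have "1 \<le> real L ^ 2" using pos by (intro one_le_power)
      ultimately have "1 * (\<epsilon>^2 * \<iota>^2 * \<nu>) \<le> 125 * (real L)^2" by linarith
      hence "ln (2 * m) * (\<epsilon>^2 * \<iota>^2 * \<nu>) \<le> ln (2 * m) * (125 * (real L)^2)" using ln by (intro mult_left_mono) auto
      hence "ln (2 * m) \<le> ln (2 * m) * (125 * (real L)^2) / (\<epsilon>^2 * \<iota>^2 * \<nu>)" using \<epsilon> pos by (simp add: pos_le_divide_eq)
      also have "\<dots> = \<nu> / 8 * (1000 * (L^2 / (\<iota>^2 * \<nu>^2)) * ln (2 * m) * (1 / \<epsilon>^2))"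
        using pos \<epsilon> by (simp add: power2_eq_square ac_simps)
      also have "\<dots> \<le> \<nu> / 8 * T" using TL pos by (intro mult_left_mono) auto
      finally show ?thesis by simp
    qed
    hence "exp (- (\<nu> * T) / 8) \<le> exp (- ln (2 * m))" by simp
    also have "\<dots> = 1 / (2 * m)" using pos by (simp add: exp_minus inverse_eq_divide)
    finally have "m * (2 * exp (- (\<nu> * T) / 8)) \<le> 1" using pos by (simp add: field_simps)
    hence "1 / \<iota> * (m * (2 * exp (- (\<nu> * T) / 8))) \<le> 1 / \<iota> * 1" using pos by (intro mult_left_mono) auto
    also have "\<dots> \<le> 1 / 10 * (\<epsilon> * T)"
    proof (rule small)
      have "1 / \<iota> * 1 * (\<epsilon> * \<iota>^2 * \<nu>^2) = (\<epsilon> * \<iota> * \<nu>^2)" using pos by (simp add: power2_eq_square)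
      also have "\<dots> \<le> 1 * 1 * 1" using \<epsilon> pos by (intro mult_mono) (auto simp: power_le_one)
      also have "1 * 1 * 1 \<le> 50 * real L ^ 2" using one_le_power[OF pos(1), of 2] by linarith
      finally show "1 / \<iota> * 1 * (\<epsilon> * \<iota>^2 * \<nu>^2) \<le> 50 * (real L)^2" .
    qed
    finally show ?thesis .
  qed
  show ?thesis
  proof (rule reward_ge_sum[OF \<epsilon> g _ _ _ _ N eq_refl[OF D1] D2 D3, where D = demanding])
    show "card A \<le> N" if "A \<subseteq> {1..m}" "(\<Sum>i\<in>A. b i) \<le> L * T" for A
      using card_le_of_sum_budgets[of A 1] that by (simp add: N_def)
    fix X S assume X: "X \<in> Q2" and S: "S \<in> trajectories"
    have "real (card (demanding X S)) \<le> real V" using card_demanding_le_V[OF X S] by simp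
    also have "\<dots> \<le> 2 * real L / \<nu>" using V_le_budgets pos by (simp add: le_nat_floor le_nat_iff le_floor_iff)
    finally show "demanding X S \<subseteq> {1..m} \<and> card (demanding X S) \<le> 2 * real L / \<nu>"
      by (auto simp: demanding_def[OF X])
    fix i assume i: "i \<in> {1..m}" "i \<notin> demanding X S"
    hence "load i S X \<le> b i / 2" by (auto simp: demanding_def[OF X])
    hence "overflow i S X \<le> 2 * exp (- b i / 8)"
      by (rule excess_rounding(2)[OF X S i(1)])
    also have "\<dots> \<le> 2 * exp (- (\<nu> * T) / 8)" using \<nu>_le[OF i(1)] by simp
    finally show "overflow i S X \<le> 2 * exp (- (\<nu> * T) / 8)" .
  qed simp
qed

end

section \<open>The size of the time bounds\<close>

context lazy_sampling
begin

text \<open>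
  The factor \<open>1 + \<eta>\<^sub>1 \<eta>\<^sub>2 \<le> M\<^sup>3\<close> per round comes from the recursive calls; the other powers of \<open>M\<close> pay for
  the work done in a round.
\<close>

lemma round_time_le:
  fixes M :: real
  assumes M: "2 \<le> M" "n1 \<le> M" "n2 \<le> M" "real q \<le> M" "real L \<le> M"
  shows "round_time k \<le> sim_cost I * M ^ (10 * k)"
proof (induction k)
  case 0
  show ?case using wf_simps by simp
next
  case (Suc k)
  let ?C = "sim_cost I"
  have C: "1 \<le> ?C" by (rule wf_simps)
  have pow: "2 * M ^ j \<le> M ^ Suc j" for j using M(1) by (simp add: mult_right_mono)
  have M0: "1 \<le> M" using M by simp
  have M1: "2 \<le> M" "2 * M \<le> M ^ 2" "2 * M ^ 2 \<le> M ^ 3" "2 * M ^ 3 \<le> M ^ 4" "2 * M ^ 4 \<le> M ^ 5"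
    "2 * M ^ 5 \<le> M ^ 6" "2 * M ^ 6 \<le> M ^ 7" "2 * M ^ 7 \<le> M ^ 8" "2 * M ^ 8 \<le> M ^ 9"
    using pow[of 1] pow[of 2] pow[of 3] pow[of 4] pow[of 5] pow[of 6] pow[of 7] pow[of 8] M(1) by (simp_all add: eval_nat_numeral)
  have "gradient_time n1 n2 \<le> M * (M * (M * (7 * M + 2) + 8) + 4) + 3"
    unfolding gradient_time_def using M by (intro add_mono mult_mono order_refl) auto
  also have "\<dots> = 7 * M ^ 4 + 2 * M ^ 3 + 8 * M ^ 2 + 4 * M + 3" by (simp add: algebra_simps eval_nat_numeral)
  also have "\<dots> \<le> 12 * M ^ 4" using M1 by linarith
  finally have grad: "gradient_time n1 n2 \<le> 12 * M ^ 4" .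
  have "update_time n1 n2 \<le> M * (12 * M ^ 4 + 7) + (6 * M * M + 8 * M)"
    unfolding update_time_def using M grad by (intro add_mono mult_mono order_refl) (auto simp: gradient_time_def)
  also have "\<dots> = 12 * M ^ 5 + 6 * M ^ 2 + 15 * M" by (simp add: algebra_simps eval_nat_numeral)
  also have "\<dots> \<le> 14 * M ^ 5" using M1 by linarith
  finally have upd: "update_time n1 n2 \<le> 14 * M ^ 5" .
  have n12: "n1 * n2 \<le> M * M" "n1 * (?C + 1) \<le> M * (?C + 1)" using M C by (intro mult_mono; simp)+
  have "round_time (Suc k) = round_time k * (1 + n1 * n2) + (2 + n1 * (?C + 1) + 2 * n1 + 4 * (n1 * n2) + update_time n1 n2)"
    by (simp add: algebra_simps)
  also have "\<dots> \<le> round_time k * M ^ 3 + ?C * (16 * M ^ 5)"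
  proof (rule add_mono)
    have "1 + n1 * n2 \<le> M ^ 3" using n12(1) M1 unfolding power2_eq_square by linarith
    thus "round_time k * (1 + n1 * n2) \<le> round_time k * M ^ 3" using round_time_nonneg by (rule mult_left_mono)
    obtain P where P: "P = 2 + 3 * M + 4 * M ^ 2 + 14 * M ^ 5" by simp
    have "1 * P \<le> ?C * P" using M0 C unfolding P by (intro mult_right_mono) auto
    moreover have "n1 * (?C + 1) \<le> ?C * M + M" using n12(2) by (simp add: algebra_simps)
    moreover have "n1 * n2 \<le> M ^ 2" using n12(1) by (simp add: power2_eq_square)
    ultimately have "2 + n1 * (?C + 1) + 2 * n1 + 4 * (n1 * n2) + update_time n1 n2 \<le> ?C * M + ?C * P"
      using upd M(2) P by linarith
    also have "\<dots> = ?C * (2 + 4 * M + 4 * M ^ 2 + 14 * M ^ 5)" unfolding P by (simp add: algebra_simps)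
    also have "\<dots> \<le> ?C * (16 * M ^ 5)" using M1 C by (intro mult_left_mono) linarith+
    finally show "2 + n1 * (?C + 1) + 2 * n1 + 4 * (n1 * n2) + update_time n1 n2 \<le> ?C * (16 * M ^ 5)" .
  qed
  also have "\<dots> \<le> ?C * M ^ (10 * k) * M ^ 3 + ?C * M ^ 9"
  proof (rule add_mono)
    show "round_time k * M ^ 3 \<le> ?C * M ^ (10 * k) * M ^ 3" using Suc.IH M0 by (intro mult_right_mono) auto
    show "?C * (16 * M ^ 5) \<le> ?C * M ^ 9" using M1 C by (intro mult_left_mono) linarith+
  qed
  also have "\<dots> = ?C * (M ^ (10 * k + 3) + M ^ 9)" by (simp add: algebra_simps power_add)
  also have "\<dots> \<le> ?C * (M ^ (10 * k + 9) + M ^ (10 * k + 9))"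
    using M0 C by (intro mult_left_mono add_mono power_increasing) auto
  also have "\<dots> \<le> ?C * M ^ (10 * Suc k)"
    using pow[of "10 * k + 9"] C by (intro mult_left_mono) auto
  finally show ?case .
qed

lemma decision_time_le:
  fixes M c :: real
  assumes M: "2 \<le> M" "n1 \<le> M" "n2 \<le> M" "real q \<le> M" "real L \<le> M" "real K \<le> M" "0 \<le> c" "c \<le> M"
    and samp: "samp_time (num_indices p) \<le> c * (n2 + 1)"
  shows "decide_time + rest_time \<le> sim_cost I * M ^ (12 * K)"
proof -
  let ?C = "sim_cost I"
  have C: "1 \<le> ?C" by (rule wf_simps)
  have pow: "2 * M ^ j \<le> M ^ Suc j" for j using M(1) by (simp add: mult_right_mono)
  have M1: "2 \<le> M" "2 * M \<le> M ^ 2" "2 * M ^ 2 \<le> M ^ 3" "2 * M ^ 3 \<le> M ^ 4" "2 * M ^ 4 \<le> M ^ 5"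
    "2 * M ^ 5 \<le> M ^ 6" "2 * M ^ 6 \<le> M ^ 7"
    using pow[of 1] pow[of 2] pow[of 3] pow[of 4] pow[of 5] pow[of 6] M(1) by (simp_all add: eval_nat_numeral)
  have "c * (n2 + 1) \<le> M * (M + 1)" using M by (intro mult_mono) auto
  hence "real K * (samp_time (num_indices p) + 1) \<le> real K * (M * (M + 1) + 1)" using samp by (intro mult_left_mono) auto
  also have "\<dots> \<le> M * (M * (M + 1) + 1)" using M by (intro mult_right_mono) auto
  finally have 1: "real K * (samp_time (num_indices p) + 1) \<le> M ^ 3 + M ^ 2 + M" by (simp add: algebra_simps eval_nat_numeral)
  have "real q * (2 * real K + 2) \<le> M * (2 * M + 2)" using M by (intro mult_mono) auto
  hence 2: "real q * (2 * real K + 2) \<le> 2 * M ^ 2 + 2 * M" by (simp add: algebra_simps power2_eq_square)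
  have "real q * (7 * real L + 10) \<le> M * (7 * M + 10)" using M by (intro mult_mono) auto
  hence 3: "rest_time \<le> 7 * M ^ 2 + 13 * M + 1" using M(4) unfolding rest_time_def finish_time_def by (simp add: algebra_simps power2_eq_square)
  have "decide_time + rest_time \<le> round_time K + (M ^ 3 + 10 * M ^ 2 + 16 * M + 1)"
    unfolding decide_time_def core_time_def using 1 2 3 by linarith
  also have "\<dots> \<le> ?C * M ^ (10 * K) + M ^ 7" using round_time_le[OF M(1-5), of K] M1 by linarith
  also have "\<dots> \<le> ?C * M ^ (10 * K) + ?C * M ^ (10 * K)"
  proof -
    have "7 \<le> 10 * K" using rounds_pos by linarith
    hence "1 * M ^ 7 \<le> ?C * M ^ (10 * K)" using C M by (intro mult_mono power_increasing) auto
    thus ?thesis by simp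
  qed
  also have "\<dots> = ?C * (2 * M ^ (10 * K))" by simp
  also have "\<dots> \<le> ?C * M ^ Suc (10 * K)" using pow C by (intro mult_left_mono) auto
  also have "\<dots> \<le> ?C * M ^ (12 * K)"
    using C M rounds_pos by (intro mult_left_mono power_increasing) linarith+
  finally show ?thesis .
qed

end

context wf_nrm
begin

abbreviation tuned :: "real \<Rightarrow> setting \<Rightarrow> params" where
  "tuned \<epsilon> \<equiv> settings (\<theta>_pen (0.45 * \<epsilon>)) (0.45 * \<epsilon> / 2)"

text \<open>
  The setting with the least worst-case time is no slower than the setting \<open>s\<close>, and only the latter's
  time is bounded through its parameters.
\<close>

lemma computed_within_setting:
  fixes \<epsilon> M c :: real
  assumes \<epsilon>: "0 < \<epsilon>" "\<epsilon> < 1" and p: "p = tuned \<epsilon> s"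
    and samp: "\<And>k. 0 \<le> samp_time k" "\<And>k. samp_time k \<le> c * (real k + 1)"
    and M: "2 \<le> M" "real (num_sims p) \<le> M" "real (num_indices p) \<le> M" "real q \<le> M" "real L \<le> M" "real (rounds p) \<le> M" "0 \<le> c" "c \<le> M"
  shows "computed_within \<epsilon> (sim_cost I * M ^ (12 * rounds p))"
proof -
  let ?\<theta> = "\<theta>_pen (0.45 * \<epsilon>)" and ?\<delta> = "0.45 * \<epsilon> / 2"
  have \<theta>: "0 < ?\<theta>" using \<epsilon> by (intro \<theta>_pen_pos) simp
  have \<delta>: "0 < ?\<delta>" using \<epsilon> by simp
  let ?w = "\<lambda>s. worst_time (decide_params ?\<theta> (tuned \<epsilon> s))"
  obtain s' where s': "params_pen (0.45 * \<epsilon>) = tuned \<epsilon> s'" and min: "?w s' \<le> ?w s"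
  proof -
    let ?s = "arg_min ?w (\<lambda>_. True)"
    have "finite (UNIV :: setting set)"
      by (rule finite_subset[of _ "{Setting_i, Setting_ii, Setting_iii}"]) (use setting.exhaust in auto)
    then obtain s0 where s0: "\<And>s. \<not> ?w s < ?w s0"
      using ex_is_arg_min_if_finite[of UNIV ?w] by (auto simp: is_arg_min_def)
    have "?w ?s \<le> ?w s" by (rule arg_minI[of "\<lambda>_. True" s0]) (use s0 in \<open>auto simp: not_less\<close>)
    thus ?thesis using that[of ?s] unfolding params_pen_def chosen_def by blast
  qed
  let ?p' = "tuned \<epsilon> s'"
  have lazy: "lazy_sampling I ?\<theta> ?p'" "lazy_sampling I ?\<theta> p"
    unfolding p by (rule lazy_settings[OF \<theta> \<delta>])+
  have dec: "decide_NRM \<epsilon> E = do { x \<leftarrow> decide_params ?\<theta> ?p' E; rest_of E x }" for E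
    unfolding decide_NRM_eq s' ..
  have "?w s \<le> lazy_sampling.decide_time samp_time I p"
    unfolding p[symmetric] by (rule lazy_sampling.worst_time_le[OF lazy(2) samp(1)])
  moreover have "lazy_sampling.decide_time samp_time I p + rest_time \<le> sim_cost I * M ^ (12 * rounds p)"
    by (rule lazy_sampling.decision_time_le[OF lazy(2) M, where samp_time = samp_time]) (rule samp(2))
  ultimately have bound: "?w s' + rest_time \<le> sim_cost I * M ^ (12 * rounds p)" using min by linarith
  show ?thesis
    unfolding computed_within_def
  proof (intro ballI conjI)
    fix S assume S: "S \<in> trajectories"
    have "map_pmf (map fst) (run (decide_NRM \<epsilon>) S) = outputs (decide_NRM \<epsilon>) (prefixes S) initial"
      unfolding run_def outputs_def by (simp add: map_pmf_comp)
    also have "\<dots> = map_pmf (\<lambda>A. map (\<lambda>t. map (A (take t S)) [0..<q]) [1..<Suc T])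
        (bind_pmf (A_params ?\<theta> ?p') (\<lambda>X. map_pmf (\<lambda>Y. J (F Y)) (H X)))"
      by (rule lazy_sampling.outputs_law[OF lazy(1) S dec])
    also have "bind_pmf (A_params ?\<theta> ?p') (\<lambda>X. map_pmf (\<lambda>Y. J (F Y)) (H X)) = A_NRM \<epsilon>"
      unfolding A_NRM_def A_pen_def s' ..
    finally show "map_pmf (map fst) (run (decide_NRM \<epsilon>) S)
        = map_pmf (\<lambda>A. map (\<lambda>t. map (A (take t S)) [0..<q]) [1..<Suc T]) (A_NRM \<epsilon>)" .
    fix xs y assume xs: "xs \<in> set_pmf (run (decide_NRM \<epsilon>) S)" "y \<in> set xs"
    obtain x t where y: "y = (x, t)" by (cases y)
    have "t \<le> ?w s' + rest_time"
      using lazy_sampling.decision_times_rest[OF lazy(1) samp(1) dec S xs(1)] xs(2) unfolding y by blast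
    thus "case y of (x, t) \<Rightarrow> t \<le> sim_cost I * M ^ (12 * rounds p)" unfolding y using bound by simp
  qed
qed

section \<open>The number of rounds\<close>

lemma \<kappa>_le: "\<kappa> \<le> q"
proof -
  let ?P = "{card {r\<in>{..<q}. 0 < a r i E} | E i. E \<in> histories \<and> i \<in> {1..m}}"
  have "?P \<subseteq> (\<lambda>(E, i). card {r\<in>{..<q}. 0 < a r i E}) ` (histories \<times> {1..m})" by force
  hence fin: "finite ?P" by (rule finite_subset) (use finite_histories in simp)
  obtain S where "S \<in> trajectories" using trajectories_nonempty by blast
  hence "take 1 S \<in> histories" "1 \<in> {1..m}" using take_history wf_simps by auto
  hence "?P \<noteq> {}" by blast
  moreover have "card {r\<in>{..<q}. 0 < a r i E} \<le> q" for i E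
    using card_mono[of "{..<q}" "{r\<in>{..<q}. 0 < a r i E}"] by auto
  ultimately show ?thesis unfolding \<kappa>_def using fin by (intro Max.boundedI) auto
qed

lemma U_le: "U\<^sub>r \<le> T * \<kappa>"
proof -
  let ?P = "{card (option_times i S) | S i. S \<in> trajectories \<and> i \<in> {1..m}}"
  have le: "card (option_times i S) \<le> T * \<kappa>" if S: "S \<in> trajectories" and i: "i \<in> {1..m}" for S i
  proof -
    have "option_times i S = (\<Union>t\<in>{1..T}. (\<lambda>r. (r, t)) ` {r\<in>{..<q}. 0 < a r i (take t S)})"
      unfolding option_times_def by auto
    hence "card (option_times i S) \<le> (\<Sum>t=1..T. card ((\<lambda>r. (r, t)) ` {r\<in>{..<q}. 0 < a r i (take t S)}))"
      by (simp add: card_UN_le)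
    also have "\<dots> \<le> (\<Sum>t=1..T. \<kappa>)"
      by (intro sum_mono order_trans[OF card_image_le le_\<kappa>]) (use take_history[OF S] i in auto)
    finally show ?thesis by simp
  qed
  have "finite ?P" by (rule finite_subset[of _ "{..T * \<kappa>}"]) (use le in auto)
  moreover have "?P \<noteq> {}" using trajectories_nonempty wf_simps(4) by fastforce
  ultimately show ?thesis unfolding U\<^sub>r_def using le by (intro Max.boundedI) blast+
qed

lemma W_le: "W \<le> L * T * \<kappa>"
proof -
  let ?P = "{\<Sum>t=1..T. \<Sum>l=1..<q. card (aplus l (take t S) \<inter> aplus r (take u S)) | S u r.
              S \<in> trajectories \<and> u \<in> {1..T} \<and> r < q}"
  have le: "(\<Sum>t=1..T. \<Sum>l=1..<q. card (aplus l (take t S) \<inter> aplus r (take u S))) \<le> L * T * \<kappa>"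
    if S: "S \<in> trajectories" and u: "u \<in> {1..T}" and r: "r < q" for S u r
  proof -
    let ?A = "aplus r (take u S)"
    have "(\<Sum>l=1..<q. card (aplus l (take t S) \<inter> ?A)) \<le> L * \<kappa>" if t: "t \<in> {1..T}" for t
    proof -
      have "(\<Sum>l=1..<q. card (aplus l (take t S) \<inter> ?A)) = (\<Sum>l=1..<q. \<Sum>i\<in>?A. if i \<in> aplus l (take t S) then 1 else 0)"
        by (intro sum.cong refl) (simp add: sum.If_cases finite_aplus Int_commute Int_def)
      also have "\<dots> = (\<Sum>i\<in>?A. \<Sum>l=1..<q. if i \<in> aplus l (take t S) then 1 else 0)" by (rule sum.swap)
      also have "\<dots> \<le> (\<Sum>i\<in>?A. \<kappa>)"
      proof (rule sum_mono)
        fix i assume "i \<in> ?A"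
        hence i: "i \<in> {1..m}" by (simp add: aplus_def)
        have "(\<Sum>l=1..<q. if i \<in> aplus l (take t S) then 1 else 0) = card {l\<in>{1..<q}. i \<in> aplus l (take t S)}"
          by (simp add: sum.If_cases Int_def)
        also have "\<dots> \<le> card {l\<in>{..<q}. 0 < a l i (take t S)}" by (rule card_mono) (auto simp: aplus_def)
        also have "\<dots> \<le> \<kappa>" by (rule le_\<kappa>[OF take_history[OF S t] i])
        finally show "(\<Sum>l=1..<q. if i \<in> aplus l (take t S) then 1 else 0) \<le> \<kappa>" .
      qed
      also have "\<dots> \<le> L * \<kappa>" using card_aplus[OF take_history[OF S u] r] by simp
      finally show ?thesis .
    qed
    hence "(\<Sum>t=1..T. \<Sum>l=1..<q. card (aplus l (take t S) \<inter> ?A)) \<le> (\<Sum>t=1..T. L * \<kappa>)" by (rule sum_mono)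
    thus ?thesis by (simp add: ac_simps)
  qed
  have "finite ?P" by (rule finite_subset[of _ "{..L * T * \<kappa>}"]) (use le in auto)
  moreover have "?P \<noteq> {}"
  proof -
    obtain S where "S \<in> trajectories" using trajectories_nonempty by blast
    moreover have "1 \<in> {1..T}" "0 < q" using wf_simps by auto
    ultimately show ?thesis by blast
  qed
  ultimately show ?thesis unfolding W_def using le by (intro Max.boundedI) blast+
qed

abbreviation Y :: real where "Y \<equiv> max 1 (real V)"
abbreviation \<kappa>1 :: real where "\<kappa>1 \<equiv> max 1 (real \<kappa>)"

lemma \<theta>_pen_eq: "\<theta>_pen \<epsilon>' = \<epsilon>' * T * \<iota> / (4 * Y)"
  unfolding \<theta>_pen_def by (simp only: of_nat_mult of_nat_max of_nat_1 of_nat_numeral)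

lemma nat_ceiling_le: "0 \<le> x \<Longrightarrow> real (nat \<lceil>x\<rceil>) \<le> x + 1"
  by linarith

text \<open>
  As \<open>U\<^sub>r \<le> T \<kappa>\<close>, \<open>W \<le> L T \<kappa>\<close>, and \<open>\<theta>\<close> is proportional to \<open>T\<close>, the horizon cancels.
\<close>

lemma \<rho>_le:
  fixes \<epsilon> :: real
  assumes \<epsilon>: "0 < \<epsilon>" "\<epsilon> < 1"
  shows "\<rho> (\<theta>_pen (0.45 * \<epsilon>)) \<le> 4 * (sqrt (\<kappa>1 * L * Y) / (\<iota> * sqrt \<epsilon>))"
proof -
  have pos: "1 \<le> real L" "0 < \<iota>" "\<iota> \<le> 1" "0 < real T" using wf_simps by auto
  let ?z = "sqrt (\<kappa>1 * L * Y) / (\<iota> * sqrt \<epsilon>)"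
  have z1: "1 \<le> ?z"
  proof -
    have "1 * 1 * 1 \<le> \<kappa>1 * L * Y" using pos by (intro mult_mono) auto
    hence "1 \<le> sqrt (\<kappa>1 * L * Y)" by simp
    moreover have "\<iota> * sqrt \<epsilon> \<le> 1 * 1" using pos \<epsilon> by (intro mult_mono) auto
    ultimately have "1 * (\<iota> * sqrt \<epsilon>) \<le> sqrt (\<kappa>1 * L * Y)" by linarith
    moreover have "0 < \<iota> * sqrt \<epsilon>" using pos \<epsilon> by simp
    ultimately show ?thesis by (simp only: pos_le_divide_eq)
  qed
  have \<theta>: "0 < \<theta>_pen (0.45 * \<epsilon>)" using \<epsilon> by (intro \<theta>_pen_pos) simp
  have "real (U\<^sub>r * L * W) \<le> (T * \<kappa>) * L * (L * T * \<kappa>)"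
    using mult_mono[OF mult_mono[OF U_le order_refl, of L] W_le] unfolding of_nat_le_iff by simp
  also have "\<dots> = (real T * real \<kappa> * real L)^2" by (simp add: power2_eq_square)
  also have "\<dots> \<le> (real T * \<kappa>1 * real L)^2" by (intro power_mono mult_mono) auto
  finally have ULW: "real (U\<^sub>r * L * W) \<le> (real T * \<kappa>1 * real L)^2" .
  have "root 4 (real (U\<^sub>r * L * W)) \<le> root 4 ((real T * \<kappa>1 * real L)^2)" by (rule real_root_le_mono[OF _ ULW]) simp
  also have "\<dots> = sqrt (sqrt ((real T * \<kappa>1 * real L)^2))"
    using real_root_mult_exp[of 2 2] by (simp add: sqrt_def)
  also have "\<dots> = sqrt (real T * \<kappa>1 * real L)" by simp
  finally have "root 4 (real (U\<^sub>r * L * W)) / sqrt (\<iota> * \<theta>_pen (0.45 * \<epsilon>)) \<le> sqrt (real T * \<kappa>1 * real L) / sqrt (\<iota> * \<theta>_pen (0.45 * \<epsilon>))"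
    using pos \<theta> by (intro divide_right_mono) auto
  also have "\<dots> = sqrt (80 / 9 * (\<kappa>1 * L * Y / (\<iota>^2 * \<epsilon>)))"
    unfolding real_sqrt_divide[symmetric] \<theta>_pen_eq using pos \<epsilon> by (simp add: field_simps power2_eq_square)
  also have "\<dots> \<le> sqrt (9 * (\<kappa>1 * L * Y / (\<iota>^2 * \<epsilon>)))"
    using pos \<epsilon> by (intro real_sqrt_le_mono mult_right_mono) auto
  also have "\<dots> = 3 * ?z" using pos by (simp add: real_sqrt_mult real_sqrt_divide)
  finally have x: "root 4 (real (U\<^sub>r * L * W)) / sqrt (\<iota> * \<theta>_pen (0.45 * \<epsilon>)) \<le> 3 * ?z" .
  have "0 \<le> root 4 (real (U\<^sub>r * L * W)) / sqrt (\<iota> * \<theta>_pen (0.45 * \<epsilon>))" using pos \<theta> by simp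
  from nat_ceiling_le[OF this] show ?thesis unfolding \<rho>_def using x z1 by simp
qed

text \<open>A quantity that bounds the parameters of the first two settings up to constants.\<close>

definition scale :: "real \<Rightarrow> real" where
  "scale \<epsilon> = (real L)^2 * q * Y^2 / (\<iota> ^ 4 * \<epsilon> ^ 4)"

lemma rounds_i:
  fixes \<epsilon> :: real
  assumes \<epsilon>: "0 < \<epsilon>" "\<epsilon> < 1"
  shows "rounds (tuned \<epsilon> Setting_i) \<le> 6000 * ((real L)^2 * q / (\<iota>^2 * \<epsilon>^2))"
proof -
  have pos: "1 \<le> real L" "0 < \<iota>" "\<iota> \<le> 1" "1 \<le> real q" using wf_simps by auto
  let ?z = "(real L)^2 * q / (\<iota>^2 * \<epsilon>^2)"
  have "1 * 1 \<le> (real L)^2 * q" using pos by (intro mult_mono) auto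
  moreover have "\<iota>^2 * \<epsilon>^2 \<le> 1 * 1" using pos \<epsilon> by (intro mult_mono) (auto simp: power_le_one)
  ultimately have z: "1 \<le> ?z" using pos \<epsilon> by (simp add: pos_le_divide_eq)
  have eq: "288 * L^2 * q / ((0.45 * \<epsilon> / 2)^2 * \<iota>^2) = 288 * 1600 / 81 * ?z"
    by (simp add: power_divide power_mult_distrib mult_ac)
  have "rounds (tuned \<epsilon> Setting_i) \<le> 288 * 1600 / 81 * ?z + 1"
    unfolding settings_def params_i_def setting.case params.simps eq by (rule nat_ceiling_le) (use z in simp)
  thus ?thesis using z by linarith
qed

lemma rounds_ii:
  fixes \<epsilon> :: real
  assumes \<epsilon>: "0 < \<epsilon>" "\<epsilon> < 1"
  shows "rounds (tuned \<epsilon> Setting_ii) \<le> 224 * (sqrt (\<kappa>1 * L * Y) / (\<iota> * \<epsilon>))"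
proof -
  have s: "1 \<le> 1 / sqrt \<epsilon>" using \<epsilon> by simp
  have "(1 / 3 * sqrt \<epsilon>)^2 \<le> 0.45 * \<epsilon> / 2" using \<epsilon> by (simp add: power_mult_distrib power_divide)
  hence "1 / 3 * sqrt \<epsilon> \<le> sqrt (0.45 * \<epsilon> / 2)" by (rule real_le_rsqrt)
  hence "1 / sqrt (0.45 * \<epsilon> / 2) \<le> 3 * (1 / sqrt \<epsilon>)" using \<epsilon> by (simp add: field_simps)
  moreover have "real (nat \<lceil>1 / sqrt (0.45 * \<epsilon> / 2)\<rceil>) \<le> 1 / sqrt (0.45 * \<epsilon> / 2) + 1"
    by (rule nat_ceiling_le) (use \<epsilon> in simp)
  ultimately have n: "real (nat \<lceil>1 / sqrt (0.45 * \<epsilon> / 2)\<rceil>) \<le> 4 * (1 / sqrt \<epsilon>)" using s by linarith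
  have "rounds (tuned \<epsilon> Setting_ii)
      = 14 * real (\<rho> (\<theta>_pen (0.45 * \<epsilon>))) * real (nat \<lceil>1 / sqrt (0.45 * \<epsilon> / 2)\<rceil>)"
    unfolding settings_def params_ii_def by simp
  also have "\<dots> \<le> 14 * (4 * (sqrt (\<kappa>1 * L * Y) / (\<iota> * sqrt \<epsilon>))) * (4 * (1 / sqrt \<epsilon>))"
    by (rule mult_mono[OF mult_left_mono[OF \<rho>_le[OF \<epsilon>]] n]) (simp, use wf_simps \<epsilon> in simp, rule of_nat_0_le_iff)
  also have "\<dots> = 224 * (sqrt (\<kappa>1 * L * Y) / (\<iota> * (sqrt \<epsilon> * sqrt \<epsilon>)))" by simp
  finally show ?thesis using \<epsilon> by simp
qed

lemma
  fixes \<epsilon> :: real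
  assumes \<epsilon>: "0 < \<epsilon>" "\<epsilon> < 1"
  shows scale_ge: "2 \<le> scale \<epsilon>" "real q \<le> scale \<epsilon>" "real L \<le> scale \<epsilon>"
    and num_sims_le: "s \<noteq> Setting_iii \<Longrightarrow> num_sims (tuned \<epsilon> s) \<le> 2 * 10 ^ 9 * scale \<epsilon>"
    and num_indices_le: "s \<noteq> Setting_iii \<Longrightarrow> num_indices (tuned \<epsilon> s) \<le> 2 * 10 ^ 9 * scale \<epsilon>"
    and rounds_le: "s \<noteq> Setting_iii \<Longrightarrow> rounds (tuned \<epsilon> s) \<le> 2 * 10 ^ 9 * scale \<epsilon>"
proof -
  have pos: "1 \<le> real L" "0 < \<iota>" "\<iota> \<le> 1" "2 \<le> real q" "0 < real T" using wf_simps by auto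
  let ?\<theta> = "\<theta>_pen (0.45 * \<epsilon>)" and ?\<delta> = "0.45 * \<epsilon> / 2"
  have \<epsilon>\<iota>: "0 < \<iota> ^ 4 * \<epsilon> ^ 4" "\<iota> ^ 4 * \<epsilon> ^ 4 \<le> 1" "0 < \<iota>\<^sup>2 * \<epsilon>^2" "\<iota>^2 * \<epsilon>^2 \<le> 1" "\<iota> ^ 4 * \<epsilon> ^ 4 \<le> \<iota>^2 * \<epsilon>^2" "\<iota> ^ 4 * \<epsilon> ^ 4 \<le> \<iota> * \<epsilon>"
  proof -
    show "\<iota> ^ 4 * \<epsilon> ^ 4 \<le> 1" "\<iota>^2 * \<epsilon>^2 \<le> 1" using pos \<epsilon> by (simp_all add: mult_le_one power_le_one)
    show "\<iota> ^ 4 * \<epsilon> ^ 4 \<le> \<iota>^2 * \<epsilon>^2" using pos \<epsilon> by (intro mult_mono power_decreasing) auto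
    show "\<iota> ^ 4 * \<epsilon> ^ 4 \<le> \<iota> * \<epsilon>" using pos \<epsilon> power_decreasing[of 1 4 \<iota>] power_decreasing[of 1 4 \<epsilon>] by (intro mult_mono) auto
  qed (use pos \<epsilon> in simp_all)
  have L2: "real L \<le> (real L)^2" "1 \<le> (real L)^2" "1 \<le> Y^2" "Y \<le> Y^2"
    using pos self_le_power[of "real L" 2] self_le_power[of Y 2] one_le_power[of Y 2] one_le_power[of "real L" 2] by auto
  have B: "x / y \<le> scale \<epsilon>" if "0 \<le> x" "x \<le> (real L)^2 * q * Y^2" "\<iota> ^ 4 * \<epsilon> ^ 4 \<le> y" for x y
    unfolding scale_def using that \<epsilon>\<iota> by (intro frac_le) auto
  have LqY: "real q \<le> (real L)^2 * q * Y^2" "real L \<le> (real L)^2 * q * Y^2" "(real L)^2 * q \<le> (real L)^2 * q * Y^2"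
  proof -
    have "1 * real q * 1 \<le> (real L)^2 * q * Y^2" by (intro mult_mono) (use L2 pos in auto)
    thus "real q \<le> (real L)^2 * q * Y^2" by simp
    have "real L * 1 * 1 \<le> (real L)^2 * q * Y^2" by (intro mult_mono) (use L2 pos in auto)
    thus "real L \<le> (real L)^2 * q * Y^2" by simp
    have "(real L)^2 * q * 1 \<le> (real L)^2 * q * Y^2" by (intro mult_mono) (use L2 pos in auto)
    thus "(real L)^2 * q \<le> (real L)^2 * q * Y^2" by simp
  qed
  show q: "real q \<le> scale \<epsilon>" "real L \<le> scale \<epsilon>" using B[of "real q" 1] B[of "real L" 1] LqY \<epsilon>\<iota> by auto
  show two: "2 \<le> scale \<epsilon>" using q pos by linarith
  have z: "(real L)^2 * q / (\<iota>^2 * \<epsilon>^2) \<le> scale \<epsilon>" by (rule B) (use LqY \<epsilon>\<iota> in auto)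
  have sims: "real (nat \<lceil>c * L^2 * q / (\<iota>^2 * ?\<delta>^2)\<rceil>) \<le> 2 * 10 ^ 9 * scale \<epsilon>" if c: "0 \<le> c" "c \<le> 10 ^ 6" for c :: real
  proof -
    have "c * L^2 * q / (\<iota>^2 * ?\<delta>^2) = c * (1600 / 81) * ((real L)^2 * q / (\<iota>^2 * \<epsilon>^2))"
      by (simp add: power_divide power_mult_distrib)
    also have "\<dots> \<le> 10 ^ 6 * (1600 / 81) * scale \<epsilon>" using c z two by (intro mult_mono) auto
    finally have "c * L^2 * q / (\<iota>^2 * ?\<delta>^2) \<le> 10 ^ 6 * (1600 / 81) * scale \<epsilon>" .
    moreover have "real (nat \<lceil>c * L^2 * q / (\<iota>^2 * ?\<delta>^2)\<rceil>) \<le> c * L^2 * q / (\<iota>^2 * ?\<delta>^2) + 1"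
      by (rule nat_ceiling_le) (use c in simp)
    ultimately show ?thesis using two by simp
  qed
  have indices: "real (nat \<lceil>min (c * L^2 * T^2 * q / (\<iota>^2 * ?\<theta>^2 * ?\<delta>^2)) T\<rceil>) \<le> 2 * 10 ^ 9 * scale \<epsilon>"
    if c: "0 \<le> c" "c \<le> 10 ^ 6" for c :: real
  proof -
    have "c * L^2 * T^2 * q / (\<iota>^2 * ?\<theta>^2 * ?\<delta>^2) = c * (6400 / 81) * (1600 / 81) * scale \<epsilon>"
      unfolding \<theta>_pen_eq scale_def using pos \<epsilon>
      by (simp add: power_divide power_mult_distrib field_simps) (simp add: eval_nat_numeral)?
    also have "\<dots> \<le> 10 ^ 6 * (6400 / 81) * (1600 / 81) * scale \<epsilon>" using c two by (intro mult_right_mono) auto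
    finally have "min (c * L^2 * T^2 * q / (\<iota>^2 * ?\<theta>^2 * ?\<delta>^2)) T \<le> 10 ^ 6 * (6400 / 81) * (1600 / 81) * scale \<epsilon>"
      by (rule order_trans[OF min.cobounded1])
    moreover have "real (nat \<lceil>min (c * L^2 * T^2 * q / (\<iota>^2 * ?\<theta>^2 * ?\<delta>^2)) T\<rceil>) \<le> min (c * L^2 * T^2 * q / (\<iota>^2 * ?\<theta>^2 * ?\<delta>^2)) T + 1"
      by (rule nat_ceiling_le) (use c in simp)
    ultimately show ?thesis using two by simp
  qed
  show "num_sims (tuned \<epsilon> s) \<le> 2 * 10 ^ 9 * scale \<epsilon>" if "s \<noteq> Setting_iii"
    using that sims[of 2304] sims[of 142800] unfolding settings_def params_i_def params_ii_def by (cases s) simp_all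
  show "num_indices (tuned \<epsilon> s) \<le> 2 * 10 ^ 9 * scale \<epsilon>" if "s \<noteq> Setting_iii"
    using that indices[of 20736] indices[of 691200] unfolding settings_def params_i_def params_ii_def by (cases s) simp_all
  show "rounds (tuned \<epsilon> s) \<le> 2 * 10 ^ 9 * scale \<epsilon>" if s: "s \<noteq> Setting_iii"
  proof (cases s)
    case Setting_i
    thus ?thesis using rounds_i[OF \<epsilon>] z two by simp
  next
    case Setting_ii
    have "\<kappa>1 * L * Y \<le> real q * (real L)^2 * Y^2" using \<kappa>_le pos L2 by (intro mult_mono) auto
    moreover have "1 * 1 * 1 \<le> \<kappa>1 * L * Y" using pos by (intro mult_mono) auto
    moreover from this have "sqrt (\<kappa>1 * L * Y) \<le> \<kappa>1 * L * Y"
      using self_le_power[of "\<kappa>1 * L * Y" 2] by (intro real_le_lsqrt) auto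
    ultimately have "sqrt (\<kappa>1 * L * Y) / (\<iota> * \<epsilon>) \<le> scale \<epsilon>" using \<epsilon>\<iota>(6) by (intro B) (auto simp: ac_simps)
    thus ?thesis using rounds_ii[OF \<epsilon>] two unfolding Setting_ii by simp
  qed (use s in simp)
qed

end

section \<open>The exponents of the time bounds\<close>

context wf_nrm
begin

lemma computed_within_mono: "computed_within \<epsilon> x \<Longrightarrow> x \<le> y \<Longrightarrow> computed_within \<epsilon> y"
  unfolding computed_within_def by fastforce

lemma computed_within_exp:
  fixes \<epsilon> c x :: real
  assumes \<epsilon>: "0 < \<epsilon>" "\<epsilon> < 1" and s: "s \<noteq> Setting_iii"
    and samp: "\<And>k. 0 \<le> samp_time k" "\<And>k. samp_time k \<le> c * (real k + 1)" "0 \<le> c"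
    and x: "12 * real (rounds (tuned \<epsilon> s)) * (ln (2 * 10 ^ 9 + c) + ln (scale \<epsilon>)) \<le> x"
  shows "computed_within \<epsilon> (sim_cost I * exp x)"
proof -
  let ?p = "tuned \<epsilon> s"
  let ?M = "(2 * 10 ^ 9 + c) * scale \<epsilon>"
  have sc: "2 \<le> scale \<epsilon>" by (rule scale_ge(1)[OF \<epsilon>])
  have le: "y \<le> ?M" if "y \<le> 2 * 10 ^ 9 * scale \<epsilon>" for y
  proof -
    have "0 \<le> c * scale \<epsilon>" using samp(3) sc by simp
    thus ?thesis using that unfolding distrib_right by linarith
  qed
  have le': "y \<le> ?M" if "y \<le> scale \<epsilon>" for y
  proof -
    have "1 * scale \<epsilon> \<le> 2 * 10 ^ 9 * scale \<epsilon>" using sc by (intro mult_right_mono) auto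
    thus ?thesis using that by (intro le) simp
  qed
  have "c * 1 \<le> ?M" using samp(3) sc by (intro mult_mono) auto
  hence cM: "c \<le> ?M" by simp
  have "computed_within \<epsilon> (sim_cost I * ?M ^ (12 * rounds ?p))"
    by (rule computed_within_setting[OF \<epsilon> refl samp(1,2) le'[OF sc] le[OF num_sims_le[OF \<epsilon> s]] le[OF num_indices_le[OF \<epsilon> s]]
          le'[OF scale_ge(2)[OF \<epsilon>]] le'[OF scale_ge(3)[OF \<epsilon>]] le[OF rounds_le[OF \<epsilon> s]] samp(3) cM])
  moreover have "?M ^ (12 * rounds ?p) \<le> exp x"
  proof -
    have M: "0 < ?M" using samp(3) sc by (intro mult_pos_pos) auto
    have "?M ^ (12 * rounds ?p) = exp (ln ?M) ^ (12 * rounds ?p)" using M by (simp only: exp_ln)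
    also have "\<dots> = exp (real (12 * rounds ?p) * ln ?M)" by (simp only: exp_of_nat_mult)
    also have "ln ?M = ln (2 * 10 ^ 9 + c) + ln (scale \<epsilon>)" using samp(3) sc by (intro ln_mult_pos) auto
    also have "real (12 * rounds ?p) = 12 * real (rounds ?p)" by simp
    finally show ?thesis using x by simp
  qed
  ultimately show ?thesis
    by (elim computed_within_mono) (use wf_simps in \<open>simp add: mult_left_mono\<close>)
qed

text \<open>
  The logarithm of \<open>M\<close> is \<open>d + g\<close> with a constant \<open>d\<close>; since \<open>Q\<close> and \<open>l\<close> are at least \<open>1\<close>, the product \<open>Q l\<close>
  absorbs it.
\<close>

lemma exponent_le:
  fixes A B k K d Q l g :: real
  assumes k: "0 \<le> k" "k \<le> K * B" and ln: "0 \<le> d + g" "g \<le> 10 * Q * l" and d: "0 \<le> d" "1 \<le> Q" "1 \<le> l"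
    and K: "12 * K \<le> 72000" and B: "0 \<le> B" "B * Q \<le> A"
  shows "12 * k * (d + g) \<le> 72000 * (d + 10) * A * l"
proof -
  have "1 * 1 \<le> Q * l" using d by (intro mult_mono) auto
  hence "d * 1 \<le> d * (Q * l)" using d by (intro mult_left_mono) auto
  hence dg: "d + g \<le> (d + 10) * (Q * l)" using ln(2) by (simp add: algebra_simps)
  have nn: "0 \<le> (d + 10) * (Q * l)" using d by (intro mult_nonneg_nonneg) auto
  have "12 * k * (d + g) \<le> 12 * (K * B) * ((d + 10) * (Q * l))"
    using k dg ln nn by (intro mult_mono) auto
  also have "\<dots> = 12 * K * (B * ((d + 10) * (Q * l)))" by simp
  also have "\<dots> \<le> 72000 * (B * ((d + 10) * (Q * l)))" using K B nn by (intro mult_right_mono) auto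
  also have "\<dots> = 72000 * ((d + 10) * l) * (B * Q)" by simp
  also have "\<dots> \<le> 72000 * ((d + 10) * l) * A" using B d by (intro mult_left_mono) auto
  finally show ?thesis by (simp add: mult_ac)
qed

text \<open>
  The number of rounds is \<open>O(Q\<^sup>2 / \<epsilon>\<^sup>2)\<close> in the first setting, and \<open>O(Q\<^sup>2 \<surd>m / \<epsilon>)\<close> in the second, as \<open>\<kappa> \<le> q\<close>
  and \<open>V \<le> m\<close>.  One more factor \<open>Q\<close> comes from \<open>ln M\<close>.
\<close>

theorem time_few_resources:
  fixes \<epsilon> c :: real
  assumes \<epsilon>: "0 < \<epsilon>" "\<epsilon> < 1"
    and samp: "\<And>k. 0 \<le> samp_time k" "\<And>k. samp_time k \<le> c * (real k + 1)" "0 \<le> c"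
  shows "computed_within \<epsilon> (sim_cost I * exp (72000 * (ln (2 * 10 ^ 9 + c) + 10) * (real L * real q / \<iota>) ^ 3
      * \<lceil>ln (real m / \<epsilon>)\<rceil> * (1 / \<epsilon>) * min (sqrt m) (1 / \<epsilon>)))"
proof -
  define Q where "Q = real L * real q / \<iota>"
  define l where "l = real_of_int \<lceil>ln (real m / \<epsilon>)\<rceil>"
  define d where "d = ln (2 * 10 ^ 9 + c)"
  have pos: "1 \<le> real L" "0 < \<iota>" "\<iota> \<le> 1" "2 \<le> real q" "1 \<le> real m" using wf_simps by auto
  have Lq: "1 \<le> real L * real q" using mult_mono[of 1 "real L" 1 "real q"] pos by simp
  have Q: "real L * real q \<le> Q" "1 \<le> Q"
  proof -
    show "real L * real q \<le> Q" unfolding Q_def using pos by (simp add: pos_le_divide_eq mult_le_cancel_left1)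
    thus "1 \<le> Q" using Lq by linarith
  qed
  have m\<epsilon>: "1 < real m / \<epsilon>" using pos \<epsilon> by (simp add: pos_less_divide_eq)
  have l: "1 \<le> l" "ln (real m / \<epsilon>) \<le> l"
    unfolding l_def using m\<epsilon> ln_gt_zero[OF m\<epsilon>] by (simp_all add: less_ceiling_iff flip: less_eq_iff_succ_less)
  have d: "0 \<le> d" unfolding d_def using samp(3) by (intro ln_ge_zero) simp
  have Y: "Y \<le> m" using V_le_m pos by simp
  have ln_scale: "ln (scale \<epsilon>) \<le> 10 * Q * l"
  proof -
    have "scale \<epsilon> \<le> Q ^ 4 * (real m / \<epsilon>) ^ 4"
    proof -
      have "(real L)^2 * q * Y^2 \<le> real L ^ 4 * real q ^ 4 * real m ^ 4"
      proof (intro mult_mono)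
        show "Y^2 \<le> real m ^ 4" using power_mono[OF Y, of 2] power_increasing[of 2 4 "real m"] pos by linarith
      qed (use pos self_le_power[of "real q" 4] in \<open>auto intro: power_increasing\<close>)
      hence "scale \<epsilon> \<le> real L ^ 4 * real q ^ 4 * real m ^ 4 / (\<iota> ^ 4 * \<epsilon> ^ 4)"
        unfolding scale_def using pos \<epsilon> by (intro divide_right_mono) auto
      also have "\<dots> = Q ^ 4 * (real m / \<epsilon>) ^ 4" by (simp add: Q_def power_divide power_mult_distrib)
      finally show ?thesis .
    qed
    hence "ln (scale \<epsilon>) \<le> ln (Q ^ 4 * (real m / \<epsilon>) ^ 4)" using scale_ge(1)[OF \<epsilon>] by (intro ln_mono) auto
    also have "\<dots> = 4 * ln Q + 4 * ln (real m / \<epsilon>)"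
      using Q pos \<epsilon> by (subst ln_mult_pos) (auto simp: ln_realpow)
    also have "\<dots> \<le> 4 * Q + 4 * l" using ln_bound[of Q] Q l by simp
    also have "\<dots> \<le> 10 * Q * l"
    proof -
      have "Q * 1 \<le> Q * l" "1 * l \<le> Q * l" using Q l by (intro mult_mono; simp)+
      moreover have "10 * Q * l = 10 * (Q * l)" by simp
      moreover have "0 \<le> Q * l" using Q l by simp
      ultimately show ?thesis by linarith
    qed
    finally show ?thesis .
  qed
  have dg: "0 \<le> d + ln (scale \<epsilon>)" using d scale_ge(1)[OF \<epsilon>] by simp
  have Q3: "Q^2 * x * Q \<le> Q ^ 3 * x" for x by (simp add: eval_nat_numeral)
  have 1: "computed_within \<epsilon> (sim_cost I * exp (72000 * (d + 10) * (Q ^ 3 * ((1 / \<epsilon>) * (1 / \<epsilon>))) * l))"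
  proof (rule computed_within_exp[OF \<epsilon> _ samp, of Setting_i], simp)
    have "rounds (tuned \<epsilon> Setting_i) \<le> 6000 * ((real L)^2 * q / (\<iota>^2 * \<epsilon>^2))"
      by (rule rounds_i[OF \<epsilon>])
    also have "\<dots> \<le> 6000 * ((real L)^2 * (real q)^2 / (\<iota>^2 * \<epsilon>^2))"
      using pos \<epsilon> self_le_power[of "real q" 2] by (intro mult_left_mono divide_right_mono) auto
    also have "\<dots> = 6000 * (Q^2 * ((1 / \<epsilon>) * (1 / \<epsilon>)))" by (simp add: Q_def power_divide power_mult_distrib power2_eq_square)
    finally show "12 * real (rounds (tuned \<epsilon> Setting_i)) * (ln (2 * 10 ^ 9 + c) + ln (scale \<epsilon>))
        \<le> 72000 * (d + 10) * (Q ^ 3 * ((1 / \<epsilon>) * (1 / \<epsilon>))) * l"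
      unfolding d_def[symmetric] by (intro exponent_le[OF _ _ dg ln_scale d Q(2) l(1) _ _ Q3]) auto
  qed
  have 2: "computed_within \<epsilon> (sim_cost I * exp (72000 * (d + 10) * (Q ^ 3 * ((1 / \<epsilon>) * sqrt m)) * l))"
  proof (rule computed_within_exp[OF \<epsilon> _ samp, of Setting_ii], simp)
    have "\<kappa>1 * L * Y \<le> (real q * real L) * m" using \<kappa>_le pos Y by (intro mult_mono) auto
    hence "sqrt (\<kappa>1 * L * Y) \<le> sqrt (real q * real L) * sqrt m" unfolding real_sqrt_mult[symmetric] by simp
    also have "\<dots> \<le> (real L * real q) * sqrt m"
      using Lq self_le_power[of "real L * real q" 2] by (intro mult_right_mono real_le_lsqrt) (auto simp: mult.commute)
    finally have "sqrt (\<kappa>1 * L * Y) / (\<iota> * \<epsilon>) \<le> (real L * real q) * sqrt m / (\<iota> * \<epsilon>)"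
      using pos \<epsilon> by (intro divide_right_mono) auto
    also have "\<dots> = Q * ((1 / \<epsilon>) * sqrt m)" by (simp add: Q_def)
    also have "\<dots> \<le> Q^2 * ((1 / \<epsilon>) * sqrt m)" using Q \<epsilon> self_le_power[of Q 2] by (intro mult_right_mono) auto
    finally have "rounds (tuned \<epsilon> Setting_ii) \<le> 224 * (Q^2 * ((1 / \<epsilon>) * sqrt m))"
      using rounds_ii[OF \<epsilon>] by linarith
    thus "12 * real (rounds (tuned \<epsilon> Setting_ii)) * (ln (2 * 10 ^ 9 + c) + ln (scale \<epsilon>))
        \<le> 72000 * (d + 10) * (Q ^ 3 * ((1 / \<epsilon>) * sqrt m)) * l"
      unfolding d_def[symmetric] using \<epsilon> by (intro exponent_le[OF _ _ dg ln_scale d Q(2) l(1) _ _ Q3]) auto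
  qed
  have "computed_within \<epsilon> (sim_cost I * exp (72000 * (d + 10) * (Q ^ 3 * ((1 / \<epsilon>) * min (sqrt m) (1 / \<epsilon>))) * l))"
    using 1 2 by (cases "sqrt m \<le> 1 / \<epsilon>") (simp_all only: min_def if_True if_False)
  thus ?thesis unfolding d_def Q_def l_def by (simp only: mult_ac)
qed

text \<open>
  Every resource counted by \<open>V\<close> receives half of its budget, so \<open>V \<le> 2 L / \<nu>\<close>, and the second setting
  takes \<open>O(P / \<epsilon>)\<close> rounds.
\<close>

theorem time_large_budgets:
  fixes \<epsilon> c :: real
  assumes \<epsilon>: "0 < \<epsilon>" "\<epsilon> < 1"
    and samp: "\<And>k. 0 \<le> samp_time k" "\<And>k. samp_time k \<le> c * (real k + 1)" "0 \<le> c"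
  shows "computed_within \<epsilon> (sim_cost I * exp (72000 * (ln (2 * 10 ^ 9 + c) + 10) * (real L * \<kappa>1 / (\<iota> * min 1 \<nu>))^2
      * \<lceil>ln (real q / \<epsilon>)\<rceil> * (1 / \<epsilon>)))"
proof -
  define \<nu>1 where "\<nu>1 = min 1 \<nu>"
  define P where "P = real L * \<kappa>1 / (\<iota> * \<nu>1)"
  define l where "l = real_of_int \<lceil>ln (real q / \<epsilon>)\<rceil>"
  define d where "d = ln (2 * 10 ^ 9 + c)"
  have pos: "1 \<le> real L" "0 < \<iota>" "\<iota> \<le> 1" "2 \<le> real q" "1 \<le> real m" "0 < \<nu>1" "\<nu>1 \<le> 1" "\<nu>1 \<le> \<nu>" "1 \<le> \<kappa>1"
    using wf_simps \<nu>_pos by (auto simp: \<nu>1_def)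
  have P: "1 \<le> P"
  proof -
    have "1 * 1 \<le> real L * \<kappa>1" "\<iota> * \<nu>1 \<le> 1 * 1" using pos by (intro mult_mono; simp)+
    thus ?thesis unfolding P_def using pos by (simp add: pos_le_divide_eq)
  qed
  have q\<epsilon>: "1 < real q / \<epsilon>" using pos \<epsilon> by (simp add: pos_less_divide_eq)
  have l: "1 \<le> l" "ln (real q / \<epsilon>) \<le> l"
    unfolding l_def using q\<epsilon> ln_gt_zero[OF q\<epsilon>] by (simp_all add: less_ceiling_iff flip: less_eq_iff_succ_less)
  have d: "0 \<le> d" unfolding d_def using samp(3) by (intro ln_ge_zero) simp
  have Y: "Y \<le> 2 * real L / \<nu>1"
  proof -
    have "real V \<le> 2 * real L / \<nu>" using V_le_budgets \<nu>_pos by (simp add: le_nat_iff le_floor_iff)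
    also have "\<dots> \<le> 2 * real L / \<nu>1" using pos by (intro divide_left_mono) auto
    finally have "real V \<le> 2 * real L / \<nu>1" .
    moreover have "1 \<le> 2 * real L / \<nu>1" using pos by (simp add: pos_le_divide_eq)
    ultimately show ?thesis by simp
  qed
  have ln_scale: "ln (scale \<epsilon>) \<le> 10 * P * l"
  proof -
    have "scale \<epsilon> \<le> 4 * (P ^ 4 * (real q / \<epsilon>) ^ 4)"
    proof -
      have "1 * real L \<le> \<kappa>1 * real L" using pos by (intro mult_right_mono) auto
      hence L: "real L / \<nu>1 \<le> \<kappa>1 * real L / \<nu>1" "real L \<le> \<kappa>1 * real L / \<nu>1"
      proof -
        show "real L / \<nu>1 \<le> \<kappa>1 * real L / \<nu>1" using \<open>1 * real L \<le> \<kappa>1 * real L\<close> pos by (intro divide_right_mono) auto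
        have "real L \<le> real L / \<nu>1" using pos by (simp add: pos_le_divide_eq mult_le_cancel_left1)
        thus "real L \<le> \<kappa>1 * real L / \<nu>1" using \<open>real L / \<nu>1 \<le> \<kappa>1 * real L / \<nu>1\<close> by linarith
      qed
      have "Y^2 \<le> (2 * (\<kappa>1 * real L / \<nu>1))^2" using Y L by (intro power_mono) auto
      hence "(real L)^2 * q * Y^2 \<le> (\<kappa>1 * real L / \<nu>1)^2 * real q ^ 4 * (2 * (\<kappa>1 * real L / \<nu>1))^2"
        using L pos self_le_power[of "real q" 4] by (intro mult_mono power_mono) auto
      hence "scale \<epsilon> \<le> (\<kappa>1 * real L / \<nu>1)^2 * real q ^ 4 * (2 * (\<kappa>1 * real L / \<nu>1))^2 / (\<iota> ^ 4 * \<epsilon> ^ 4)"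
        unfolding scale_def using pos \<epsilon> by (intro divide_right_mono) auto
      also have "\<dots> = 4 * (P ^ 4 * (real q / \<epsilon>) ^ 4)"
        by (simp add: P_def power_divide power_mult_distrib mult_ac power_add[symmetric] flip: power2_eq_square) (simp add: eval_nat_numeral)?
      finally show ?thesis .
    qed
    hence "ln (scale \<epsilon>) \<le> ln (4 * (P ^ 4 * (real q / \<epsilon>) ^ 4))" using scale_ge(1)[OF \<epsilon>] by (intro ln_mono) auto
    also have "\<dots> = ln 4 + (4 * ln P + 4 * ln (real q / \<epsilon>))"
    proof -
      have "ln (4 * (P ^ 4 * R ^ 4)) = ln 4 + (4 * ln P + 4 * ln R)" if R: "0 < R" for R
      proof -
        have "ln (4 * (P ^ 4 * R ^ 4)) = ln 4 + ln (P ^ 4 * R ^ 4)"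
          by (rule ln_mult_pos) (use R P in \<open>simp_all add: zero_less_mult_iff\<close>)
        also have "ln (P ^ 4 * R ^ 4) = ln (P ^ 4) + ln (R ^ 4)" by (rule ln_mult_pos) (use R P in simp_all)
        finally show ?thesis using R P by (simp add: ln_realpow)
      qed
      thus ?thesis using q\<epsilon> by (meson less_trans zero_less_one)
    qed
    also have "\<dots> \<le> 2 + (4 * P + 4 * l)"
    proof -
      have "ln (4 :: real) = 2 * ln 2" using ln_realpow[of 2 2] by simp
      moreover have "ln (2 :: real) \<le> 1" using ln_le_minus_one[of 2] by simp
      moreover have "ln P \<le> P" using ln_bound[of P] P by simp
      ultimately show ?thesis using l by linarith
    qed
    also have "\<dots> \<le> 10 * P * l"
    proof -
      have "P * 1 \<le> P * l" "1 * l \<le> P * l" using P l by (intro mult_mono; simp)+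
      moreover have "10 * P * l = 10 * (P * l)" by simp
      ultimately show ?thesis using P l by linarith
    qed
    finally show ?thesis .
  qed
  have dg: "0 \<le> d + ln (scale \<epsilon>)" using d scale_ge(1)[OF \<epsilon>] by simp
  have P2: "P * (1 / \<epsilon>) * P \<le> P^2 * (1 / \<epsilon>)" by (simp add: power2_eq_square)
  have "computed_within \<epsilon> (sim_cost I * exp (72000 * (d + 10) * (P^2 * (1 / \<epsilon>)) * l))"
  proof (rule computed_within_exp[OF \<epsilon> _ samp, of Setting_ii], simp)
    have "\<kappa>1 * L * Y \<le> \<kappa>1 * L * (2 * real L / \<nu>1)" using Y pos by (intro mult_left_mono) auto
    also have "\<dots> \<le> (\<kappa>1 / \<nu>1) * (\<kappa>1 / \<nu>1) * (4 * real L * real L)"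
    proof -
      have "\<kappa>1 / \<nu>1 * 1 \<le> \<kappa>1 / \<nu>1 * (\<kappa>1 / \<nu>1)" using pos by (intro mult_left_mono) (auto simp: pos_le_divide_eq)
      hence "\<kappa>1 / \<nu>1 * 1 * (4 * real L * real L) \<le> \<kappa>1 / \<nu>1 * (\<kappa>1 / \<nu>1) * (4 * real L * real L)"
        by (rule mult_right_mono) simp
      moreover have "\<kappa>1 * L * (2 * real L / \<nu>1) \<le> \<kappa>1 / \<nu>1 * 1 * (4 * real L * real L)"
      proof -
        have "0 \<le> \<kappa>1 * real L * real L / \<nu>1" using pos by simp
        hence "2 * (\<kappa>1 * real L * real L / \<nu>1) \<le> 4 * (\<kappa>1 * real L * real L / \<nu>1)" by simp
        thus ?thesis by (simp add: mult_ac)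
      qed
      ultimately show ?thesis by linarith
    qed
    also have "\<dots> = (2 * (real L * \<kappa>1 / \<nu>1))^2" by (simp add: power2_eq_square)
    finally have "sqrt (\<kappa>1 * L * Y) \<le> 2 * (real L * \<kappa>1 / \<nu>1)"
      using pos by (intro real_le_lsqrt) auto
    hence "sqrt (\<kappa>1 * L * Y) / (\<iota> * \<epsilon>) \<le> 2 * (real L * \<kappa>1 / \<nu>1) / (\<iota> * \<epsilon>)"
      using pos \<epsilon> by (intro divide_right_mono) auto
    also have "\<dots> = 2 * (P * (1 / \<epsilon>))" by (simp add: P_def)
    finally have "rounds (tuned \<epsilon> Setting_ii) \<le> 448 * (P * (1 / \<epsilon>))"
      using rounds_ii[OF \<epsilon>] by linarith
    thus "12 * real (rounds (tuned \<epsilon> Setting_ii)) * (ln (2 * 10 ^ 9 + c) + ln (scale \<epsilon>))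
        \<le> 72000 * (d + 10) * (P^2 * (1 / \<epsilon>)) * l"
      unfolding d_def[symmetric] using \<epsilon> P by (intro exponent_le[OF _ _ dg ln_scale d P l(1) _ _ P2]) auto
  qed
  thus ?thesis unfolding d_def P_def l_def \<nu>1_def by (simp only: mult_ac)
qed

end

lemma linear_bound:
  fixes f :: "nat \<Rightarrow> real"
  assumes "f \<in> O(\<lambda>k. real k)" "\<And>k. 0 \<le> f k"
  obtains c where "0 \<le> c" "\<And>k. f k \<le> c * (real k + 1)"
proof -
  obtain c where c: "c > 0" "eventually (\<lambda>k. norm (f k) \<le> c * norm (real k)) at_top"
    using landau_o.bigE[OF assms(1)] by blast
  then obtain N where N: "\<And>k. N \<le> k \<Longrightarrow> f k \<le> c * real k" unfolding eventually_at_top_linorder by fastforce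
  let ?c = "c + (\<Sum>j<N. f j)"
  have s: "0 \<le> (\<Sum>j<N. f j)" using assms(2) by (intro sum_nonneg) auto
  have "f k \<le> ?c * (real k + 1)" for k
  proof (cases "N \<le> k")
    case True
    have "0 \<le> (\<Sum>j<N. f j) * (real k + 1)" using s by simp
    thus ?thesis using N[OF True] c(1) by (simp add: algebra_simps)
  next
    case False
    hence "f k \<le> (\<Sum>j<N. f j)" using assms(2) by (intro member_le_sum) auto
    hence "f k \<le> ?c * 1" using c(1) by simp
    also have "\<dots> \<le> ?c * (real k + 1)" using c(1) s by (intro mult_left_mono) auto
    finally show ?thesis .
  qed
  thus ?thesis using that[of ?c] c(1) s by simp
qed

theorem theorem1:
  fixes samp_time :: "nat \<Rightarrow> real"
  assumes "\<And>k. 0 \<le> samp_time k" and "samp_time \<in> O(\<lambda>k. real k)"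
  shows "\<exists>c0>0. \<forall>I \<epsilon>. nrm.well_formed I \<longrightarrow> 0 < \<epsilon> \<longrightarrow> \<epsilon> < 1 \<longrightarrow>
    (let T = real (horizon I); q = real (num_choices I); m = real (num_resources I);
         L = real (sparsity I); \<iota> = granularity I; C = sim_cost I;
         \<kappa> = real (nrm.\<kappa> I); \<nu> = nrm.\<nu> I; A = nrm.A_NRM samp_time I \<epsilon>
     in nrm.admissible I A \<and>
        (nrm.computed_within samp_time I \<epsilon>
           (C * exp (c0 * (L * q / \<iota>) ^ 3 * \<lceil>ln (m / \<epsilon>)\<rceil> * (1 / \<epsilon>) * min (sqrt m) (1 / \<epsilon>))) \<and>
         (T \<ge> c0 * (L * q / \<iota>) ^ 3 * m * (1 / \<epsilon>\<^sup>2) \<longrightarrow>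
            nrm.expected_reward I A \<ge> nrm.OPT I - \<epsilon> * T)) \<and>
        (nrm.computed_within samp_time I \<epsilon>
           (C * exp (c0 * (L * max 1 \<kappa> / (\<iota> * min 1 \<nu>))\<^sup>2 * \<lceil>ln (q / \<epsilon>)\<rceil> * (1 / \<epsilon>))) \<and>
         (T \<ge> c0 * (L * \<kappa> / (\<iota> * \<nu>))\<^sup>2 * ln (2 * m) * (1 / \<epsilon>\<^sup>2) \<longrightarrow>
            nrm.expected_reward I A \<ge> nrm.OPT I - \<epsilon> * T)))"
proof -
  obtain c where c: "0 \<le> c" "\<And>k. samp_time k \<le> c * (real k + 1)" using linear_bound[OF assms(2,1)] by blast
  \<comment> \<open>\<open>c\<close> depends on the cost of sampling indices only, hence so does \<open>c0\<close>.\<close>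
  define c0 where "c0 = 72000 * (ln (2 * 10 ^ 9 + c) + 10)"
  have "0 \<le> ln (2 * 10 ^ 9 + c)" using c(1) by (intro ln_ge_zero) simp
  hence c0: "1000 \<le> c0" by (simp add: c0_def)
  show ?thesis
  proof (intro exI[of _ c0] conjI[OF _ allI[OF allI[OF impI[OF impI[OF impI]]]]], goal_cases)
    case 1
    show ?case using c0 by simp
  next
    case (2 I \<epsilon>)
    note \<epsilon> = 2(2,3)
    interpret wf_nrm samp_time I by unfold_locales (rule 2(1))
    have weaken: "1000 * x * y * z \<le> T" if "c0 * x * y * z \<le> real T" "0 \<le> x" "0 \<le> y" "0 \<le> z" for x y z :: real
    proof -
      have "1000 * (x * y * z) \<le> c0 * (x * y * z)" using c0 that by (intro mult_right_mono) auto
      thus ?thesis using that(1) by (simp add: mult.assoc)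
    qed
    have few: "OPT - \<epsilon> * T \<le> expected_reward (A_NRM \<epsilon>)" if "c0 * (real L * real q / \<iota>) ^ 3 * m * (1 / \<epsilon>^2) \<le> T"
      by (rule reward_few_resources[OF \<epsilon>]) (use weaken[OF that] wf_simps in simp)
    have large: "OPT - \<epsilon> * T \<le> expected_reward (A_NRM \<epsilon>)" if "c0 * (real L * real \<kappa> / (\<iota> * \<nu>))^2 * ln (2 * real m) * (1 / \<epsilon>^2) \<le> T"
      by (rule reward_large_budgets[OF \<epsilon>]) (use weaken[OF that] wf_simps in simp)
    show ?case
      unfolding Let_def
      using admissible_A_NRM time_few_resources[OF \<epsilon> assms(1) c(2,1)] time_large_budgets[OF \<epsilon> assms(1) c(2,1)] few large
      unfolding c0_def[symmetric] by blast
  qed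
qed

end
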